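(* Let $r,p,q$ be positive integers and let $\mathbf d=(\mathbf a,\mathbf b,\mathbf c)\in\Lambda^{J}=\Lambda^{J}_{r,p,q}$. Then exactly one of the following holds: either $\mathbf d$ is of finite type in $\mathscr J$, or $\mathbf d$ has at least one summand $\mathbf d'$ on $\mathscr J$ such that $\mathbf d'^{+}$ is one of the following: $$((2^3),(1^3,3),(1^3,3)),\quad ((3^3),(2^2,5),(1^5,4)),\quad ((3^3),(1^5,4),(2^2,5)),$$ $$((1^4),(1^2,2),(1^2,2)),\quad ((2^4),(3,5),(1^5,3)),\quad ((2^4),(1^5,3),(3,5)),$$ $$((1^5),(2,3),(1^3,2)),\quad ((1^5),(1^3,2),(2,3)),\quad ((1^7),(3,4),(2^2,3)),\quad ((1^7),(2^2,3),(3,4)).$$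
   Context: The base field $\Bbbk$ is algebraically closed of characteristic zero. A "partition" is a finite sequence $\mathbf a=(a_1,\dots,a_p)$ of non-negative integers (zero parts allowed, no ordering required); $|\mathbf a|=a_1+\cdots+a_p$, $\mathbf a'=(a_1,\dots,a_{p-1})$, $\ell(\mathbf a)=p$, and inside a sequence $a^k$ means that $a$ is repeated $k$ times. $\mathrm{Fl}_{\mathbf a}(V)$ is the variety of flags $0=A_0\subset A_1\subset\cdots\subset A_p=V$ with $\dim A_i-\dim A_{i-1}=a_i$ for $i=1,\dots,p$ (so $\dim V=|\mathbf a|$). $\Lambda^J=\Lambda^J_{r,p,q}$ is the additive semigroup (componentwise addition) of all triples $(\mathbf a,\mathbf b,\mathbf c)$ of partitions with $(\ell(\mathbf a),\ell(\mathbf b),\ell(\mathbf c))=(r,p,q)$, $|\mathbf a|=|\mathbf b|=|\mathbf c|$ and $|\mathbf a|=|\mathbf b'|+|\mathbf c'|$; it contains the zero triple. For $\mathbf d=(\mathbf a,\mathbf b,\mathbf c)\in\Lambda^J$ and $V$ a $\Bbbk$-vector space of dimension $|\mathbf a|$, $\mathrm{Fl}_{\mathbf d}(V)=\mathrm{Fl}_{\mathbf a}(V)\times\mathrm{Fl}_{\mathbf b}(V)\times\mathrm{Fl}_{\mathbf c}(V)$, and the joint flag variety $\mathrm{Jl}_{\mathbf d}(V)\subset\mathrm{Fl}_{\mathbf d}(V)$ is the subvariety of triples $(A,B,C)$ with $B_{p-1}\oplus C_{q-1}=V$. $GL(V)$ acts diagonally. $\mathbf d$ is of finite type in $\mathscr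 J$ if the number of $GL(V)$-orbits in $\mathrm{Jl}_{\mathbf d}(V)$ is finite. A non-zero $\mathbf d'\in\Lambda^J$ is a summand of $\mathbf d\in\Lambda^J$ on $\mathscr J$ if $\mathbf d-\mathbf d'\in\Lambda^J$. For a partition $\mathbf a$, $\mathbf a^+$ is obtained by removing all zero parts and rearranging the non-zero parts in weakly decreasing order; for $\mathbf d=(\mathbf a,\mathbf b,\mathbf c)\in\Lambda^J$, $\mathbf d^+=(\mathbf a^+,(\mathbf b'^+,|\mathbf c'|),(\mathbf c'^+,|\mathbf b'|))$, where $(\mathbf b'^+,|\mathbf c'|)$ denotes the sequence $\mathbf b'^+$ followed by the last entry $|\mathbf c'|$, and similarly for $(\mathbf c'^+,|\mathbf b'|)$. *)

theory Defs
  imports "HOL-Computational_Algebra.Polynomial"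
begin

section \<open>Partitions and the semigroup of joint triples\<close>

text \<open>
  A partition is an arbitrary list of natural numbers: zero parts are allowed and no order is
  imposed. The truncated partition of \<open>a\<close>, without its last part, is \<open>butlast a\<close>.
\<close>

type_synonym partition = "nat list"
type_synonym partition_triple = "partition \<times> partition \<times> partition"

definition LambdaJ :: "nat \<Rightarrow> nat \<Rightarrow> nat \<Rightarrow> partition_triple set" where
  "LambdaJ r p q = {(a, b, c). length a = r \<and> length b = p \<and> length c = q \<and>
     sum_list a = sum_list b \<and> sum_list b = sum_list c \<and>
     sum_list a = sum_list (butlast b) + sum_list (butlast c)}"

definition zero_triple :: "nat \<Rightarrow> nat \<Rightarrow> nat \<Rightarrow> partition_triple" where
  "zero_triple r p q = (replicate r 0, replicate p 0, replicate q 0)"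

text \<open>The function \<open>map2\<close> truncates to the shorter list; within one \<open>LambdaJ r p q\<close> lengths agree.\<close>

definition add_triple :: "partition_triple \<Rightarrow> partition_triple \<Rightarrow> partition_triple" where
  "add_triple = (\<lambda>(a, b, c) (a', b', c'). (map2 (+) a a', map2 (+) b b', map2 (+) c c'))"

text \<open>
  That \<open>d - d'\<close> lies in the semigroup is expressed by \<open>d = d' + e\<close> with \<open>e\<close> in the semigroup,
  since subtraction of natural numbers truncates at zero.
\<close>

definition is_summand ::
  "nat \<Rightarrow> nat \<Rightarrow> nat \<Rightarrow> partition_triple \<Rightarrow> partition_triple \<Rightarrow> bool" where
  "is_summand r p q d' d \<longleftrightarrow> d' \<in> LambdaJ r p q \<and> d' \<noteq> zero_triple r p q \<and>
     (\<exists>e \<in> LambdaJ r p q. d = add_triple d' e)"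

definition plus_partition :: "partition \<Rightarrow> partition" where
  "plus_partition a = rev (sort (filter (\<lambda>n. n \<noteq> 0) a))"

definition plus_triple :: "partition_triple \<Rightarrow> partition_triple" where
  "plus_triple = (\<lambda>(a, b, c).
     (plus_partition a,
      plus_partition (butlast b) @ [sum_list (butlast c)],
      plus_partition (butlast c) @ [sum_list (butlast b)]))"

definition critical_triples :: "partition_triple set" where
  "critical_triples =
    {([2,2,2], [1,1,1,3], [1,1,1,3]),
     ([3,3,3], [2,2,5], [1,1,1,1,1,4]),
     ([3,3,3], [1,1,1,1,1,4], [2,2,5]),
     ([1,1,1,1], [1,1,2], [1,1,2]),
     ([2,2,2,2], [3,5], [1,1,1,1,1,3]),
     ([2,2,2,2], [1,1,1,1,1,3], [3,5]),
     ([1,1,1,1,1], [2,3], [1,1,1,2]),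
     ([1,1,1,1,1], [1,1,1,2], [2,3]),
     ([1,1,1,1,1,1,1], [3,4], [2,2,3]),
     ([1,1,1,1,1,1,1], [2,2,3], [3,4])}"

section \<open>Joint flag varieties and finite type\<close>

type_synonym 'v flag = "'v set list"
type_synonym 'v flag_triple = "'v flag \<times> 'v flag \<times> 'v flag"

text \<open>
  The vector space \<open>V\<close> is the whole type \<open>'v\<close> with the scalar multiplication \<open>scale\<close>. Since the
  base field is going to be algebraically closed, varieties are represented by their sets of
  rational points.

  A flag \<open>A\<^sub>0 \<subseteq> \<dots> \<subseteq> A\<^sub>p\<close> is the list of all its \<open>p + 1\<close> members, so that \<open>A ! i\<close> is \<open>A\<^sub>i\<close>, whereas
  the \<open>i\<close>-th part of the partition \<open>a\<close> is \<open>a ! (i - 1)\<close>. The inclusions need not be strict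
  because parts may be zero.
\<close>

definition Fl :: "('k::field \<Rightarrow> 'v::ab_group_add \<Rightarrow> 'v) \<Rightarrow> partition \<Rightarrow> 'v flag set" where
  "Fl scale a = {A. length A = length a + 1 \<and> A ! 0 = {0} \<and> A ! length a = UNIV \<and>
     (\<forall>i \<le> length a. module.subspace scale (A ! i)) \<and>
     (\<forall>i < length a. A ! i \<subseteq> A ! (i + 1) \<and>
        vector_space.dim scale (A ! (i + 1)) = vector_space.dim scale (A ! i) + a ! i)}"

definition is_direct_sum :: "'v::ab_group_add set \<Rightarrow> 'v set \<Rightarrow> bool" where
  "is_direct_sum U W \<longleftrightarrow> U \<inter> W = {0} \<and> {u + w | u w. u \<in> U \<and> w \<in> W} = UNIV"

definition Jl ::
  "('k::field \<Rightarrow> 'v::ab_group_add \<Rightarrow> 'v) \<Rightarrow> partition_triple \<Rightarrow> 'v flag_triple set" where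
  "Jl scale = (\<lambda>(a, b, c).
     {(A, B, C). A \<in> Fl scale a \<and> B \<in> Fl scale b \<and> C \<in> Fl scale c \<and>
        is_direct_sum (B ! (length b - 1)) (C ! (length c - 1))})"

definition GL :: "('k::field \<Rightarrow> 'v::ab_group_add \<Rightarrow> 'v) \<Rightarrow> ('v \<Rightarrow> 'v) set" where
  "GL scale = {g. Vector_Spaces.linear scale scale g \<and> bij g}"

definition act :: "('v \<Rightarrow> 'v) \<Rightarrow> 'v flag_triple \<Rightarrow> 'v flag_triple" where
  "act g = (\<lambda>(A, B, C). (map (image g) A, map (image g) B, map (image g) C))"

definition orbit ::
  "('k::field \<Rightarrow> 'v::ab_group_add \<Rightarrow> 'v) \<Rightarrow> 'v flag_triple \<Rightarrow> 'v flag_triple set" where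
  "orbit scale x = {act g x | g. g \<in> GL scale}"

text \<open>This is meant for \<open>V\<close> of finite dimension \<open>|a|\<close>.\<close>

definition finite_type ::
  "('k::field \<Rightarrow> 'v::ab_group_add \<Rightarrow> 'v) \<Rightarrow> partition_triple \<Rightarrow> bool" where
  "finite_type scale d \<longleftrightarrow> finite (orbit scale ` Jl scale d)"

end

theory Submission
  imports Defs "HOL-Library.Product_Plus" "HOL-Library.Function_Algebras"
begin

text \<open>
  The condition on summands is first made numerical: \<open>d\<close> has a summand of one of the ten listed forms
  if and only if, for one of ten tuples \<open>(m\<^sub>1,k\<^sub>1,m\<^sub>2,k\<^sub>2,m\<^sub>3,k\<^sub>3)\<close>, at least \<open>m\<^sub>1\<close> parts of \<open>a\<close> are \<open>\<ge> k\<^sub>1\<close>, at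
  least \<open>m\<^sub>2\<close> parts of \<open>b'\<close> are \<open>\<ge> k\<^sub>2\<close> and at least \<open>m\<^sub>3\<close> parts of \<open>c'\<close> are \<open>\<ge> k\<^sub>3\<close>
  (\<open>summand_iff_critical\<close>). Such dimension types are called critical. It remains to show that the orbits
  are finite in number exactly for the types that are not critical (\<open>finite_type_iff_not_critical\<close>).

  Finiteness. A triple of flags is a direct sum of indecomposable triples, and the possible types of the
  summands are finite in number and again not critical. So it suffices that an indecomposable triple is
  determined by its type \<open>d\<close> (\<open>indecomposable_unique\<close>). Choose numbers \<open>\<alpha>\<^sub>i\<close>, \<open>\<beta>\<^sub>k\<close>, \<open>\<gamma>\<^sub>l\<close> that satisfy
  \<open>\<Sum> \<alpha>\<^sub>i a\<^sub>i = \<Sum> \<beta>\<^sub>k b\<^sub>k + \<Sum> \<gamma>\<^sub>l c\<^sub>l\<close> and no rational linear relation that is not a consequence of this one. Over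
  an algebraically closed field the endomorphism ring of an indecomposable triple is local, its elements
  are scalars plus nilpotents, and by duality for the trace form there is an operator \<open>X\<close> on
  \<open>V = B \<oplus> C\<close> that acts as \<open>\<alpha>\<^sub>i\<close> on the \<open>i\<close>-th factor of the flag in \<open>V\<close>, and whose diagonal blocks act
  as \<open>\<beta>\<^sub>k\<close> and \<open>\<gamma>\<^sub>l\<close> on the factors of the two other flags (\<open>lifting\<close>). This is the lifting argument from
  the additive Deligne-Simpson problem. Since the numbers are distinct, the eigenspaces of \<open>X\<close> and
  of its diagonal blocks recover the flags, so it suffices that the operator is unique up to conjugation
  by block diagonal matrices (\<open>generic_unique\<close>).

  Eliminating \<open>B\<close> turns \<open>X\<close> into the rational matrix function
  \<open>F(\<theta>) = \<theta> - \<Sum> \<gamma>\<^sub>l H\<^sub>l - \<Sum> Q E\<^sub>k P / (\<theta> - \<beta>\<^sub>k)\<close> on \<open>C\<close>, whose kernel at \<open>\<alpha>\<^sub>i\<close> has dimension \<open>a\<^sub>i\<close> and whose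
  residue at \<open>\<beta>\<^sub>k\<close> has rank \<open>b\<^sub>k\<close>. Multiplication by \<open>(\<theta> - \<beta>\<^sub>j) / (\<theta> - \<alpha>\<^sub>i)\<close> exchanges the roles of
  \<open>\<alpha>\<^sub>i\<close> and \<open>\<beta>\<^sub>j\<close> and replaces \<open>a\<^sub>i\<close>, \<open>b\<^sub>j\<close> by \<open>|c'| - b\<^sub>j\<close>, \<open>|c'| - a\<^sub>i\<close> (\<open>reflect\<close>); the same holds with the
  two blocks interchanged. A type that is not critical admits such a reflection that makes it smaller
  (\<open>critical_if_irreducible\<close>), until one block is empty and there is nothing left to choose.

  Infiniteness. For each of the ten shapes there is an explicit one-parameter family of triples without
  non-zero homomorphisms between different members (\<open>rigid_pencil\<close>). Adding the same complementary
  coordinate flags to all members gives triples of type \<open>d\<close>. If infinitely many of them lay in one orbit,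
  the images of a common vector under the isomorphisms to a fixed triple would be infinitely many linearly
  independent vectors (\<open>orthogonal_family_infinite\<close>).
\<close>

section \<open>Linear algebra inside a fixed ambient space\<close>

locale ambient = vector_space
begin

abbreviation lin :: "('b \<Rightarrow> 'b) \<Rightarrow> bool" where
  "lin f \<equiv> Vector_Spaces.linear scale scale f"

abbreviation functional :: "('b \<Rightarrow> 'a) \<Rightarrow> bool" where
  "functional f \<equiv> Vector_Spaces.linear scale (*) f"

abbreviation ssum :: "'b set \<Rightarrow> 'b set \<Rightarrow> 'b set" where
  "ssum S T \<equiv> {x + y | x y. x \<in> S \<and> y \<in> T}"

lemma ssumI: "x \<in> S \<Longrightarrow> y \<in> T \<Longrightarrow> x + y \<in> ssum S T"
  by blast

lemma fixes f :: "'b \<Rightarrow> 'b" and x y :: 'b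
  shows lin_add: "lin f \<Longrightarrow> f (x + y) = f x + f y"
  and lin_scale: "lin f \<Longrightarrow> f (c *s x) = c *s f x"
  and lin_0: "lin f \<Longrightarrow> f 0 = 0"
  and lin_diff: "lin f \<Longrightarrow> f (x - y) = f x - f y"
  and lin_neg: "lin f \<Longrightarrow> f (- x) = - f x"
  and lin_sum: "lin f \<Longrightarrow> f (sum g A) = (\<Sum>a\<in>A. f (g a))"
  by (simp_all add: linear_iff_module_hom module_hom.add
      module_hom.scale module_hom.zero module_hom.diff module_hom.neg module_hom.sum)

lemma linI:
  fixes f :: "'b \<Rightarrow> 'b"
  shows "(\<And>x y. f (x + y) = f x + f y) \<Longrightarrow> (\<And>c x. f (c *s x) = c *s f x) \<Longrightarrow> lin f"
  by (simp add: Vector_Spaces.linear_iff vector_space_axioms)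

lemma lin_compose_app:
  fixes f :: "'b \<Rightarrow> 'b"
  shows "lin f \<Longrightarrow> lin g \<Longrightarrow> lin (\<lambda>x. f (g x))"
  by (rule linI) (simp_all add: lin_add lin_scale)

lemma lin_plus: "lin f \<Longrightarrow> lin g \<Longrightarrow> lin (\<lambda>x. f x + g x)"
  by (rule linI) (simp_all add: lin_add lin_scale algebra_simps)

lemma lin_minus: "lin f \<Longrightarrow> lin g \<Longrightarrow> lin (\<lambda>x. f x - g x)"
  by (rule linI) (simp_all add: lin_add lin_scale algebra_simps)

lemma lin_smult: "lin f \<Longrightarrow> lin (\<lambda>x. c *s f x)"
  by (rule linI) (simp_all add: lin_add lin_scale algebra_simps)

lemma lin_summation: "(\<And>i. i \<in> I \<Longrightarrow> lin (f i)) \<Longrightarrow> lin (\<lambda>x. \<Sum>i\<in>I. f i x)"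
  by (rule linI) (simp_all add: lin_add lin_scale algebra_simps sum.distrib scale_sum_right)

lemma lin_ident: "lin (\<lambda>x. x)" and lin_zero: "lin (\<lambda>x. 0)"
  by (rule linI; simp)+

lemmas lin_intros = lin_ident lin_zero lin_plus lin_minus lin_smult lin_summation

lemma lin_subspace_image: "lin f \<Longrightarrow> subspace S \<Longrightarrow> subspace (f ` S)"
  by (simp add: linear_iff_module_hom module_hom.subspace_image)

lemma lin_subspace_preimage: "lin f \<Longrightarrow> subspace S \<Longrightarrow> subspace T \<Longrightarrow> subspace {x \<in> S. f x \<in> T}"
  by (rule subspaceI) (auto simp: lin_add lin_scale lin_0 subspace_0 subspace_add subspace_scale)

lemma lin_subspace_kernel: "lin f \<Longrightarrow> subspace S \<Longrightarrow> subspace {x \<in> S. f x = 0}"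
  using lin_subspace_preimage[of f S "{0}"] by simp

lemma lin_inj_onI:
  assumes "lin f" "subspace S" "\<And>x. x \<in> S \<Longrightarrow> f x = 0 \<Longrightarrow> x = 0"
  shows "inj_on f S"
proof (rule inj_onI)
  fix x y assume "x \<in> S" "y \<in> S" "f x = f y"
  then show "x = y" using assms(3)[of "x - y"] by (simp add: lin_diff[OF assms(1)] subspace_diff[OF assms(2)])
qed

lemma separating_functional:
  assumes "subspace S" "v \<notin> S"
  shows "\<exists>f. functional f \<and> (\<forall>x\<in>S. f x = 0) \<and> f v = 1"
proof -
  interpret vector_space_pair scale "(*) :: 'a \<Rightarrow> 'a \<Rightarrow> 'a"
    by unfold_locales (simp_all add: algebra_simps)
  obtain B where B: "B \<subseteq> S" "independent B" "S \<subseteq> span B"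
    using maximal_independent_subset by metis
  have spB: "span B = S" using B assms(1) span_subspace by blast
  have "independent (insert v B)" using B assms spB independent_insertI by metis
  then obtain f where f: "functional f" "\<forall>x\<in>insert v B. f x = (if x = v then 1 else 0)"
    using linear_independent_extend[of "insert v B" "\<lambda>x. if x = v then 1 else 0"] by blast
  have "f x = 0" if "x \<in> S" for x
  proof -
    have "\<And>b. b \<in> B \<Longrightarrow> f b = 0" using f(2) B(1) assms(2) by auto
    then show ?thesis
      using linear_eq_0_on_span[OF f(1), of B x] that spB by blast
  qed
  then show ?thesis using f by auto
qed

lemma projection_along:
  assumes S: "subspace S" and T: "subspace T" and ST: "S \<inter> T = {0}"
  shows "\<exists>f. lin f \<and> (\<forall>x\<in>S. f x = x) \<and> (\<forall>x\<in>T. f x = 0)"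
proof -
  interpret vector_space_pair scale scale by unfold_locales
  obtain B where B: "B \<subseteq> S" "independent B" "S \<subseteq> span B"
    using maximal_independent_subset by metis
  have spB: "span B = S" using B S span_subspace by blast
  obtain C where C: "B \<subseteq> C" "C \<subseteq> ssum S T" "independent C" "ssum S T \<subseteq> span C"
    using maximal_independent_subset_extend[of B "ssum S T"] B
    by (smt (verit, best) T add.right_neutral mem_Collect_eq subset_eq subspace_0)
  obtain g where g: "lin g" "\<forall>x\<in>C. g x = (if x \<in> B then 0 else (SOME t. t \<in> T \<and> x - t \<in> S))"
    using linear_independent_extend[OF C(3), of "\<lambda>x. if x \<in> B then 0 else SOME t. t \<in> T \<and> x - t \<in> S"] by blast
  have gS: "g x = 0" if "x \<in> S" for x
  proof -
    have "\<And>b. b \<in> B \<Longrightarrow> g b = 0" using g(2) C(1) by auto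
    then show ?thesis using linear_eq_0_on_span[OF g(1), of B x] that spB by blast
  qed
  have gC: "g x \<in> T \<and> x - g x \<in> S" if x: "x \<in> C" for x
  proof (cases "x \<in> B")
    case True then show ?thesis using g(2) x B T by (auto simp: subspace_0)
  next
    case False
    obtain s t where "s \<in> S" "t \<in> T" "x = s + t" using C(2) x by blast
    then have "\<exists>t. t \<in> T \<and> x - t \<in> S" by (intro exI[of _ t]) auto
    from someI_ex[OF this] show ?thesis using g(2) x False by auto
  qed
  have gsp: "g x \<in> T \<and> x - g x \<in> S" if "x \<in> span C" for x
    using that
  proof (induction rule: span_induct_alt)
    case base then show ?case using S T by (simp add: lin_0[OF g(1)] subspace_0)
  next
    case (step c x y)
    have "c *s x + y - g (c *s x + y) = c *s (x - g x) + (y - g y)"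
      by (simp add: lin_add[OF g(1)] lin_scale[OF g(1)] algebra_simps)
    then show ?case using gC[OF step(1)] step(2) S T
      by (metis g(1) lin_add lin_scale subspace_add subspace_scale)
  qed
  have "x - g x = 0" if "x \<in> T" for x
  proof -
    have "0 + x \<in> ssum S T" using that S subspace_0 by blast
    then have "x \<in> span C" using C(4) by auto
    then have "x - g x \<in> S \<inter> T" using gsp that T subspace_diff by auto
    then show ?thesis using ST by blast
  qed
  then show ?thesis
    by (intro exI[of _ "\<lambda>x. x - g x"]) (auto simp: gS intro!: lin_intros g)
qed

lemma left_inverse_on:
  assumes "lin f" "subspace S" "inj_on f S"
  shows "\<exists>g. lin g \<and> (\<forall>x\<in>S. g (f x) = x)"
proof -
  interpret vector_space_pair scale scale by unfold_locales
  show ?thesis using linear_exists_left_inverse_on[OF assms] by blast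
qed

end

locale fin_ambient = finite_dimensional_vector_space
begin

sublocale ambient ..

lemma dim_ssum:
  assumes "subspace S" "subspace T" "S \<inter> T = {0}"
  shows "dim (ssum S T) = dim S + dim T"
  using dim_sums_Int[OF assms(1,2)] assms(3) by simp

lemma dim_inj_image:
  assumes "lin f" "subspace S" "inj_on f S" shows "dim (f ` S) = dim S"
proof -
  interpret finite_dimensional_vector_space_pair scale Basis scale Basis by unfold_locales
  show ?thesis using dim_image_eq[OF assms(1), of S] assms span_eq_iff by metis
qed

lemma subspace_iso:
  assumes "subspace S" "subspace T" "dim S = dim T"
  shows "\<exists>f. lin f \<and> f ` S = T \<and> inj_on f S"
proof -
  interpret finite_dimensional_vector_space_pair scale Basis scale Basis by unfold_locales
  show ?thesis using subspace_isomorphism[OF assms] .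
qed

lemma subspace_complement:
  assumes "subspace K" "subspace S" "K \<subseteq> S"
  shows "\<exists>T. subspace T \<and> T \<subseteq> S \<and> K \<inter> T = {0} \<and> ssum K T = S"
proof -
  obtain f where f: "lin f" "\<forall>x\<in>K. f x = x" "\<forall>x\<in>{0}. f x = 0"
    using projection_along[OF assms(1) subspace_single_0] assms(1) subspace_0 by blast
  obtain B where B: "B \<subseteq> K" "independent B" "K \<subseteq> span B"
    using maximal_independent_subset by metis
  obtain C where C: "B \<subseteq> C" "C \<subseteq> S" "independent C" "S \<subseteq> span C"
    using maximal_independent_subset_extend[of B S] B assms by blast
  have K: "K = span B" and S: "S = span C" using B C assms span_subspace by metis+
  have CB: "C = B \<union> (C - B)" using C by blast
  have "x = 0" if "x \<in> K" "x \<in> span (C - B)" for x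
  proof (rule ccontr)
    assume x: "x \<noteq> 0"
    define r where "r = representation C x"
    have "r = representation B x"
      unfolding r_def using representation_extend[OF C(3) _ C(1)] that K by metis
    moreover have "r = representation (C - B) x"
      unfolding r_def using representation_extend[OF C(3) _ Diff_subset] that by metis
    ultimately have "\<And>b. r b \<noteq> 0 \<Longrightarrow> b \<in> B \<inter> (C - B)"
      using representation_ne_zero by (metis IntI)
    then have "r = (\<lambda>b. 0)" by blast
    then have "x = 0" using sum_nonzero_representation_eq[OF C(3), of x] that S K C(1) span_mono
      unfolding r_def by (metis (mono_tags, lifting) subsetD sum.neutral scale_zero_left)
    then show False using x by simp
  qed
  moreover have "ssum K (span (C - B)) = S"
    using span_Un[of B "C - B"] CB K S by simp
  ultimately show ?thesis
    by (intro exI[of _ "span (C - B)"]) (auto simp: K S subspace_0 span_zero intro: span_mono[THEN subsetD])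
qed

lemma rank_nullity:
  assumes f: "lin f" and S: "subspace S"
  shows "dim (f ` S) + dim {x \<in> S. f x = 0} = dim S"
proof -
  let ?K = "{x \<in> S. f x = 0}"
  obtain T where T: "subspace T" "T \<subseteq> S" "?K \<inter> T = {0}" "ssum ?K T = S"
    using subspace_complement[OF lin_subspace_kernel[OF f S] S] by auto
  have inj: "inj_on f T" using T by (intro lin_inj_onI f) auto
  have "f ` S = f ` T"
  proof (rule antisym)
    show "f ` S \<subseteq> f ` T"
    proof safe
      fix x assume "x \<in> S"
      then obtain k t where "k \<in> ?K" "t \<in> T" "x = k + t" using T(4) by blast
      then show "f x \<in> f ` T" by (simp add: lin_add[OF f])
    qed
  qed (use T in auto)
  then show ?thesis
    using dim_inj_image[OF f T(1) inj] dim_ssum[OF lin_subspace_kernel[OF f S] T(1,3)] T(4) by simp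
qed

lemma subspace_eq_if_dim_le: "subspace S \<Longrightarrow> subspace T \<Longrightarrow> S \<subseteq> T \<Longrightarrow> dim T \<le> dim S \<Longrightarrow> S = T"
  using subspace_dim_equal by blast

lemma subspace_of_dim:
  assumes "subspace S" "m \<le> dim S"
  shows "\<exists>T. subspace T \<and> T \<subseteq> S \<and> dim T = m"
proof -
  obtain B where B: "B \<subseteq> S" "independent B" "S \<subseteq> span B" "card B = dim S"
    using basis_exists by metis
  obtain C where C: "C \<subseteq> B" "card C = m" using assms(2) B(4) obtain_subset_with_card_n by metis
  then have "independent C" using B independent_mono by blast
  then show ?thesis
    using C B assms(1) by (intro exI[of _ "span C"]) (simp add: dim_eq_card_independent span_minimal)
qed

end

section \<open>Independent families of subspaces and eigenspaces\<close>

context ambient begin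

definition fam_sum :: "'i set \<Rightarrow> ('i \<Rightarrow> 'b set) \<Rightarrow> 'b set" where
  "fam_sum I S = {\<Sum>i\<in>I. s i | s. \<forall>i\<in>I. s i \<in> S i}"

definition indep_family :: "'i set \<Rightarrow> ('i \<Rightarrow> 'b set) \<Rightarrow> bool" where
  "indep_family I S \<longleftrightarrow> (\<forall>s. (\<forall>i\<in>I. s i \<in> S i) \<longrightarrow> (\<Sum>i\<in>I. s i) = 0 \<longrightarrow> (\<forall>i\<in>I. s i = 0))"

lemma indep_familyD:
  assumes "indep_family I S" "\<And>i. i \<in> I \<Longrightarrow> s i \<in> S i" "(\<Sum>i\<in>I. s i) = 0" "i \<in> I"
  shows "s i = 0"
  using assms(1)[unfolded indep_family_def, rule_format, of s i] assms(2-4) by simp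

lemma fam_sumI:
  assumes "\<And>i. i \<in> I \<Longrightarrow> s i \<in> S i" shows "(\<Sum>i\<in>I. s i) \<in> fam_sum I S"
  unfolding fam_sum_def using assms by (intro CollectI exI[of _ s]) simp

lemma fam_sumE:
  assumes "x \<in> fam_sum I S"
  obtains s where "\<forall>i\<in>I. s i \<in> S i" "x = (\<Sum>i\<in>I. s i)"
  using assms that unfolding fam_sum_def mem_Collect_eq by (elim exE conjE)

lemma subspace_fam_sum:
  assumes "\<And>i. i \<in> I \<Longrightarrow> subspace (S i)" shows "subspace (fam_sum I S)"
proof (rule subspaceI)
  have "(\<Sum>i\<in>I. 0) \<in> fam_sum I S"
    by (rule fam_sumI) (rule subspace_0[OF assms])
  then show "0 \<in> fam_sum I S" by simp
next
  fix x y assume "x \<in> fam_sum I S" "y \<in> fam_sum I S"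
  then obtain s t where s: "\<forall>i\<in>I. s i \<in> S i" "x = (\<Sum>i\<in>I. s i)"
    and t: "\<forall>i\<in>I. t i \<in> S i" "y = (\<Sum>i\<in>I. t i)"
    by (metis fam_sumE)
  have "(\<Sum>i\<in>I. s i + t i) \<in> fam_sum I S"
    by (rule fam_sumI) (rule subspace_add[OF assms bspec[OF s(1)] bspec[OF t(1)]])
  then show "x + y \<in> fam_sum I S" by (simp add: sum.distrib s(2) t(2))
next
  fix c x assume "x \<in> fam_sum I S"
  then obtain s where s: "\<forall>i\<in>I. s i \<in> S i" "x = (\<Sum>i\<in>I. s i)"
    by (rule fam_sumE)
  have "(\<Sum>i\<in>I. c *s s i) \<in> fam_sum I S"
    by (rule fam_sumI) (rule subspace_scale[OF assms bspec[OF s(1)]])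
  then show "c *s x \<in> fam_sum I S" by (simp add: scale_sum_right s(2))
qed

lemma sum_insert_upd:
  assumes "finite I" "j \<notin> I"
  shows "(\<Sum>i\<in>insert j I. (s(j := y)) i) = y + (\<Sum>i\<in>I. s i)"
proof -
  have "(\<Sum>i\<in>I. (s(j := y)) i) = (\<Sum>i\<in>I. s i)"
    by (rule sum.cong[OF refl]) (use assms(2) in auto)
  then show ?thesis using assms by simp
qed

lemma fam_sum_insert:
  assumes "finite I" "j \<notin> I"
  shows "fam_sum (insert j I) S = ssum (S j) (fam_sum I S)"
proof (intro set_eqI iffI)
  fix x assume "x \<in> fam_sum (insert j I) S"
  then obtain s where s: "\<forall>i\<in>insert j I. s i \<in> S i" "x = (\<Sum>i\<in>insert j I. s i)"
    by (rule fam_sumE)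
  have "s j + (\<Sum>i\<in>I. s i) \<in> ssum (S j) (fam_sum I S)"
    by (intro ssumI fam_sumI) (use s(1) in auto)
  then show "x \<in> ssum (S j) (fam_sum I S)"
    using assms s(2) by simp
next
  fix x assume "x \<in> ssum (S j) (fam_sum I S)"
  then obtain y z where yz: "y \<in> S j" "z \<in> fam_sum I S" "x = y + z" by blast
  from yz(2) obtain s where s: "\<forall>i\<in>I. s i \<in> S i" "z = (\<Sum>i\<in>I. s i)"
    by (rule fam_sumE)
  have "(\<Sum>i\<in>insert j I. (s(j := y)) i) = y + (\<Sum>i\<in>I. s i)"
    using assms by (rule sum_insert_upd)
  moreover have "(\<Sum>i\<in>insert j I. (s(j := y)) i) \<in> fam_sum (insert j I) S"
    by (rule fam_sumI) (use s(1) yz(1) in auto)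
  ultimately show "x \<in> fam_sum (insert j I) S" using s(2) yz(3) by simp
qed

lemma indep_family_insertD:
  assumes "finite I" "j \<notin> I" "indep_family (insert j I) S" "\<And>i. i \<in> insert j I \<Longrightarrow> subspace (S i)"
  shows "indep_family I S" "S j \<inter> fam_sum I S = {0}"
proof -
  show "indep_family I S"
    unfolding indep_family_def
  proof (intro allI impI)
    fix s assume s: "\<forall>i\<in>I. s i \<in> S i" "(\<Sum>i\<in>I. s i) = 0"
    have "(\<Sum>i\<in>insert j I. (s(j := 0)) i) = (\<Sum>i\<in>I. s i)"
      using sum_insert_upd[OF assms(1,2), of s 0] by simp
    then have su: "(\<Sum>i\<in>insert j I. (s(j := 0)) i) = 0" using s(2) by (rule trans)
    have me: "(s(j := 0)) i \<in> S i" if "i \<in> insert j I" for i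
      using that s(1) assms(4) by (auto simp: subspace_0)
    note z = indep_familyD[OF assms(3), of "s(j := 0)", OF me su]
    show "\<forall>i\<in>I. s i = 0"
    proof
      fix i assume "i \<in> I"
      then show "s i = 0" using z[of i] assms(2) by (cases "i = j") auto
    qed
  qed
  have "x = 0" if x: "x \<in> S j" "x \<in> fam_sum I S" for x
  proof -
    obtain s where s: "\<forall>i\<in>I. s i \<in> S i" "x = (\<Sum>i\<in>I. s i)"
      using x(2) by (rule fam_sumE)
    have "(\<Sum>i\<in>insert j I. (s(j := - x)) i) = - x + (\<Sum>i\<in>I. s i)"
      using assms(1,2) by (rule sum_insert_upd)
    then have su: "(\<Sum>i\<in>insert j I. (s(j := - x)) i) = 0" using s(2) by simp
    have me: "(s(j := - x)) i \<in> S i" if "i \<in> insert j I" for i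
      using that s(1) assms(4) \<open>x \<in> S j\<close> by (auto simp: subspace_neg)
    have "(s(j := - x)) j = 0"
      by (rule indep_familyD[OF assms(3), of "s(j := - x)", OF me su]) auto
    then show ?thesis by simp
  qed
  moreover have "0 \<in> S j \<inter> fam_sum I S" using assms(4) subspace_fam_sum[of I S] by (simp add: subspace_0)
  ultimately show "S j \<inter> fam_sum I S = {0}" by auto
qed

text \<open>Independence makes the projections onto the single summands well defined on the sum; they extend
  linearly to the ambient space.\<close>

lemma indep_family_projections:
  assumes I: "finite I" and ind: "indep_family I S" and S: "\<And>i. i \<in> I \<Longrightarrow> subspace (S i)"
  shows "\<exists>E. (\<forall>i. lin (E i)) \<and> (\<forall>i\<in>I. \<forall>j\<in>I. \<forall>x\<in>S j. E i x = (if i = j then x else 0))"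
proof -
  have "\<exists>f. lin f \<and> (i \<in> I \<longrightarrow> (\<forall>j\<in>I. \<forall>x\<in>S j. f x = (if i = j then x else 0)))" for i
  proof (cases "i \<in> I")
    case False then show ?thesis by (intro exI[of _ "\<lambda>x. 0"]) (simp add: lin_zero)
  next
    case True
    let ?J = "I - {i}"
    have iJ: "insert i ?J = I" "i \<notin> ?J" "finite ?J" using True I by auto
    have d: "S i \<inter> fam_sum ?J S = {0}"
      by (rule indep_family_insertD(2)[OF iJ(3,2)]) (use ind S iJ(1) in auto)
    have su: "subspace (fam_sum ?J S)" by (rule subspace_fam_sum) (use S in auto)
    obtain f where f: "lin f" "\<forall>x\<in>S i. f x = x" "\<forall>x\<in>fam_sum ?J S. f x = 0"
      using projection_along[OF S[OF True] su d] by blast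
    have "f x = 0" if "j \<in> ?J" "x \<in> S j" for j x
    proof -
      have "(\<Sum>k\<in>?J. if k = j then x else 0) \<in> fam_sum ?J S"
        by (rule fam_sumI) (use that S in \<open>auto simp: subspace_0\<close>)
      then show ?thesis using f(3) that iJ by (simp add: sum.delta)
    qed
    then show ?thesis using f by (intro exI[of _ f]) auto
  qed
  then have "\<forall>i. \<exists>f. lin f \<and> (i \<in> I \<longrightarrow> (\<forall>j\<in>I. \<forall>x\<in>S j. f x = (if i = j then x else 0)))"
    by (rule allI)
  from choice[OF this] obtain E
    where "\<forall>i. lin (E i) \<and> (i \<in> I \<longrightarrow> (\<forall>j\<in>I. \<forall>x\<in>S j. E i x = (if i = j then x else 0)))" ..
  then show ?thesis by (intro exI[of _ E]) simp
qed

text \<open>Eigenvectors for distinct eigenvalues are independent: apply \<open>X - \<alpha>\<^sub>j\<close> to remove one summand.\<close>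

lemma eigen_indep:
  assumes "finite I" "lin X" "inj_on \<alpha> I" "\<And>i x. i \<in> I \<Longrightarrow> x \<in> S i \<Longrightarrow> X x = \<alpha> i *s x"
  shows "indep_family I S"
proof -
  have main: "\<forall>i\<in>I. s i = 0" if "\<forall>i\<in>I. X (s i) = \<alpha> i *s s i" "(\<Sum>i\<in>I. s i) = 0" for s
    using assms(1,3) that
  proof (induction I arbitrary: s rule: finite_induct)
    case (insert j I)
    let ?s = "\<lambda>i. (\<alpha> i - \<alpha> j) *s s i"
    have Xs: "X (s i) = \<alpha> i *s s i" if "i \<in> insert j I" for i using insert(5) that by blast
    have "X (\<Sum>i\<in>insert j I. s i) - \<alpha> j *s (\<Sum>i\<in>insert j I. s i) = (\<Sum>i\<in>insert j I. ?s i)"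
      unfolding lin_sum[OF assms(2)] scale_sum_right sum_subtractf[symmetric]
      by (rule sum.cong[OF refl]) (simp only: Xs scale_left_diff_distrib)
    then have "(\<Sum>i\<in>insert j I. ?s i) = 0" unfolding insert(6) by (simp add: lin_0[OF assms(2)])
    then have "(\<Sum>i\<in>I. ?s i) = 0" using insert(1,2) by simp
    moreover have "\<forall>i\<in>I. X (?s i) = \<alpha> i *s ?s i"
      using Xs by (auto simp only: lin_scale[OF assms(2)] insertI2 scale_left_commute)
    ultimately have "\<forall>i\<in>I. ?s i = 0" using insert.IH[of ?s] inj_on_subset[OF insert(4)] by blast
    moreover have "\<alpha> i \<noteq> \<alpha> j" if "i \<in> I" for i
      using inj_onD[OF insert(4), of i j] insert(2) that by blast
    ultimately have z: "\<forall>i\<in>I. s i = 0" by simp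
    then have "s j = 0" using insert(1,2,6) by simp
    then show ?case using z by simp
  qed simp
  show ?thesis unfolding indep_family_def
  proof (intro allI impI)
    fix s assume s: "\<forall>i\<in>I. s i \<in> S i" "(\<Sum>i\<in>I. s i) = 0"
    have "X (s i) = \<alpha> i *s s i" if "i \<in> I" for i
      using assms(4)[OF that bspec[OF s(1) that]] .
    then have "\<forall>i\<in>I. X (s i) = \<alpha> i *s s i" by blast
    from main[OF this s(2)] show "\<forall>i\<in>I. s i = 0" .
  qed
qed

end

context fin_ambient begin

lemma dim_fam_sum:
  assumes "finite I" "indep_family I S" "\<And>i. i \<in> I \<Longrightarrow> subspace (S i)"
  shows "dim (fam_sum I S) = (\<Sum>i\<in>I. dim (S i))"
  using assms
proof (induction I rule: finite_induct)
  case empty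
  then show ?case by (simp add: fam_sum_def)
next
  case (insert j I)
  note D = indep_family_insertD[OF insert(1,2,4,5)]
  show ?case
    using insert D(2) subspace_fam_sum[of I S] dim_ssum[of "S j" "fam_sum I S"] insert.IH[OF D(1)]
    by (simp add: fam_sum_insert)
qed

text \<open>An operator whose eigenspaces already account for the dimension is diagonalisable.\<close>

lemma eigen_exhaust:
  assumes "finite I" "lin X" "inj_on \<alpha> I" "\<And>i x. i \<in> I \<Longrightarrow> x \<in> S i \<Longrightarrow> X x = \<alpha> i *s x"
    and S: "\<And>i. i \<in> I \<Longrightarrow> subspace (S i)" "\<And>i. i \<in> I \<Longrightarrow> S i \<subseteq> T" and T: "subspace T"
    and d: "dim T \<le> (\<Sum>i\<in>I. dim (S i))"
  shows "fam_sum I S = T"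
proof (rule subspace_eq_if_dim_le)
  show "fam_sum I S \<subseteq> T"
    unfolding fam_sum_def using S(2) by (auto intro!: subspace_sum[OF T])
  have ind: "indep_family I S" by (rule eigen_indep[of I X \<alpha>]; fact)
  show "dim T \<le> dim (fam_sum I S)"
    using dim_fam_sum[OF assms(1) ind S(1)] d by simp
qed (use subspace_fam_sum S(1) T in auto)

lemma eigen_exhaust_bij:
  assumes "finite I" "lin X" "inj_on \<alpha> I" "\<And>i x. i \<in> I \<Longrightarrow> x \<in> S i \<Longrightarrow> X x = \<alpha> i *s x"
    and S: "\<And>i. i \<in> I \<Longrightarrow> subspace (S i)" "\<And>i. i \<in> I \<Longrightarrow> S i \<subseteq> T" and T: "subspace T"
    and d: "dim T \<le> (\<Sum>i\<in>I. dim (S i))"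
    and \<theta>: "\<And>i. i \<in> I \<Longrightarrow> \<alpha> i \<noteq> \<theta>"
  shows "\<And>x. x \<in> T \<Longrightarrow> X x = \<theta> *s x \<Longrightarrow> x = 0"
    and "\<And>y. y \<in> T \<Longrightarrow> \<exists>x\<in>T. X x - \<theta> *s x = y"
proof -
  have ex: "fam_sum I S = T" by (rule eigen_exhaust[of I X \<alpha> S T]; fact)
  have ind: "indep_family I S" by (rule eigen_indep[of I X \<alpha>]; fact)
  { fix x assume x: "x \<in> T" "X x = \<theta> *s x"
    have "x \<in> fam_sum I S" unfolding ex by (rule x(1))
    then obtain s where s: "\<forall>i\<in>I. s i \<in> S i" "x = (\<Sum>i\<in>I. s i)" by (rule fam_sumE)
    have Xs: "X (s i) = \<alpha> i *s s i" if "i \<in> I" for i using assms(4)[OF that bspec[OF s(1) that]] .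
    have "X x - \<theta> *s x = (\<Sum>i\<in>I. (\<alpha> i - \<theta>) *s s i)"
      unfolding s(2) lin_sum[OF assms(2)] scale_sum_right sum_subtractf[symmetric]
      by (rule sum.cong[OF refl]) (simp only: Xs scale_left_diff_distrib)
    then have su: "(\<Sum>i\<in>I. (\<alpha> i - \<theta>) *s s i) = 0" using x(2) by simp
    have me: "(\<alpha> i - \<theta>) *s s i \<in> S i" if "i \<in> I" for i
      by (rule subspace_scale[OF S(1)[OF that] bspec[OF s(1) that]])
    have "s i = 0" if "i \<in> I" for i
      using indep_familyD[OF ind me su that] \<theta>[OF that] by simp
    then show "x = 0" unfolding s(2) by (intro sum.neutral) blast }
  { fix y assume y: "y \<in> T"
    have "y \<in> fam_sum I S" unfolding ex by (rule y)
    then obtain s where s: "\<forall>i\<in>I. s i \<in> S i" "y = (\<Sum>i\<in>I. s i)" by (rule fam_sumE)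
    have Xs: "X (s i) = \<alpha> i *s s i" if "i \<in> I" for i using assms(4)[OF that bspec[OF s(1) that]] .
    define x where "x = (\<Sum>i\<in>I. (1 / (\<alpha> i - \<theta>)) *s s i)"
    have "X x - \<theta> *s x = (\<Sum>i\<in>I. s i)"
      unfolding x_def lin_sum[OF assms(2)] scale_sum_right sum_subtractf[symmetric]
    proof (rule sum.cong[OF refl])
      fix i assume i: "i \<in> I"
      have "X ((1 / (\<alpha> i - \<theta>)) *s s i) - \<theta> *s (1 / (\<alpha> i - \<theta>)) *s s i
          = ((1 / (\<alpha> i - \<theta>)) * (\<alpha> i - \<theta>)) *s s i"
        by (simp only: lin_scale[OF assms(2)] Xs[OF i] scale_scale mult.commute scale_left_diff_distrib left_diff_distrib)
      then show "X ((1 / (\<alpha> i - \<theta>)) *s s i) - \<theta> *s (1 / (\<alpha> i - \<theta>)) *s s i = s i" using \<theta>[OF i] by simp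
    qed
    moreover have "x \<in> T" unfolding x_def
      by (intro subspace_sum[OF T] subspace_scale[OF T]) (use s S in blast)
    ultimately show "\<exists>x\<in>T. X x - \<theta> *s x = y" using s(2) by blast }
qed

end

section \<open>Spectral systems\<close>

context ambient begin

text \<open>Total functions stand for maps defined on \<open>U\<close>. They are taken to be linear on the ambient space, which
  is possible by extension and makes compositions linear without side conditions.\<close>

definition resolution :: "nat \<Rightarrow> 'b set \<Rightarrow> (nat \<Rightarrow> 'b \<Rightarrow> 'b) \<Rightarrow> bool" where
  "resolution p U E \<longleftrightarrow> (\<forall>k. lin (E k)) \<and> (\<forall>k<p. \<forall>u\<in>U. E k u \<in> U) \<and> (\<forall>u\<in>U. (\<Sum>k<p. E k u) = u) \<and>
     (\<forall>k<p. \<forall>l<p. \<forall>u\<in>U. E k (E l u) = (if k = l then E l u else 0))"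

lemma resolution_lin: "resolution p U E \<Longrightarrow> lin (E k)"
  and resolution_mem: "resolution p U E \<Longrightarrow> k < p \<Longrightarrow> u \<in> U \<Longrightarrow> E k u \<in> U"
  and resolution_sum: "resolution p U E \<Longrightarrow> u \<in> U \<Longrightarrow> (\<Sum>k<p. E k u) = u"
  and resolution_comp: "resolution p U E \<Longrightarrow> k < p \<Longrightarrow> l < p \<Longrightarrow> u \<in> U \<Longrightarrow> E k (E l u) = (if k = l then E l u else 0)"
  unfolding resolution_def by blast+

lemma resolution_coeff:
  assumes E: "resolution p U E" and k: "k < p" and u: "\<And>l. l < p \<Longrightarrow> u l \<in> U"
  shows "E k (\<Sum>l<p. f l *s E l (u l)) = f k *s E k (u k)"
proof -
  have "E k (\<Sum>l<p. f l *s E l (u l)) = (\<Sum>l<p. if l = k then f l *s E l (u l) else 0)"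
    unfolding lin_sum[OF resolution_lin[OF E]]
    by (rule sum.cong) (use resolution_comp[OF E k _ u] in \<open>auto simp: lin_scale[OF resolution_lin[OF E]]\<close>)
  then show ?thesis using k by simp
qed

lemma resolution_eqI:
  assumes E: "resolution p U E" and "u \<in> U" "v \<in> U" "\<And>k. k < p \<Longrightarrow> E k u = E k v"
  shows "u = v"
  using resolution_sum[OF E assms(2)] resolution_sum[OF E assms(3)] assms(4) by (metis (no_types, lifting) lessThan_iff sum.cong)

lemma resolution_piece_iff:
  "resolution p U E \<Longrightarrow> k < p \<Longrightarrow> x \<in> E k ` U \<longleftrightarrow> x \<in> U \<and> E k x = x"
  using resolution_comp[of p U E k k] resolution_mem[of p U E k] by (metis (no_types, lifting) imageE image_eqI)

text \<open>The Schur complement of \<open>\<theta> - X\<close> on \<open>W\<close>, where \<open>X\<close> is the operator on \<open>U \<times> W\<close> with diagonal blocks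
  \<open>\<Sum> \<beta>\<^sub>k E\<^sub>k\<close> and \<open>\<Sum> \<gamma>\<^sub>l H\<^sub>l\<close> and off-diagonal blocks \<open>P : W \<rightarrow> U\<close> and \<open>Q : U \<rightarrow> W\<close>.\<close>

definition spectral_map ::
  "nat \<Rightarrow> nat \<Rightarrow> (nat \<Rightarrow> 'a) \<Rightarrow> (nat \<Rightarrow> 'a) \<Rightarrow> (nat \<Rightarrow> 'b \<Rightarrow> 'b) \<Rightarrow> (nat \<Rightarrow> 'b \<Rightarrow> 'b) \<Rightarrow>
    ('b \<Rightarrow> 'b) \<Rightarrow> ('b \<Rightarrow> 'b) \<Rightarrow> 'a \<Rightarrow> 'b \<Rightarrow> 'b" where
  "spectral_map p q \<beta> \<gamma> E H P Q \<theta> w =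
     \<theta> *s w - (\<Sum>l<q. \<gamma> l *s H l w) - (\<Sum>k<p. (1 / (\<theta> - \<beta> k)) *s Q (E k (P w)))"

definition bisystem where
  "bisystem p q U E W H P Q \<longleftrightarrow> subspace U \<and> subspace W \<and> resolution p U E \<and> resolution q W H \<and>
     lin P \<and> lin Q \<and> (\<forall>w\<in>W. P w \<in> U) \<and> (\<forall>u\<in>U. Q u \<in> W)"

lemma bisystem_swap: "bisystem p q U E W H P Q \<Longrightarrow> bisystem q p W H U E Q P"
  unfolding bisystem_def by blast

lemma bisystemD:
  assumes "bisystem p q U E W H P Q"
  shows "subspace U" "subspace W" "resolution p U E" "resolution q W H" "lin P" "lin Q"
    "\<And>w. w \<in> W \<Longrightarrow> P w \<in> U" "\<And>u. u \<in> U \<Longrightarrow> Q u \<in> W" "\<And>k. lin (E k)" "\<And>l. lin (H l)"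
    "\<And>k u. k < p \<Longrightarrow> u \<in> U \<Longrightarrow> E k u \<in> U" "\<And>l w. l < q \<Longrightarrow> w \<in> W \<Longrightarrow> H l w \<in> W"
  using assms unfolding bisystem_def resolution_def by blast+

lemma spectral_map_lin:
  assumes B: "bisystem p q U E W H P Q" shows "lin (spectral_map p q \<beta> \<gamma> E H P Q \<theta>)"
proof -
  note D = bisystemD[OF B]
  show ?thesis unfolding spectral_map_def
    by (intro lin_intros lin_compose_app[OF D(6)] lin_compose_app[OF D(9)] D(5,10))
qed

lemma spectral_map_mem:
  assumes B: "bisystem p q U E W H P Q" and w: "w \<in> W" shows "spectral_map p q \<beta> \<gamma> E H P Q \<theta> w \<in> W"
proof -
  note D = bisystemD[OF B]
  show ?thesis unfolding spectral_map_def
    by (intro subspace_diff[OF D(2)] subspace_scale[OF D(2)] subspace_sum[OF D(2)] D(8,12,7,11) w) auto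
qed

abbreviation spectral_kernel where
  "spectral_kernel p q \<beta> \<gamma> E W H P Q \<theta> \<equiv> {w \<in> W. spectral_map p q \<beta> \<gamma> E H P Q \<theta> w = 0}"

end

context fin_ambient begin

text \<open>Under \<open>\<theta> \<noteq> \<beta>\<^sub>k\<close> the kernel of the Schur complement is the \<open>\<theta>\<close>-eigenspace of \<open>X\<close>. So the dimensions
  \<open>a\<close> prescribe the eigenspaces of \<open>X\<close>, and \<open>b\<close> and \<open>c\<close> those of its diagonal blocks.\<close>

definition realises ::
  "nat \<Rightarrow> nat \<Rightarrow> nat \<Rightarrow> (nat \<Rightarrow> 'a) \<Rightarrow> (nat \<Rightarrow> 'a) \<Rightarrow> (nat \<Rightarrow> 'a) \<Rightarrow> (nat \<Rightarrow> nat) \<Rightarrow> (nat \<Rightarrow> nat) \<Rightarrow> (nat \<Rightarrow> nat) \<Rightarrow>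
    'b set \<Rightarrow> (nat \<Rightarrow> 'b \<Rightarrow> 'b) \<Rightarrow> 'b set \<Rightarrow> (nat \<Rightarrow> 'b \<Rightarrow> 'b) \<Rightarrow> ('b \<Rightarrow> 'b) \<Rightarrow> ('b \<Rightarrow> 'b) \<Rightarrow> bool" where
  "realises r p q \<alpha> \<beta> \<gamma> a b c U E W H P Q \<longleftrightarrow> bisystem p q U E W H P Q \<and>
     (\<forall>k<p. dim (E k ` U) = b k) \<and> (\<forall>l<q. dim (H l ` W) = c l) \<and>
     (\<forall>i<r. dim (spectral_kernel p q \<beta> \<gamma> E W H P Q (\<alpha> i)) = a i)"

lemma resolution_dim:
  assumes E: "resolution p U E" and U: "subspace U"
  shows "dim U = (\<Sum>k<p. dim (E k ` U))"
proof -
  let ?S = "\<lambda>k. E k ` U"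
  have ind: "indep_family {..<p} ?S"
    unfolding indep_family_def
  proof (intro allI impI ballI)
    fix s k assume s: "\<forall>i\<in>{..<p}. s i \<in> E i ` U" "(\<Sum>i<p. s i) = 0" "k \<in> {..<p}"
    then have si: "s i \<in> U" "E i (s i) = s i" if "i < p" for i
      using resolution_piece_iff[OF E that] that by auto
    have "E k (\<Sum>l<p. 1 *s E l (s l)) = 1 *s E k (s k)"
      by (rule resolution_coeff[OF E _ si(1)]) (use s(3) in auto)
    moreover have "(\<Sum>l<p. 1 *s E l (s l)) = (\<Sum>l<p. s l)"
      by (rule sum.cong[OF refl]) (simp add: si(2))
    ultimately show "s k = 0" using s(2,3) si(2)[of k] lin_0[OF resolution_lin[OF E]] by simp
  qed
  have "fam_sum {..<p} ?S = U"
  proof (rule antisym; rule subsetI)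
    fix x assume "x \<in> fam_sum {..<p} ?S"
    then obtain s where s: "\<forall>i\<in>{..<p}. s i \<in> E i ` U" "x = (\<Sum>i<p. s i)" by (rule fam_sumE)
    have "s i \<in> U" if "i \<in> {..<p}" for i
      using resolution_piece_iff[OF E, of i] bspec[OF s(1) that] that by simp
    then show "x \<in> U" unfolding s(2) by (rule subspace_sum[OF U])
  next
    fix x assume x: "x \<in> U"
    have "(\<Sum>k<p. E k x) \<in> fam_sum {..<p} ?S" by (rule fam_sumI) (use x in blast)
    then show "x \<in> fam_sum {..<p} ?S" unfolding resolution_sum[OF E x] .
  qed
  then show ?thesis
    using dim_fam_sum[OF _ ind lin_subspace_image[OF resolution_lin[OF E] U]] by simp
qed

text \<open>The Schur complements of \<open>\<theta> - X\<close> with respect to the two diagonal blocks have isomorphic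
  kernels, both being coordinates of the \<open>\<theta>\<close>-eigenvectors of \<open>X\<close>.\<close>

lemma spectral_kernel_transfer:
  assumes B: "bisystem p q U E W H P Q" and \<beta>: "\<And>k. k < p \<Longrightarrow> \<theta> \<noteq> \<beta> k" and \<gamma>: "\<And>l. l < q \<Longrightarrow> \<theta> \<noteq> \<gamma> l"
    and w: "w \<in> spectral_kernel p q \<beta> \<gamma> E W H P Q \<theta>"
  defines "u \<equiv> (\<Sum>k<p. (1 / (\<theta> - \<beta> k)) *s E k (P w))"
  shows "u \<in> spectral_kernel q p \<gamma> \<beta> H U E Q P \<theta>" "(\<Sum>l<q. (1 / (\<theta> - \<gamma> l)) *s H l (Q u)) = w"
proof -
  note D = bisystemD[OF B]
  have wW: "w \<in> W" and w0: "spectral_map p q \<beta> \<gamma> E H P Q \<theta> w = 0" using w by auto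
  have uU: "u \<in> U" unfolding u_def
    by (intro subspace_sum[OF D(1)] subspace_scale[OF D(1)] D(11,7) wW) auto
  have Qu: "Q u = \<theta> *s w - (\<Sum>l<q. \<gamma> l *s H l w)"
    using w0 unfolding spectral_map_def u_def by (simp add: lin_sum[OF D(6)] lin_scale[OF D(6)])
  have HQ: "H l (Q u) = (\<theta> - \<gamma> l) *s H l w" if "l < q" for l
    unfolding Qu using resolution_coeff[OF D(4) that, of "\<lambda>_. w" \<gamma>] wW
    by (simp add: lin_diff[OF D(10)] lin_scale[OF D(10)] scale_left_diff_distrib)
  have HQ': "(1 / (\<theta> - \<gamma> l)) *s H l (Q u) = H l w" if "l < q" for l
    using HQ[OF that] \<gamma>[OF that] by simp
  then show 2: "(\<Sum>l<q. (1 / (\<theta> - \<gamma> l)) *s H l (Q u)) = w"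
    using resolution_sum[OF D(4) wW] by simp
  have "(\<Sum>l<q. (1 / (\<theta> - \<gamma> l)) *s P (H l (Q u))) = P w"
    using arg_cong[OF 2, of P] by (simp add: lin_sum[OF D(5)] lin_scale[OF D(5)])
  moreover have "\<theta> *s u - (\<Sum>k<p. \<beta> k *s E k u) = P w"
  proof -
    have Eu: "E k u = (1 / (\<theta> - \<beta> k)) *s E k (P w)" if "k < p" for k
      unfolding u_def using resolution_coeff[OF D(3) that, of "\<lambda>_. P w" "\<lambda>k. 1 / (\<theta> - \<beta> k)"] D(7)[OF wW] by simp
    have "\<theta> *s u - (\<Sum>k<p. \<beta> k *s E k u) = (\<Sum>k<p. \<theta> *s E k u) - (\<Sum>k<p. \<beta> k *s E k u)"
      using resolution_sum[OF D(3) uU] by (simp add: scale_sum_right[symmetric])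
    also have "\<dots> = (\<Sum>k<p. (\<theta> - \<beta> k) *s E k u)"
      by (simp add: sum_subtractf[symmetric] scale_left_diff_distrib)
    also have "\<dots> = (\<Sum>k<p. E k (P w))"
      by (rule sum.cong) (use Eu \<beta> in auto)
    finally show ?thesis using resolution_sum[OF D(3) D(7)[OF wW]] by simp
  qed
  ultimately show "u \<in> spectral_kernel q p \<gamma> \<beta> H U E Q P \<theta>"
    using uU unfolding spectral_map_def by simp
qed

lemma spectral_kernel_dim_swap:
  assumes B: "bisystem p q U E W H P Q" and \<beta>: "\<And>k. k < p \<Longrightarrow> \<theta> \<noteq> \<beta> k" and \<gamma>: "\<And>l. l < q \<Longrightarrow> \<theta> \<noteq> \<gamma> l"
  shows "dim (spectral_kernel p q \<beta> \<gamma> E W H P Q \<theta>) = dim (spectral_kernel q p \<gamma> \<beta> H U E Q P \<theta>)"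
proof -
  have le: "dim (spectral_kernel p q \<beta> \<gamma> E W H P Q \<theta>) \<le> dim (spectral_kernel q p \<gamma> \<beta> H U E Q P \<theta>)"
    if B: "bisystem p q U E W H P Q" and \<beta>: "\<And>k. k < p \<Longrightarrow> \<theta> \<noteq> \<beta> k" and \<gamma>: "\<And>l. l < q \<Longrightarrow> \<theta> \<noteq> \<gamma> l"
    for p q \<beta> \<gamma> E W H P Q U
  proof -
    note D = bisystemD[OF B]
    let ?K = "spectral_kernel p q \<beta> \<gamma> E W H P Q \<theta>"
    let ?f = "\<lambda>w. \<Sum>k<p. (1 / (\<theta> - \<beta> k)) *s E k (P w)"
    let ?g = "\<lambda>u. \<Sum>l<q. (1 / (\<theta> - \<gamma> l)) *s H l (Q u)"
    have f: "lin ?f" by (intro lin_intros lin_compose_app[OF D(9)] D(5))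
    have K: "subspace ?K" by (rule lin_subspace_kernel[OF spectral_map_lin[OF B] D(2)])
    have T: "?f w \<in> spectral_kernel q p \<gamma> \<beta> H U E Q P \<theta>" "?g (?f w) = w" if "w \<in> ?K" for w
      by (rule spectral_kernel_transfer[OF B _ _ that]; use \<beta> \<gamma> in blast)+
    have "inj_on ?f ?K" by (rule inj_on_inverseI[of _ ?g]) (rule T(2))
    then have "dim ?K = dim (?f ` ?K)" by (rule dim_inj_image[OF f K, symmetric])
    also have "\<dots> \<le> dim (spectral_kernel q p \<gamma> \<beta> H U E Q P \<theta>)"
      by (rule dim_subset, rule image_subsetI) (rule T(1))
    finally show ?thesis .
  qed
  show ?thesis
    by (rule antisym; rule le) (fact B bisystem_swap[OF B] \<beta> \<gamma>)+
qed

end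

context ambient begin

text \<open>The inverse of \<open>\<theta> - \<Sum> \<beta>\<^sub>k E\<^sub>k\<close> on \<open>U\<close>.\<close>

lemma resolvent:
  assumes E: "resolution p U E" and U: "subspace U" and v: "v \<in> U" and \<beta>: "\<And>k. k < p \<Longrightarrow> \<theta> \<noteq> \<beta> k"
  defines "u \<equiv> (\<Sum>k<p. (1 / (\<theta> - \<beta> k)) *s E k v)"
  shows "u \<in> U" "\<theta> *s u - (\<Sum>k<p. \<beta> k *s E k u) = v"
proof -
  show uU: "u \<in> U" unfolding u_def
    by (intro subspace_sum[OF U] subspace_scale[OF U]) (use resolution_mem[OF E] v in auto)
  have Eu: "E k u = (1 / (\<theta> - \<beta> k)) *s E k v" if "k < p" for k
    unfolding u_def by (rule resolution_coeff[OF E that v])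
  have "\<theta> *s u = \<theta> *s (\<Sum>k<p. E k u)" using resolution_sum[OF E uU] by simp
  then have "\<theta> *s u - (\<Sum>k<p. \<beta> k *s E k u) = (\<Sum>k<p. (\<theta> - \<beta> k) *s E k u)"
    by (simp add: sum_subtractf[symmetric] scale_left_diff_distrib scale_sum_right)
  also have "\<dots> = (\<Sum>k<p. E k v)"
    by (rule sum.cong[OF refl]) (use Eu \<beta> in auto)
  finally show "\<theta> *s u - (\<Sum>k<p. \<beta> k *s E k u) = v" using resolution_sum[OF E v] by simp
qed

lemma resolution_piece_weighted_sum:
  assumes E: "resolution p U E" and "u \<in> U" "E k u = u" "k < p"
  shows "(\<Sum>j<p. \<beta> j *s E j u) = \<beta> k *s u"
proof -
  have "E j u = (if j = k then u else 0)" if "j < p" for j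
    using resolution_comp[OF E that assms(4,2)] assms(3) by simp
  then have "(\<Sum>j<p. \<beta> j *s E j u) = (\<Sum>j<p. if j = k then \<beta> j *s u else 0)"
    by (intro sum.cong[OF refl]) auto
  then show ?thesis using assms(4) by simp
qed

end

context fin_ambient begin

text \<open>The operator \<open>X\<close> lives on pairs of vectors, so dimensions have to be counted in the square of the
  ambient space.\<close>

lemma product_ambient:
  "\<exists>BB. fin_ambient (\<lambda>c (z :: 'b \<times> 'b). (c *s fst z, c *s snd z)) BB"
proof -
  define sc where "sc = (\<lambda>c (z :: 'b \<times> 'b). (c *s fst z, c *s snd z))"
  have vs: "vector_space sc"
    unfolding sc_def by unfold_locales (simp_all only: scale_right_distrib scale_left_distrib scale_scale scale_one fst_conv snd_conv fst_add snd_add add_Pair prod.collapse)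
  interpret pr: vector_space sc by (rule vs)
  let ?G = "(\<lambda>x. (x, 0)) ` Basis \<union> (\<lambda>x. (0, x)) ` Basis"
  obtain BB where BB: "BB \<subseteq> ?G" "pr.independent BB" "?G \<subseteq> pr.span BB"
    using pr.maximal_independent_subset[of ?G] by blast
  have l: "Vector_Spaces.linear scale sc (\<lambda>x. (x, 0))" "Vector_Spaces.linear scale sc (\<lambda>x. (0, x))"
    by (simp_all add: Vector_Spaces.linear_iff vector_space_axioms vs) (simp_all add: sc_def)
  interpret vp: vector_space_pair scale sc by unfold_locales
  have sub: "(\<lambda>x. (x, 0)) ` UNIV \<subseteq> pr.span BB" "(\<lambda>x. (0, x)) ` UNIV \<subseteq> pr.span BB"
    using vp.linear_span_image[OF l(1), of Basis] vp.linear_span_image[OF l(2), of Basis] BB(3) span_Basis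
      pr.span_minimal[OF _ pr.subspace_span[of BB]] by (metis Un_subset_iff)+
  have "z \<in> pr.span BB" for z
  proof -
    have "(fst z, 0) + (0, snd z) \<in> pr.span BB"
      by (rule pr.span_add) (use sub in auto)
    then show ?thesis by simp
  qed
  then have "pr.span BB = UNIV" by blast
  moreover have "finite BB" using BB(1) finite_Basis finite_subset by blast
  ultimately have "finite_dimensional_vector_space sc BB"
    using BB(2) by unfold_locales
  then show ?thesis unfolding fin_ambient_def sc_def by blast
qed

text \<open>When the eigenspaces found on \<open>W\<close> exhaust \<open>U \<times> W\<close>, the operator \<open>X\<close> has no eigenvalue
  \<open>\<beta>\<^sub>k\<close>; this makes the off-diagonal blocks injective on, respectively surjective onto, the piece
  of \<open>U\<close> belonging to \<open>\<beta>\<^sub>k\<close>.\<close>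

lemma realises_minimal:
  assumes R: "realises r p q \<alpha> \<beta> \<gamma> a b c U E W H P Q"
    and \<alpha>: "inj_on \<alpha> {..<r}" and \<alpha>\<beta>': "\<forall>i<r. \<forall>k<p. \<alpha> i \<noteq> \<beta> k"
    and sum: "(\<Sum>i<r. a i) = (\<Sum>k<p. b k) + (\<Sum>l<q. c l)" and k: "k < p"
  shows "\<And>u. u \<in> U \<Longrightarrow> E k u = u \<Longrightarrow> Q u = 0 \<Longrightarrow> u = 0"
    and "\<And>u. u \<in> U \<Longrightarrow> E k u = u \<Longrightarrow> \<exists>w\<in>W. E k (P w) = u"
proof -
  have \<alpha>\<beta>: "\<alpha> i \<noteq> \<beta> k" if "i < r" "k < p" for i k using \<alpha>\<beta>' that by blast
  have B: "bisystem p q U E W H P Q"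
    and b: "\<And>k. k < p \<Longrightarrow> dim (E k ` U) = b k" and c: "\<And>l. l < q \<Longrightarrow> dim (H l ` W) = c l"
    and a: "\<And>i. i < r \<Longrightarrow> dim (spectral_kernel p q \<beta> \<gamma> E W H P Q (\<alpha> i)) = a i"
    using R unfolding realises_def by blast+
  note D = bisystemD[OF B]
  define sc where "sc = (\<lambda>c (z :: 'b \<times> 'b). (c *s fst z, c *s snd z))"
  obtain BB where "fin_ambient sc BB" using product_ambient unfolding sc_def by blast
  then interpret pr: fin_ambient sc BB .
  interpret vp: finite_dimensional_vector_space_pair scale Basis sc BB by unfold_locales
  have linI2: "Vector_Spaces.linear scale sc (\<lambda>x. (f x, g x))" if "lin f" "lin g" for f g
    using that by (simp add: Vector_Spaces.linear_iff vector_space_axioms pr.vector_space_axioms) (simp add: sc_def)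
  have inj_dim: "pr.dim ((\<lambda>x. (f x, g x)) ` S) = dim S"
    if "lin f" "lin g" "subspace S" "inj_on (\<lambda>x. (f x, g x)) S" for f g S
  proof (rule vp.dim_image_eq[OF linI2[OF that(1,2)]])
    have "span S = S" using that(3) by simp
    then show "inj_on (\<lambda>x. (f x, g x)) (span S)" using that(4) by (simp only:)
  qed
  have sub2: "pr.subspace ((\<lambda>x. (f x, g x)) ` S)" if "lin f" "lin g" "subspace S" for f g S
    by (rule vp.linear_subspace_image[OF linI2[OF that(1,2)] that(3)])
  define X where "X z = ((\<Sum>k<p. \<beta> k *s E k (fst z)) + P (snd z), Q (fst z) + (\<Sum>l<q. \<gamma> l *s H l (snd z)))" for z
  define K where "K i = spectral_kernel p q \<beta> \<gamma> E W H P Q (\<alpha> i)" for i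
  define f where "f i w = (\<Sum>k<p. (1 / (\<alpha> i - \<beta> k)) *s E k (P w))" for i w
  define S where "S i = (\<lambda>w. (f i w, w)) ` K i" for i
  have f: "lin (f i)" for i unfolding f_def by (intro lin_intros lin_compose_app[OF D(9)] D(5))
  have K: "subspace (K i)" for i unfolding K_def by (rule lin_subspace_kernel[OF spectral_map_lin[OF B] D(2)])
  have Y: "lin (\<lambda>u. \<Sum>k<p. \<beta> k *s E k u)" by (intro lin_intros D(9))
  have Z: "lin (\<lambda>u. \<Sum>k<q. \<gamma> k *s H k u)" by (intro lin_intros D(10))
  have X: "pr.lin X"
    unfolding X_def
    by (rule pr.linI) (simp_all add: lin_add[OF D(5)] lin_add[OF D(6)] lin_add[OF Y] lin_add[OF Z]
        lin_scale[OF D(5)] lin_scale[OF D(6)] lin_scale[OF Y] lin_scale[OF Z] scale_right_distrib sc_def)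
  have T: "pr.subspace (U \<times> W)"
    by (rule pr.subspaceI) (auto simp: zero_prod_def subspace_0[OF D(1)] subspace_0[OF D(2)]
        subspace_add[OF D(1)] subspace_add[OF D(2)] subspace_scale[OF D(1)] subspace_scale[OF D(2)] sc_def)
  have S1: "pr.subspace (S i)" for i
    unfolding S_def by (rule sub2[OF f lin_ident K])
  have S2: "S i \<subseteq> U \<times> W" if i: "i < r" for i
    unfolding S_def
  proof (rule image_subsetI)
    fix w assume "w \<in> K i"
    then have "w \<in> W" unfolding K_def by blast
    then show "(f i w, w) \<in> U \<times> W"
      unfolding f_def using resolvent(1)[OF D(3,1) D(7), of w "\<alpha> i" \<beta>] \<alpha>\<beta>[OF i] by simp
  qed
  have ev: "X z = sc (\<alpha> i) z" if i: "i \<in> {..<r}" and z: "z \<in> S i" for i z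
  proof -
    obtain w where w: "w \<in> K i" "z = (f i w, w)" using z unfolding S_def by blast
    then have wW: "w \<in> W" and w0: "spectral_map p q \<beta> \<gamma> E H P Q (\<alpha> i) w = 0" unfolding K_def by blast+
    have "\<alpha> i *s f i w - (\<Sum>k<p. \<beta> k *s E k (f i w)) = P w"
      unfolding f_def using resolvent(2)[OF D(3,1) D(7)[OF wW], of "\<alpha> i" \<beta>] \<alpha>\<beta> i by simp
    moreover have "Q (f i w) = \<alpha> i *s w - (\<Sum>l<q. \<gamma> l *s H l w)"
      using w0 unfolding spectral_map_def f_def by (simp add: lin_sum[OF D(6)] lin_scale[OF D(6)])
    ultimately show ?thesis unfolding X_def w(2) sc_def by (simp add: algebra_simps)
  qed
  have dS: "pr.dim (S i) = a i" if "i < r" for i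
  proof -
    have "inj_on (\<lambda>w. (f i w, w)) (K i)" by (rule inj_onI) simp
    then have "pr.dim (S i) = dim (K i)" unfolding S_def by (rule inj_dim[OF f lin_ident K])
    then show ?thesis using a[OF that] unfolding K_def by simp
  qed
  have "pr.dim (U \<times> W) \<le> dim U + dim W"
  proof -
    have "U \<times> W = pr.ssum ((\<lambda>u. (u, 0)) ` U) ((\<lambda>w. (0, w)) ` W)" by force
    moreover have "pr.dim ((\<lambda>u. (u, 0)) ` U) = dim U"
      by (rule inj_dim[OF lin_ident lin_zero D(1)]) (simp add: inj_on_def)
    moreover have "pr.dim ((\<lambda>w. (0, w)) ` W) = dim W"
      by (rule inj_dim[OF lin_zero lin_ident D(2)]) (simp add: inj_on_def)
    moreover have "pr.subspace ((\<lambda>u. (u, 0)) ` U)" "pr.subspace ((\<lambda>w. (0, w)) ` W)"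
      by (rule sub2[OF lin_ident lin_zero D(1)], rule sub2[OF lin_zero lin_ident D(2)])
    ultimately show ?thesis using pr.dim_sums_Int[of "(\<lambda>u. (u, 0)) ` U" "(\<lambda>w. (0, w)) ` W"] by simp
  qed
  also have "\<dots> = (\<Sum>i<r. a i)"
    using sum b c resolution_dim[OF D(3,1)] resolution_dim[OF D(4,2)] by simp
  also have "\<dots> = (\<Sum>i<r. pr.dim (S i))" using dS by simp
  finally have le: "pr.dim (U \<times> W) \<le> (\<Sum>i\<in>{..<r}. pr.dim (S i))" .
  have ne: "\<alpha> i \<noteq> \<beta> k" if "i \<in> {..<r}" for i using \<alpha>\<beta> k that by simp
  have S2': "S i \<subseteq> U \<times> W" if "i \<in> {..<r}" for i using S2 that by simp
  have S1': "pr.subspace (S i)" if "i \<in> {..<r}" for i by (rule S1)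
  have bij1: "z = 0" if z: "z \<in> U \<times> W" "X z = sc (\<beta> k) z" for z
  proof (rule pr.eigen_exhaust_bij(1)[of "{..<r}" X \<alpha> S "U \<times> W" "\<beta> k"])
    show "finite {..<r}" by simp
    show "pr.lin X" by (rule X)
    show "inj_on \<alpha> {..<r}" by (rule \<alpha>)
    show "X x = sc (\<alpha> i) x" if "i \<in> {..<r}" "x \<in> S i" for i x using that by (rule ev)
    show "pr.subspace (S i)" for i by (rule S1)
    show "S i \<subseteq> U \<times> W" if "i \<in> {..<r}" for i using that by (rule S2')
    show "pr.subspace (U \<times> W)" by (rule T)
    show "pr.dim (U \<times> W) \<le> (\<Sum>i\<in>{..<r}. pr.dim (S i))" by (rule le)
    show "\<alpha> i \<noteq> \<beta> k" if "i \<in> {..<r}" for i using that by (rule ne)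
  qed (rule z)+
  have bij2: "\<exists>y\<in>U \<times> W. X y - sc (\<beta> k) y = z" if z: "z \<in> U \<times> W" for z
  proof (rule pr.eigen_exhaust_bij(2)[of "{..<r}" X \<alpha> S "U \<times> W" "\<beta> k"])
    show "finite {..<r}" by simp
    show "pr.lin X" by (rule X)
    show "inj_on \<alpha> {..<r}" by (rule \<alpha>)
    show "X x = sc (\<alpha> i) x" if "i \<in> {..<r}" "x \<in> S i" for i x using that by (rule ev)
    show "pr.subspace (S i)" for i by (rule S1)
    show "S i \<subseteq> U \<times> W" if "i \<in> {..<r}" for i using that by (rule S2')
    show "pr.subspace (U \<times> W)" by (rule T)
    show "pr.dim (U \<times> W) \<le> (\<Sum>i\<in>{..<r}. pr.dim (S i))" by (rule le)
    show "\<alpha> i \<noteq> \<beta> k" if "i \<in> {..<r}" for i using that by (rule ne)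
  qed (rule z)
  { fix u assume u: "u \<in> U" "E k u = u" "Q u = 0"
    have "X (u, 0) = sc (\<beta> k) (u, 0)"
      unfolding X_def sc_def using resolution_piece_weighted_sum[OF D(3) u(1,2) k] u(3) lin_0[OF D(5)] lin_0[OF Z] by simp
    then have "(u, 0 :: 'b) = 0"
      by (intro bij1) (use u(1) subspace_0[OF D(2)] in auto)
    then show "u = 0" by (simp add: zero_prod_def) }
  { fix u assume u: "u \<in> U" "E k u = u"
    have "(u, 0) \<in> U \<times> W" using u subspace_0[OF D(2)] by simp
    from bij2[OF this] obtain z where z: "z \<in> U \<times> W" "X z - sc (\<beta> k) z = (u, 0)" by auto
    then have zz: "fst z \<in> U" "snd z \<in> W"
      and eq: "(\<Sum>j<p. \<beta> j *s E j (fst z)) + P (snd z) - \<beta> k *s fst z = u"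
      unfolding X_def sc_def by (auto simp: mem_Times_iff)
    have "E k u = E k (\<Sum>j<p. \<beta> j *s E j (fst z)) + E k (P (snd z)) - \<beta> k *s E k (fst z)"
      unfolding eq[symmetric] by (simp add: lin_add[OF D(9)] lin_diff[OF D(9)] lin_scale[OF D(9)])
    also have "E k (\<Sum>j<p. \<beta> j *s E j (fst z)) = \<beta> k *s E k (fst z)"
      by (rule resolution_coeff[OF D(3) k zz(1)])
    finally show "\<exists>w\<in>W. E k (P w) = u" using u(2) zz(2) by (intro bexI[of _ "snd z"]) simp_all }
qed

definition isomorphic where
  "isomorphic p q U1 E1 W1 H1 P1 Q1 U2 E2 W2 H2 P2 Q2 \<longleftrightarrow> (\<exists>g h. lin g \<and> lin h \<and> g ` U1 = U2 \<and> h ` W1 = W2 \<and>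
     (\<forall>k<p. \<forall>u\<in>U1. g (E1 k u) = E2 k (g u)) \<and> (\<forall>l<q. \<forall>w\<in>W1. h (H1 l w) = H2 l (h w)) \<and>
     (\<forall>w\<in>W1. g (P1 w) = P2 (h w)) \<and> (\<forall>u\<in>U1. h (Q1 u) = Q2 (g u)))"

lemma isomorphic_swap:
  assumes "isomorphic p q U1 E1 W1 H1 P1 Q1 U2 E2 W2 H2 P2 Q2"
  shows "isomorphic q p W1 H1 U1 E1 Q1 P1 W2 H2 U2 E2 Q2 P2"
proof -
  from assms obtain g h where "lin g \<and> lin h \<and> g ` U1 = U2 \<and> h ` W1 = W2 \<and>
     (\<forall>k<p. \<forall>u\<in>U1. g (E1 k u) = E2 k (g u)) \<and> (\<forall>l<q. \<forall>w\<in>W1. h (H1 l w) = H2 l (h w)) \<and>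
     (\<forall>w\<in>W1. g (P1 w) = P2 (h w)) \<and> (\<forall>u\<in>U1. h (Q1 u) = Q2 (g u))"
    unfolding isomorphic_def by (elim exE)
  then show ?thesis unfolding isomorphic_def by (intro exI[of _ h] exI[of _ g]) simp
qed

lemma realises_swap:
  assumes R: "realises r p q \<alpha> \<beta> \<gamma> a b c U E W H P Q"
    and "\<And>i k. i < r \<Longrightarrow> k < p \<Longrightarrow> \<alpha> i \<noteq> \<beta> k" "\<And>i l. i < r \<Longrightarrow> l < q \<Longrightarrow> \<alpha> i \<noteq> \<gamma> l"
  shows "realises r q p \<alpha> \<gamma> \<beta> a c b W H U E Q P"
proof -
  have B: "bisystem p q U E W H P Q" using R unfolding realises_def by (elim conjE)
  have "dim (spectral_kernel q p \<gamma> \<beta> H U E Q P (\<alpha> i)) = a i" if "i < r" for i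
    using spectral_kernel_dim_swap[OF B, of "\<alpha> i" \<beta> \<gamma>] assms(2,3) R that unfolding realises_def by simp
  then show ?thesis using R bisystem_swap[OF B] unfolding realises_def by simp
qed

end

context fin_ambient begin

lemma realises_bisystem: "realises r p q \<alpha> \<beta> \<gamma> a b c U E W H P Q \<Longrightarrow> bisystem p q U E W H P Q"
  unfolding realises_def by (elim conjE)

lemma spectral_map_split:
  assumes "j < p"
  shows "spectral_map p q \<beta> \<gamma> E H P Q x w = x *s w - (\<Sum>l<q. \<gamma> l *s H l w)
    - ((1 / (x - \<beta> j)) *s Q (E j (P w)) + (\<Sum>k\<in>{..<p} - {j}. (1 / (x - \<beta> k)) *s Q (E k (P w))))"
  unfolding spectral_map_def using assms by (subst sum.remove[of "{..<p}" j]) simp_all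

text \<open>With \<open>F\<close> the transfer function \<open>spectral_map\<close>, the reflected system has the transfer function
  \<open>(\<theta> - \<beta>\<^sub>j) / (\<theta> - \<alpha>\<^sub>i) * F(\<theta>)\<close>. The pole at \<open>\<beta>\<^sub>j\<close> disappears and the value there becomes a multiple of the
  former residue, whose kernel has dimension \<open>C - b\<^sub>j\<close>; at \<open>\<alpha>\<^sub>i\<close> a pole with residue \<open>s F(\<alpha>\<^sub>i)\<close>, of rank
  \<open>C - a\<^sub>i\<close>, appears; the other residues are multiplied by \<open>f\<^sub>k\<close> and the constant term shifts by \<open>s\<close>. By
  minimality a system can be read off from the residues of its transfer function. The inequalities hold
  because an eigenspace in \<open>W\<close> and the rank of a residue on \<open>W\<close> cannot exceed \<open>C = dim W\<close>.\<close>

lemma reflect: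
  assumes R: "realises r p q \<alpha> \<beta> \<gamma> a b c U E W H P Q"
    and \<alpha>: "inj_on \<alpha> {..<r}" and \<beta>: "inj_on \<beta> {..<p}"
    and \<alpha>\<beta>': "\<forall>i<r. \<forall>k<p. \<alpha> i \<noteq> \<beta> k"
    and sum: "(\<Sum>i<r. a i) = (\<Sum>k<p. b k) + (\<Sum>l<q. c l)" and i: "i < r" and j: "j < p"
    and s: "s = \<alpha> i - \<beta> j" and C: "C = (\<Sum>l<q. c l)"
    and f: "\<And>k. f k = (\<beta> k - \<beta> j) / (\<beta> k - \<alpha> i)"
  shows "a i \<le> C" "b j \<le> C"
    and "C \<le> a i + b j \<Longrightarrow> \<exists>U' P' Q'.
      realises r p q (\<alpha>(i := \<beta> j)) (\<beta>(j := \<alpha> i)) (\<lambda>l. \<gamma> l - s) (a(i := C - b j)) (b(j := C - a i)) c U' E W H P' Q' \<and>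
      U' \<subseteq> U \<and> (\<forall>u\<in>U. \<forall>k<p. k \<noteq> j \<longrightarrow> E k u \<in> U') \<and> (\<forall>w\<in>W. \<forall>k<p. k \<noteq> j \<longrightarrow> E k (P' w) = E k (P w)) \<and>
      (\<forall>u\<in>U'. \<forall>k<p. k \<noteq> j \<longrightarrow> Q' (E k u) = f k *s Q (E k u)) \<and>
      (\<forall>w\<in>W. Q' (E j (P' w)) = - (s *s spectral_map p q \<beta> \<gamma> E H P Q (\<alpha> i) w))"
proof -
  have \<alpha>\<beta>: "\<alpha> i \<noteq> \<beta> k" if "i < r" "k < p" for i k using \<alpha>\<beta>' that by blast
  have B: "bisystem p q U E W H P Q"
    and b: "\<And>k. k < p \<Longrightarrow> dim (E k ` U) = b k" and c: "\<And>l. l < q \<Longrightarrow> dim (H l ` W) = c l"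
    and a: "\<And>i. i < r \<Longrightarrow> dim (spectral_kernel p q \<beta> \<gamma> E W H P Q (\<alpha> i)) = a i"
    using R unfolding realises_def by blast+
  note D = bisystemD[OF B]
  note min1 = realises_minimal(1)[OF R \<alpha> \<alpha>\<beta>' sum j] and min2 = realises_minimal(2)[OF R \<alpha> \<alpha>\<beta>' sum j]
  have s0: "s \<noteq> 0" using \<alpha>\<beta>[OF i j] s by simp
  define F where "F = spectral_map p q \<beta> \<gamma> E H P Q (\<alpha> i)"
  have Fl: "lin F" unfolding F_def by (rule spectral_map_lin[OF B])
  have FW: "F w \<in> W" if "w \<in> W" for w unfolding F_def by (rule spectral_map_mem[OF B that])
  have dW: "dim W = C" using resolution_dim[OF D(4,2)] c C by simp
  have dFW: "dim (F ` W) + a i = C"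
    using rank_nullity[OF Fl D(2)] a[OF i] dW unfolding F_def by simp
  then show "a i \<le> C" by simp
  define Rr where "Rr k w = Q (E k (P w))" for k w
  have Rl: "lin (Rr k)" for k unfolding Rr_def by (intro lin_compose_app[OF D(6)] lin_compose_app[OF D(9)] D(5))
  have EjU: "subspace (E j ` U)" by (rule lin_subspace_image[OF D(9,1)])
  have EjD: "u \<in> U" "E j u = u" if "u \<in> E j ` U" for u
    using resolution_piece_iff[OF D(3) j, of u] that by auto
  have "Rr j ` W = Q ` (E j ` U)"
  proof (rule antisym; rule subsetI)
    fix x assume "x \<in> Rr j ` W"
    then show "x \<in> Q ` (E j ` U)" unfolding Rr_def using D(7) by blast
  next
    fix x assume "x \<in> Q ` (E j ` U)"
    then obtain u where u: "u \<in> E j ` U" "x = Q u" by blast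
    then obtain w where "w \<in> W" "E j (P w) = u" using min2 EjD by metis
    then show "x \<in> Rr j ` W" unfolding Rr_def using u(2) by blast
  qed
  moreover have "dim (Q ` (E j ` U)) = b j"
    using dim_inj_image[OF D(6) EjU lin_inj_onI[OF D(6) EjU]] min1 EjD b[OF j] by metis
  ultimately have dR: "b j + dim {w \<in> W. Rr j w = 0} = C"
    using rank_nullity[OF Rl D(2), of j] dW by simp
  then show "b j \<le> C" by simp
  assume le: "C \<le> a i + b j"
  obtain N where N: "subspace N" "N \<subseteq> E j ` U" "dim N = C - a i"
  proof -
    have "C - a i \<le> dim (E j ` U)" using b[OF j] le by simp
    from subspace_of_dim[OF EjU this] that show ?thesis by blast
  qed
  have sFW: "subspace (F ` W)" by (rule lin_subspace_image[OF Fl D(2)])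
  obtain io where io: "lin io" "io ` (F ` W) = N" "inj_on io (F ` W)"
    using subspace_iso[OF sFW N(1)] dFW N(3) by auto
  obtain ka where ka: "lin ka" "\<forall>x\<in>F ` W. ka (io x) = x" using left_inverse_on[OF io(1) sFW io(3)] by blast
  define U' where "U' = {u \<in> U. E j u \<in> N}"
  define P' where "P' w = P w - E j (P w) + io (F w)" for w
  define Q' where "Q' u = (\<Sum>k<p. f k *s Q (E k u)) - s *s ka (E j u)" for u
  have NU: "x \<in> U" "E j x = x" if "x \<in> N" for x using N(2) EjD that by blast+
  have U': "subspace U'" unfolding U'_def by (rule lin_subspace_preimage[OF D(9,1) N(1)])
  have U'U: "U' \<subseteq> U" unfolding U'_def by blast
  have N0: "0 \<in> N" by (rule subspace_0[OF N(1)])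
  have EkU': "E k u \<in> U'" if "u \<in> U" "k < p" "k \<noteq> j" for u k
    unfolding U'_def using resolution_comp[OF D(3) j that(2,1)] that D(11) N0 by simp
  have EjU': "E j u \<in> U'" if "u \<in> U'" for u
    using that unfolding U'_def using NU D(11)[OF j] by auto
  have res': "resolution p U' E"
    unfolding resolution_def
  proof (intro conjI allI impI ballI)
    show "lin (E k)" for k by (rule D(9))
    show "E k u \<in> U'" if "k < p" "u \<in> U'" for k u using EkU' EjU' that U'U by (cases "k = j") auto
    show "(\<Sum>k<p. E k u) = u" if "u \<in> U'" for u using resolution_sum[OF D(3)] U'U that by blast
    show "E k (E l u) = (if k = l then E l u else 0)" if "k < p" "l < p" "u \<in> U'" for k l u
      using resolution_comp[OF D(3) that(1,2)] U'U that(3) by blast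
  qed
  have ioF: "io (F w) \<in> N" if "w \<in> W" for w using io(2) that by blast
  have EP': "E k (P' w) = (if k = j then io (F w) else E k (P w))" if "w \<in> W" "k < p" for k w
  proof -
    have "E k (io (F w)) = (if k = j then io (F w) else 0)"
      using resolution_comp[OF D(3) that(2) j, of "io (F w)"] NU[OF ioF[OF that(1)]] by auto
    then show ?thesis unfolding P'_def lin_add[OF D(9)] lin_diff[OF D(9)]
      using resolution_comp[OF D(3) that(2) j D(7)[OF that(1)]] by auto
  qed
  have P'U': "P' w \<in> U'" if "w \<in> W" for w
  proof -
    have "P' w \<in> U" unfolding P'_def
      by (intro subspace_add[OF D(1)] subspace_diff[OF D(1)] D(7,11) j that NU(1) ioF)
    then show ?thesis unfolding U'_def using EP'[OF that j] ioF[OF that] by simp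
  qed
  have Q'W: "Q' u \<in> W" if "u \<in> U'" for u
  proof -
    have "E j u \<in> N" "u \<in> U" using that unfolding U'_def by auto
    then obtain w where "w \<in> W" "E j u = io (F w)" using io(2) by blast
    then have "ka (E j u) \<in> W" using ka(2) FW by simp
    moreover have "(\<Sum>k<p. f k *s Q (E k u)) \<in> W"
      using \<open>u \<in> U\<close> by (intro subspace_sum[OF D(2)] subspace_scale[OF D(2)] D(8,11)) auto
    ultimately show ?thesis unfolding Q'_def by (intro subspace_diff[OF D(2)] subspace_scale[OF D(2)])
  qed
  have P'l: "lin P'" unfolding P'_def
    by (intro lin_plus lin_minus lin_compose_app[OF D(9)] lin_compose_app[OF io(1)] D(5) Fl)
  have Q'l: "lin Q'" unfolding Q'_def
    by (intro lin_minus lin_smult lin_summation lin_compose_app[OF D(6)] lin_compose_app[OF ka(1)] D(9))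
  have B': "bisystem p q U' E W H P' Q'"
    unfolding bisystem_def using U' D(2,4) res' P'l Q'l P'U' Q'W by blast
  have fj: "f j = 0" unfolding f by simp
  have Q'k: "Q' (E k u) = f k *s Q (E k u)" if "u \<in> U'" "k < p" "k \<noteq> j" for k u
  proof -
    have uU: "u \<in> U" using that U'U by blast
    have "(\<Sum>l<p. f l *s Q (E l (E k u))) = (\<Sum>l<p. if l = k then f l *s Q (E k u) else 0)"
      by (rule sum.cong[OF refl]) (use resolution_comp[OF D(3) _ that(2) uU] lin_0[OF D(6)] in auto)
    moreover have "E j (E k u) = 0" using resolution_comp[OF D(3) j that(2) uU] that(3) by auto
    ultimately show ?thesis unfolding Q'_def using that(2) lin_0[OF ka(1)] by simp
  qed
  have Q'j: "Q' (E j (P' w)) = - (s *s F w)" if w: "w \<in> W" for w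
  proof -
    have eq: "E j (P' w) = io (F w)" using EP'[OF w j] by simp
    have ioU: "io (F w) \<in> U" "E j (io (F w)) = io (F w)" using NU[OF ioF[OF w]] by auto
    have "(\<Sum>l<p. f l *s Q (E l (io (F w)))) = (\<Sum>l<p. 0)"
    proof (rule sum.cong[OF refl])
      fix l assume l: "l \<in> {..<p}"
      show "f l *s Q (E l (io (F w))) = 0"
      proof (cases "l = j")
        case False
        then have "E l (io (F w)) = 0" using resolution_comp[OF D(3) _ j ioU(1), of l] ioU(2) l by auto
        then show ?thesis using lin_0[OF D(6)] by simp
      qed (simp add: fj)
    qed
    then show ?thesis unfolding eq Q'_def ioU(2) using ka(2) w by simp
  qed
  let ?T = "{..<p} - {j}"
  define Z where "Z w = (\<Sum>l<q. \<gamma> l *s H l w)" for w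
  define S where "S w = (\<Sum>k\<in>?T. (1 / (\<alpha> i - \<beta> k)) *s Rr k w)" for w
  have Feq: "F w = \<alpha> i *s w - Z w - ((1 / s) *s Rr j w + S w)" for w
    unfolding F_def spectral_map_split[OF j] Z_def S_def Rr_def s ..
  let ?F' = "spectral_map p q (\<beta>(j := \<alpha> i)) (\<lambda>l. \<gamma> l - s) E H P' Q'"
  have F': "?F' x w = (x + s + e * s * \<alpha> i) *s w - (1 + e * s) *s Z w - e *s Rr j w
      - ((\<Sum>k\<in>?T. (f k / (x - \<beta> k)) *s Rr k w) + (e * s) *s S w)"
    if w: "w \<in> W" and e: "e = 1 / (x - \<alpha> i)" for x w e
  proof -
    have 1: "(\<Sum>l<q. (\<gamma> l - s) *s H l w) = Z w - s *s w"
      using resolution_sum[OF D(4) w] unfolding Z_def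
      by (simp add: scale_left_diff_distrib sum_subtractf scale_sum_right[symmetric])
    have 2: "(\<Sum>k\<in>?T. (1 / (x - (\<beta>(j := \<alpha> i)) k)) *s Q' (E k (P' w))) = (\<Sum>k\<in>?T. (f k / (x - \<beta> k)) *s Rr k w)"
    proof (rule sum.cong[OF refl])
      fix k assume k: "k \<in> ?T"
      then have "Q' (E k (P' w)) = f k *s Rr k w"
        using Q'k[OF P'U'[OF w], of k] EP'[OF w, of k] unfolding Rr_def by auto
      then show "(1 / (x - (\<beta>(j := \<alpha> i)) k)) *s Q' (E k (P' w)) = (f k / (x - \<beta> k)) *s Rr k w"
        using k by simp
    qed
    have "?F' x w = x *s w - (Z w - s *s w) - (e *s (- (s *s F w)) + (\<Sum>k\<in>?T. (f k / (x - \<beta> k)) *s Rr k w))"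
      unfolding spectral_map_split[OF j] 1 2 Q'j[OF w] e by simp
    also have "\<dots> = (x + s + e * s * \<alpha> i) *s w - (1 + e * s) *s Z w - e *s Rr j w
      - ((\<Sum>k\<in>?T. (f k / (x - \<beta> k)) *s Rr k w) + (e * s) *s S w)"
      unfolding Feq using s0
      by (simp add: scale_right_diff_distrib scale_right_distrib scale_left_distrib mult.assoc, (simp add: algebra_simps)?)
    finally show ?thesis .
  qed
  have T: "k < p" "k \<noteq> j" "\<beta> k \<noteq> \<alpha> i" "\<beta> k \<noteq> \<beta> j" if "k \<in> ?T" for k
    using that \<alpha>\<beta>[OF i] inj_onD[OF \<beta>, of k j] j by fastforce+
  have ker: "dim (spectral_kernel p q (\<beta>(j := \<alpha> i)) (\<lambda>l. \<gamma> l - s) E W H P' Q' ((\<alpha>(i := \<beta> j)) m)) = (a(i := C - b j)) m"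
    if m: "m < r" for m
  proof (cases "m = i")
    case True
    have "?F' (\<beta> j) w = (1 / s) *s Rr j w" if w: "w \<in> W" for w
    proof -
      have ee: "1 / (\<beta> j - \<alpha> i) = - (1 / s)" unfolding s by (metis minus_diff_eq divide_minus_right)
      have "(\<Sum>k\<in>?T. (f k / (\<beta> j - \<beta> k)) *s Rr k w) = S w"
        unfolding S_def
      proof (rule sum.cong[OF refl])
        fix k assume "k \<in> ?T"
        then have "f k / (\<beta> j - \<beta> k) = 1 / (\<alpha> i - \<beta> k)"
          unfolding f using T(3,4)[of k] by (simp add: divide_simps, (simp add: algebra_simps)?)
        then show "(f k / (\<beta> j - \<beta> k)) *s Rr k w = (1 / (\<alpha> i - \<beta> k)) *s Rr k w" by simp
      qed
      moreover have "\<beta> j + s + - (1 / s) * s * \<alpha> i = 0" "1 + - (1 / s) * s = 0" "- (1 / s) * s = - 1"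
        using s0 s by simp_all
      ultimately show ?thesis using F'[OF w ee[symmetric]] by simp
    qed
    then have "spectral_kernel p q (\<beta>(j := \<alpha> i)) (\<lambda>l. \<gamma> l - s) E W H P' Q' (\<beta> j) = {w \<in> W. Rr j w = 0}"
      using s0 by auto
    then show ?thesis using dR True by simp
  next
    case False
    have x: "\<alpha> m \<noteq> \<alpha> i" "\<alpha> m \<noteq> \<beta> j" "\<And>k. k \<in> ?T \<Longrightarrow> \<alpha> m \<noteq> \<beta> k"
      using False m i j inj_onD[OF \<alpha>, of m i] \<alpha>\<beta>[OF m] by auto
    define cc where "cc = (\<alpha> m - \<beta> j) / (\<alpha> m - \<alpha> i)"
    have "?F' (\<alpha> m) w = cc *s spectral_map p q \<beta> \<gamma> E H P Q (\<alpha> m) w" if w: "w \<in> W" for w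
    proof -
      let ?e = "1 / (\<alpha> m - \<alpha> i)"
      have e0: "(\<Sum>k\<in>?T. (f k / (\<alpha> m - \<beta> k)) *s Rr k w) + (?e * s) *s S w
          = cc *s (\<Sum>k\<in>?T. (1 / (\<alpha> m - \<beta> k)) *s Rr k w)"
        unfolding S_def scale_sum_right sum.distrib[symmetric]
      proof (rule sum.cong[OF refl])
        fix k assume k: "k \<in> ?T"
        have "f k / (\<alpha> m - \<beta> k) + ?e * s * (1 / (\<alpha> i - \<beta> k)) = cc * (1 / (\<alpha> m - \<beta> k))"
          unfolding f cc_def s using T(3)[OF k] x(1) x(3)[OF k]
          by (simp add: divide_simps, (simp add: algebra_simps)?)
        then show "(f k / (\<alpha> m - \<beta> k)) *s Rr k w + (?e * s) *s (1 / (\<alpha> i - \<beta> k)) *s Rr k w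
            = cc *s (1 / (\<alpha> m - \<beta> k)) *s Rr k w"
          by (simp only: scale_scale scale_left_distrib[symmetric])
      qed
      have e1: "\<alpha> m + s + ?e * s * \<alpha> i = cc * \<alpha> m" and e2: "1 + ?e * s = cc" and e3: "?e = cc * (1 / (\<alpha> m - \<beta> j))"
        unfolding cc_def s using x(1,2) by (simp_all add: divide_simps, (simp_all add: algebra_simps)?)
      have "?F' (\<alpha> m) w = (cc * \<alpha> m) *s w - cc *s Z w - (cc * (1 / (\<alpha> m - \<beta> j))) *s Rr j w
          - cc *s (\<Sum>k\<in>?T. (1 / (\<alpha> m - \<beta> k)) *s Rr k w)"
        unfolding F'[OF w refl] e0 e1 e2 by (simp only: e3)
      also have "\<dots> = cc *s spectral_map p q \<beta> \<gamma> E H P Q (\<alpha> m) w"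
        unfolding spectral_map_split[OF j] Z_def[symmetric] Rr_def[symmetric]
        by (simp only: scale_right_diff_distrib scale_right_distrib scale_scale) (simp add: diff_diff_eq add.assoc)
      finally show ?thesis .
    qed
    moreover have "cc \<noteq> 0" unfolding cc_def using x by simp
    ultimately have "spectral_kernel p q (\<beta>(j := \<alpha> i)) (\<lambda>l. \<gamma> l - s) E W H P' Q' (\<alpha> m) = spectral_kernel p q \<beta> \<gamma> E W H P Q (\<alpha> m)"
      by auto
    then show ?thesis using a[OF m] False by simp
  qed
  have dE: "dim (E k ` U') = (b(j := C - a i)) k" if k: "k < p" for k
  proof (cases "k = j")
    case True
    have "E j ` U' = N"
    proof (rule antisym; rule subsetI)
      fix x assume "x \<in> E j ` U'" then show "x \<in> N" unfolding U'_def by blast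
    next
      fix x assume x: "x \<in> N"
      then have "x \<in> U'" unfolding U'_def using NU[OF x] by simp
      then show "x \<in> E j ` U'" using NU(2)[OF x] by (metis image_eqI)
    qed
    then show ?thesis using N(3) True by simp
  next
    case False
    have "E k ` U' = E k ` U"
    proof (rule antisym; rule subsetI)
      fix x assume "x \<in> E k ` U'" then show "x \<in> E k ` U" using U'U by blast
    next
      fix x assume "x \<in> E k ` U"
      then obtain u where u: "u \<in> U" "x = E k u" by blast
      then have "x = E k (E k u)" using resolution_comp[OF D(3) k k u(1)] by simp
      then show "x \<in> E k ` U'" using EkU'[OF u(1) k False] by blast
    qed
    then show ?thesis using b[OF k] False by simp
  qed
  have "realises r p q (\<alpha>(i := \<beta> j)) (\<beta>(j := \<alpha> i)) (\<lambda>l. \<gamma> l - s) (a(i := C - b j)) (b(j := C - a i)) c U' E W H P' Q'"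
    unfolding realises_def using B' dE c ker by blast
  moreover have "\<forall>w\<in>W. \<forall>k<p. k \<noteq> j \<longrightarrow> E k (P' w) = E k (P w)" using EP' by simp
  ultimately show "\<exists>U' P' Q'.
      realises r p q (\<alpha>(i := \<beta> j)) (\<beta>(j := \<alpha> i)) (\<lambda>l. \<gamma> l - s) (a(i := C - b j)) (b(j := C - a i)) c U' E W H P' Q' \<and>
      U' \<subseteq> U \<and> (\<forall>u\<in>U. \<forall>k<p. k \<noteq> j \<longrightarrow> E k u \<in> U') \<and> (\<forall>w\<in>W. \<forall>k<p. k \<noteq> j \<longrightarrow> E k (P' w) = E k (P w)) \<and>
      (\<forall>u\<in>U'. \<forall>k<p. k \<noteq> j \<longrightarrow> Q' (E k u) = f k *s Q (E k u)) \<and>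
      (\<forall>w\<in>W. Q' (E j (P' w)) = - (s *s spectral_map p q \<beta> \<gamma> E H P Q (\<alpha> i) w))"
    using U'U EkU' Q'k Q'j unfolding F_def by (intro exI[of _ U'] exI[of _ P'] exI[of _ Q'] conjI) auto
qed


text \<open>The reflection loses no information: an isomorphism of reflected systems extends to the
  original ones, because the residue at \<open>\<beta>\<^sub>j\<close>, which it forgets, can be recovered from the value of
  the transfer function at \<open>\<alpha>\<^sub>i\<close>.\<close>

lemma reflect_isomorphic:
  assumes R1: "realises r p q \<alpha> \<beta> \<gamma> a b c U1 E1 W1 H1 P1 Q1"
    and R2: "realises r p q \<alpha> \<beta> \<gamma> a b c U2 E2 W2 H2 P2 Q2"
    and \<alpha>: "inj_on \<alpha> {..<r}" and \<beta>: "inj_on \<beta> {..<p}"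
    and \<alpha>\<beta>': "\<forall>i<r. \<forall>k<p. \<alpha> i \<noteq> \<beta> k"
    and sum: "(\<Sum>i<r. a i) = (\<Sum>k<p. b k) + (\<Sum>l<q. c l)" and i: "i < r" and j: "j < p"
    and s: "s = \<alpha> i - \<beta> j" and C: "C = (\<Sum>l<q. c l)" and le: "C \<le> a i + b j"
    and hyp: "\<And>U1' E1' W1' H1' P1' Q1' U2' E2' W2' H2' P2' Q2'.
      realises r p q (\<alpha>(i := \<beta> j)) (\<beta>(j := \<alpha> i)) (\<lambda>l. \<gamma> l - s) (a(i := C - b j)) (b(j := C - a i)) c U1' E1' W1' H1' P1' Q1' \<Longrightarrow>
      realises r p q (\<alpha>(i := \<beta> j)) (\<beta>(j := \<alpha> i)) (\<lambda>l. \<gamma> l - s) (a(i := C - b j)) (b(j := C - a i)) c U2' E2' W2' H2' P2' Q2' \<Longrightarrow>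
      isomorphic p q U1' E1' W1' H1' P1' Q1' U2' E2' W2' H2' P2' Q2'"
  shows "isomorphic p q U1 E1 W1 H1 P1 Q1 U2 E2 W2 H2 P2 Q2"
proof -
  have \<alpha>\<beta>: "\<alpha> i \<noteq> \<beta> k" if "i < r" "k < p" for i k using \<alpha>\<beta>' that by blast
  define f where "f k = (\<beta> k - \<beta> j) / (\<beta> k - \<alpha> i)" for k
  note rfl = reflect(3)[OF _ \<alpha> \<beta> \<alpha>\<beta>' sum i j s C f_def le]
  obtain U1' P1' Q1' where
    R1': "realises r p q (\<alpha>(i := \<beta> j)) (\<beta>(j := \<alpha> i)) (\<lambda>l. \<gamma> l - s) (a(i := C - b j)) (b(j := C - a i)) c U1' E1 W1 H1 P1' Q1'"
    and A1: "U1' \<subseteq> U1" "\<forall>u\<in>U1. \<forall>k<p. k \<noteq> j \<longrightarrow> E1 k u \<in> U1'"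
      "\<forall>w\<in>W1. \<forall>k<p. k \<noteq> j \<longrightarrow> E1 k (P1' w) = E1 k (P1 w)"
      "\<forall>u\<in>U1'. \<forall>k<p. k \<noteq> j \<longrightarrow> Q1' (E1 k u) = f k *s Q1 (E1 k u)"
      "\<forall>w\<in>W1. Q1' (E1 j (P1' w)) = - (s *s spectral_map p q \<beta> \<gamma> E1 H1 P1 Q1 (\<alpha> i) w)"
    using rfl[OF R1] by (elim exE conjE)
  obtain U2' P2' Q2' where
    R2': "realises r p q (\<alpha>(i := \<beta> j)) (\<beta>(j := \<alpha> i)) (\<lambda>l. \<gamma> l - s) (a(i := C - b j)) (b(j := C - a i)) c U2' E2 W2 H2 P2' Q2'"
    and A2: "U2' \<subseteq> U2" "\<forall>u\<in>U2. \<forall>k<p. k \<noteq> j \<longrightarrow> E2 k u \<in> U2'"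
      "\<forall>w\<in>W2. \<forall>k<p. k \<noteq> j \<longrightarrow> E2 k (P2' w) = E2 k (P2 w)"
      "\<forall>u\<in>U2'. \<forall>k<p. k \<noteq> j \<longrightarrow> Q2' (E2 k u) = f k *s Q2 (E2 k u)"
      "\<forall>w\<in>W2. Q2' (E2 j (P2' w)) = - (s *s spectral_map p q \<beta> \<gamma> E2 H2 P2 Q2 (\<alpha> i) w)"
    using rfl[OF R2] by (elim exE conjE)
  have B1: "bisystem p q U1 E1 W1 H1 P1 Q1" and B2: "bisystem p q U2 E2 W2 H2 P2 Q2"
    and B1': "bisystem p q U1' E1 W1 H1 P1' Q1'" and B2': "bisystem p q U2' E2 W2 H2 P2' Q2'"
    by (rule realises_bisystem, fact)+
  note D1 = bisystemD[OF B1] and D2 = bisystemD[OF B2] and D1' = bisystemD[OF B1'] and D2' = bisystemD[OF B2']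
  note min1 = realises_minimal(2)[OF R1 \<alpha> \<alpha>\<beta>' sum j]
    and min2 = realises_minimal[OF R2 \<alpha> \<alpha>\<beta>' sum j]
  obtain g' h where g': "lin g'" "g' ` U1' = U2'" "\<forall>k<p. \<forall>u\<in>U1'. g' (E1 k u) = E2 k (g' u)"
      "\<forall>w\<in>W1. g' (P1' w) = P2' (h w)"
    and h: "lin h" "h ` W1 = W2" "\<forall>l<q. \<forall>w\<in>W1. h (H1 l w) = H2 l (h w)"
      "\<forall>u\<in>U1'. h (Q1' u) = Q2' (g' u)"
    using hyp[OF R1' R2'] unfolding isomorphic_def by (elim exE conjE)
  have s0: "s \<noteq> 0" using \<alpha>\<beta>[OF i j] s by simp
  let ?T = "{..<p} - {j}"
  have T: "k < p" "k \<noteq> j" "\<beta> k \<noteq> \<alpha> i" "f k \<noteq> 0" if "k \<in> ?T" for k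
    using that \<alpha>\<beta>[OF i] inj_onD[OF \<beta>, of k j] j unfolding f_def by fastforce+
  have hW: "h w \<in> W2" if "w \<in> W1" for w using h(2) that by blast
  have gU: "g' u \<in> U2'" if "u \<in> U1'" for u using g'(2) that by blast
  define F1 where "F1 = spectral_map p q \<beta> \<gamma> E1 H1 P1 Q1 (\<alpha> i)"
  define F2 where "F2 = spectral_map p q \<beta> \<gamma> E2 H2 P2 Q2 (\<alpha> i)"
  have hQE: "h (Q1' (E1 k u)) = Q2' (E2 k (g' u))" if "u \<in> U1'" "k < p" for u k
    using h(4) g'(3) D1'(11)[OF that(2,1)] that by simp
  have hF: "h (F1 w) = F2 (h w)" if w: "w \<in> W1" for w
  proof -
    have "h (- (s *s F1 w)) = - (s *s F2 (h w))"
      using hQE[OF D1'(7)[OF w] j] A1(5) A2(5) g'(4) w hW[OF w] unfolding F1_def F2_def by simp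
    then show ?thesis using s0 by (simp add: lin_neg[OF h(1)] lin_scale[OF h(1)])
  qed
  have hR: "h (Q1 (E1 k (P1 w))) = Q2 (E2 k (P2 (h w)))" if w: "w \<in> W1" and k: "k \<in> ?T" for w k
  proof -
    have "h (f k *s Q1 (E1 k (P1' w))) = f k *s Q2 (E2 k (P2' (h w)))"
      using hQE[OF D1'(7)[OF w] T(1)[OF k]] A1(4) A2(4) T(1,2)[OF k] g'(4) w hW[OF w] D1'(7)[OF w] D2'(7)[OF hW[OF w]]
      by simp
    then show ?thesis using A1(3) A2(3) T[OF k] w hW[OF w] by (simp add: lin_scale[OF h(1)])
  qed
  have Feq: "Q (E j (P w)) = s *s (\<alpha> i *s w - (\<Sum>l<q. \<gamma> l *s H l w)
      - (\<Sum>k\<in>?T. (1 / (\<alpha> i - \<beta> k)) *s Q (E k (P w))) - spectral_map p q \<beta> \<gamma> E H P Q (\<alpha> i) w)"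
    for E H :: "nat \<Rightarrow> 'b \<Rightarrow> 'b" and P Q w
    unfolding spectral_map_split[OF j] s[symmetric] using s0 by (simp add: algebra_simps)
  have hRj: "h (Q1 (E1 j (P1 w))) = Q2 (E2 j (P2 (h w)))" if w: "w \<in> W1" for w
  proof -
    have "h (\<Sum>l<q. \<gamma> l *s H1 l w) = (\<Sum>l<q. \<gamma> l *s H2 l (h w))"
      unfolding lin_sum[OF h(1)] lin_scale[OF h(1)] by (rule sum.cong[OF refl]) (use h(3) w in simp)
    moreover have "h (\<Sum>k\<in>?T. (1 / (\<alpha> i - \<beta> k)) *s Q1 (E1 k (P1 w))) = (\<Sum>k\<in>?T. (1 / (\<alpha> i - \<beta> k)) *s Q2 (E2 k (P2 (h w))))"
      unfolding lin_sum[OF h(1)] lin_scale[OF h(1)] by (rule sum.cong[OF refl]) (use hR[OF w] in simp)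
    ultimately have "h (s *s (\<alpha> i *s w - (\<Sum>l<q. \<gamma> l *s H1 l w)
        - (\<Sum>k\<in>?T. (1 / (\<alpha> i - \<beta> k)) *s Q1 (E1 k (P1 w))) - spectral_map p q \<beta> \<gamma> E1 H1 P1 Q1 (\<alpha> i) w))
      = s *s (\<alpha> i *s h w - (\<Sum>l<q. \<gamma> l *s H2 l (h w))
        - (\<Sum>k\<in>?T. (1 / (\<alpha> i - \<beta> k)) *s Q2 (E2 k (P2 (h w)))) - spectral_map p q \<beta> \<gamma> E2 H2 P2 Q2 (\<alpha> i) (h w))"
      using hF[OF w] unfolding F1_def F2_def by (simp only: lin_scale[OF h(1)] lin_diff[OF h(1)])
    then show ?thesis unfolding Feq[of Q1 E1 P1 w H1, symmetric] Feq[of Q2 E2 P2 "h w" H2, symmetric] .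
  qed
  have EjD: "u \<in> U2" "E2 j u = u" if "u \<in> E2 j ` U2" for u
    using resolution_piece_iff[OF D2(3) j, of u] that by auto
  have EjU: "subspace (E2 j ` U2)" by (rule lin_subspace_image[OF D2(9,1)])
  have "inj_on Q2 (E2 j ` U2)"
    by (rule lin_inj_onI[OF D2(6) EjU]) (rule min2(1)[OF EjD])
  from left_inverse_on[OF D2(6) EjU this]
  obtain L where L: "lin L" "\<forall>x\<in>E2 j ` U2. L (Q2 x) = x" by blast
  define v where "v u = L (h (Q1 (E1 j u)))" for u
  have v: "v u \<in> E2 j ` U2" "Q2 (v u) = h (Q1 (E1 j u))" if u: "u \<in> U1" for u
  proof -
    obtain w where w: "w \<in> W1" "E1 j (P1 w) = E1 j u"
      using min1[OF D1(11)[OF j u]] resolution_comp[OF D1(3) j j u] by auto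
    have hq: "h (Q1 (E1 j u)) = Q2 (E2 j (P2 (h w)))" using hRj[OF w(1)] w(2) by simp
    have m: "E2 j (P2 (h w)) \<in> E2 j ` U2" using D2(7)[OF hW[OF w(1)]] by blast
    have "v u = E2 j (P2 (h w))" unfolding v_def hq using bspec[OF L(2) m] by simp
    then show "v u \<in> E2 j ` U2" "Q2 (v u) = h (Q1 (E1 j u))"
      using m hq by simp_all
  qed
  define g where "g u = (\<Sum>k\<in>?T. g' (E1 k u)) + v u" for u
  have vl: "lin v" unfolding v_def
    by (intro lin_compose_app[OF L(1)] lin_compose_app[OF h(1)] lin_compose_app[OF D1(6)] D1(9))
  have gl: "lin g" unfolding g_def by (intro lin_plus lin_summation lin_compose_app[OF g'(1)] D1(9) vl)
  have v0: "v (E1 k u) = 0" if "u \<in> U1" "k \<in> ?T" for u k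
    unfolding v_def using resolution_comp[OF D1(3) j T(1)[OF that(2)] that(1)] T(2)[OF that(2)]
    by (simp add: lin_0[OF D1(6)] lin_0[OF h(1)] lin_0[OF L(1)])
  have gT: "g (E1 k u) = g' (E1 k u)" if u: "u \<in> U1" and k: "k \<in> ?T" for u k
  proof -
    have "(\<Sum>l\<in>?T. g' (E1 l (E1 k u))) = (\<Sum>l\<in>?T. if l = k then g' (E1 k u) else 0)"
      by (rule sum.cong[OF refl]) (use resolution_comp[OF D1(3) _ T(1)[OF k] u] lin_0[OF g'(1)] in auto)
    then show ?thesis unfolding g_def v0[OF u k] using k by simp
  qed
  have gj: "g (E1 j u) = v u" if u: "u \<in> U1" for u
  proof -
    have "(\<Sum>l\<in>?T. g' (E1 l (E1 j u))) = (\<Sum>l\<in>?T. 0)"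
      by (rule sum.cong[OF refl]) (use resolution_comp[OF D1(3) _ j u] lin_0[OF g'(1)] in auto)
    moreover have "v (E1 j u) = v u" unfolding v_def using resolution_comp[OF D1(3) j j u] by simp
    ultimately show ?thesis unfolding g_def by simp
  qed
  have EkU: "E1 k u \<in> U1'" if "u \<in> U1" "k \<in> ?T" for u k using A1(2) T[OF that(2)] that(1) by blast
  have E2g': "E2 l (g' (E1 k u)) = (if l = k then g' (E1 k u) else 0)" if u: "u \<in> U1" and k: "k \<in> ?T" and l: "l < p" for u k l
  proof -
    have "E2 l (g' (E1 k u)) = g' (E1 l (E1 k u))" using g'(3) l EkU[OF u k] by simp
    then show ?thesis using resolution_comp[OF D1(3) l T(1)[OF k] u] lin_0[OF g'(1)] by simp
  qed
  have E2v: "E2 l (v u) = (if l = j then v u else 0)" if u: "u \<in> U1" and l: "l < p" for u l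
    using resolution_comp[OF D2(3) l j EjD(1)[OF v(1)[OF u]]] EjD(2)[OF v(1)[OF u]] by auto
  have E2g: "E2 l (g u) = g (E1 l u)" if u: "u \<in> U1" and l: "l < p" for u l
  proof (cases "l = j")
    case True
    have "(\<Sum>k\<in>?T. E2 l (g' (E1 k u))) = (\<Sum>k\<in>?T. 0)"
      by (rule sum.cong[OF refl]) (use E2g'[OF u _ l] True in auto)
    then show ?thesis unfolding g_def[of u] lin_add[OF D2(9)] lin_sum[OF D2(9)] E2v[OF u l] using True gj[OF u] by simp
  next
    case False
    then have lT: "l \<in> ?T" using l by simp
    have "(\<Sum>k\<in>?T. E2 l (g' (E1 k u))) = (\<Sum>k\<in>?T. if k = l then g' (E1 l u) else 0)"
      by (rule sum.cong[OF refl]) (use E2g'[OF u _ l] in auto)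
    then show ?thesis unfolding g_def[of u] lin_add[OF D2(9)] lin_sum[OF D2(9)] E2v[OF u l] using False lT gT[OF u lT] by simp
  qed
  have gU2: "g u \<in> U2" if u: "u \<in> U1" for u
    unfolding g_def using gU[OF EkU[OF u]] A2(1) EjD(1)[OF v(1)[OF u]]
    by (intro subspace_add[OF D2(1)] subspace_sum[OF D2(1)]) auto
  have hQ: "h (Q1 u) = Q2 (g u)" if u: "u \<in> U1" for u
  proof -
    have "h (Q1 (E1 k u)) = Q2 (g' (E1 k u))" if k: "k \<in> ?T" for k
    proof -
      have e: "E1 k (E1 k u) = E1 k u" using resolution_comp[OF D1(3) T(1)[OF k] T(1)[OF k] u] by simp
      have "h (Q1' (E1 k (E1 k u))) = Q2' (E2 k (g' (E1 k u)))" by (rule hQE[OF EkU[OF u k] T(1)[OF k]])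
      then have "h (f k *s Q1 (E1 k u)) = f k *s Q2 (g' (E1 k u))"
        using A1(4)[rule_format, OF EkU[OF u k] T(1,2)[OF k]] A2(4)[rule_format, OF gU[OF EkU[OF u k]] T(1,2)[OF k]]
          E2g'[OF u k T(1)[OF k]] unfolding e by simp
      then show ?thesis using T(4)[OF k] by (simp add: lin_scale[OF h(1)])
    qed
    then have "(\<Sum>k\<in>?T. h (Q1 (E1 k u))) = (\<Sum>k\<in>?T. Q2 (g' (E1 k u)))" by (rule sum.cong[OF refl])
    moreover have "u = E1 j u + (\<Sum>k\<in>?T. E1 k u)"
      using resolution_sum[OF D1(3) u] sum.remove[of "{..<p}" j "\<lambda>k. E1 k u"] j by simp
    then have "h (Q1 u) = h (Q1 (E1 j u + (\<Sum>k\<in>?T. E1 k u)))" by simp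
    ultimately show ?thesis unfolding g_def
      by (simp add: lin_add[OF D1(6)] lin_sum[OF D1(6)] lin_add[OF h(1)] lin_sum[OF h(1)] lin_add[OF D2(6)] lin_sum[OF D2(6)] v(2)[OF u])
  qed
  have gP: "g (P1 w) = P2 (h w)" if w: "w \<in> W1" for w
  proof (rule resolution_eqI[OF D2(3) gU2[OF D1(7)[OF w]] D2(7)[OF hW[OF w]]])
    fix k assume k: "k < p"
    note Pw = D1(7)[OF w]
    show "E2 k (g (P1 w)) = E2 k (P2 (h w))"
    proof (cases "k = j")
      case True
      have "E2 j (P2 (h w)) \<in> E2 j ` U2" using D2(7)[OF hW[OF w]] by blast
      then have "v (P1 w) = E2 j (P2 (h w))" unfolding v_def hRj[OF w] by (rule bspec[OF L(2)])
      then show ?thesis unfolding E2g[OF Pw k] using gj[OF Pw] True by simp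
    next
      case False
      then have kT: "k \<in> ?T" using k by simp
      have "g' (E1 k (P1' w)) = E2 k (P2' (h w))" using g'(3,4) D1'(7)[OF w] k w by simp
      then show ?thesis unfolding E2g[OF Pw k] gT[OF Pw kT]
        using A1(3) A2(3) k False w hW[OF w] by simp
    qed
  qed
  have "g ` U1 = U2"
  proof (rule antisym; rule subsetI)
    fix x assume "x \<in> g ` U1" then show "x \<in> U2" using gU2 by blast
  next
    fix x assume x: "x \<in> U2"
    have "E2 k x \<in> g ` U1" if k: "k < p" for k
    proof (cases "k = j")
      case True
      obtain w where w: "w \<in> W2" "E2 j (P2 w) = E2 j x"
        using min2(2)[OF D2(11)[OF j x]] resolution_comp[OF D2(3) j j x] by auto
      obtain w1 where w1: "w1 \<in> W1" "w = h w1" using w(1) h(2) by blast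
      have "E2 j x = g (E1 j (P1 w1))" using w(2) w1 gP[OF w1(1)] E2g[OF D1(7)[OF w1(1)] j] by simp
      then show ?thesis using D1(11)[OF j D1(7)[OF w1(1)]] True by blast
    next
      case False
      then have kT: "k \<in> ?T" using k by simp
      have "E2 k x \<in> U2'" using A2(2) x k False by blast
      then obtain y where y: "y \<in> U1'" "E2 k x = g' y" using g'(2) by blast
      have yU: "y \<in> U1" using y A1(1) by blast
      have "E2 k (E2 k x) = g' (E1 k y)" using y g'(3) k by simp
      then have "E2 k x = g (E1 k y)" using resolution_comp[OF D2(3) k k x] gT[OF yU kT] by simp
      then show ?thesis using D1(11)[OF k yU] by blast
    qed
    then have "(\<Sum>k<p. E2 k x) \<in> g ` U1"
      by (intro subspace_sum[OF lin_subspace_image[OF gl D1(1)]]) auto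
    then show "x \<in> g ` U1" using resolution_sum[OF D2(3) x] by simp
  qed
  then show ?thesis
    unfolding isomorphic_def using gl h(1,2,3) E2g gP hQ by (intro exI[of _ g] exI[of _ h] conjI) auto
qed

end

section \<open>Dimension types that admit no reflection\<close>

text \<open>An entry \<open>(m\<^sub>1,k\<^sub>1,m\<^sub>2,k\<^sub>2,m\<^sub>3,k\<^sub>3)\<close> stands for \<open>m\<^sub>1\<close> parts \<open>k\<^sub>1\<close>, \<open>m\<^sub>2\<close> parts \<open>k\<^sub>2\<close> and \<open>m\<^sub>3\<close> parts \<open>k\<^sub>3\<close>. For each of
  them the joint flag variety has dimension \<open>(m\<^sub>1 k\<^sub>1)\<^sup>2\<close>, one more than the group modulo scalars.\<close>

definition critical_shapes :: "(nat \<times> nat \<times> nat \<times> nat \<times> nat \<times> nat) set" where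
  "critical_shapes = {(4,1,2,1,2,1), (3,2,3,1,3,1), (3,3,2,2,5,1), (3,3,5,1,2,2), (4,2,1,3,5,1), (4,2,5,1,1,3),
     (5,1,1,2,3,1), (5,1,3,1,1,2), (7,1,1,3,2,2), (7,1,2,2,1,3)}"

definition parts_ge :: "nat \<Rightarrow> (nat \<Rightarrow> nat) \<Rightarrow> nat \<Rightarrow> nat set" where
  "parts_ge r a k = {i. i < r \<and> k \<le> a i}"

definition critical :: "nat \<Rightarrow> nat \<Rightarrow> nat \<Rightarrow> (nat \<Rightarrow> nat) \<Rightarrow> (nat \<Rightarrow> nat) \<Rightarrow> (nat \<Rightarrow> nat) \<Rightarrow> bool" where
  "critical r p q a b c \<longleftrightarrow> (\<exists>(m1, k1, m2, k2, m3, k3)\<in>critical_shapes.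
     m1 \<le> card (parts_ge r a k1) \<and> m2 \<le> card (parts_ge p b k2) \<and> m3 \<le> card (parts_ge q c k3))"

lemma finite_parts_ge [simp]: "finite (parts_ge r a k)"
  unfolding parts_ge_def by simp

lemma critical_swap: "critical r q p a c b \<Longrightarrow> critical r p q a b c"
  unfolding critical_def critical_shapes_def by auto

lemma critical_mono:
  assumes "critical r p q a' b' c'"
    and le: "\<And>i. i < r \<Longrightarrow> a' i \<le> a i" "\<And>k. k < p \<Longrightarrow> b' k \<le> b k" "\<And>l. l < q \<Longrightarrow> c' l \<le> c l"
  shows "critical r p q a b c"
proof -
  have card: "card (parts_ge r a' k) \<le> card (parts_ge r a k)" if "\<And>i. i < r \<Longrightarrow> a' i \<le> a i" for r a a' k
    by (rule card_mono) (use that in \<open>auto simp: parts_ge_def intro: le_trans\<close>)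
  obtain m1 k1 m2 k2 m3 k3 where m: "(m1, k1, m2, k2, m3, k3) \<in> critical_shapes"
    "m1 \<le> card (parts_ge r a' k1)" "m2 \<le> card (parts_ge p b' k2)" "m3 \<le> card (parts_ge q c' k3)"
    using assms(1) unfolding critical_def by (elim bexE) (simp split: prod.splits)
  have "card (parts_ge r a' k1) \<le> card (parts_ge r a k1)" by (rule card) (rule le(1))
  moreover have "card (parts_ge p b' k2) \<le> card (parts_ge p b k2)" by (rule card) (rule le(2))
  moreover have "card (parts_ge q c' k3) \<le> card (parts_ge q c k3)" by (rule card) (rule le(3))
  ultimately show ?thesis unfolding critical_def
    by (intro bexI[OF _ m(1)]) (use m(2-4) in simp)
qed

lemma sum_le_parts:
  fixes a :: "nat \<Rightarrow> nat"
  assumes A: "\<And>i. i < r \<Longrightarrow> a i \<le> A"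
  shows "(\<Sum>i<r. a i) \<le> card (parts_ge r a 1) * A"
    and "\<And>i. i < r \<Longrightarrow> 1 \<le> a i \<Longrightarrow> (\<Sum>i<r. a i) + A \<le> a i + card (parts_ge r a 1) * A"
proof -
  let ?S = "parts_ge r a 1"
  have sub: "?S \<subseteq> {..<r}" unfolding parts_ge_def by auto
  have eq: "(\<Sum>i<r. a i) = (\<Sum>i\<in>?S. a i)"
    by (rule sum.mono_neutral_right[OF _ sub]) (auto simp: parts_ge_def not_le)
  have bd: "(\<Sum>i\<in>T. a i) \<le> card T * A" if "T \<subseteq> ?S" for T
    using sum_bounded_above[of T a A] A sub that by auto
  show "(\<Sum>i<r. a i) \<le> card ?S * A" using bd[of ?S] eq by simp
  fix i assume i: "i < r" "1 \<le> a i"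
  then have iS: "i \<in> ?S" unfolding parts_ge_def by simp
  have "(\<Sum>i\<in>?S. a i) = a i + (\<Sum>i\<in>?S - {i}. a i)" by (rule sum.remove[OF _ iS]) simp
  also have "(\<Sum>i\<in>?S - {i}. a i) \<le> card (?S - {i}) * A" by (rule bd) auto
  finally have "(\<Sum>i<r. a i) \<le> a i + card (?S - {i}) * A" using eq by simp
  moreover have "card ?S = Suc (card (?S - {i}))" by (rule card.remove[OF _ iS]) simp
  ultimately show "(\<Sum>i<r. a i) + A \<le> a i + card ?S * A" by simp
qed

lemma parts_ge_all:
  assumes "\<And>i. i < r \<Longrightarrow> 1 \<le> a i \<Longrightarrow> k \<le> a i" shows "card (parts_ge r a 1) \<le> card (parts_ge r a k)"
  by (rule card_mono) (use assms in \<open>auto simp: parts_ge_def\<close>)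

lemma parts_ge_one: "i < r \<Longrightarrow> k \<le> a i \<Longrightarrow> 1 \<le> card (parts_ge r a k)"
  by (metis (mono_tags, lifting) One_nat_def Suc_leI card_gt_0_iff empty_iff finite_parts_ge mem_Collect_eq parts_ge_def)

lemma exists_max_part:
  fixes b :: "nat \<Rightarrow> nat"
  assumes "0 < (\<Sum>k<p. b k)"
  obtains j where "j < p" "\<And>k. k < p \<Longrightarrow> b k \<le> b j" "1 \<le> b j"
proof -
  have "p > 0" using assms by (cases p) auto
  then have ne: "b ` {..<p} \<noteq> {}" by auto
  have "Max (b ` {..<p}) \<in> b ` {..<p}" by (rule Max_in[OF _ ne]) simp
  then obtain j where j: "j < p" "b j = Max (b ` {..<p})" by auto
  have le: "b k \<le> b j" if "k < p" for k unfolding j(2) by (rule Max_ge) (use that in auto)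
  have "1 \<le> b j"
  proof (rule ccontr)
    assume "\<not> 1 \<le> b j"
    then have "\<And>k. k < p \<Longrightarrow> b k = 0" using le by fastforce
    then show False using assms by simp
  qed
  then show ?thesis using that[OF j(1) le] by blast
qed

text \<open>If no reflection decreases the dimension, the sums of two largest parts are bounded by the totals of
  the blocks. A total is at most the number of its non-zero parts times the largest one, which bounds
  these numbers from below and leads to one of the shapes in each case. Where a shape asks for parts
  larger than \<open>1\<close>, the estimates are tight and leave no room for a smaller non-zero part.\<close>

lemma critical_if_irreducible:
  assumes sum: "(\<Sum>i<r. a i) = (\<Sum>k<p. b k) + (\<Sum>l<q. c l)" and pos: "0 < (\<Sum>i<r. a i)"
    and ab: "\<And>i k. i < r \<Longrightarrow> k < p \<Longrightarrow> a i + b k \<le> (\<Sum>l<q. c l)"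
    and ac: "\<And>i l. i < r \<Longrightarrow> l < q \<Longrightarrow> a i + c l \<le> (\<Sum>k<p. b k)"
  shows "critical r p q a b c"
proof -
  have main: "critical r p q a b c"
    if sum: "(\<Sum>i<r. a i) = (\<Sum>k<p. b k) + (\<Sum>l<q. c l)"
      and ab: "\<And>i k. i < r \<Longrightarrow> k < p \<Longrightarrow> a i + b k \<le> (\<Sum>l<q. c l)"
      and ac: "\<And>i l. i < r \<Longrightarrow> l < q \<Longrightarrow> a i + c l \<le> (\<Sum>k<p. b k)"
      and rbc: "card (parts_ge p b 1) \<le> card (parts_ge q c 1)"
    for p q b c
  proof -
    define X where "X = (\<Sum>k<p. b k)"
    define Y where "Y = (\<Sum>l<q. c l)"
    obtain i0 where i0: "i0 < r" "\<And>i. i < r \<Longrightarrow> a i \<le> a i0" "1 \<le> a i0" using exists_max_part[OF pos] by metis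
    have "0 < X \<and> 0 < Y"
    proof -
      have "0 < X \<or> 0 < Y" using sum pos unfolding X_def Y_def by auto
      moreover have "0 < X" if "0 < Y"
        using exists_max_part[of c q] that ac[OF i0(1)] i0(3) unfolding X_def Y_def by (metis add_gr_0 less_le_trans zero_less_one)
      moreover have "0 < Y" if "0 < X"
        using exists_max_part[of b p] that ab[OF i0(1)] i0(3) unfolding X_def Y_def by (metis add_gr_0 less_le_trans zero_less_one)
      ultimately show ?thesis by blast
    qed
    then have "0 < (\<Sum>k<p. b k)" "0 < (\<Sum>l<q. c l)" unfolding X_def Y_def by auto
    from exists_max_part[OF this(1)] exists_max_part[OF this(2)]
    obtain j0 l0 where j0: "j0 < p" "\<And>k. k < p \<Longrightarrow> b k \<le> b j0" "1 \<le> b j0"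
      and l0: "l0 < q" "\<And>l. l < q \<Longrightarrow> c l \<le> c l0" "1 \<le> c l0" by metis
    define A where "A = a i0"
    define B where "B = b j0"
    define C where "C = c l0"
    define ra where "ra = card (parts_ge r a 1)"
    define rb where "rb = card (parts_ge p b 1)"
    define rc where "rc = card (parts_ge q c 1)"
    have pos1: "1 \<le> A" "1 \<le> B" "1 \<le> C" using i0 j0 l0 unfolding A_def B_def C_def by auto
    have AB: "A + B \<le> Y" and AC: "A + C \<le> X"
      using ab[OF i0(1) j0(1)] ac[OF i0(1) l0(1)] unfolding A_def B_def C_def X_def Y_def by auto
    have n: "(\<Sum>i<r. a i) = X + Y" using sum unfolding X_def Y_def by simp
    have na: "X + Y \<le> ra * A" and nai: "\<And>i. i < r \<Longrightarrow> 1 \<le> a i \<Longrightarrow> X + Y + A \<le> a i + ra * A"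
      using sum_le_parts[of r a A] i0 unfolding n A_def ra_def by auto
    have nb: "X \<le> rb * B" and nbi: "\<And>i. i < p \<Longrightarrow> 1 \<le> b i \<Longrightarrow> X + B \<le> b i + rb * B"
      using sum_le_parts[of p b B] j0 unfolding X_def B_def rb_def by auto
    have nc: "Y \<le> rc * C" and nci: "\<And>i. i < q \<Longrightarrow> 1 \<le> c i \<Longrightarrow> Y + C \<le> c i + rc * C"
      using sum_le_parts[of q c C] l0 unfolding Y_def C_def rc_def by auto
    have ratio: "m \<le> k" if "m * D \<le> k * D" "1 \<le> D" for m k D :: nat using that by simp
    have show_crit: "critical r p q a b c"
      if "(m1, k1, m2, k2, m3, k3) \<in> critical_shapes" "m1 \<le> card (parts_ge r a k1)" "m2 \<le> card (parts_ge p b k2)" "m3 \<le> card (parts_ge q c k3)"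
      for m1 k1 m2 k2 m3 k3
      unfolding critical_def by (rule bexI[OF _ that(1)]) (use that(2-4) in simp)
    have ra_ge: "ra \<le> card (parts_ge r a k)" if "k + ra * A \<le> X + Y + A" for k
      unfolding ra_def by (rule parts_ge_all) (use nai that in fastforce)
    have rb_ge: "rb \<le> card (parts_ge p b k)" if "k + rb * B \<le> X + B" for k
      unfolding rb_def by (rule parts_ge_all) (use nbi that in fastforce)
    have rc_ge: "rc \<le> card (parts_ge q c k)" if "k + rc * C \<le> Y + C" for k
      unfolding rc_def by (rule parts_ge_all) (use nci that in fastforce)
    have b1: "1 \<le> card (parts_ge p b k)" if "k \<le> B" for k
      using parts_ge_one[OF j0(1), of k b] that unfolding B_def by simp
    have rb1: "1 \<le> rb" using b1[OF pos1(2)] unfolding rb_def by simp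
    have "2 * A < ra * A" using na AB AC pos1 by linarith
    then have ra3: "3 \<le> ra" by simp
    consider "rb = 1" | "rb = 2" | "rb \<ge> 3" using rb1 by linarith
    then show ?thesis
    proof cases
      case 1
      then have XB: "X \<le> B" using nb by simp
      have "2 * X + A \<le> ra * A" using na AB XB by linarith
      then have "3 * A < ra * A" using AC pos1 by linarith
      then have ra4: "4 \<le> ra" by simp
      have "rc \<noteq> 1" using nc AB AC XB pos1 by (intro notI) simp
      then consider "rc = 2" | "rc \<ge> 3" using rbc 1 unfolding rb_def rc_def by linarith
      then show ?thesis
      proof cases
        case 1
        have C2: "2 * A \<le> C" using nc 1 AB AC XB by simp
        have "7 * A \<le> ra * A" using na AB AC XB C2 by linarith
        then have "7 \<le> ra" using ratio pos1(1) by blast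
        moreover have "3 \<le> B" using AC C2 pos1 XB by linarith
        moreover have "2 + rc * C \<le> Y + C" using 1 AB AC XB C2 pos1 by simp
        ultimately show ?thesis
          using show_crit[of 7 1 1 3 2 2] b1[of 3] rc_ge[of 2] 1 unfolding ra_def critical_shapes_def by simp
      next
        case 2
        show ?thesis
        proof (cases "ra = 4")
          case True
          have C2: "2 * C \<le> A" using \<open>2 * X + A \<le> ra * A\<close> AC True by simp
          have "3 \<le> B" using AC C2 pos1 XB by linarith
          moreover have "2 + ra * A \<le> X + Y + A" using True AB AC XB pos1 by simp
          moreover have "5 * C \<le> rc * C" using nc AB AC XB C2 by linarith
          then have "5 \<le> rc" using ratio pos1(3) by blast
          ultimately show ?thesis
            using show_crit[of 4 2 1 3 5 1] b1[of 3] ra_ge[of 2] True unfolding rc_def critical_shapes_def by simp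
        next
          case False
          then have "5 \<le> ra" using ra4 by simp
          moreover have "2 \<le> B" using AC XB pos1 by linarith
          ultimately show ?thesis
            using show_crit[of 5 1 1 2 3 1] b1[of 2] 2 unfolding ra_def rc_def critical_shapes_def by simp
        qed
      qed
    next
      case 2
      then have rc2: "2 \<le> rc" using rbc unfolding rb_def rc_def by simp
      show ?thesis
      proof (cases "ra = 3")
        case True
        have A1: "B + C \<le> A" using na AB AC True by simp
        have XB: "X \<le> 2 * B" using nb 2 by simp
        have B2: "2 * C \<le> B" using XB AC A1 by linarith
        have "5 * C \<le> rc * C" using nc AB A1 B2 by linarith
        then have "5 \<le> rc" using ratio pos1(3) by blast
        moreover have "3 + ra * A \<le> X + Y + A" using True AB AC B2 pos1 by simp
        moreover have "2 + rb * B \<le> X + B" using 2 AC A1 pos1 by simp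
        ultimately show ?thesis
          using show_crit[of 3 3 2 2 5 1] ra_ge[of 3] rb_ge[of 2] True 2 unfolding rc_def critical_shapes_def by simp
      next
        case False
        then show ?thesis
          using show_crit[of 4 1 2 1 2 1] ra3 2 rc2 unfolding ra_def rb_def rc_def critical_shapes_def by simp
      qed
    next
      case 3
      then have rc3: "3 \<le> rc" using rbc unfolding rb_def rc_def by simp
      show ?thesis
      proof (cases "ra = 3")
        case True
        have "2 + ra * A \<le> X + Y + A" using True AB AC pos1 by simp
        then show ?thesis
          using show_crit[of 3 2 3 1 3 1] ra_ge[of 2] True 3 rc3 unfolding rb_def rc_def critical_shapes_def by simp
      next
        case False
        then show ?thesis
          using show_crit[of 4 1 2 1 2 1] ra3 3 rc3 unfolding ra_def rb_def rc_def critical_shapes_def by simp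
      qed
    qed
  qed
  show ?thesis
  proof (cases "card (parts_ge p b 1) \<le> card (parts_ge q c 1)")
    case True
    show ?thesis by (rule main[OF sum ab ac True])
  next
    case False
    have sum': "(\<Sum>i<r. a i) = (\<Sum>l<q. c l) + (\<Sum>k<p. b k)" using sum by simp
    have le: "card (parts_ge q c 1) \<le> card (parts_ge p b 1)" using False by linarith
    show ?thesis by (rule critical_swap, rule main[OF sum' ac ab le])
  qed
qed

section \<open>Generic spectra\<close>

text \<open>The trace condition of the additive Deligne-Simpson problem: a system of type \<open>(fa, fb, fc)\<close> with
  spectra \<open>x\<close>, \<open>y\<close>, \<open>z\<close> has weight \<open>0\<close>. Types are integral, not only natural, because differences and
  reflections of types occur.\<close>

definition weight :: "nat \<Rightarrow> nat \<Rightarrow> nat \<Rightarrow> (nat \<Rightarrow> 'k::field_char_0) \<Rightarrow> (nat \<Rightarrow> 'k) \<Rightarrow> (nat \<Rightarrow> 'k) \<Rightarrow>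
    (nat \<Rightarrow> int) \<Rightarrow> (nat \<Rightarrow> int) \<Rightarrow> (nat \<Rightarrow> int) \<Rightarrow> 'k" where
  "weight r p q x y z fa fb fc = (\<Sum>i<r. of_int (fa i) * x i) - (\<Sum>k<p. of_int (fb k) * y k) - (\<Sum>l<q. of_int (fc l) * z l)"

definition proportional :: "nat \<Rightarrow> nat \<Rightarrow> nat \<Rightarrow> (nat \<Rightarrow> int) \<Rightarrow> (nat \<Rightarrow> int) \<Rightarrow> (nat \<Rightarrow> int) \<Rightarrow>
    (nat \<Rightarrow> nat) \<Rightarrow> (nat \<Rightarrow> nat) \<Rightarrow> (nat \<Rightarrow> nat) \<Rightarrow> bool" where
  "proportional r p q fa fb fc a b c \<longleftrightarrow> (\<exists>m n. m \<noteq> 0 \<and> (\<forall>i<r. m * fa i = n * int (a i)) \<and>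
     (\<forall>k<p. m * fb k = n * int (b k)) \<and> (\<forall>l<q. m * fc l = n * int (c l)))"

text \<open>Each argument stands for one condition on the spectra, and only finitely many of them are used at a
  time. A sequence of spectra that satisfies every condition eventually therefore serves as well as
  a single generic one, and it can be written down over the rational numbers.\<close>

definition generic :: "nat \<Rightarrow> nat \<Rightarrow> nat \<Rightarrow> (nat \<Rightarrow> nat \<Rightarrow> 'k::field_char_0) \<Rightarrow> (nat \<Rightarrow> nat \<Rightarrow> 'k) \<Rightarrow> (nat \<Rightarrow> nat \<Rightarrow> 'k) \<Rightarrow>
    (nat \<Rightarrow> nat) \<Rightarrow> (nat \<Rightarrow> nat) \<Rightarrow> (nat \<Rightarrow> nat) \<Rightarrow> bool" where
  "generic r p q X Y Z a b c \<longleftrightarrow> (\<forall>fa fb fc. \<not> proportional r p q fa fb fc a b c \<longrightarrow>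
     eventually (\<lambda>M. weight r p q (X M) (Y M) (Z M) fa fb fc \<noteq> 0) sequentially)"

lemma genericD: "generic r p q X Y Z a b c \<Longrightarrow> \<not> proportional r p q fa fb fc a b c \<Longrightarrow>
    eventually (\<lambda>M. weight r p q (X M) (Y M) (Z M) fa fb fc \<noteq> 0) sequentially"
  unfolding generic_def by simp

lemma weight_swap: "weight r q p x z y fa fc fb = weight r p q x y z fa fb fc"
  unfolding weight_def by simp

lemma generic_swap:
  assumes "generic r p q X Y Z a b c" shows "generic r q p X Z Y a c b"
  unfolding generic_def
proof (intro allI impI)
  fix fa fb fc :: "nat \<Rightarrow> int" assume "\<not> proportional r q p fa fb fc a c b"
  then have "\<not> proportional r p q fa fc fb a b c"
    unfolding proportional_def by meson
  from genericD[OF assms this] show "eventually (\<lambda>M. weight r q p (X M) (Z M) (Y M) fa fb fc \<noteq> 0) sequentially"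
    by (simp only: weight_swap[of r q p])
qed

abbreviation unit_at :: "nat \<Rightarrow> nat \<Rightarrow> int" where "unit_at i \<equiv> (\<lambda>k. if k = i then 1 else 0)"

lemma sum_unit_at: "i < r \<Longrightarrow> (\<Sum>k<r. of_int (unit_at i k) * x k) = (x i :: 'k::field_char_0)"
proof -
  assume "i < r"
  have "(\<Sum>k<r. of_int (unit_at i k) * x k) = (\<Sum>k<r. if k = i then x k else 0)"
    by (rule sum.cong[OF refl]) simp
  then show ?thesis using \<open>i < r\<close> by simp
qed

text \<open>The difference of two numbers of the same kind has coefficients \<open>1\<close> and \<open>-1\<close>, and a type, being without
  negative entries, is not proportional to that. This covers the case \<open>c = 0\<close>.\<close>

lemma generic_inj:
  assumes G: "generic r p q X Y Z a b c"
  shows "eventually (\<lambda>M. inj_on (X M) {..<r}) sequentially" "eventually (\<lambda>M. inj_on (Y M) {..<p}) sequentially"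
proof -
  have contra: "m = 0" if "m = n * int s" "- m = n * int t" for m n :: int and s t
  proof -
    have "n * (int s + int t) = 0" using that by (simp add: distrib_left)
    then show ?thesis using that by auto
  qed
  have 2: "eventually (\<lambda>M. X M i \<noteq> X M i') sequentially" if "i < r" "i' < r" "i \<noteq> i'" for i i'
  proof -
    have "\<not> proportional r p q (\<lambda>k. unit_at i k - unit_at i' k) (\<lambda>k. 0) (\<lambda>l. 0) a b c"
      unfolding proportional_def
    proof (intro notI, elim exE conjE)
      fix m n :: int assume A: "m \<noteq> 0" "\<forall>k<r. m * (unit_at i k - unit_at i' k) = n * int (a k)"
      show False using A(1) contra[of m n "a i" "a i'"] A(2)[rule_format, OF that(1)] A(2)[rule_format, OF that(2)] that(3) by simp
    qed
    from genericD[OF G this] show ?thesis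
      unfolding weight_def of_int_diff left_diff_distrib sum_subtractf sum_unit_at[OF that(1)] sum_unit_at[OF that(2)] by simp
  qed
  have 3: "eventually (\<lambda>M. Y M i \<noteq> Y M i') sequentially" if "i < p" "i' < p" "i \<noteq> i'" for i i'
  proof -
    have "\<not> proportional r p q (\<lambda>k. 0) (\<lambda>k. unit_at i' k - unit_at i k) (\<lambda>l. 0) a b c"
      unfolding proportional_def
    proof (intro notI, elim exE conjE)
      fix m n :: int assume A: "m \<noteq> 0" "\<forall>k<p. m * (unit_at i' k - unit_at i k) = n * int (b k)"
      show False using A(1) contra[of m n "b i'" "b i"] A(2)[rule_format, OF that(1)] A(2)[rule_format, OF that(2)] that(3) by simp
    qed
    from genericD[OF G this] show ?thesis
      unfolding weight_def of_int_diff left_diff_distrib sum_subtractf sum_unit_at[OF that(1)] sum_unit_at[OF that(2)] by simp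
  qed
  have inj: "eventually (\<lambda>M. inj_on (V M) {..<n}) sequentially"
    if "\<And>i i'. i < n \<Longrightarrow> i' < n \<Longrightarrow> i \<noteq> i' \<Longrightarrow> eventually (\<lambda>M. V M i \<noteq> V M i') sequentially"
    for V :: "nat \<Rightarrow> nat \<Rightarrow> 'a" and n
  proof -
    have "eventually (\<lambda>M. \<forall>i\<in>{..<n}. \<forall>i'\<in>{..<n}. i \<noteq> i' \<longrightarrow> V M i \<noteq> V M i') sequentially"
    proof (intro eventually_ball_finite ballI finite_lessThan)
      fix i i' assume ii: "i \<in> {..<n}" "i' \<in> {..<n}"
      show "eventually (\<lambda>M. i \<noteq> i' \<longrightarrow> V M i \<noteq> V M i') sequentially"
        using that[of i i'] ii by (cases "i = i'") auto
    qed
    then show ?thesis by (rule eventually_mono) (auto simp: inj_on_def)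
  qed
  show "eventually (\<lambda>M. inj_on (X M) {..<r}) sequentially" by (rule inj[OF 2])
  show "eventually (\<lambda>M. inj_on (Y M) {..<p}) sequentially" by (rule inj[OF 3])
qed

text \<open>A coincidence of two of the numbers is a non-zero relation in which no \<open>\<gamma>\<close> occurs, and a type
  proportional to it would have \<open>c = 0\<close>.\<close>

lemma generic_distinct:
  assumes G: "generic r p q X Y Z a b c" and c: "0 < (\<Sum>l<q. c l)"
  shows "eventually (\<lambda>M. \<forall>i<r. \<forall>k<p. X M i \<noteq> Y M k) sequentially"
    and "eventually (\<lambda>M. inj_on (X M) {..<r}) sequentially"
    and "eventually (\<lambda>M. inj_on (Y M) {..<p}) sequentially"
proof -
  obtain l where l: "l < q" "1 \<le> c l"
    using exists_max_part[OF c] by blast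
  have zero: "n = 0" if "\<forall>l<q. m * (0::int) = n * int (c l)" for m n
    using that[rule_format, OF l(1)] l(2) by simp
  have 1: "eventually (\<lambda>M. X M i \<noteq> Y M k) sequentially" if "i < r" "k < p" for i k
  proof -
    have "\<not> proportional r p q (unit_at i) (unit_at k) (\<lambda>l. 0) a b c"
      unfolding proportional_def
    proof (intro notI, elim exE conjE)
      fix m n :: int assume A: "m \<noteq> 0" "\<forall>k<r. m * unit_at i k = n * int (a k)" "\<forall>l<q. m * 0 = n * int (c l)"
      have "n = 0" by (rule zero[OF A(3)])
      then show False using A(1) A(2)[rule_format, OF that(1)] by simp
    qed
    from genericD[OF G this] show ?thesis unfolding weight_def sum_unit_at[OF that(1)] sum_unit_at[OF that(2)] by simp
  qed
  have "eventually (\<lambda>M. \<forall>i\<in>{..<r}. \<forall>k\<in>{..<p}. X M i \<noteq> Y M k) sequentially"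
    by (intro eventually_ball_finite ballI finite_lessThan) (use 1 in simp)
  then show "eventually (\<lambda>M. \<forall>i<r. \<forall>k<p. X M i \<noteq> Y M k) sequentially" by (simp add: Ball_def)
  show "eventually (\<lambda>M. inj_on (X M) {..<r}) sequentially" "eventually (\<lambda>M. inj_on (Y M) {..<p}) sequentially"
    by (rule generic_inj[OF G])+
qed

lemma sum_upd:
  fixes f g :: "nat \<Rightarrow> 'k::comm_ring_1"
  assumes "i < r" shows "(\<Sum>k<r. f k * g k) = f i * g i + (\<Sum>k\<in>{..<r} - {i}. f k * g k)"
  using assms by (simp add: sum.remove)

text \<open>Reflections of types are adjoint to the exchange of two numbers in the spectra. So a relation for
  the reflected spectra is a relation for the original ones, and genericity is preserved.\<close>

lemma weight_reflect:
  assumes "i < r" "j < p"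
  shows "weight r p q (x(i := y j)) (y(j := x i)) (\<lambda>l. z l - (x i - y j)) fa fb fc =
    weight r p q x y z (fa(i := (\<Sum>l<q. fc l) - fb j)) (fb(j := (\<Sum>l<q. fc l) - fa i)) fc"
proof -
  have 1: "(\<Sum>k\<in>{..<r} - {i}. of_int (fa k) * (x(i := y j)) k) = (\<Sum>k\<in>{..<r} - {i}. of_int ((fa(i := t)) k) * x k)" for t
    by (rule sum.cong[OF refl]) simp
  have 2: "(\<Sum>k\<in>{..<p} - {j}. of_int (fb k) * (y(j := x i)) k) = (\<Sum>k\<in>{..<p} - {j}. of_int ((fb(j := t)) k) * y k)" for t
    by (rule sum.cong[OF refl]) simp
  have 3: "(\<Sum>l<q. of_int (fc l) * (z l - (x i - y j))) = (\<Sum>l<q. of_int (fc l) * z l) - of_int (\<Sum>l<q. fc l) * (x i - y j)"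
    by (simp add: right_diff_distrib sum_subtractf sum_distrib_right)
  show ?thesis
    unfolding weight_def sum_upd[OF assms(1)] sum_upd[OF assms(2)] 3
      1[of "(\<Sum>l<q. fc l) - fb j"] 2[of "(\<Sum>l<q. fc l) - fa i"]
    by (simp add: algebra_simps)
qed

lemma generic_reflect:
  assumes G: "generic r p q X Y Z a b c" and i: "i < r" and j: "j < p"
    and C: "C = (\<Sum>l<q. c l)" and le: "a i \<le> C" "b j \<le> C"
  shows "generic r p q (\<lambda>M. (X M)(i := Y M j)) (\<lambda>M. (Y M)(j := X M i)) (\<lambda>M l. Z M l - (X M i - Y M j))
    (a(i := C - b j)) (b(j := C - a i)) c"
  unfolding generic_def
proof (intro allI impI)
  fix fa fb fc assume np: "\<not> proportional r p q fa fb fc (a(i := C - b j)) (b(j := C - a i)) c"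
  let ?t = "\<Sum>l<q. fc l"
  have "\<not> proportional r p q (fa(i := ?t - fb j)) (fb(j := ?t - fa i)) fc a b c"
  proof
    assume "proportional r p q (fa(i := ?t - fb j)) (fb(j := ?t - fa i)) fc a b c"
    then obtain m n where m: "m \<noteq> 0" and A: "\<forall>k<r. m * (fa(i := ?t - fb j)) k = n * int (a k)"
      and B: "\<forall>k<p. m * (fb(j := ?t - fa i)) k = n * int (b k)" and D: "\<forall>l<q. m * fc l = n * int (c l)"
      unfolding proportional_def by (elim exE conjE)
    have t: "m * ?t = n * int C" unfolding C of_nat_sum sum_distrib_left by (rule sum.cong[OF refl]) (use D in simp)
    have Ai: "m * (?t - fb j) = n * int (a i)" using A i by auto
    have Bj: "m * (?t - fa i) = n * int (b j)" using B j by auto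
    have fb: "m * fb j = n * int (C - a i)" using Ai t le(1) by (simp add: right_diff_distrib of_nat_diff)
    have fa: "m * fa i = n * int (C - b j)" using Bj t le(2) by (simp add: right_diff_distrib of_nat_diff)
    have "m * fa k = n * int ((a(i := C - b j)) k)" if "k < r" for k
      using A[rule_format, OF that] fa by (cases "k = i") simp_all
    moreover have "m * fb k = n * int ((b(j := C - a i)) k)" if "k < p" for k
      using B[rule_format, OF that] fb by (cases "k = j") simp_all
    ultimately have "proportional r p q fa fb fc (a(i := C - b j)) (b(j := C - a i)) c"
      unfolding proportional_def using m D by (intro exI[of _ m] exI[of _ n]) simp
    then show False using np by simp
  qed
  from genericD[OF G this]
  show "eventually (\<lambda>M. weight r p q ((X M)(i := Y M j)) ((Y M)(j := X M i)) (\<lambda>l. Z M l - (X M i - Y M j)) fa fb fc \<noteq> 0) sequentially"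
    unfolding weight_reflect[OF i j] .
qed

lemma sum_lessThan_add:
  fixes f :: "nat \<Rightarrow> 'k::comm_monoid_add"
  shows "(\<Sum>t<m + n. f t) = (\<Sum>t<m. f t) + (\<Sum>k<n. f (m + k))"
  by (induction n) (simp_all add: add.assoc)

text \<open>On the hyperplane orthogonal to \<open>d\<close>, the large powers of an integer \<open>M\<close>, corrected in one
  coordinate where \<open>d\<close> does not vanish, avoid every other rational hyperplane for all large \<open>M\<close>.\<close>

lemma generic_exists:
  assumes pos: "0 < (\<Sum>i<r. a i)"
  shows "\<exists>X Y Z :: nat \<Rightarrow> nat \<Rightarrow> 'k::field_char_0. generic r p q X Y Z a b c \<and>
    (\<forall>M. weight r p q (X M) (Y M) (Z M) (\<lambda>i. int (a i)) (\<lambda>k. int (b k)) (\<lambda>l. int (c l)) = 0)"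
proof -
  obtain i0 where i0: "i0 < r" "1 \<le> a i0" using exists_max_part[OF pos] by blast
  \<comment> \<open>A type becomes a polynomial in \<open>M\<close> of degree below \<open>N\<close>, with its entries as coefficients.\<close>
  define N where "N = r + p + q"
  define pk where "pk fa fb fc t = (if t < r then fa t else if t < r + p then fb (t - r) else fc (t - r - p))"
    for fa fb fc :: "nat \<Rightarrow> int" and t
  define ev :: "nat \<Rightarrow> (nat \<Rightarrow> int) \<Rightarrow> 'k" where "ev M g = (\<Sum>t<N. of_int (g t) * of_nat M ^ t)" for M g
  \<comment> \<open>Subtracting \<open>D M\<close> in the coordinate \<open>i0\<close> puts the spectra on the hyperplane of weight \<open>0\<close>; the
    factor \<open>s\<close> avoids the division by the coefficient there.\<close>
  define D :: "nat \<Rightarrow> 'k" where "D M = ev M (pk (\<lambda>i. int (a i)) (\<lambda>k. int (b k)) (\<lambda>l. int (c l)))" for M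
  define s :: 'k where "s = of_nat (a i0)"
  define X :: "nat \<Rightarrow> nat \<Rightarrow> 'k" where "X M i = s * of_nat M ^ i - (if i = i0 then D M else 0)" for M i
  define Y :: "nat \<Rightarrow> nat \<Rightarrow> 'k" where "Y M k = - (s * of_nat M ^ (r + k))" for M k
  define Z :: "nat \<Rightarrow> nat \<Rightarrow> 'k" where "Z M l = - (s * of_nat M ^ (r + p + l))" for M l
  have evpk: "ev M (pk fa fb fc) = (\<Sum>i<r. of_int (fa i) * of_nat M ^ i) + (\<Sum>k<p. of_int (fb k) * of_nat M ^ (r + k))
      + (\<Sum>l<q. of_int (fc l) * of_nat M ^ (r + p + l))" for M fa fb fc
    unfolding ev_def N_def sum_lessThan_add
    by (intro arg_cong2[where f = "(+)"] sum.cong refl) (simp_all add: pk_def)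
  have wt: "weight r p q (X M) (Y M) (Z M) fa fb fc = s * ev M (pk fa fb fc) - of_int (fa i0) * D M" for M fa fb fc
  proof -
    have "(\<Sum>i<r. of_int (fa i) * X M i) = s * (\<Sum>i<r. of_int (fa i) * of_nat M ^ i) - (\<Sum>i<r. if i = i0 then of_int (fa i) * D M else 0)"
      unfolding sum_distrib_left sum_subtractf[symmetric]
      by (rule sum.cong[OF refl]) (simp add: X_def algebra_simps)
    moreover have "(\<Sum>k<p. of_int (fb k) * Y M k) = - (s * (\<Sum>k<p. of_int (fb k) * of_nat M ^ (r + k)))"
      unfolding sum_distrib_left sum_negf[symmetric] by (rule sum.cong[OF refl]) (simp add: Y_def)
    moreover have "(\<Sum>l<q. of_int (fc l) * Z M l) = - (s * (\<Sum>l<q. of_int (fc l) * of_nat M ^ (r + p + l)))"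
      unfolding sum_distrib_left sum_negf[symmetric] by (rule sum.cong[OF refl]) (simp add: Z_def)
    ultimately show ?thesis unfolding weight_def evpk using i0(1) by (simp add: algebra_simps)
  qed
  have "weight r p q (X M) (Y M) (Z M) (\<lambda>i. int (a i)) (\<lambda>k. int (b k)) (\<lambda>l. int (c l)) = 0" for M
    unfolding wt D_def[symmetric] s_def by simp
  moreover have "generic r p q X Y Z a b c"
    unfolding generic_def
  proof (intro allI impI)
    fix fa fb fc assume np: "\<not> proportional r p q fa fb fc a b c"
    define g where "g t = int (a i0) * pk fa fb fc t - fa i0 * pk (\<lambda>i. int (a i)) (\<lambda>k. int (b k)) (\<lambda>l. int (c l)) t" for t
    have w: "weight r p q (X M) (Y M) (Z M) fa fb fc = ev M g" for M
      unfolding wt D_def s_def ev_def sum_distrib_left sum_subtractf[symmetric]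
      by (rule sum.cong[OF refl]) (simp add: g_def algebra_simps)
    have "\<exists>t<N. g t \<noteq> 0"
    proof (rule ccontr)
      assume "\<not> (\<exists>t<N. g t \<noteq> 0)"
      then have g0: "g t = 0" if "t < N" for t using that by blast
      have "int (a i0) * fa i = fa i0 * int (a i)" if "i < r" for i
        using g0[of i] that unfolding g_def pk_def N_def by simp
      moreover have "int (a i0) * fb k = fa i0 * int (b k)" if "k < p" for k
        using g0[of "r + k"] that unfolding g_def pk_def N_def by simp
      moreover have "int (a i0) * fc l = fa i0 * int (c l)" if "l < q" for l
        using g0[of "r + p + l"] that unfolding g_def pk_def N_def by simp
      ultimately have "proportional r p q fa fb fc a b c"
        unfolding proportional_def using i0(2) by (intro exI[of _ "int (a i0)"] exI[of _ "fa i0"]) simp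
      then show False using np by simp
    qed
    then obtain t0 where t0: "t0 < N" "g t0 \<noteq> 0" by blast
    define P :: "'k poly" where "P = (\<Sum>t<N. monom (of_int (g t)) t)"
    have "coeff P t0 = (\<Sum>t<N. if t = t0 then of_int (g t) else 0)"
      unfolding P_def coeff_sum by (rule sum.cong[OF refl]) simp
    then have "P \<noteq> 0" using t0 by auto
    have "finite {M :: nat. poly P (of_nat M) = 0}"
    proof (rule finite_imageD)
      show "finite ((of_nat :: nat \<Rightarrow> 'k) ` {M. poly P (of_nat M) = 0})"
        by (rule finite_subset[OF _ poly_roots_finite[OF \<open>P \<noteq> 0\<close>]]) auto
      show "inj_on (of_nat :: nat \<Rightarrow> 'k) {M. poly P (of_nat M) = 0}" by (simp add: inj_on_def)
    qed
    moreover have "poly P (of_nat M) = ev M g" for M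
      unfolding P_def ev_def poly_sum poly_monom ..
    ultimately have "finite {M. \<not> ev M g \<noteq> 0}" by simp
    then have "eventually (\<lambda>M. ev M g \<noteq> 0) cofinite" unfolding eventually_cofinite .
    then show "eventually (\<lambda>M. weight r p q (X M) (Y M) (Z M) fa fb fc \<noteq> 0) sequentially"
      unfolding w cofinite_eq_sequentially .
  qed
  ultimately show ?thesis by blast
qed

locale closed_ambient = fin_ambient scale Basis
  for scale :: "'k::{alg_closed_field,field_char_0} \<Rightarrow> 'v::ab_group_add \<Rightarrow> 'v" (infixr "*s" 75) and Basis :: "'v set"
begin

text \<open>On an empty block the maps \<open>P\<close> and \<open>Q\<close> vanish, and a resolution of the identity is determined by
  the ranks of its members.\<close>

lemma isomorphic_if_trivial:
  assumes B1: "bisystem p q U1 E1 W1 H1 P1 Q1" and B2: "bisystem p q U2 E2 W2 H2 P2 Q2"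
    and d: "\<And>k. k < p \<Longrightarrow> dim (E1 k ` U1) = dim (E2 k ` U2)" and W: "W1 = {0}" "W2 = {0}"
  shows "isomorphic p q U1 E1 W1 H1 P1 Q1 U2 E2 W2 H2 P2 Q2"
proof -
  note D1 = bisystemD[OF B1] and D2 = bisystemD[OF B2]
  have "\<exists>f. lin f \<and> (k < p \<longrightarrow> f ` (E1 k ` U1) = E2 k ` U2)" for k
  proof (cases "k < p")
    case True
    show ?thesis
      using subspace_iso[OF lin_subspace_image[OF D1(9,1)] lin_subspace_image[OF D2(9,1)] d[OF True]] by blast
  qed (use lin_zero in blast)
  then have "\<forall>k. \<exists>f. lin f \<and> (k < p \<longrightarrow> f ` (E1 k ` U1) = E2 k ` U2)" by (rule allI)
  from choice[OF this] obtain f where "\<forall>k. lin (f k) \<and> (k < p \<longrightarrow> f k ` (E1 k ` U1) = E2 k ` U2)" ..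
  then have fl: "lin (f k)" and fim: "k < p \<Longrightarrow> f k ` (E1 k ` U1) = E2 k ` U2" for k by simp_all
  define g where "g u = (\<Sum>k<p. f k (E1 k u))" for u
  have gl: "lin g" unfolding g_def by (intro lin_summation lin_compose_app[OF fl] D1(9))
  have fE: "f k (E1 k u) \<in> U2" "E2 k (f k (E1 k u)) = f k (E1 k u)" if "u \<in> U1" "k < p" for u k
  proof -
    have "f k (E1 k u) \<in> E2 k ` U2" using fim[OF that(2)] that(1) by blast
    then show "f k (E1 k u) \<in> U2" "E2 k (f k (E1 k u)) = f k (E1 k u)"
      using resolution_piece_iff[OF D2(3) that(2), of "f k (E1 k u)"] by simp_all
  qed
  have gE: "g (E1 l u) = f l (E1 l u)" if u: "u \<in> U1" and l: "l < p" for u l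
  proof -
    have "(\<Sum>k<p. f k (E1 k (E1 l u))) = (\<Sum>k<p. if k = l then f l (E1 l u) else 0)"
      by (rule sum.cong[OF refl]) (use resolution_comp[OF D1(3) _ l u] lin_0[OF fl] in simp)
    then show ?thesis unfolding g_def using l by simp
  qed
  have Eg: "E2 l (g u) = f l (E1 l u)" if u: "u \<in> U1" and l: "l < p" for u l
  proof -
    have "(\<Sum>k<p. E2 l (f k (E1 k u))) = (\<Sum>k<p. if k = l then f l (E1 l u) else 0)"
    proof (rule sum.cong[OF refl])
      fix k assume k: "k \<in> {..<p}"
      have "E2 l (E2 k (f k (E1 k u))) = (if l = k then E2 k (f k (E1 k u)) else 0)"
        by (rule resolution_comp[OF D2(3) l _ fE(1)[OF u]]) (use k in auto)
      then show "E2 l (f k (E1 k u)) = (if k = l then f l (E1 l u) else 0)" using fE(2)[OF u, of k] k by (cases "k = l") simp_all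
    qed
    then show ?thesis unfolding g_def lin_sum[OF D2(9)] using l by simp
  qed
  have "g ` U1 = U2"
  proof (rule antisym; rule subsetI)
    fix x assume "x \<in> g ` U1"
    then obtain u where u: "u \<in> U1" "x = g u" by blast
    show "x \<in> U2" unfolding u(2) g_def by (rule subspace_sum[OF D2(1)]) (use fE(1)[OF u(1)] in simp)
  next
    fix x assume x: "x \<in> U2"
    have "E2 k x \<in> g ` U1" if k: "k < p" for k
    proof -
      have "E2 k x \<in> f k ` (E1 k ` U1)" using fim[OF k] x by blast
      then obtain u where u: "u \<in> U1" "E2 k x = f k (E1 k u)" by blast
      then have "E2 k x = g (E1 k u)" using gE[OF u(1) k] by simp
      then show ?thesis using D1(11)[OF k u(1)] by blast
    qed
    then have "(\<Sum>k<p. E2 k x) \<in> g ` U1"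
      by (intro subspace_sum[OF lin_subspace_image[OF gl D1(1)]]) simp
    then show "x \<in> g ` U1" using resolution_sum[OF D2(3) x] by simp
  qed
  note gU = this
  have Q20: "Q2 u = 0" if "u \<in> U2" for u using D2(8)[OF that] W(2) by simp
  show ?thesis
    unfolding isomorphic_def W
  proof (rule exI[of _ g], rule exI[of _ "\<lambda>x. 0"], intro conjI allI impI ballI)
    show "lin g" by (rule gl)
    show "lin (\<lambda>x. 0)" by (rule lin_zero)
    show "g ` U1 = U2" by (rule gU)
    show "(\<lambda>x. 0) ` {0} = {0}" by simp
    show "g (E1 k u) = E2 k (g u)" if "k < p" "u \<in> U1" for k u
      unfolding gE[OF that(2,1)] Eg[OF that(2,1)] ..
    show "0 = H2 l 0" for l using lin_0[OF D2(10)] by simp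
    show "g (P1 w) = P2 0" if "w \<in> {0}" for w
      using that by (simp add: lin_0[OF gl] lin_0[OF D1(5)] lin_0[OF D2(5)])
    show "0 = Q2 (g u)" if "u \<in> U1" for u using imageI[OF that, of g] Q20 unfolding gU by simp
  qed
qed

definition unique_system where
  "unique_system r p q x y z a b c \<longleftrightarrow> (\<forall>U1 E1 W1 H1 P1 Q1 U2 E2 W2 H2 P2 Q2.
     realises r p q x y z a b c U1 E1 W1 H1 P1 Q1 \<longrightarrow> realises r p q x y z a b c U2 E2 W2 H2 P2 Q2 \<longrightarrow>
     isomorphic p q U1 E1 W1 H1 P1 Q1 U2 E2 W2 H2 P2 Q2)"

lemma unique_systemD: "unique_system r p q x y z a b c \<Longrightarrow> realises r p q x y z a b c U1 E1 W1 H1 P1 Q1 \<Longrightarrow>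
    realises r p q x y z a b c U2 E2 W2 H2 P2 Q2 \<Longrightarrow> isomorphic p q U1 E1 W1 H1 P1 Q1 U2 E2 W2 H2 P2 Q2"
  unfolding unique_system_def by simp

lemma unique_systemI:
  assumes "\<And>U1 E1 W1 H1 P1 Q1 U2 E2 W2 H2 P2 Q2. realises r p q x y z a b c U1 E1 W1 H1 P1 Q1 \<Longrightarrow>
    realises r p q x y z a b c U2 E2 W2 H2 P2 Q2 \<Longrightarrow> isomorphic p q U1 E1 W1 H1 P1 Q1 U2 E2 W2 H2 P2 Q2"
  shows "unique_system r p q x y z a b c"
  unfolding unique_system_def using assms by simp

lemma realises_dims:
  assumes R: "realises r p q x y z a b c U E W H P Q"
  shows "dim U = (\<Sum>k<p. b k)" "dim W = (\<Sum>l<q. c l)" "\<And>k. k < p \<Longrightarrow> dim (E k ` U) = b k" "\<And>l. l < q \<Longrightarrow> dim (H l ` W) = c l"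
proof -
  note D = bisystemD[OF realises_bisystem[OF R]]
  show b: "dim (E k ` U) = b k" if "k < p" for k using R that unfolding realises_def by simp
  show c: "dim (H l ` W) = c l" if "l < q" for l using R that unfolding realises_def by simp
  show "dim U = (\<Sum>k<p. b k)" "dim W = (\<Sum>l<q. c l)"
    using resolution_dim[OF D(3,1)] resolution_dim[OF D(4,2)] b c by simp_all
qed

lemma subspace_dim_0: "subspace S \<Longrightarrow> dim S = 0 \<Longrightarrow> S = {0}"
  using subspace_eq_if_dim_le[of "{0}" S] subspace_0 by simp

lemma unique_if_no_W:
  assumes "(\<Sum>l<q. c l) = 0" shows "unique_system r p q x y z a b c"
proof (rule unique_systemI)
  fix U1 E1 W1 H1 P1 Q1 U2 E2 W2 H2 P2 Q2
  assume R: "realises r p q x y z a b c U1 E1 W1 H1 P1 Q1" "realises r p q x y z a b c U2 E2 W2 H2 P2 Q2"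
  note D = realises_dims[OF R(1)] realises_dims[OF R(2)] and B = realises_bisystem[OF R(1)] realises_bisystem[OF R(2)]
  show "isomorphic p q U1 E1 W1 H1 P1 Q1 U2 E2 W2 H2 P2 Q2"
  proof (rule isomorphic_if_trivial[OF B])
    show "dim (E1 k ` U1) = dim (E2 k ` U2)" if "k < p" for k using D(3,7)[OF that] by simp
    show "W1 = {0}" by (rule subspace_dim_0[OF bisystemD(2)[OF B(1)]]) (simp add: D(2) assms)
    show "W2 = {0}" by (rule subspace_dim_0[OF bisystemD(2)[OF B(2)]]) (simp add: D(6) assms)
  qed
qed

lemma unique_if_no_U:
  assumes "(\<Sum>k<p. b k) = 0" shows "unique_system r p q x y z a b c"
proof (rule unique_systemI)
  fix U1 E1 W1 H1 P1 Q1 U2 E2 W2 H2 P2 Q2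
  assume R: "realises r p q x y z a b c U1 E1 W1 H1 P1 Q1" "realises r p q x y z a b c U2 E2 W2 H2 P2 Q2"
  note D = realises_dims[OF R(1)] realises_dims[OF R(2)] and B = realises_bisystem[OF R(1)] realises_bisystem[OF R(2)]
  show "isomorphic p q U1 E1 W1 H1 P1 Q1 U2 E2 W2 H2 P2 Q2"
  proof (rule isomorphic_swap, rule isomorphic_if_trivial[OF bisystem_swap[OF B(1)] bisystem_swap[OF B(2)]])
    show "dim (H1 l ` W1) = dim (H2 l ` W2)" if "l < q" for l using D(4,8)[OF that] by simp
    show "U1 = {0}" by (rule subspace_dim_0[OF bisystemD(1)[OF B(1)]]) (simp add: D(1) assms)
    show "U2 = {0}" by (rule subspace_dim_0[OF bisystemD(1)[OF B(2)]]) (simp add: D(5) assms)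
  qed
qed

text \<open>Dimension types below no critical shape are reduced by reflections to the case that one of the
  two diagonal blocks is empty.\<close>

lemma generic_unique:
  assumes "(\<Sum>i<r. a i) = (\<Sum>k<p. b k) + (\<Sum>l<q. c l)" "\<not> critical r p q a b c" "generic r p q X Y Z a b c"
  shows "eventually (\<lambda>M. unique_system r p q (X M) (Y M) (Z M) a b c) sequentially"
  using assms
proof (induction "\<Sum>i<r. a i" arbitrary: p q a b c X Y Z rule: less_induct)
  case less
  have step: "eventually (\<lambda>M. unique_system r p q (X M) (Y M) (Z M) a b c) sequentially"
    if sum: "(\<Sum>i<r. a i) = (\<Sum>k<p. b k) + (\<Sum>l<q. c l)" and nc: "\<not> critical r p q a b c" and G: "generic r p q X Y Z a b c"
      and c0: "0 < (\<Sum>l<q. c l)" and ij: "i < r" "j < p" "(\<Sum>l<q. c l) < a i + b j"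
    for p q b c Y Z i j
  proof -
    define C where "C = (\<Sum>l<q. c l)"
    note dist = generic_distinct[OF G c0]
    have le: "C \<le> a i + b j" using ij(3) unfolding C_def by simp
    show ?thesis
    proof (cases "a i \<le> C \<and> b j \<le> C")
      case False
      from dist show ?thesis
      proof (eventually_elim, intro unique_systemI)
        fix M U1 E1 W1 H1 P1 Q1 U2 E2 W2 H2 P2 Q2
        assume d: "\<forall>i<r. \<forall>k<p. X M i \<noteq> Y M k" "inj_on (X M) {..<r}" "inj_on (Y M) {..<p}"
          and R: "realises r p q (X M) (Y M) (Z M) a b c U1 E1 W1 H1 P1 Q1"
        have "a i \<le> C" "b j \<le> C"
          using reflect(1,2)[OF R d(2,3,1) sum ij(1,2) refl C_def refl] by simp_all
        then show "isomorphic p q U1 E1 W1 H1 P1 Q1 U2 E2 W2 H2 P2 Q2" using False by simp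
      qed
    next
      case True
      let ?a = "a(i := C - b j)" and ?b = "b(j := C - a i)"
      have sa: "(\<Sum>k<r. ?a k) = (C - b j) + (\<Sum>k\<in>{..<r} - {i}. a k)" "(\<Sum>k<r. a k) = a i + (\<Sum>k\<in>{..<r} - {i}. a k)"
        using ij(1) by (simp_all add: sum.remove)
      have sb: "(\<Sum>k<p. ?b k) = (C - a i) + (\<Sum>k\<in>{..<p} - {j}. b k)" "(\<Sum>k<p. b k) = b j + (\<Sum>k\<in>{..<p} - {j}. b k)"
        using ij(2) by (simp_all add: sum.remove)
      have lt: "(\<Sum>k<r. ?a k) < (\<Sum>k<r. a k)" using sa True ij(3) C_def by linarith
      have sum': "(\<Sum>k<r. ?a k) = (\<Sum>k<p. ?b k) + (\<Sum>l<q. c l)"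
        using sa sb sum True ij(3) unfolding C_def by linarith
      have nc': "\<not> critical r p q ?a ?b c"
      proof
        assume "critical r p q ?a ?b c"
        then have "critical r p q a b c"
          by (rule critical_mono) (use le in auto)
        then show False using nc by simp
      qed
      note G' = generic_reflect[OF G ij(1,2) C_def conjunct1[OF True] conjunct2[OF True]]
      have "eventually (\<lambda>M. unique_system r p q ((X M)(i := Y M j)) ((Y M)(j := X M i)) (\<lambda>l. Z M l - (X M i - Y M j)) ?a ?b c) sequentially"
        by (rule less.hyps[OF lt sum' nc' G'])
      with dist show ?thesis
      proof (eventually_elim, intro unique_systemI)
        fix M U1 E1 W1 H1 P1 Q1 U2 E2 W2 H2 P2 Q2
        assume d: "\<forall>i<r. \<forall>k<p. X M i \<noteq> Y M k" "inj_on (X M) {..<r}" "inj_on (Y M) {..<p}"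
          and R: "realises r p q (X M) (Y M) (Z M) a b c U1 E1 W1 H1 P1 Q1" "realises r p q (X M) (Y M) (Z M) a b c U2 E2 W2 H2 P2 Q2"
          and u: "unique_system r p q ((X M)(i := Y M j)) ((Y M)(j := X M i)) (\<lambda>l. Z M l - (X M i - Y M j)) ?a ?b c"
        show "isomorphic p q U1 E1 W1 H1 P1 Q1 U2 E2 W2 H2 P2 Q2"
          by (rule reflect_isomorphic[OF R d(2,3,1) sum ij(1,2) refl C_def le]) (rule unique_systemD[OF u])
      qed
    qed
  qed
  note sum = less.prems(1) and nc = less.prems(2) and G = less.prems(3)
  consider "(\<Sum>k<p. b k) = 0" | "(\<Sum>l<q. c l) = 0" | "0 < (\<Sum>k<p. b k)" "0 < (\<Sum>l<q. c l)" by linarith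
  then show ?case
  proof cases
    case 1 show ?thesis using unique_if_no_U[OF 1] by simp
  next
    case 2 show ?thesis using unique_if_no_W[OF 2] by simp
  next
    case 3
    have "\<exists>i<r. (\<exists>j<p. (\<Sum>l<q. c l) < a i + b j) \<or> (\<exists>l<q. (\<Sum>k<p. b k) < a i + c l)"
    proof (rule ccontr)
      assume not: "\<not> ?thesis"
      have pos: "0 < (\<Sum>i<r. a i)" using sum 3 by simp
      have ab: "a i + b j \<le> (\<Sum>l<q. c l)" if "i < r" "j < p" for i j using not that by (meson not_le)
      have ac: "a i + c l \<le> (\<Sum>k<p. b k)" if "i < r" "l < q" for i l using not that by (meson not_le)
      show False using critical_if_irreducible[OF sum pos ab ac] nc by simp
    qed
    then consider i j where "i < r" "j < p" "(\<Sum>l<q. c l) < a i + b j" | i l where "i < r" "l < q" "(\<Sum>k<p. b k) < a i + c l" by blast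
    then show ?thesis
    proof cases
      case 1
      show ?thesis by (rule step[OF sum nc G 3(2) 1])
    next
      case 2
      have nc': "\<not> critical r q p a c b" using nc critical_swap by blast
      have sum': "(\<Sum>i<r. a i) = (\<Sum>l<q. c l) + (\<Sum>k<p. b k)" using sum by simp
      note G' = generic_swap[OF G]
      note ev = step[OF sum' nc' G' 3(1) 2]
      from ev generic_distinct(1)[OF G 3(2)] generic_distinct(1)[OF G' 3(1)] show ?thesis
      proof (eventually_elim, intro unique_systemI)
        fix M U1 E1 W1 H1 P1 Q1 U2 E2 W2 H2 P2 Q2
        assume u: "unique_system r q p (X M) (Z M) (Y M) a c b"
          and d: "\<forall>i<r. \<forall>k<p. X M i \<noteq> Y M k" "\<forall>i<r. \<forall>k<q. X M i \<noteq> Z M k"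
          and R: "realises r p q (X M) (Y M) (Z M) a b c U1 E1 W1 H1 P1 Q1" "realises r p q (X M) (Y M) (Z M) a b c U2 E2 W2 H2 P2 Q2"
        have "isomorphic q p W1 H1 U1 E1 Q1 P1 W2 H2 U2 E2 Q2 P2"
          by (rule unique_systemD[OF u]; rule realises_swap; use d R in simp)
        then show "isomorphic p q U1 E1 W1 H1 P1 Q1 U2 E2 W2 H2 P2 Q2" by (rule isomorphic_swap)
      qed
    qed
  qed
qed

end

section \<open>Chains of subspaces\<close>

context fin_ambient begin

definition chain :: "nat \<Rightarrow> (nat \<Rightarrow> nat) \<Rightarrow> (nat \<Rightarrow> 'b set) \<Rightarrow> bool" where
  "chain r a A \<longleftrightarrow> A 0 = {0} \<and> (\<forall>i\<le>r. subspace (A i)) \<and>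
     (\<forall>i<r. A i \<subseteq> A (Suc i) \<and> dim (A (Suc i)) = dim (A i) + a i)"

lemma chainD:
  assumes "chain r a A"
  shows "A 0 = {0}" "\<And>i. i \<le> r \<Longrightarrow> subspace (A i)" "\<And>i. i < r \<Longrightarrow> A i \<subseteq> A (Suc i)"
    "\<And>i. i < r \<Longrightarrow> dim (A (Suc i)) = dim (A i) + a i"
  using assms unfolding chain_def by simp_all

lemma chain_mono:
  assumes "chain r a A" "i \<le> j" "j \<le> r" shows "A i \<subseteq> A j"
  using assms(2,3)
proof (induction j rule: dec_induct)
  case (step n)
  then show ?case using chainD(3)[OF assms(1), of n] by auto
qed simp

lemma chain_dim:
  assumes "chain r a A" "i \<le> r" shows "dim (A i) = (\<Sum>k<i. a k)"
  using assms(2)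
proof (induction i)
  case 0 then show ?case by (simp add: chainD(1)[OF assms(1)])
next
  case (Suc i) then show ?case using chainD(4)[OF assms(1), of i] by simp
qed

definition stable :: "nat \<Rightarrow> (nat \<Rightarrow> 'b set) \<Rightarrow> ('b \<Rightarrow> 'b) \<Rightarrow> bool" where
  "stable r A f \<longleftrightarrow> (\<forall>i\<le>r. \<forall>v\<in>A i. f v \<in> A i)"

lemma lin_funpow: "lin f \<Longrightarrow> lin (f ^^ n)"
proof (induction n)
  case 0 show ?case unfolding funpow_0 by (rule linI) simp_all
next
  case (Suc n)
  have "lin (\<lambda>x. f ((f ^^ n) x))" by (rule lin_compose_app[OF Suc.prems Suc.IH[OF Suc.prems]])
  then show ?case by (simp add: comp_def)
qed

lemma funpow_mem: "(\<And>v. v \<in> S \<Longrightarrow> f v \<in> S) \<Longrightarrow> v \<in> S \<Longrightarrow> (f ^^ n) v \<in> S"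
  by (induction n) simp_all

subsection \<open>Bases adapted to a chain and triangular for a nilpotent operator\<close>

text \<open>The filtration of \<open>D'/D\<close> by the kernels of the powers of \<open>\<nu>\<close> shows that a basis of \<open>D\<close> can be
  extended in such a way that \<open>\<nu>\<close> is strictly triangular on the new vectors.\<close>

lemma adapted_block:
  assumes "lin \<nu>" "subspace D" "subspace D'" "D \<subseteq> D'" "\<And>v. v \<in> D \<Longrightarrow> \<nu> v \<in> D" "\<And>v. v \<in> D' \<Longrightarrow> \<nu> v \<in> D'"
    and "\<And>v. v \<in> D' \<Longrightarrow> (\<nu> ^^ N) v \<in> D" and G: "independent G" "span G = D"
  shows "\<exists>G'. G \<subseteq> G' \<and> independent G' \<and> span G' = D' \<and> (\<forall>e\<in>G' - G. \<nu> e \<in> span (G' - {e}))"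
  using assms(3,4,6,7)
proof (induction N arbitrary: D')
  case 0
  then have "D' = D" by auto
  then show ?case using G by (intro exI[of _ G]) simp
next
  case (Suc N)
  let ?D = "ssum D (\<nu> ` D')"
  have s: "subspace ?D" by (rule subspace_sums[OF assms(2) lin_subspace_image[OF assms(1) Suc.prems(1)]])
  have 0: "0 \<in> D" "0 \<in> D'" using subspace_0 assms(2) Suc.prems(1) by simp_all
  have sub1: "D \<subseteq> ?D"
  proof
    fix x assume "x \<in> D"
    then have "x + \<nu> 0 \<in> ?D" using 0(2) by blast
    then show "x \<in> ?D" by (simp add: lin_0[OF assms(1)])
  qed
  have sub2: "?D \<subseteq> D'"
    using Suc.prems(2,3) subspace_add[OF Suc.prems(1)] by auto
  have im: "\<nu> v \<in> ?D" if "v \<in> D'" for v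
  proof -
    have "0 + \<nu> v \<in> ?D" using 0(1) that by blast
    then show ?thesis by simp
  qed
  have st: "\<nu> v \<in> ?D" if "v \<in> ?D" for v using im sub2 that by blast
  have nil: "(\<nu> ^^ N) v \<in> D" if v: "v \<in> ?D" for v
  proof -
    obtain d x where dx: "d \<in> D" "x \<in> D'" "v = d + \<nu> x" using v by blast
    have "(\<nu> ^^ N) (\<nu> x) \<in> D" using Suc.prems(4)[OF dx(2)] by (simp add: funpow_swap1)
    moreover have "(\<nu> ^^ N) d \<in> D" by (rule funpow_mem[OF assms(5) dx(1)])
    ultimately show ?thesis unfolding dx(3) lin_add[OF lin_funpow[OF assms(1)]] by (intro subspace_add[OF assms(2)])
  qed
  have "\<exists>G'. G \<subseteq> G' \<and> independent G' \<and> span G' = ?D \<and> (\<forall>e\<in>G' - G. \<nu> e \<in> span (G' - {e}))"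
  proof (rule Suc.IH[OF s sub1])
    show "\<nu> v \<in> ?D" if "v \<in> ?D" for v by (rule st[OF that])
    show "(\<nu> ^^ N) v \<in> D" if "v \<in> ?D" for v by (rule nil[OF that])
  qed
  then obtain G1 where G1: "G \<subseteq> G1" "independent G1" "span G1 = ?D" "\<forall>e\<in>G1 - G. \<nu> e \<in> span (G1 - {e})"
    by (elim exE conjE)
  have "G1 \<subseteq> D'" using G1(3) sub2 span_superset[of G1] by simp
  then obtain G2 where G2: "G1 \<subseteq> G2" "G2 \<subseteq> D'" "independent G2" "D' \<subseteq> span G2"
    using maximal_independent_subset_extend[of G1 D'] G1(2) by blast
  have sp: "span G2 = D'" using span_subspace[OF G2(2,4) Suc.prems(1)] .
  have "\<nu> e \<in> span (G2 - {e})" if e: "e \<in> G2 - G" for e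
  proof (cases "e \<in> G1")
    case True
    then have "\<nu> e \<in> span (G1 - {e})" using G1(4) e by blast
    then show ?thesis using span_mono[of "G1 - {e}" "G2 - {e}"] G2(1) by blast
  next
    case False
    have "\<nu> e \<in> span G1" unfolding G1(3) by (rule im) (use e G2(2) in blast)
    moreover have "G1 \<subseteq> G2 - {e}" using False G2(1) by blast
    ultimately show ?thesis using span_mono by blast
  qed
  then show ?case using G1(1) G2(1,3) sp by (intro exI[of _ G2]) blast
qed

text \<open>Bases of the members of a chain, increasing, in which the matrix of \<open>\<nu>\<close> has zeros on the diagonal.\<close>

definition adapted :: "nat \<Rightarrow> (nat \<Rightarrow> 'b set) \<Rightarrow> ('b \<Rightarrow> 'b) \<Rightarrow> (nat \<Rightarrow> 'b set) \<Rightarrow> bool" where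
  "adapted r A \<nu> G \<longleftrightarrow> G 0 = {} \<and> (\<forall>i\<le>r. independent (G i) \<and> span (G i) = A i) \<and>
     (\<forall>i<r. G i \<subseteq> G (Suc i) \<and> (\<forall>e\<in>G (Suc i) - G i. \<nu> e \<in> span (G (Suc i) - {e})))"

lemma adaptedD:
  assumes "adapted r A \<nu> G"
  shows "G 0 = {}" "\<And>i. i \<le> r \<Longrightarrow> independent (G i)" "\<And>i. i \<le> r \<Longrightarrow> span (G i) = A i"
    "\<And>i. i < r \<Longrightarrow> G i \<subseteq> G (Suc i)" "\<And>i e. i < r \<Longrightarrow> e \<in> G (Suc i) - G i \<Longrightarrow> \<nu> e \<in> span (G (Suc i) - {e})"
  using assms unfolding adapted_def by blast+

lemma adapted_exists:
  assumes A: "chain r a A" and \<nu>: "lin \<nu>" "stable r A \<nu>" and nil: "\<And>v. v \<in> A r \<Longrightarrow> (\<nu> ^^ N) v = 0"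
  shows "\<exists>G. adapted r A \<nu> G"
proof -
  have "\<exists>G. adapted m A \<nu> G" if "m \<le> r" for m
    using that
  proof (induction m)
    case 0
    have "adapted 0 A \<nu> (\<lambda>i. {})" unfolding adapted_def using chainD(1)[OF A] independent_empty by simp
    then show ?case by blast
  next
    case (Suc m)
    then have "m \<le> r" by simp
    from Suc.IH[OF this] obtain G where G: "adapted m A \<nu> G" ..
    have st: "\<nu> v \<in> A i" if "i \<le> r" "v \<in> A i" for i v using \<nu>(2) that unfolding stable_def by blast
    have m: "m < r" "m \<le> r" "Suc m \<le> r" using Suc.prems by auto
    have "\<exists>G'. G m \<subseteq> G' \<and> independent G' \<and> span G' = A (Suc m) \<and> (\<forall>e\<in>G' - G m. \<nu> e \<in> span (G' - {e}))"
    proof (rule adapted_block[OF \<nu>(1) chainD(2)[OF A m(2)] chainD(2)[OF A m(3)] chainD(3)[OF A m(1)], of N])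
      show "(\<nu> ^^ N) v \<in> A m" if "v \<in> A (Suc m)" for v
        using nil[of v] chain_mono[OF A m(3) order_refl] that subspace_0[OF chainD(2)[OF A m(2)]] by auto
    qed (use st m adaptedD(2,3)[OF G, of m] in auto)
    then obtain G' where G': "G m \<subseteq> G'" "independent G'" "span G' = A (Suc m)" "\<forall>e\<in>G' - G m. \<nu> e \<in> span (G' - {e})"
      by (elim exE conjE)
    define G2 where "G2 i = (if i \<le> m then G i else G')" for i
    have "adapted (Suc m) A \<nu> G2"
      unfolding adapted_def
    proof (intro conjI allI impI)
      show "G2 0 = {}" using adaptedD(1)[OF G] unfolding G2_def by simp
      fix i assume "i \<le> Suc m"
      then consider "i \<le> m" | "i = Suc m" by linarith
      then show "independent (G2 i)" "span (G2 i) = A i"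
        by (cases; use adaptedD(2,3)[OF G, of i] G' in \<open>simp add: G2_def\<close>)+
    next
      fix i assume "i < Suc m"
      then consider "i < m" | "i = m" by linarith
      then show "G2 i \<subseteq> G2 (Suc i)" by (cases; use adaptedD(4)[OF G, of i] G'(1) in \<open>simp add: G2_def\<close>)
    next
      fix i assume "i < Suc m"
      then consider "i < m" | "i = m" by linarith
      then show "\<forall>e\<in>G2 (Suc i) - G2 i. \<nu> e \<in> span (G2 (Suc i) - {e})"
        by (cases; use adaptedD(5)[OF G, of i] G'(4) in \<open>simp add: G2_def\<close>)
    qed
    then show ?case by blast
  qed
  then show ?thesis by simp
qed

lemma adapted_mono:
  assumes "adapted r A \<nu> G" "i \<le> j" "j \<le> r" shows "G i \<subseteq> G j"
  using assms(2,3)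
proof (induction j rule: dec_induct)
  case (step n)
  then show ?case using adaptedD(4)[OF assms(1), of n] by auto
qed simp

lemma adapted_card:
  assumes G: "adapted r A \<nu> G" and A: "chain r a A" and i: "i < r"
  shows "finite (G (Suc i))" "card (G (Suc i) - G i) = a i"
proof -
  have f: "finite (G j)" "card (G j) = dim (A j)" if "j \<le> r" for j
    using adaptedD(2,3)[OF G that] finiteI_independent dim_span_eq_card_independent[of "G j"] by auto
  show "finite (G (Suc i))" using f i by simp
  show "card (G (Suc i) - G i) = a i"
    using card_Diff_subset[OF f(1) adaptedD(4)[OF G i]] f(2)[of i] f(2)[of "Suc i"] chainD(4)[OF A i] i by simp
qed

definition block_value :: "nat \<Rightarrow> (nat \<Rightarrow> 'b set) \<Rightarrow> (nat \<Rightarrow> 'a) \<Rightarrow> 'b \<Rightarrow> 'a" where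
  "block_value r G \<alpha> e = (if e \<in> G r then \<alpha> (LEAST i. e \<in> G (Suc i)) else 0)"

lemma block_value:
  assumes G: "adapted r A \<nu> G" and i: "i < r" and e: "e \<in> G (Suc i) - G i"
  shows "block_value r G \<alpha> e = \<alpha> i"
proof -
  have "(LEAST i. e \<in> G (Suc i)) = i"
  proof (rule Least_equality)
    show "i \<le> j" if "e \<in> G (Suc j)" for j
    proof (rule ccontr)
      assume "\<not> i \<le> j"
      then have "G (Suc j) \<subseteq> G i" using i by (intro adapted_mono[OF G]) auto
      then show False using that e by blast
    qed
  qed (use e in blast)
  moreover have "e \<in> G r" using adapted_mono[OF G, of "Suc i" r] i e by auto
  ultimately show ?thesis unfolding block_value_def by simp
qed

lemma adapted_block_of:
  assumes G: "adapted r A \<nu> G" and m: "m \<le> r" and e: "e \<in> G m"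
  obtains i where "i < m" "e \<in> G (Suc i) - G i"
proof -
  have "\<exists>i<m. e \<in> G (Suc i) - G i" using m e
  proof (induction m)
    case 0 then show ?case using adaptedD(1)[OF G] by simp
  next
    case (Suc m)
    then show ?case by (cases "e \<in> G m") (auto intro: less_SucI)
  qed
  then show ?thesis using that by blast
qed

text \<open>It suffices to prescribe an operator on an adapted basis: if each basis vector of the \<open>i\<close>-th step
  is an eigenvector for \<open>\<alpha>\<^sub>i\<close>, the operator acts as \<open>\<alpha>\<^sub>i\<close> on the \<open>i\<close>-th factor of the chain.\<close>

lemma operator_on_chain:
  assumes G: "adapted r A \<nu> G" and A: "chain r a A" and X: "lin X"
    and Xe: "\<And>i e. i < r \<Longrightarrow> e \<in> G (Suc i) - G i \<Longrightarrow> X e = \<alpha> i *s e"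
    and i: "i < r" and v: "v \<in> A (Suc i)"
  shows "X v - \<alpha> i *s v \<in> A i"
proof -
  have Ai: "subspace (A i)" using chainD(2)[OF A] i by simp
  have l: "lin (\<lambda>v. X v - \<alpha> i *s v)" by (intro lin_minus X lin_smult lin_ident)
  have "X e - \<alpha> i *s e \<in> A i" if e: "e \<in> G (Suc i)" for e
  proof (cases "e \<in> G i")
    case True
    obtain k where k: "k < i" "e \<in> G (Suc k) - G k" by (rule adapted_block_of[OF G _ True]) (use i in auto)
    have "e \<in> A i" using adaptedD(3)[OF G, of i] i True span_base by auto
    moreover have "X e - \<alpha> i *s e = (\<alpha> k - \<alpha> i) *s e" using Xe[OF _ k(2)] k(1) i by (simp add: scale_left_diff_distrib)
    ultimately show ?thesis using subspace_scale[OF Ai] by simp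
  next
    case False
    then show ?thesis using Xe[OF i] e subspace_0[OF Ai] by simp
  qed
  then have "G (Suc i) \<subseteq> {v \<in> UNIV. X v - \<alpha> i *s v \<in> A i}" by blast
  then have "span (G (Suc i)) \<subseteq> {v \<in> UNIV. X v - \<alpha> i *s v \<in> A i}"
    by (rule span_minimal[OF _ lin_subspace_preimage[OF l subspace_UNIV Ai]])
  then show ?thesis using v adaptedD(3)[OF G, of "Suc i"] i by auto
qed

lemma adapted_sum:
  assumes G: "adapted r A \<nu> G" and A: "chain r a A"
  shows "(\<Sum>e\<in>G r. block_value r G \<alpha> e) = (\<Sum>i<r. \<alpha> i * of_nat (a i))"
proof -
  have "(\<Sum>e\<in>G m. block_value r G \<alpha> e) = (\<Sum>i<m. \<alpha> i * of_nat (a i))" if "m \<le> r" for m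
    using that
  proof (induction m)
    case 0 then show ?case by (simp add: adaptedD(1)[OF G])
  next
    case (Suc m)
    then have m: "m < r" by simp
    have "(\<Sum>e\<in>G (Suc m). block_value r G \<alpha> e) = (\<Sum>e\<in>G (Suc m) - G m. block_value r G \<alpha> e) + (\<Sum>e\<in>G m. block_value r G \<alpha> e)"
      by (rule sum.subset_diff[OF adaptedD(4)[OF G m] adapted_card(1)[OF G A m]])
    also have "(\<Sum>e\<in>G (Suc m) - G m. block_value r G \<alpha> e) = (\<Sum>e\<in>G (Suc m) - G m. \<alpha> m)"
      by (rule sum.cong[OF refl]) (rule block_value[OF G m])
    also have "\<dots> = \<alpha> m * of_nat (a m)" using adapted_card(2)[OF G A m] by (simp add: mult.commute)
    finally show ?case using Suc by simp
  qed
  then show ?thesis by simp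
qed

lemma representation_avoids:
  assumes "independent G" "x \<in> span (G - {e})" shows "representation G x e = 0"
  using representation_extend[OF assms(1,2) Diff_subset] representation_ne_zero[of "G - {e}" x e] by auto

lemma representation_functional:
  assumes "independent G" "span G = UNIV" shows "functional (\<lambda>x. representation G x e)"
proof -
  interpret vector_space_pair scale "(*) :: 'a \<Rightarrow> 'a \<Rightarrow> 'a"
    by unfold_locales (simp_all add: algebra_simps)
  show ?thesis
    by (simp add: Vector_Spaces.linear_iff vector_space_axioms vs2.vector_space_axioms
        representation_add[OF assms(1)] representation_scale[OF assms(1)] assms(2))
qed

lemma indep_union:
  assumes "independent G" "independent H" "span G \<inter> span H = {0}"
  shows "independent (G \<union> H)" "G \<inter> H = {}"
proof -
  have f: "finite G" "finite H" using assms finiteI_independent by auto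
  have z: "0 \<notin> G" using assms(1) dependent_zero by blast
  show d: "G \<inter> H = {}"
  proof (rule ccontr)
    assume "G \<inter> H \<noteq> {}"
    then obtain e where "e \<in> G" "e \<in> H" by blast
    then have "e \<in> span G \<inter> span H" using span_base by blast
    then show False using z \<open>e \<in> G\<close> assms(3) by auto
  qed
  have "dim (span (G \<union> H)) = dim (span G) + dim (span H)"
    unfolding span_Un by (rule dim_ssum[OF subspace_span subspace_span assms(3)])
  also have "\<dots> = card (G \<union> H)"
    using card_Un_disjoint[OF f d] by (simp only: dim_span_eq_card_independent[OF assms(1)] dim_span_eq_card_independent[OF assms(2)])
  finally have "card (G \<union> H) = dim (span (G \<union> H))" ..
  from card_eq_dim[OF span_superset this] show "independent (G \<union> H)" using f by simp
qed

lemma basis_extension: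
  assumes "independent G" shows "\<exists>G'. G \<subseteq> G' \<and> independent G' \<and> span G' = UNIV"
proof -
  obtain G' where "G \<subseteq> G'" "G' \<subseteq> UNIV" "independent G'" "UNIV \<subseteq> span G'"
    by (rule maximal_independent_subset_extend[OF subset_UNIV assms])
  then show ?thesis by (intro exI[of _ G']) auto
qed

end

section \<open>Lifting a triple of chains to an operator with prescribed spectra\<close>

context fin_ambient begin

text \<open>The functional \<open>\<psi>\<close> is \<open>X \<mapsto> tr (\<phi> X)\<close>. Its values on operators of rank one determine it and avoid
  the choice of a basis.\<close>

definition represents :: "(('b \<Rightarrow> 'b) \<Rightarrow> 'a) \<Rightarrow> ('b \<Rightarrow> 'b) \<Rightarrow> bool" where
  "represents \<psi> \<phi> \<longleftrightarrow> (\<forall>X Y. \<psi> (\<lambda>v. X v + Y v) = \<psi> X + \<psi> Y) \<and> (\<forall>c X. \<psi> (\<lambda>v. c *s X v) = c * \<psi> X) \<and>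
     (\<forall>\<xi> v. functional \<xi> \<longrightarrow> \<psi> (\<lambda>x. \<xi> x *s v) = \<xi> (\<phi> v))"

lemma representsD:
  assumes "represents \<psi> \<phi>"
  shows "\<psi> (\<lambda>v. X v + Y v) = \<psi> X + \<psi> Y" "\<psi> (\<lambda>v. c *s X v) = c * \<psi> X"
    "functional \<xi> \<Longrightarrow> \<psi> (\<lambda>x. \<xi> x *s v) = \<xi> (\<phi> v)"
proof -
  note 1 = assms[unfolded represents_def]
  show "\<psi> (\<lambda>v. X v + Y v) = \<psi> X + \<psi> Y" using conjunct1[OF 1, rule_format, of X Y] .
  show "\<psi> (\<lambda>v. c *s X v) = c * \<psi> X" using conjunct1[OF conjunct2[OF 1], rule_format, of c X] .
  show "functional \<xi> \<Longrightarrow> \<psi> (\<lambda>x. \<xi> x *s v) = \<xi> (\<phi> v)" using conjunct2[OF conjunct2[OF 1], rule_format, of \<xi> v] .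
qed

lemma represents_sum:
  assumes "represents \<psi> \<phi>" "finite I"
  shows "\<psi> (\<lambda>v. \<Sum>i\<in>I. c i *s X i v) = (\<Sum>i\<in>I. c i * \<psi> (X i))"
  using assms(2)
proof (induction I rule: finite_induct)
  case empty
  show ?case using representsD(2)[OF assms(1), of 0 "\<lambda>v. 0"] by simp
next
  case (insert j I)
  have "\<psi> (\<lambda>v. \<Sum>i\<in>insert j I. c i *s X i v) = \<psi> (\<lambda>v. c j *s X j v + (\<Sum>i\<in>I. c i *s X i v))"
    using insert(1,2) by simp
  also have "\<dots> = \<psi> (\<lambda>v. c j *s X j v) + \<psi> (\<lambda>v. \<Sum>i\<in>I. c i *s X i v)"
    by (rule representsD(1)[OF assms(1)])
  also have "\<dots> = c j * \<psi> (X j) + (\<Sum>i\<in>I. c i * \<psi> (X i))"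
    using insert.IH representsD(2)[OF assms(1)] by (simp only:)
  finally show ?case using insert(1,2) by simp
qed

definition diag :: "'b set \<Rightarrow> ('b \<Rightarrow> 'a) \<Rightarrow> 'b \<Rightarrow> 'b" where
  "diag G val x = (\<Sum>e\<in>G. val e *s (representation G x e *s e))"

lemma diag_lin:
  assumes "independent G" "span G = UNIV" shows "lin (diag G val)"
  unfolding diag_def
proof (intro lin_summation lin_smult)
  fix e
  show "lin (\<lambda>x. representation G x e *s e)"
    using representation_add[OF assms(1)] representation_scale[OF assms(1)] assms(2)
    by (intro linI) (simp_all add: scale_left_distrib)
qed

lemma diag_basis:
  assumes "independent G" "e \<in> G" shows "diag G val e = val e *s e"
proof -
  have "diag G val e = (\<Sum>x\<in>G. if x = e then val e *s e else 0)"
    unfolding diag_def by (rule sum.cong[OF refl]) (simp add: representation_basis[OF assms])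
  then show ?thesis using assms finiteI_independent[OF assms(1)] by simp
qed

lemma diag_represents:
  assumes "represents \<psi> \<phi>" "independent G" "span G = UNIV"
  shows "\<psi> (diag G val) = (\<Sum>e\<in>G. val e * representation G (\<phi> e) e)"
proof -
  have "diag G val = (\<lambda>x. \<Sum>e\<in>G. val e *s (\<lambda>x. representation G x e *s e) x)" unfolding diag_def ..
  then have "\<psi> (diag G val) = (\<Sum>e\<in>G. val e * \<psi> (\<lambda>x. representation G x e *s e))"
    using represents_sum[OF assms(1) finiteI_independent[OF assms(2)], of val "\<lambda>e x. representation G x e *s e"] by (simp only:)
  also have "\<dots> = (\<Sum>e\<in>G. val e * representation G (\<phi> e) e)"
    by (rule sum.cong[OF refl]) (simp only: representsD(3)[OF assms(1) representation_functional[OF assms(2,3)]])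
  finally show ?thesis .
qed

lemma adapted_diagonal_entry:
  assumes G: "adapted r A \<nu> G" and e: "e \<in> G r" and H: "G r \<subseteq> H" "independent H" "span H = UNIV"
    and \<phi>: "\<phi> e = c *s e + \<nu> e"
  shows "representation H (\<phi> e) e = c"
proof -
  obtain i where i: "i < r" "e \<in> G (Suc i) - G i" by (rule adapted_block_of[OF G order_refl e])
  have "G (Suc i) \<subseteq> H" using adapted_mono[OF G, of "Suc i" r] i(1) H(1) by auto
  then have "\<nu> e \<in> span (H - {e})" using adaptedD(5)[OF G i] span_mono[of "G (Suc i) - {e}" "H - {e}"] by blast
  then have "representation H (\<nu> e) e = 0" by (rule representation_avoids[OF H(2)])
  then show ?thesis unfolding \<phi> using e H representation_basis[OF H(2), of e]
    by (simp add: representation_add[OF H(2)] representation_scale[OF H(2)] subset_iff)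
qed

text \<open>In an adapted basis the nilpotent part of \<open>\<phi>\<close> has no diagonal entries. Against an operator that is
  diagonal in this basis, the trace form of \<open>\<phi>\<close> therefore sees only the scalar part.\<close>

lemma diag_one_chain:
  assumes A: "chain r a A" and \<nu>: "lin \<nu>" "stable r A \<nu>" "\<And>v. v \<in> A r \<Longrightarrow> (\<nu> ^^ N) v = 0"
  shows "\<exists>X. lin X \<and> (\<forall>i<r. \<forall>v\<in>A (Suc i). X v - \<alpha> i *s v \<in> A i) \<and>
    (\<forall>\<psi> \<phi> c. represents \<psi> \<phi> \<longrightarrow> (\<forall>v\<in>A r. \<phi> v = c *s v + \<nu> v) \<longrightarrow> \<psi> X = c * (\<Sum>i<r. \<alpha> i * of_nat (a i)))"
proof -
  obtain G where G: "adapted r A \<nu> G" using adapted_exists[OF A \<nu>] by blast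
  obtain H where H: "G r \<subseteq> H" "independent H" "span H = UNIV" using basis_extension[OF adaptedD(2)[OF G order_refl]] by blast
  define X where "X = diag H (block_value r G \<alpha>)"
  have X: "lin X" unfolding X_def by (rule diag_lin[OF H(2,3)])
  have Xe: "X e = \<alpha> i *s e" if "i < r" "e \<in> G (Suc i) - G i" for i e
  proof -
    have "e \<in> H" using adapted_mono[OF G, of "Suc i" r] that H(1) by auto
    then show ?thesis unfolding X_def using diag_basis[OF H(2)] block_value[OF G that] by simp
  qed
  have "X v - \<alpha> i *s v \<in> A i" if "i < r" "v \<in> A (Suc i)" for i v
    by (rule operator_on_chain[OF G A X Xe that])
  moreover have "\<psi> X = c * (\<Sum>i<r. \<alpha> i * of_nat (a i))"
    if \<psi>: "represents \<psi> \<phi>" and \<phi>: "\<forall>v\<in>A r. \<phi> v = c *s v + \<nu> v" for \<psi> \<phi> c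
  proof -
    have "\<psi> X = (\<Sum>e\<in>H. block_value r G \<alpha> e * representation H (\<phi> e) e)"
      unfolding X_def by (rule diag_represents[OF \<psi> H(2,3)])
    also have "\<dots> = (\<Sum>e\<in>G r. block_value r G \<alpha> e * representation H (\<phi> e) e)"
      by (rule sum.mono_neutral_right[OF finiteI_independent[OF H(2)] H(1)]) (simp add: block_value_def)
    also have "\<dots> = (\<Sum>e\<in>G r. c * block_value r G \<alpha> e)"
    proof (rule sum.cong[OF refl])
      fix e assume e: "e \<in> G r"
      have "e \<in> A r" using adaptedD(3)[OF G order_refl] span_base[OF e] by simp
      then have "representation H (\<phi> e) e = c" using adapted_diagonal_entry[OF G e H, of \<phi> c] \<phi> by simp
      then show "block_value r G \<alpha> e * representation H (\<phi> e) e = c * block_value r G \<alpha> e" by simp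
    qed
    finally show ?thesis using adapted_sum[OF G A, of \<alpha>] by (simp add: sum_distrib_left[symmetric])
  qed
  ultimately show ?thesis using X by (intro exI[of _ X]) simp
qed

lemma diag_two_chains:
  assumes B: "chain p b B" and C: "chain q c C" and BC: "B p \<inter> C q = {0}"
    and \<nu>: "lin \<nu>" "stable p B \<nu>" "\<And>v. v \<in> B p \<Longrightarrow> (\<nu> ^^ N) v = 0" "stable q C \<nu>" "\<And>v. v \<in> C q \<Longrightarrow> (\<nu> ^^ N) v = 0"
  shows "\<exists>X. lin X \<and> (\<forall>k<p. \<forall>v\<in>B (Suc k). X v - \<beta> k *s v \<in> B k) \<and> (\<forall>l<q. \<forall>v\<in>C (Suc l). X v - \<gamma> l *s v \<in> C l) \<and>
    (\<forall>\<psi> \<phi> t. represents \<psi> \<phi> \<longrightarrow> (\<forall>v\<in>B p. \<phi> v = t *s v + \<nu> v) \<longrightarrow> (\<forall>v\<in>C q. \<phi> v = t *s v + \<nu> v) \<longrightarrow>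
      \<psi> X = t * ((\<Sum>k<p. \<beta> k * of_nat (b k)) + (\<Sum>l<q. \<gamma> l * of_nat (c l))))"
proof -
  obtain G where G: "adapted p B \<nu> G" using adapted_exists[OF B \<nu>(1-3)] by blast
  obtain K where K: "adapted q C \<nu> K" using adapted_exists[OF C \<nu>(1,4,5)] by blast
  note Gi = adaptedD(2,3)[OF G order_refl] and Ki = adaptedD(2,3)[OF K order_refl]
  have sp: "span (G p) \<inter> span (K q) = {0}" using BC Gi(2) Ki(2) by simp
  note ind = indep_union[OF Gi(1) Ki(1) sp]
  obtain H where H: "G p \<union> K q \<subseteq> H" "independent H" "span H = UNIV" using basis_extension[OF ind(1)] by blast
  have HG: "G p \<subseteq> H" and HK: "K q \<subseteq> H" using H(1) by blast+
  define val where "val e = block_value p G \<beta> e + block_value q K \<gamma> e" for e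
  have valG: "val e = block_value p G \<beta> e" if "e \<in> G p" for e
    using that ind(2) unfolding val_def block_value_def[of q] by auto
  have valK: "val e = block_value q K \<gamma> e" if "e \<in> K q" for e
    using that ind(2) unfolding val_def block_value_def[of p] by auto
  define X where "X = diag H val"
  have X: "lin X" unfolding X_def by (rule diag_lin[OF H(2,3)])
  have XG: "X e = \<beta> i *s e" if "i < p" "e \<in> G (Suc i) - G i" for i e
  proof -
    have "e \<in> G p" using adapted_mono[OF G, of "Suc i" p] that by auto
    moreover from this have "e \<in> H" using HG by blast
    ultimately show ?thesis unfolding X_def using diag_basis[OF H(2)] block_value[OF G that] valG by simp
  qed
  have XK: "X e = \<gamma> i *s e" if "i < q" "e \<in> K (Suc i) - K i" for i e
  proof -
    have "e \<in> K q" using adapted_mono[OF K, of "Suc i" q] that by auto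
    moreover from this have "e \<in> H" using HK by blast
    ultimately show ?thesis unfolding X_def using diag_basis[OF H(2)] block_value[OF K that] valK by simp
  qed
  have 1: "X v - \<beta> i *s v \<in> B i" if "i < p" "v \<in> B (Suc i)" for i v
    by (rule operator_on_chain[OF G B X XG that])
  have 2: "X v - \<gamma> i *s v \<in> C i" if "i < q" "v \<in> C (Suc i)" for i v
    by (rule operator_on_chain[OF K C X XK that])
  have 3: "\<psi> X = t * ((\<Sum>k<p. \<beta> k * of_nat (b k)) + (\<Sum>l<q. \<gamma> l * of_nat (c l)))"
    if \<psi>: "represents \<psi> \<phi>" and \<phi>: "\<forall>v\<in>B p. \<phi> v = t *s v + \<nu> v" "\<forall>v\<in>C q. \<phi> v = t *s v + \<nu> v" for \<psi> \<phi> t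
  proof -
    have fin: "finite (G p)" "finite (K q)" using Gi(1) Ki(1) finiteI_independent by auto
    have rG: "representation H (\<phi> e) e = t" if e: "e \<in> G p" for e
    proof -
      have "e \<in> B p" using Gi(2) span_base[OF e] by simp
      then show ?thesis using adapted_diagonal_entry[OF G e HG H(2,3), of \<phi> t] \<phi>(1) by simp
    qed
    have rK: "representation H (\<phi> e) e = t" if e: "e \<in> K q" for e
    proof -
      have "e \<in> C q" using Ki(2) span_base[OF e] by simp
      then show ?thesis using adapted_diagonal_entry[OF K e HK H(2,3), of \<phi> t] \<phi>(2) by simp
    qed
    have "\<psi> X = (\<Sum>e\<in>H. val e * representation H (\<phi> e) e)"
      unfolding X_def by (rule diag_represents[OF \<psi> H(2,3)])
    also have "\<dots> = (\<Sum>e\<in>G p \<union> K q. val e * representation H (\<phi> e) e)"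
      by (rule sum.mono_neutral_right[OF finiteI_independent[OF H(2)] H(1)]) (simp add: val_def block_value_def)
    also have "\<dots> = (\<Sum>e\<in>G p. val e * representation H (\<phi> e) e) + (\<Sum>e\<in>K q. val e * representation H (\<phi> e) e)"
      by (rule sum.union_disjoint[OF fin ind(2)])
    also have "(\<Sum>e\<in>G p. val e * representation H (\<phi> e) e) = (\<Sum>e\<in>G p. t * block_value p G \<beta> e)"
      by (rule sum.cong[OF refl]) (simp add: rG valG)
    also have "(\<Sum>e\<in>K q. val e * representation H (\<phi> e) e) = (\<Sum>e\<in>K q. t * block_value q K \<gamma> e)"
      by (rule sum.cong[OF refl]) (simp add: rK valK)
    finally show ?thesis using adapted_sum[OF G B, of \<beta>] adapted_sum[OF K C, of \<gamma>]
      by (simp add: sum_distrib_left[symmetric] distrib_left)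
  qed
  show ?thesis using X 1 2 3 by (intro exI[of _ X]) simp
qed

text \<open>The obstruction to the existence of \<open>X\<close> is a linear functional on operators, that is, the trace
  form of an endomorphism of the triple; on a scalar plus nilpotent endomorphism it is the scalar times
  the difference of the weighted dimensions.\<close>

lemma lifting:
  assumes A: "chain r a A" and B: "chain p b B" and C: "chain q c C" and BC: "B p \<inter> C q = {0}"
    and ABC: "A r = ssum (B p) (C q)"
    and loc: "\<And>\<phi>. lin \<phi> \<Longrightarrow> stable r A \<phi> \<Longrightarrow> stable p B \<phi> \<Longrightarrow> stable q C \<phi> \<Longrightarrow> \<exists>t N. \<forall>v\<in>A r. ((\<lambda>x. \<phi> x - t *s x) ^^ N) v = 0"
    and wt: "(\<Sum>i<r. \<alpha> i * of_nat (a i)) = (\<Sum>k<p. \<beta> k * of_nat (b k)) + (\<Sum>l<q. \<gamma> l * of_nat (c l))"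
  shows "\<exists>X. lin X \<and> (\<forall>i<r. \<forall>v\<in>A (Suc i). X v - \<alpha> i *s v \<in> A i) \<and>
    (\<forall>k<p. \<forall>v\<in>B (Suc k). X v - \<beta> k *s v \<in> ssum (B k) (C q)) \<and> (\<forall>l<q. \<forall>v\<in>C (Suc l). X v - \<gamma> l *s v \<in> ssum (C l) (B p))"
proof -
  define sc where "sc = (\<lambda>c (f :: 'b \<Rightarrow> 'b) v. c *s f v)"
  have vs: "vector_space sc"
    unfolding sc_def by unfold_locales (simp_all add: fun_eq_iff scale_right_distrib scale_left_distrib)
  then interpret fs: ambient sc unfolding ambient_def .
  have sA: "subspace (A i)" if "i \<le> r" for i by (rule chainD(2)[OF A that])
  have sB: "subspace (B i)" if "i \<le> p" for i by (rule chainD(2)[OF B that])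
  have sC: "subspace (C i)" if "i \<le> q" for i by (rule chainD(2)[OF C that])
  have BA: "B p \<subseteq> A r" "C q \<subseteq> A r"
  proof -
    have "x + 0 \<in> A r" if "x \<in> B p" for x unfolding ABC using that subspace_0[OF sC[OF order_refl]] by blast
    then show "B p \<subseteq> A r" by auto
    have "0 + x \<in> A r" if "x \<in> C q" for x unfolding ABC using that subspace_0[OF sB[OF order_refl]] by blast
    then show "C q \<subseteq> A r" by auto
  qed
  have sBC: "subspace (ssum (B k) (C q))" if "k \<le> p" for k by (rule subspace_sums[OF sB[OF that] sC[OF order_refl]])
  have sCB: "subspace (ssum (C l) (B p))" if "l \<le> q" for l by (rule subspace_sums[OF sC[OF that] sB[OF order_refl]])
  have inBC: "x \<in> ssum (B k) (C q)" if "x \<in> B k \<or> x \<in> C q" "k \<le> p" for x k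
  proof -
    have "x + 0 \<in> ssum (B k) (C q) \<or> 0 + x \<in> ssum (B k) (C q)"
      using that(1) subspace_0[OF sB[OF that(2)]] subspace_0[OF sC[OF order_refl]] by blast
    then show ?thesis by simp
  qed
  have inCB: "x \<in> ssum (C l) (B p)" if "x \<in> C l \<or> x \<in> B p" "l \<le> q" for x l
  proof -
    have "x + 0 \<in> ssum (C l) (B p) \<or> 0 + x \<in> ssum (C l) (B p)"
      using that(1) subspace_0[OF sC[OF that(2)]] subspace_0[OF sB[OF order_refl]] by blast
    then show ?thesis by simp
  qed
  define opA where "opA = {X. lin X \<and> (\<forall>i<r. \<forall>v\<in>A (Suc i). X v \<in> A i)}"
  define opBC where "opBC = {X. lin X \<and> (\<forall>k<p. \<forall>v\<in>B (Suc k). X v \<in> ssum (B k) (C q)) \<and> (\<forall>l<q. \<forall>v\<in>C (Suc l). X v \<in> ssum (C l) (B p))}"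
  have suA: "fs.subspace opA"
  proof (rule fs.subspaceI)
    have "(\<lambda>v. 0) \<in> opA"
      unfolding opA_def
    proof (rule CollectI, intro conjI allI impI ballI lin_zero)
      show "0 \<in> A i" if "i < r" for i using subspace_0[OF sA, of i] that by simp
    qed
    then show "0 \<in> opA" unfolding zero_fun_def .
    show "X + Y \<in> opA" if X: "X \<in> opA" and Y: "Y \<in> opA" for X Y
      unfolding opA_def plus_fun_def
    proof (rule CollectI, intro conjI allI impI ballI)
      show "lin (\<lambda>x. X x + Y x)" using X Y unfolding opA_def by (intro lin_plus) simp_all
      show "X v + Y v \<in> A k" if "k < r" "v \<in> A (Suc k)" for k v
        by (rule subspace_add[OF sA]) (use X Y that in \<open>unfold opA_def, simp_all\<close>)
    qed
    show "sc t X \<in> opA" if X: "X \<in> opA" for t X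
      unfolding opA_def sc_def
    proof (rule CollectI, intro conjI allI impI ballI)
      show "lin (\<lambda>v. t *s X v)" using X unfolding opA_def by (intro lin_smult) simp
      show "t *s X v \<in> A k" if "k < r" "v \<in> A (Suc k)" for k v
        by (rule subspace_scale[OF sA]) (use X that in \<open>unfold opA_def, simp_all\<close>)
    qed
  qed
  have opBC1: "lin X" if "X \<in> opBC" for X
    by (rule conjunct1[OF CollectD[OF that[unfolded opBC_def]]])
  have opBC2: "X v \<in> ssum (B k) (C q)" if "X \<in> opBC" "k < p" "v \<in> B (Suc k)" for X k v
    by (rule conjunct1[OF conjunct2[OF CollectD[OF that(1)[unfolded opBC_def]]], rule_format, OF that(2,3)])
  have opBC3: "X v \<in> ssum (C l) (B p)" if "X \<in> opBC" "l < q" "v \<in> C (Suc l)" for X l v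
    by (rule conjunct2[OF conjunct2[OF CollectD[OF that(1)[unfolded opBC_def]]], rule_format, OF that(2,3)])
  have suBC: "fs.subspace opBC"
  proof (rule fs.subspaceI)
    have "(\<lambda>v. 0) \<in> opBC"
      unfolding opBC_def
    proof (rule CollectI, intro conjI allI impI ballI lin_zero)
      show "0 \<in> ssum (B k) (C q)" if "k < p" for k using subspace_0[OF sBC, of k] that by (simp only: less_imp_le)
      show "0 \<in> ssum (C l) (B p)" if "l < q" for l using subspace_0[OF sCB, of l] that by (simp only: less_imp_le)
    qed
    then show "0 \<in> opBC" unfolding zero_fun_def .
    show "X + Y \<in> opBC" if X: "X \<in> opBC" and Y: "Y \<in> opBC" for X Y
      unfolding opBC_def plus_fun_def
    proof (rule CollectI, intro conjI allI impI ballI)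
      show "lin (\<lambda>x. X x + Y x)" by (rule lin_plus[OF opBC1[OF X] opBC1[OF Y]])
      show "X v + Y v \<in> ssum (B k) (C q)" if "k < p" "v \<in> B (Suc k)" for k v
        by (rule subspace_add[OF sBC[OF less_imp_le[OF that(1)]] opBC2[OF X that] opBC2[OF Y that]])
      show "X v + Y v \<in> ssum (C l) (B p)" if "l < q" "v \<in> C (Suc l)" for l v
        by (rule subspace_add[OF sCB[OF less_imp_le[OF that(1)]] opBC3[OF X that] opBC3[OF Y that]])
    qed
    show "sc t X \<in> opBC" if X: "X \<in> opBC" for t X
      unfolding opBC_def sc_def
    proof (rule CollectI, intro conjI allI impI ballI)
      show "lin (\<lambda>v. t *s X v)" by (rule lin_smult[OF opBC1[OF X]])
      show "t *s X v \<in> ssum (B k) (C q)" if "k < p" "v \<in> B (Suc k)" for k v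
        by (rule subspace_scale[OF sBC[OF less_imp_le[OF that(1)]] opBC2[OF X that]])
      show "t *s X v \<in> ssum (C l) (B p)" if "l < q" "v \<in> C (Suc l)" for l v
        by (rule subspace_scale[OF sCB[OF less_imp_le[OF that(1)]] opBC3[OF X that]])
    qed
  qed
  have st0: "stable m D (\<lambda>x. 0)" if "\<And>i. i \<le> m \<Longrightarrow> subspace (D i)" for m D
    using that subspace_0 unfolding stable_def by blast
  have nil0: "((\<lambda>x. 0 :: 'b) ^^ 1) v = 0" for v :: 'b by simp
  obtain XA where XA: "lin XA" "\<forall>i<r. \<forall>v\<in>A (Suc i). XA v - \<alpha> i *s v \<in> A i"
    using diag_one_chain[OF A lin_zero st0[OF sA] nil0] by blast
  obtain XB where XB: "lin XB" "\<forall>k<p. \<forall>v\<in>B (Suc k). XB v - \<beta> k *s v \<in> B k" "\<forall>l<q. \<forall>v\<in>C (Suc l). XB v - \<gamma> l *s v \<in> C l"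
    using diag_two_chains[OF B C BC lin_zero st0[OF sB] nil0 st0[OF sC] nil0] by blast
  have diffA: "(\<lambda>v. X v - X' v) \<in> opA" if "lin X" "\<forall>i<r. \<forall>v\<in>A (Suc i). X v - \<alpha> i *s v \<in> A i" "lin X'" "\<forall>i<r. \<forall>v\<in>A (Suc i). X' v - \<alpha> i *s v \<in> A i" for X X'
    unfolding opA_def
  proof (rule CollectI, intro conjI allI impI ballI)
    show "lin (\<lambda>v. X v - X' v)" by (rule lin_minus[OF that(1,3)])
    fix i v assume iv: "i < r" "v \<in> A (Suc i)"
    have "(X v - \<alpha> i *s v) - (X' v - \<alpha> i *s v) \<in> A i"
      by (rule subspace_diff[OF sA]) (use iv that in auto)
    then show "X v - X' v \<in> A i" by simp
  qed
  have "(\<lambda>v. XA v - XB v) \<in> fs.ssum opA opBC"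
  proof (rule ccontr)
    assume not: "(\<lambda>v. XA v - XB v) \<notin> fs.ssum opA opBC"
    obtain \<psi> where \<psi>: "fs.functional \<psi>" "\<forall>X\<in>fs.ssum opA opBC. \<psi> X = 0" "\<psi> (\<lambda>v. XA v - XB v) = 1"
      using fs.separating_functional[OF fs.subspace_sums[OF suA suBC] not] by blast
    have \<psi>add: "\<psi> (\<lambda>v. X v + Y v) = \<psi> X + \<psi> Y" for X Y
      using \<psi>(1) unfolding Vector_Spaces.linear_iff plus_fun_def by simp
    have \<psi>sc: "\<psi> (\<lambda>v. t *s X v) = t * \<psi> X" for t X
      using \<psi>(1) unfolding Vector_Spaces.linear_iff sc_def by simp
    have \<psi>diff: "\<psi> (\<lambda>v. X v - Y v) = \<psi> X - \<psi> Y" for X Y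
      using \<psi>add[of "\<lambda>v. X v - Y v" Y] by simp
    have \<psi>A: "\<psi> X = 0" if "X \<in> opA" for X
    proof -
      have "X + 0 \<in> fs.ssum opA opBC" using that fs.subspace_0[OF suBC] by blast
      then show ?thesis using \<psi>(2) by simp
    qed
    have \<psi>B: "\<psi> X = 0" if "X \<in> opBC" for X
    proof -
      have "0 + X \<in> fs.ssum opA opBC" using that fs.subspace_0[OF suA] by blast
      then show ?thesis using \<psi>(2) by simp
    qed
    define cf where "cf e x = representation Basis x e" for e x
    have cf: "functional (cf e)" for e
      unfolding cf_def by (rule representation_functional[OF independent_Basis span_Basis])
    define \<phi> where "\<phi> v = (\<Sum>e\<in>Basis. \<psi> (\<lambda>x. cf e x *s v) *s e)" for v
    have \<phi>l: "lin \<phi>"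
    proof (rule linI)
      fix v w t
      have "\<psi> (\<lambda>x. cf e x *s (v + w)) = \<psi> (\<lambda>x. cf e x *s v) + \<psi> (\<lambda>x. cf e x *s w)" for e
        unfolding scale_right_distrib by (rule \<psi>add)
      then show "\<phi> (v + w) = \<phi> v + \<phi> w" unfolding \<phi>_def by (simp add: scale_left_distrib sum.distrib)
      have "\<psi> (\<lambda>x. cf e x *s (t *s v)) = t * \<psi> (\<lambda>x. cf e x *s v)" for e
        unfolding scale_left_commute[of _ t] by (rule \<psi>sc)
      then show "\<phi> (t *s v) = t *s \<phi> v" unfolding \<phi>_def by (simp add: scale_sum_right)
    qed
    have rank1: "\<psi> (\<lambda>x. \<xi> x *s v) = \<xi> (\<phi> v)" if \<xi>: "functional \<xi>" for \<xi> v
    proof -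
      have add: "\<xi> (x + y) = \<xi> x + \<xi> y" and scl: "\<xi> (t *s x) = t * \<xi> x" for x y t
        using \<xi> unfolding Vector_Spaces.linear_iff by simp_all
      have sm: "\<xi> (\<Sum>e\<in>I. g e) = (\<Sum>e\<in>I. \<xi> (g e))" if "finite I" for I :: "'b set" and g
        using that by (induction I rule: finite_induct) (use scl[of 0 0] add in simp_all)
      have ex: "\<xi> x = (\<Sum>e\<in>Basis. \<xi> e * cf e x)" for x
      proof -
        have "x = (\<Sum>e\<in>Basis. cf e x *s e)"
          unfolding cf_def using sum_representation_eq[OF independent_Basis _ finite_Basis order_refl, of x] span_Basis by simp
        then have "\<xi> x = \<xi> (\<Sum>e\<in>Basis. cf e x *s e)" by simp
        then show ?thesis unfolding sm[OF finite_Basis] scl by (simp add: mult.commute)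
      qed
      have "(\<lambda>x. \<xi> x *s v) = (\<lambda>x. \<Sum>e\<in>Basis. \<xi> e *s (cf e x *s v))"
        by (rule ext) (subst ex, simp add: scale_sum_left)
      moreover have "\<psi> (\<lambda>x. \<Sum>e\<in>I. \<xi> e *s (cf e x *s v)) = (\<Sum>e\<in>I. \<xi> e * \<psi> (\<lambda>x. cf e x *s v))" if "finite I" for I
        using that
      proof (induction I rule: finite_induct)
        case empty
        have "\<psi> (\<lambda>x. 0 *s 0) = 0 * \<psi> (\<lambda>x. 0)" by (rule \<psi>sc)
        then show ?case by simp
      next
        case (insert e I)
        then show ?case using \<psi>add[of "\<lambda>x. \<xi> e *s (cf e x *s v)" "\<lambda>x. \<Sum>e\<in>I. \<xi> e *s (cf e x *s v)"] \<psi>sc[of "\<xi> e" "\<lambda>x. cf e x *s v"] by simp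
      qed
      ultimately have "\<psi> (\<lambda>x. \<xi> x *s v) = (\<Sum>e\<in>Basis. \<xi> e * \<psi> (\<lambda>x. cf e x *s v))" using finite_Basis by simp
      then show ?thesis unfolding \<phi>_def sm[OF finite_Basis] scl by (simp add: mult.commute)
    qed
    have rep: "represents \<psi> \<phi>" unfolding represents_def using \<psi>add \<psi>sc rank1 by simp
    have linr1: "lin (\<lambda>x. \<xi> x *s v)" if "functional \<xi>" for \<xi> v
      using that unfolding Vector_Spaces.linear_iff[of scale "(*)"] by (intro linI) (simp_all add: scale_left_distrib)
    have stA: "stable r A \<phi>"
      unfolding stable_def
    proof (intro allI impI ballI, rule ccontr)
      fix i v assume i: "i \<le> r" and v: "v \<in> A i" and n: "\<phi> v \<notin> A i"
      obtain \<xi> where \<xi>: "functional \<xi>" "\<forall>x\<in>A i. \<xi> x = 0" "\<xi> (\<phi> v) = 1" using separating_functional[OF sA[OF i] n] by blast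
      have "(\<lambda>x. \<xi> x *s v) \<in> opA"
        unfolding opA_def
      proof (rule CollectI, intro conjI allI impI ballI linr1[OF \<xi>(1)])
        fix m x assume m: "m < r" and x: "x \<in> A (Suc m)"
        show "\<xi> x *s v \<in> A m"
        proof (cases "Suc m \<le> i")
          case True
          then have "\<xi> x = 0" using chain_mono[OF A True i] x \<xi>(2) by blast
          then show ?thesis using subspace_0[OF sA, of m] m by simp
        next
          case False
          then have "v \<in> A m" using chain_mono[OF A, of i m] m v by auto
          then show ?thesis using subspace_scale[OF sA] m by simp
        qed
      qed
      then show False using \<psi>A rank1[OF \<xi>(1), of v] \<xi>(3) by simp
    qed
    have stB: "stable p B \<phi>"
      unfolding stable_def
    proof (intro allI impI ballI, rule ccontr)
      fix i v assume i: "i \<le> p" and v: "v \<in> B i" and n: "\<phi> v \<notin> B i"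
      obtain \<xi> where \<xi>: "functional \<xi>" "\<forall>x\<in>B i. \<xi> x = 0" "\<xi> (\<phi> v) = 1" using separating_functional[OF sB[OF i] n] by blast
      have vp: "v \<in> B p" using chain_mono[OF B i order_refl] v by blast
      have "(\<lambda>x. \<xi> x *s v) \<in> opBC"
        unfolding opBC_def
      proof (rule CollectI, intro conjI allI impI ballI linr1[OF \<xi>(1)])
        fix m x assume m: "m < p" and x: "x \<in> B (Suc m)"
        have "\<xi> x *s v \<in> B m"
        proof (cases "Suc m \<le> i")
          case True
          then have "\<xi> x = 0" using chain_mono[OF B True i] x \<xi>(2) by blast
          then show ?thesis using subspace_0[OF sB, of m] m by simp
        next
          case False
          then have "v \<in> B m" using chain_mono[OF B, of i m] m v by auto
          then show ?thesis using subspace_scale[OF sB] m by simp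
        qed
        then show "\<xi> x *s v \<in> ssum (B m) (C q)" using inBC m by simp
      next
        fix m x assume m: "m < q"
        show "\<xi> x *s v \<in> ssum (C m) (B p)" by (rule inCB) (use subspace_scale[OF sB vp] m in simp_all)
      qed
      then show False using \<psi>B rank1[OF \<xi>(1), of v] \<xi>(3) by simp
    qed
    have stC: "stable q C \<phi>"
      unfolding stable_def
    proof (intro allI impI ballI, rule ccontr)
      fix i v assume i: "i \<le> q" and v: "v \<in> C i" and n: "\<phi> v \<notin> C i"
      obtain \<xi> where \<xi>: "functional \<xi>" "\<forall>x\<in>C i. \<xi> x = 0" "\<xi> (\<phi> v) = 1" using separating_functional[OF sC[OF i] n] by blast
      have vp: "v \<in> C q" using chain_mono[OF C i order_refl] v by blast
      have "(\<lambda>x. \<xi> x *s v) \<in> opBC"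
        unfolding opBC_def
      proof (rule CollectI, intro conjI allI impI ballI linr1[OF \<xi>(1)])
        fix m x assume m: "m < q" and x: "x \<in> C (Suc m)"
        have "\<xi> x *s v \<in> C m"
        proof (cases "Suc m \<le> i")
          case True
          then have "\<xi> x = 0" using chain_mono[OF C True i] x \<xi>(2) by blast
          then show ?thesis using subspace_0[OF sC, of m] m by simp
        next
          case False
          then have "v \<in> C m" using chain_mono[OF C, of i m] m v by auto
          then show ?thesis using subspace_scale[OF sC] m by simp
        qed
        then show "\<xi> x *s v \<in> ssum (C m) (B p)" using inCB m by simp
      next
        fix m x assume m: "m < p"
        show "\<xi> x *s v \<in> ssum (B m) (C q)" by (rule inBC) (use subspace_scale[OF sC vp] m in simp_all)
      qed
      then show False using \<psi>B rank1[OF \<xi>(1), of v] \<xi>(3) by simp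
    qed
    obtain t N where nil: "\<forall>v\<in>A r. ((\<lambda>x. \<phi> x - t *s x) ^^ N) v = 0" using loc[OF \<phi>l stA stB stC] by (elim exE)
    define \<nu> where "\<nu> x = \<phi> x - t *s x" for x
    have \<nu>l: "lin \<nu>" unfolding \<nu>_def by (intro lin_minus \<phi>l lin_smult lin_ident)
    have st\<nu>: "stable m D \<nu>" if "stable m D \<phi>" "\<And>i. i \<le> m \<Longrightarrow> subspace (D i)" for m D
      using that unfolding stable_def \<nu>_def by (auto intro!: subspace_diff subspace_scale)
    have nil': "(\<nu> ^^ N) v = 0" if "v \<in> A r" for v
      using nil that unfolding \<nu>_def by blast
    have \<phi>\<nu>: "\<phi> v = t *s v + \<nu> v" for v unfolding \<nu>_def by simp
    obtain X1 where X1: "lin X1" "\<forall>i<r. \<forall>v\<in>A (Suc i). X1 v - \<alpha> i *s v \<in> A i"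
      "\<psi> X1 = t * (\<Sum>i<r. \<alpha> i * of_nat (a i))"
      using diag_one_chain[OF A \<nu>l st\<nu>[OF stA sA] nil', of \<alpha>] rep \<phi>\<nu> by blast
    have nB: "(\<nu> ^^ N) v = 0" if "v \<in> B p" for v using nil' BA(1) that by blast
    have nC: "(\<nu> ^^ N) v = 0" if "v \<in> C q" for v using nil' BA(2) that by blast
    obtain X2 where X2: "lin X2" "\<forall>k<p. \<forall>v\<in>B (Suc k). X2 v - \<beta> k *s v \<in> B k" "\<forall>l<q. \<forall>v\<in>C (Suc l). X2 v - \<gamma> l *s v \<in> C l"
      "\<psi> X2 = t * ((\<Sum>k<p. \<beta> k * of_nat (b k)) + (\<Sum>l<q. \<gamma> l * of_nat (c l)))"
      using diag_two_chains[OF B C BC \<nu>l st\<nu>[OF stB sB] nB st\<nu>[OF stC sC] nC, of \<beta> \<gamma>] rep \<phi>\<nu> by blast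
    have "\<psi> XA = \<psi> X1" using \<psi>A[OF diffA[OF XA X1(1,2)]] \<psi>diff[of XA X1] by simp
    moreover have "(\<lambda>v. XB v - X2 v) \<in> opBC"
      unfolding opBC_def
    proof (rule CollectI, intro conjI allI impI ballI)
      show "lin (\<lambda>v. XB v - X2 v)" by (rule lin_minus[OF XB(1) X2(1)])
      fix i v assume iv: "i < p" "v \<in> B (Suc i)"
      have "(XB v - \<beta> i *s v) - (X2 v - \<beta> i *s v) \<in> B i"
        by (rule subspace_diff[OF sB]) (use iv XB X2 in auto)
      then show "XB v - X2 v \<in> ssum (B i) (C q)" using inBC iv by simp
    next
      fix i v assume iv: "i < q" "v \<in> C (Suc i)"
      have "(XB v - \<gamma> i *s v) - (X2 v - \<gamma> i *s v) \<in> C i"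
        by (rule subspace_diff[OF sC]) (use iv XB X2 in auto)
      then show "XB v - X2 v \<in> ssum (C i) (B p)" using inCB iv by simp
    qed
    then have "\<psi> XB = \<psi> X2" using \<psi>B[of "\<lambda>v. XB v - X2 v"] \<psi>diff[of XB X2] by simp
    ultimately show False using \<psi>(3) \<psi>diff wt X1(3) X2(4) by simp
  qed
  then obtain N1 N2 where N: "N1 \<in> opA" "N2 \<in> opBC" "(\<lambda>v. XA v - XB v) = N1 + N2" by blast
  have eq: "XA v - N1 v = XB v + N2 v" for v
    using fun_cong[OF N(3), of v] by (simp add: plus_fun_def algebra_simps)
  define X where "X v = XA v - N1 v" for v
  have N1: "lin N1" "\<forall>i<r. \<forall>v\<in>A (Suc i). N1 v \<in> A i" using N(1) unfolding opA_def by simp_all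
  show ?thesis
  proof (intro exI[of _ X] conjI allI impI ballI)
    show "lin X" unfolding X_def by (rule lin_minus[OF XA(1) N1(1)])
    fix i v assume iv: "i < r" "v \<in> A (Suc i)"
    have "(XA v - \<alpha> i *s v) - N1 v \<in> A i" by (rule subspace_diff[OF sA]) (use iv XA N1 in auto)
    then show "X v - \<alpha> i *s v \<in> A i" unfolding X_def by (simp add: algebra_simps)
  next
    fix k v assume kv: "k < p" "v \<in> B (Suc k)"
    have "(XB v - \<beta> k *s v) + N2 v \<in> ssum (B k) (C q)"
      by (rule subspace_add[OF sBC[OF less_imp_le[OF kv(1)]] inBC opBC2[OF N(2) kv]]) (use kv XB in auto)
    then show "X v - \<beta> k *s v \<in> ssum (B k) (C q)" unfolding X_def eq by (simp add: algebra_simps)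
  next
    fix k v assume kv: "k < q" "v \<in> C (Suc k)"
    have "(XB v - \<gamma> k *s v) + N2 v \<in> ssum (C k) (B p)"
      by (rule subspace_add[OF sCB[OF less_imp_le[OF kv(1)]] inCB opBC3[OF N(2) kv]]) (use kv XB in auto)
    then show "X v - \<gamma> k *s v \<in> ssum (C k) (B p)" unfolding X_def eq by (simp add: algebra_simps)
  qed
qed

end

section \<open>Fitting decompositions\<close>

context fin_ambient begin

text \<open>A strictly decreasing sequence of subspaces of \<open>S\<close> has at most \<open>dim S\<close> steps.\<close>

lemma image_funpow_stable:
  assumes \<nu>: "lin \<nu>" and S: "subspace S" and st: "\<And>v. v \<in> S \<Longrightarrow> \<nu> v \<in> S" and n: "dim S \<le> n" and m: "n \<le> m"
  shows "(\<nu> ^^ m) ` S = (\<nu> ^^ n) ` S"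
proof -
  let ?T = "\<lambda>k. (\<nu> ^^ k) ` S"
  have sT: "subspace (?T k)" for k by (rule lin_subspace_image[OF lin_funpow[OF \<nu>] S])
  have step: "?T (Suc k) = \<nu> ` ?T k" for k by (simp add: image_comp)
  have dec: "?T (Suc k) \<subseteq> ?T k" for k
  proof
    fix x assume "x \<in> ?T (Suc k)"
    then obtain v where "v \<in> S" "x = (\<nu> ^^ Suc k) v" by blast
    then have "\<nu> v \<in> S" "x = (\<nu> ^^ k) (\<nu> v)" using st by (simp_all add: funpow_swap1)
    then show "x \<in> ?T k" by blast
  qed
  have "\<exists>k\<le>n. ?T (Suc k) = ?T k"
  proof (rule ccontr)
    assume no: "\<not> (\<exists>k\<le>n. ?T (Suc k) = ?T k)"
    have lt: "dim (?T (Suc k)) < dim (?T k)" if "k \<le> n" for k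
    proof (rule ccontr)
      assume "\<not> dim (?T (Suc k)) < dim (?T k)"
      then have "?T (Suc k) = ?T k" by (intro subspace_eq_if_dim_le[OF sT sT dec]) simp
      then show False using no that by blast
    qed
    have "dim (?T k) + k \<le> dim S" if "k \<le> Suc n" for k
      using that
    proof (induction k)
      case (Suc k)
      then show ?case using lt[of k] by simp
    qed simp
    from this[of "Suc n"] show False using n by simp
  qed
  then obtain k where k: "k \<le> n" "?T (Suc k) = ?T k" by blast
  have const: "?T j = ?T k" if "k \<le> j" for j
    using that
  proof (induction j rule: dec_induct)
    case (step i)
    have "?T (Suc i) = \<nu> ` ?T i" by (rule \<open>\<And>k. ?T (Suc k) = \<nu> ` ?T k\<close>)
    then show ?case using step.IH k(2) \<open>\<And>k. ?T (Suc k) = \<nu> ` ?T k\<close>[of k] by simp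
  qed simp
  show ?thesis using const[of m] const[of n] k(1) m by simp
qed

text \<open>Fitting's decomposition for the powers of \<open>\<nu>\<close>. The number of powers depends on \<open>dim V\<close> only, so
  that one decomposition is compatible with all \<open>\<nu>\<close>-stable subspaces simultaneously.\<close>

lemma fitting:
  assumes \<nu>: "lin \<nu>" and V: "subspace V" and st: "\<And>v. v \<in> V \<Longrightarrow> \<nu> v \<in> V" and n: "dim V \<le> n"
  defines "K \<equiv> {v \<in> V. (\<nu> ^^ n) v = 0}" and "I \<equiv> (\<nu> ^^ n) ` V"
  shows "subspace K" "subspace I" "K \<inter> I = {0}"
    "\<And>S. subspace S \<Longrightarrow> S \<subseteq> V \<Longrightarrow> (\<And>v. v \<in> S \<Longrightarrow> \<nu> v \<in> S) \<Longrightarrow> S = ssum (S \<inter> K) (S \<inter> I)"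
proof -
  let ?f = "\<nu> ^^ n"
  have f: "lin ?f" by (rule lin_funpow[OF \<nu>])
  show K: "subspace K" unfolding K_def by (rule lin_subspace_kernel[OF f V])
  show I: "subspace I" unfolding I_def by (rule lin_subspace_image[OF f V])
  have two: "?f ` (?f ` S) = ?f ` S" if S: "subspace S" "S \<subseteq> V" "\<And>v. v \<in> S \<Longrightarrow> \<nu> v \<in> S" for S
  proof -
    have "dim S \<le> n" using dim_subset[OF S(2)] n by simp
    from image_funpow_stable[OF \<nu> S(1,3) this, of "n + n"] show ?thesis
      by (simp add: funpow_add image_comp)
  qed
  have fV: "?f v \<in> V" if "v \<in> V" for v by (rule funpow_mem[OF st that])
  have IV: "I \<subseteq> V" unfolding I_def using fV by blast
  have "?f ` I = I" unfolding I_def by (rule two[OF V order_refl st])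
  then have k0: "dim {x \<in> I. ?f x = 0} = 0" using rank_nullity[OF f I] by simp
  have "{x \<in> I. ?f x = 0} = {0}"
    using subspace_eq_if_dim_le[of "{0}" "{x \<in> I. ?f x = 0}"] lin_subspace_kernel[OF f I] k0 subspace_0[OF I] lin_0[OF f] by simp
  then show "K \<inter> I = {0}" unfolding K_def using IV by blast
  fix S assume S: "subspace S" "S \<subseteq> V" "\<And>v. v \<in> S \<Longrightarrow> \<nu> v \<in> S"
  show "S = ssum (S \<inter> K) (S \<inter> I)"
  proof (rule antisym; rule subsetI)
    fix v assume v: "v \<in> S"
    have eq: "?f ` (?f ` S) = ?f ` S" by (rule two[OF S(1,2)]) (rule S(3))
    have "?f v \<in> ?f ` (?f ` S)" unfolding eq using v by (rule imageI)
    then obtain u where u: "u \<in> S" "?f v = ?f (?f u)" by blast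
    have fu: "?f u \<in> S" by (rule funpow_mem[of S \<nu>, OF S(3) u(1)])
    have "v - ?f u \<in> S \<inter> K" unfolding K_def using subspace_diff[OF S(1) v fu] S(2) u(2) by (auto simp: lin_diff[OF f])
    moreover have "?f u \<in> S \<inter> I" unfolding I_def using fu u(1) S(2) by blast
    ultimately have "(v - ?f u) + ?f u \<in> ssum (S \<inter> K) (S \<inter> I)" by (rule ssumI)
    then show "v \<in> ssum (S \<inter> K) (S \<inter> I)" by simp
  next
    fix v assume "v \<in> ssum (S \<inter> K) (S \<inter> I)"
    then obtain x y where "x \<in> S" "y \<in> S" "v = x + y" by blast
    then show "v \<in> S" using subspace_add[OF S(1)] by simp
  qed
qed

definition splits :: "nat \<Rightarrow> (nat \<Rightarrow> 'b set) \<Rightarrow> 'b set \<Rightarrow> 'b set \<Rightarrow> bool" where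
  "splits r A K I \<longleftrightarrow> (\<forall>i\<le>r. A i = ssum (A i \<inter> K) (A i \<inter> I))"

definition indecomposable where
  "indecomposable r p q A B C \<longleftrightarrow> (\<forall>K I. subspace K \<longrightarrow> subspace I \<longrightarrow> K \<inter> I = {0} \<longrightarrow>
     K \<subseteq> A r \<longrightarrow> I \<subseteq> A r \<longrightarrow> splits r A K I \<longrightarrow> splits p B K I \<longrightarrow> splits q C K I \<longrightarrow> K = {0} \<or> I = {0})"

lemma stable_splits:
  assumes A: "chain r a A" and V: "subspace V" "A r \<subseteq> V" and \<nu>: "lin \<nu>" "stable r A \<nu>" "\<And>v. v \<in> V \<Longrightarrow> \<nu> v \<in> V" and n: "dim V \<le> n"
  shows "splits r A {v \<in> V. (\<nu> ^^ n) v = 0} ((\<nu> ^^ n) ` V)"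
  unfolding splits_def
proof (intro allI impI)
  fix i assume i: "i \<le> r"
  have st: "\<nu> v \<in> A i" if "v \<in> A i" for v using \<nu>(2) i that unfolding stable_def by simp
  have AV: "A i \<subseteq> V" using chain_mono[OF A i order_refl] V(2) by simp
  show "A i = ssum (A i \<inter> {v \<in> V. (\<nu> ^^ n) v = 0}) (A i \<inter> (\<nu> ^^ n) ` V)"
    by (rule fitting(4)[OF \<nu>(1) V(1) \<nu>(3) n chainD(2)[OF A i] AV st])
qed

end

context closed_ambient begin

text \<open>A polynomial of minimal degree that annihilates some non-zero vector has a root, and dividing by
  the corresponding linear factor gives an eigenvector.\<close>

lemma eigenvector_exists:
  assumes \<phi>: "lin \<phi>" and V: "subspace V" "V \<noteq> {0}" and st: "\<And>v. v \<in> V \<Longrightarrow> \<phi> v \<in> V"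
  shows "\<exists>t v. v \<in> V \<and> v \<noteq> 0 \<and> \<phi> v = t *s v"
proof -
  define ev where "ev p v = (\<Sum>i\<le>degree p. coeff p i *s (\<phi> ^^ i) v)" for p :: "'k poly" and v
  have fp: "lin (\<phi> ^^ i)" for i by (rule lin_funpow[OF \<phi>])
  have evV: "ev p v \<in> V" if "v \<in> V" for p v
    unfolding ev_def by (intro subspace_sum[OF V(1)] subspace_scale[OF V(1)] funpow_mem[of V \<phi>, OF st that])
  have big: "(\<Sum>i\<le>n. coeff p i *s (\<phi> ^^ i) v) = ev p v" if "degree p \<le> n" for p n v
    unfolding ev_def by (rule sum.mono_neutral_right) (use that in \<open>auto simp: coeff_eq_0\<close>)
  obtain v0 where v0: "v0 \<in> V" "v0 \<noteq> 0" using V subspace_0 by blast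
  let ?n = "dim V"
  let ?g = "\<lambda>i. (\<phi> ^^ i) v0"
  have gV: "?g i \<in> V" for i by (rule funpow_mem[of V \<phi>, OF st v0(1)])
  have "\<exists>p. p \<noteq> 0 \<and> ev p v0 = 0"
  proof (cases "inj_on ?g {..?n}")
    case False
    then obtain i j where ij: "i \<le> ?n" "j \<le> ?n" "i \<noteq> j" "?g i = ?g j" unfolding inj_on_def by auto
    let ?p = "monom (1 :: 'k) i - monom 1 j"
    have "coeff ?p i = 1" using ij(3) by simp
    then have p0: "?p \<noteq> 0" by (metis coeff_0 zero_neq_one)
    have "degree ?p \<le> ?n"
      using ij(1,2) by (intro degree_diff_le) (auto intro: order_trans[OF degree_monom_le])
    then have "ev ?p v0 = (\<Sum>k\<le>?n. coeff ?p k *s ?g k)" by (rule big[symmetric])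
    also have "\<dots> = (\<Sum>k\<le>?n. (if k = i then ?g i else 0) - (if k = j then ?g j else 0))"
      by (rule sum.cong[OF refl]) (auto simp: scale_left_diff_distrib)
    also have "\<dots> = 0" using ij by (simp add: sum_subtractf)
    finally have "ev ?p v0 = 0" .
    then show ?thesis using p0 by blast
  next
    case True
    have fin: "finite (?g ` {..?n})" by simp
    have "?g ` {..?n} \<subseteq> V" using gV by blast
    then have "dim (?g ` {..?n}) \<le> ?n" by (rule dim_subset)
    then have "dependent (?g ` {..?n})"
      using card_image[OF True] by (intro dependent_biggerset_general) simp
    then obtain u where u: "\<exists>x\<in>?g ` {..?n}. u x \<noteq> 0" "(\<Sum>x\<in>?g ` {..?n}. u x *s x) = 0"
      unfolding dependent_finite[OF fin] by blast
    define p where "p = (\<Sum>i\<le>?n. monom (u (?g i)) i)"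
    have cp: "coeff p k = (if k \<le> ?n then u (?g k) else 0)" for k
      unfolding p_def coeff_sum by (simp add: sum.delta coeff_monom)
    have "degree p \<le> ?n" by (rule degree_le) (simp add: cp)
    then have "ev p v0 = (\<Sum>k\<le>?n. coeff p k *s ?g k)" by (rule big[symmetric])
    also have "\<dots> = (\<Sum>k\<le>?n. u (?g k) *s ?g k)" by (rule sum.cong[OF refl]) (simp add: cp)
    also have "\<dots> = 0" using u(2) sum.reindex[OF True, of "\<lambda>x. u x *s x"] by simp
    finally have "ev p v0 = 0" .
    moreover have "p \<noteq> 0"
    proof
      assume "p = 0"
      obtain k where "k \<le> ?n" "u (?g k) \<noteq> 0" using u(1) by auto
      then have "coeff p k \<noteq> 0" using cp by simp
      then show False using \<open>p = 0\<close> by simp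
    qed
    ultimately show ?thesis by blast
  qed
  then have "\<exists>p. p \<noteq> 0 \<and> (\<exists>v\<in>V. v \<noteq> 0 \<and> ev p v = 0)" using v0 by blast
  from exists_least_iff[THEN iffD1, of "\<lambda>d. \<exists>p. degree p = d \<and> p \<noteq> 0 \<and> (\<exists>v\<in>V. v \<noteq> 0 \<and> ev p v = 0)"] this
  obtain p v where p: "p \<noteq> 0" "v \<in> V" "v \<noteq> 0" "ev p v = 0"
    and least: "\<And>q w. degree q < degree p \<Longrightarrow> q \<noteq> 0 \<Longrightarrow> w \<in> V \<Longrightarrow> w \<noteq> 0 \<Longrightarrow> ev q w \<noteq> 0"
    by metis
  have "degree p \<noteq> 0"
  proof
    assume "degree p = 0"
    then have "ev p v = coeff p 0 *s v" unfolding ev_def by simp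
    moreover have "coeff p 0 \<noteq> 0" using p(1) \<open>degree p = 0\<close> leading_coeff_neq_0 by metis
    ultimately show False using p(3,4) by simp
  qed
  then obtain t where "poly p t = 0" using alg_closed_imp_poly_has_root[of p] by blast
  then obtain q where q: "p = [:- t, 1:] * q" unfolding poly_eq_0_iff_dvd dvd_def by blast
  have q0: "q \<noteq> 0" using p(1) q by auto
  have dq: "degree p = Suc (degree q)" unfolding q using q0 by (subst degree_mult_eq) auto
  let ?m = "degree q"
  have cp: "coeff p (Suc i) = coeff q i - t * coeff q (Suc i)" "coeff p 0 = - t * coeff q 0" for i
    unfolding q by (simp_all add: mult_pCons_left)
  have "ev p v = coeff p 0 *s v + (\<Sum>i\<le>?m. coeff p (Suc i) *s (\<phi> ^^ Suc i) v)"
    unfolding ev_def dq by (subst sum.atMost_Suc_shift) simp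
  also have "\<dots> = (\<Sum>i\<le>?m. coeff q i *s (\<phi> ^^ Suc i) v) - t *s (coeff q 0 *s v + (\<Sum>i\<le>?m. coeff q (Suc i) *s (\<phi> ^^ Suc i) v))"
    unfolding cp by (simp add: scale_left_diff_distrib sum_subtractf scale_right_distrib scale_sum_right)
  also have "coeff q 0 *s v + (\<Sum>i\<le>?m. coeff q (Suc i) *s (\<phi> ^^ Suc i) v) = (\<Sum>i\<le>Suc ?m. coeff q i *s (\<phi> ^^ i) v)"
    by (subst sum.atMost_Suc_shift) simp
  also have "\<dots> = ev q v" by (rule big) simp
  also have "(\<Sum>i\<le>?m. coeff q i *s (\<phi> ^^ Suc i) v) = \<phi> (ev q v)"
    unfolding ev_def lin_sum[OF \<phi>] by (simp add: lin_scale[OF \<phi>])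
  finally have "\<phi> (ev q v) = t *s ev q v" using p(4) by simp
  moreover have "ev q v \<noteq> 0" by (rule least) (use dq q0 p in auto)
  ultimately show ?thesis using evV[OF p(2)] by blast
qed

text \<open>Take an eigenvalue \<open>t\<close> of \<open>\<phi>\<close>. The Fitting decomposition of \<open>\<phi> - t\<close> splits the triple, and its
  nilpotent part is not zero; so it is everything.\<close>

lemma indecomposable_local:
  assumes A: "chain r a A" and B: "chain p b B" and C: "chain q c C" and BC: "B p \<subseteq> A r" "C q \<subseteq> A r"
    and ind: "indecomposable r p q A B C" and ne: "A r \<noteq> {0}"
    and \<phi>: "lin \<phi>" "stable r A \<phi>" "stable p B \<phi>" "stable q C \<phi>"
  shows "\<exists>t N. \<forall>v\<in>A r. ((\<lambda>x. \<phi> x - t *s x) ^^ N) v = 0"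
proof -
  have V: "subspace (A r)" by (rule chainD(2)[OF A order_refl])
  have stV: "\<phi> v \<in> A r" if "v \<in> A r" for v using \<phi>(2) that unfolding stable_def by simp
  obtain t v where v: "v \<in> A r" "v \<noteq> 0" "\<phi> v = t *s v" using eigenvector_exists[OF \<phi>(1) V ne stV] by blast
  define \<nu> where "\<nu> x = \<phi> x - t *s x" for x
  have \<nu>: "lin \<nu>" unfolding \<nu>_def by (intro lin_minus \<phi> lin_smult lin_ident)
  have st: "stable m D \<nu>" if "stable m D \<phi>" "chain m d D" for m D d
    unfolding stable_def \<nu>_def
  proof (intro allI impI ballI)
    fix i x assume i: "i \<le> m" "x \<in> D i"
    have "\<phi> x \<in> D i" using that(1) i unfolding stable_def by simp
    then show "\<phi> x - t *s x \<in> D i"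
      using chainD(2)[OF that(2) i(1)] i(2) subspace_diff subspace_scale by metis
  qed
  have stV': "\<nu> x \<in> A r" if "x \<in> A r" for x using st[OF \<phi>(2) A] that unfolding stable_def by simp
  let ?n = "dim (A r)"
  let ?K = "{v \<in> A r. (\<nu> ^^ ?n) v = 0}" and ?I = "(\<nu> ^^ ?n) ` A r"
  note F = fitting[OF \<nu> V stV' order_refl]
  have "?K = {0} \<or> ?I = {0}"
  proof (rule ind[unfolded indecomposable_def, rule_format])
    show "?K \<subseteq> A r" by blast
    show "?I \<subseteq> A r" using funpow_mem[of "A r" \<nu>] stV' by blast
    show "splits r A ?K ?I" by (rule stable_splits[OF A V order_refl \<nu> st[OF \<phi>(2) A] stV' order_refl])
    show "splits p B ?K ?I" by (rule stable_splits[OF B V BC(1) \<nu> st[OF \<phi>(3) B] stV' order_refl])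
    show "splits q C ?K ?I" by (rule stable_splits[OF C V BC(2) \<nu> st[OF \<phi>(4) C] stV' order_refl])
  qed ((rule F(1) | rule F(2) | rule F(3)), assumption)+
  moreover have "v \<in> ?K"
  proof -
    have "\<nu> v = 0" unfolding \<nu>_def using v(3) by simp
    moreover have "?n \<noteq> 0" using ne subspace_eq_if_dim_le[of "{0}" "A r"] subspace_0[OF V] V by auto
    then obtain m where "?n = Suc m" using not0_implies_Suc by blast
    ultimately have "(\<nu> ^^ ?n) v = (\<nu> ^^ m) 0" by (simp add: funpow_swap1)
    then show ?thesis using v(1) lin_0[OF lin_funpow[OF \<nu>]] by simp
  qed
  ultimately have "?I = {0}" using v(2) by blast
  then have "\<forall>v\<in>A r. (\<nu> ^^ ?n) v = 0" by blast
  then show ?thesis unfolding \<nu>_def by blast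
qed

end

section \<open>From chains to spectral systems\<close>

context fin_ambient begin

lemma image_fam_sum:
  assumes "lin g" "\<And>i. i \<in> I \<Longrightarrow> g ` S i = T i"
  shows "g ` fam_sum I S = fam_sum I T"
proof (rule antisym; rule subsetI)
  fix x assume "x \<in> g ` fam_sum I S"
  then obtain y where y: "y \<in> fam_sum I S" "x = g y" by blast
  from y(1) obtain s where s: "\<forall>i\<in>I. s i \<in> S i" "y = (\<Sum>i\<in>I. s i)" by (rule fam_sumE)
  show "x \<in> fam_sum I T" unfolding y(2) s(2) lin_sum[OF assms(1)]
    by (rule fam_sumI) (use s(1) assms(2) in blast)
next
  fix x assume "x \<in> fam_sum I T"
  then obtain s where s: "\<forall>i\<in>I. s i \<in> T i" "x = (\<Sum>i\<in>I. s i)" by (rule fam_sumE)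
  have "\<forall>i\<in>I. \<exists>y. y \<in> S i \<and> s i = g y" using s(1) assms(2) by blast
  from bchoice[OF this] obtain y where y: "\<forall>i\<in>I. y i \<in> S i \<and> s i = g (y i)" ..
  have "x = g (\<Sum>i\<in>I. y i)" unfolding s(2) lin_sum[OF assms(1)] by (rule sum.cong[OF refl]) (use y in simp)
  moreover have "(\<Sum>i\<in>I. y i) \<in> fam_sum I S" by (rule fam_sumI) (use y in simp)
  ultimately show "x \<in> g ` fam_sum I S" by (rule rev_image_eqI[rotated])
qed

lemma fam_sum_cong:
  assumes "\<And>i. i \<in> I \<Longrightarrow> S i = T i" shows "fam_sum I S = fam_sum I T"
proof -
  have "(\<lambda>x. x) ` S i = T i" if "i \<in> I" for i using assms[OF that] by simp
  from image_fam_sum[OF lin_ident this] show ?thesis by simp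
qed

text \<open>An operator that acts on the factors of a chain by distinct scalars is diagonalisable, and its
  eigenspaces are a splitting of the chain. This is how operators determine flags.\<close>

lemma chain_eigenspaces:
  assumes A: "chain r a A" and X: "lin X" and \<alpha>: "inj_on \<alpha> {..<r}"
    and XA: "\<forall>i<r. \<forall>v\<in>A (Suc i). X v - \<alpha> i *s v \<in> A i"
  defines "S \<equiv> \<lambda>i. {v \<in> A r. X v = \<alpha> i *s v}"
  shows "\<And>i. i < r \<Longrightarrow> dim (S i) = a i" "\<And>i. i \<le> r \<Longrightarrow> A i = fam_sum {..<i} S"
    "indep_family {..<r} S" "\<And>i. subspace (S i)"
proof -
  define T where "T i = {v \<in> A (Suc i). X v = \<alpha> i *s v}" for i
  have sA: "subspace (A i)" if "i \<le> r" for i by (rule chainD(2)[OF A that])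
  have eig: "subspace {v \<in> D. X v = t *s v}" if "subspace D" for D t
  proof -
    have "subspace {v \<in> D. X v - t *s v = 0}"
      by (rule lin_subspace_kernel[OF lin_minus[OF X lin_smult[OF lin_ident]] that])
    then show ?thesis by simp
  qed
  have sT: "subspace (T i)" if "i < r" for i unfolding T_def by (rule eig[OF sA]) (use that in simp)
  show sS: "subspace (S i)" for i unfolding S_def by (rule eig[OF sA]) simp
  have TX: "X x = \<alpha> i *s x" if "x \<in> T i" for i x using that unfolding T_def by simp
  have SX: "X x = \<alpha> i *s x" if "x \<in> S i" for i x using that unfolding S_def by simp
  have sub: "{..<i} \<subseteq> {..<r}" if "i \<le> r" for i using that by auto
  have indT: "indep_family {..<i} T" if "i \<le> r" for i
    by (rule eigen_indep[OF finite_lessThan X inj_on_subset[OF \<alpha> sub[OF that]]]) (rule TX)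
  have main: "A i = fam_sum {..<i} T" if "i \<le> r" for i
    using that
  proof (induction i)
    case 0
    show ?case using chainD(1)[OF A] by (simp add: fam_sum_def)
  next
    case (Suc i)
    then have i: "i < r" "i \<le> r" and IH: "A i = fam_sum {..<i} T" by auto
    have eq: "fam_sum {..<Suc i} T = ssum (T i) (A i)"
      unfolding IH lessThan_Suc by (rule fam_sum_insert) auto
    have "A (Suc i) = ssum (T i) (A i)"
    proof (rule antisym; rule subsetI)
      fix v assume v: "v \<in> A (Suc i)"
      have "\<exists>u\<in>A i. X u - \<alpha> i *s u = X v - \<alpha> i *s v"
      proof (rule eigen_exhaust_bij(2)[of "{..<i}" X \<alpha> T "A i"])
        show "inj_on \<alpha> {..<i}" by (rule inj_on_subset[OF \<alpha> sub[OF i(2)]])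
        show "X x = \<alpha> k *s x" if "x \<in> T k" for k x by (rule TX[OF that])
        show "subspace (T k)" if "k \<in> {..<i}" for k by (rule sT) (use that i in simp)
        show "T k \<subseteq> A i" if "k \<in> {..<i}" for k
          using chain_mono[OF A, of "Suc k" i] that i unfolding T_def by auto
        have "dim (A i) = (\<Sum>k\<in>{..<i}. dim (T k))"
          unfolding IH by (rule dim_fam_sum[OF finite_lessThan indT[OF i(2)] sT]) (use i in simp)
        then show "dim (A i) \<le> (\<Sum>k\<in>{..<i}. dim (T k))" by simp
        show "\<alpha> k \<noteq> \<alpha> i" if "k \<in> {..<i}" for k using inj_onD[OF \<alpha>, of k i] that i by auto
        show "X v - \<alpha> i *s v \<in> A i" using XA i v by blast
      qed (use X sA[OF i(2)] in auto)
      then obtain u where u: "u \<in> A i" "X u - \<alpha> i *s u = X v - \<alpha> i *s v" by blast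
      have uS: "u \<in> A (Suc i)" using u(1) chainD(3)[OF A i(1)] by blast
      have "v - u \<in> A (Suc i)" by (rule subspace_diff[OF sA v uS]) (use i in simp)
      moreover have "X (v - u) = \<alpha> i *s (v - u)" using u(2) by (simp add: lin_diff[OF X] scale_right_diff_distrib algebra_simps)
      ultimately have "v - u \<in> T i" unfolding T_def by simp
      then have "(v - u) + u \<in> ssum (T i) (A i)" using u(1) by (rule ssumI)
      then show "v \<in> ssum (T i) (A i)" by simp
    next
      fix v assume "v \<in> ssum (T i) (A i)"
      then obtain x y where "x \<in> A (Suc i)" "y \<in> A i" "v = x + y" unfolding T_def by blast
      then show "v \<in> A (Suc i)" using chainD(3)[OF A i(1)] subspace_add[OF sA[of "Suc i"]] i by auto
    qed
    then show ?case using eq by simp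
  qed
  have dT: "dim (T i) = a i" if i: "i < r" for i
  proof -
    have "dim (A m) = (\<Sum>k<m. dim (T k))" if "m \<le> r" for m
      unfolding main[OF that] by (rule dim_fam_sum[OF finite_lessThan indT[OF that] sT]) (use that in simp)
    from this[of "Suc i"] this[of i] show ?thesis using chainD(4)[OF A i] i by simp
  qed
  have TS: "T i \<subseteq> S i" if "i < r" for i
    using chain_mono[OF A, of "Suc i" r] that unfolding T_def S_def by auto
  show indS: "indep_family {..<r} S" by (rule eigen_indep[OF finite_lessThan X \<alpha>]) (rule SX)
  have "fam_sum {..<r} S \<subseteq> A r"
  proof
    fix x assume "x \<in> fam_sum {..<r} S"
    then obtain s where s: "\<forall>i\<in>{..<r}. s i \<in> S i" "x = (\<Sum>i\<in>{..<r}. s i)" by (rule fam_sumE)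
    show "x \<in> A r" unfolding s(2) by (rule subspace_sum[OF sA[OF order_refl]]) (use s(1) in \<open>simp add: S_def\<close>)
  qed
  then have "(\<Sum>i<r. dim (S i)) \<le> dim (A r)"
    using dim_subset[of "fam_sum {..<r} S"] dim_fam_sum[OF finite_lessThan indS sS] by simp
  then have le: "(\<Sum>i<r. dim (S i)) \<le> (\<Sum>i<r. dim (T i))" using chain_dim[OF A order_refl] dT by simp
  have ST: "S i = T i" if i: "i < r" for i
  proof -
    have "dim (S i) \<le> dim (T i)"
    proof (rule ccontr)
      assume "\<not> dim (S i) \<le> dim (T i)"
      then have "(\<Sum>i<r. dim (T i)) < (\<Sum>i<r. dim (S i))"
        using i dim_subset[OF TS] by (intro sum_strict_mono_ex1 ballI bexI[of _ i]) auto
      then show False using le by simp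
    qed
    then show ?thesis using subspace_eq_if_dim_le[OF sT[OF i] sS TS[OF i]] by simp
  qed
  show "dim (S i) = a i" if "i < r" for i using ST[OF that] dT[OF that] by simp
  show "A i = fam_sum {..<i} S" if "i \<le> r" for i
  proof -
    have "fam_sum {..<i} S = fam_sum {..<i} T"
      by (rule fam_sum_cong) (use ST that in simp)
    then show ?thesis using main[OF that] by simp
  qed
qed

lemma chain_resolution:
  assumes B: "chain p b B" and Y: "lin Y" and \<beta>: "inj_on \<beta> {..<p}"
    and YB: "\<forall>k<p. \<forall>v\<in>B (Suc k). Y v - \<beta> k *s v \<in> B k"
  shows "\<exists>E. resolution p (B p) E \<and> (\<forall>k<p. dim (E k ` B p) = b k) \<and> (\<forall>k\<le>p. B k = fam_sum {..<k} (\<lambda>k. E k ` B p)) \<and>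
    (\<forall>u\<in>B p. Y u = (\<Sum>k<p. \<beta> k *s E k u))"
proof -
  define S where "S i = {v \<in> B p. Y v = \<beta> i *s v}" for i
  note CE = chain_eigenspaces[OF B Y \<beta> YB, folded S_def]
  obtain E where E: "\<forall>i. lin (E i)" "\<forall>i\<in>{..<p}. \<forall>j\<in>{..<p}. \<forall>x\<in>S j. E i x = (if i = j then x else 0)"
    using indep_family_projections[OF finite_lessThan CE(3,4)] by (elim exE conjE)
  have El: "lin (E i)" for i using E(1) by simp
  have ES: "E i x = (if i = j then x else 0)" if "i < p" "j < p" "x \<in> S j" for i j x using E(2) that by simp
  have SB: "S i \<subseteq> B p" for i unfolding S_def by blast
  have sB: "subspace (B p)" by (rule chainD(2)[OF B order_refl])
  have dec: "E k u \<in> S k" "(\<Sum>k<p. E k u) = u" if u: "u \<in> B p" and k: "k < p" for u k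
  proof -
    have "u \<in> fam_sum {..<p} S" using u CE(2)[OF order_refl] by simp
    then obtain s where s: "\<forall>i\<in>{..<p}. s i \<in> S i" "u = (\<Sum>i\<in>{..<p}. s i)" by (rule fam_sumE)
    have Ek: "E m u = s m" if m: "m < p" for m
    proof -
      have "E m u = (\<Sum>i<p. if i = m then s i else 0)"
        unfolding s(2) lin_sum[OF El] by (rule sum.cong[OF refl]) (use ES[OF m] s(1) in auto)
      then show ?thesis using m by simp
    qed
    show "E k u \<in> S k" using Ek[OF k] s(1) k by simp
    show "(\<Sum>k<p. E k u) = u" unfolding s(2)[symmetric] using Ek s(2) by simp
  qed
  have sum_all: "(\<Sum>k<p. E k u) = u" if u: "u \<in> B p" for u
  proof (cases "p = 0")
    case True
    then show ?thesis using u chainD(1)[OF B] by simp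
  next
    case False
    then show ?thesis using dec(2)[OF u, of 0] by simp
  qed
  have res: "resolution p (B p) E"
    unfolding resolution_def
  proof (intro conjI allI impI ballI)
    show "lin (E k)" for k by (rule El)
    show "E k u \<in> B p" if "k < p" "u \<in> B p" for k u using dec(1)[OF that(2,1)] SB by blast
    show "(\<Sum>k<p. E k u) = u" if "u \<in> B p" for u by (rule sum_all[OF that])
    show "E k (E l u) = (if k = l then E l u else 0)" if "k < p" "l < p" "u \<in> B p" for k l u
      using ES[OF that(1,2) dec(1)[OF that(3,2)]] .
  qed
  have im: "E k ` B p = S k" if k: "k < p" for k
  proof (rule antisym; rule subsetI)
    fix x assume "x \<in> E k ` B p" then show "x \<in> S k" using dec(1)[OF _ k] by blast
  next
    fix x assume x: "x \<in> S k"
    then have "E k x = x" using ES[OF k k x] by simp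
    then show "x \<in> E k ` B p" using x SB by (metis image_eqI subsetD)
  qed
  have "B k = fam_sum {..<k} (\<lambda>k. E k ` B p)" if "k \<le> p" for k
  proof -
    have "fam_sum {..<k} (\<lambda>k. E k ` B p) = fam_sum {..<k} S"
      by (rule fam_sum_cong) (use im that in simp)
    then show ?thesis using CE(2)[OF that] by (simp only:)
  qed
  note Bk = this
  have Yu: "Y u = (\<Sum>k<p. \<beta> k *s E k u)" if u: "u \<in> B p" for u
  proof -
    have "Y u = (\<Sum>k<p. Y (E k u))" using arg_cong[OF sum_all[OF u], of Y] by (simp add: lin_sum[OF Y])
    also have "\<dots> = (\<Sum>k<p. \<beta> k *s E k u)"
      by (rule sum.cong[OF refl]) (use dec(1)[OF u] in \<open>simp add: S_def\<close>)
    finally show ?thesis .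
  qed
  show ?thesis
  proof (intro exI[of _ E] conjI allI impI ballI)
    show "resolution p (B p) E" by (rule res)
    show "dim (E k ` B p) = b k" if "k < p" for k unfolding im[OF that] by (rule CE(1)[OF that])
    show "B k = fam_sum {..<k} (\<lambda>k. E k ` B p)" if "k \<le> p" for k by (rule Bk[OF that])
    show "Y u = (\<Sum>k<p. \<beta> k *s E k u)" if "u \<in> B p" for u by (rule Yu[OF that])
  qed
qed

definition triple :: "nat \<Rightarrow> nat \<Rightarrow> nat \<Rightarrow> (nat \<Rightarrow> nat) \<Rightarrow> (nat \<Rightarrow> nat) \<Rightarrow> (nat \<Rightarrow> nat) \<Rightarrow> (nat \<Rightarrow> 'b set) \<Rightarrow> (nat \<Rightarrow> 'b set) \<Rightarrow> (nat \<Rightarrow> 'b set) \<Rightarrow> bool" where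
  "triple r p q a b c A B C \<longleftrightarrow> chain r a A \<and> chain p b B \<and> chain q c C \<and> B p \<inter> C q = {0} \<and> A r = ssum (B p) (C q)"

lemma tripleD:
  assumes "triple r p q a b c A B C"
  shows "chain r a A" "chain p b B" "chain q c C" "B p \<inter> C q = {0}" "A r = ssum (B p) (C q)"
    "subspace (A r)" "subspace (B p)" "subspace (C q)" "B p \<subseteq> A r" "C q \<subseteq> A r" "(\<Sum>i<r. a i) = (\<Sum>k<p. b k) + (\<Sum>l<q. c l)"
proof -
  show t: "chain r a A" "chain p b B" "chain q c C" "B p \<inter> C q = {0}" "A r = ssum (B p) (C q)"
    using assms unfolding triple_def by simp_all
  show s: "subspace (A r)" "subspace (B p)" "subspace (C q)" using chainD(2)[OF _ order_refl] t by blast+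
  have "x + 0 \<in> A r" if "x \<in> B p" for x unfolding t(5) by (rule ssumI[OF that subspace_0[OF s(3)]])
  then show "B p \<subseteq> A r" by auto
  have "0 + x \<in> A r" if "x \<in> C q" for x unfolding t(5) by (rule ssumI[OF subspace_0[OF s(2)] that])
  then show "C q \<subseteq> A r" by auto
  show "(\<Sum>i<r. a i) = (\<Sum>k<p. b k) + (\<Sum>l<q. c l)"
    using chain_dim[OF t(1) order_refl] chain_dim[OF t(2) order_refl] chain_dim[OF t(3) order_refl]
      dim_ssum[OF s(2,3) t(4)] t(5) by simp
qed

text \<open>The spectral system cut out of \<open>X\<close> by the decomposition of the ambient space: projections onto the
  eigenspaces of the diagonal blocks, and the two off-diagonal blocks.\<close>

definition system_of where
  "system_of p q \<beta> \<gamma> b c B C X E H P Q \<longleftrightarrow> bisystem p q (B p) E (C q) H P Q \<and>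
     (\<forall>k<p. dim (E k ` B p) = b k) \<and> (\<forall>l<q. dim (H l ` C q) = c l) \<and>
     (\<forall>k\<le>p. B k = fam_sum {..<k} (\<lambda>k. E k ` B p)) \<and> (\<forall>l\<le>q. C l = fam_sum {..<l} (\<lambda>l. H l ` C q)) \<and>
     (\<forall>u\<in>B p. X u = (\<Sum>k<p. \<beta> k *s E k u) + Q u) \<and> (\<forall>w\<in>C q. X w = P w + (\<Sum>l<q. \<gamma> l *s H l w))"

lemma system_ofD:
  assumes "system_of p q \<beta> \<gamma> b c B C X E H P Q"
  shows "bisystem p q (B p) E (C q) H P Q" "\<And>k. k < p \<Longrightarrow> dim (E k ` B p) = b k" "\<And>l. l < q \<Longrightarrow> dim (H l ` C q) = c l"
    "\<And>k. k \<le> p \<Longrightarrow> B k = fam_sum {..<k} (\<lambda>k. E k ` B p)" "\<And>l. l \<le> q \<Longrightarrow> C l = fam_sum {..<l} (\<lambda>l. H l ` C q)"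
    "\<And>u. u \<in> B p \<Longrightarrow> X u = (\<Sum>k<p. \<beta> k *s E k u) + Q u" "\<And>w. w \<in> C q \<Longrightarrow> X w = P w + (\<Sum>l<q. \<gamma> l *s H l w)"
proof -
  note 1 = assms[unfolded system_of_def]
  show "bisystem p q (B p) E (C q) H P Q" by (rule conjunct1[OF 1])
  note 2 = conjunct2[OF 1]
  show "dim (E k ` B p) = b k" if "k < p" for k by (rule conjunct1[OF 2, rule_format, OF that])
  note 3 = conjunct2[OF 2]
  show "dim (H l ` C q) = c l" if "l < q" for l by (rule conjunct1[OF 3, rule_format, OF that])
  note 4 = conjunct2[OF 3]
  show "B k = fam_sum {..<k} (\<lambda>k. E k ` B p)" if "k \<le> p" for k by (rule conjunct1[OF 4, rule_format, OF that])
  note 5 = conjunct2[OF 4]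
  show "C l = fam_sum {..<l} (\<lambda>l. H l ` C q)" if "l \<le> q" for l by (rule conjunct1[OF 5, rule_format, OF that])
  note 6 = conjunct2[OF 5]
  show "X u = (\<Sum>k<p. \<beta> k *s E k u) + Q u" if "u \<in> B p" for u by (rule bspec[OF conjunct1[OF 6] that])
  show "X w = P w + (\<Sum>l<q. \<gamma> l *s H l w)" if "w \<in> C q" for w by (rule bspec[OF conjunct2[OF 6] that])
qed

lemma system_exists:
  assumes t: "triple r p q a b c A B C" and X: "lin X" and \<beta>: "inj_on \<beta> {..<p}" and \<gamma>: "inj_on \<gamma> {..<q}"
    and XA: "\<And>v. v \<in> A r \<Longrightarrow> X v \<in> A r"
    and XB: "\<forall>k<p. \<forall>v\<in>B (Suc k). X v - \<beta> k *s v \<in> ssum (B k) (C q)" and XC: "\<forall>l<q. \<forall>v\<in>C (Suc l). X v - \<gamma> l *s v \<in> ssum (C l) (B p)"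
  shows "\<exists>E H P Q. system_of p q \<beta> \<gamma> b c B C X E H P Q"
proof -
  note t = tripleD[OF t]
  obtain \<pi> where \<pi>: "lin \<pi>" "\<forall>x\<in>B p. \<pi> x = x" "\<forall>x\<in>C q. \<pi> x = 0" using projection_along[OF t(7,8,4)] by blast
  have BB: "B k \<subseteq> B p" if "k \<le> p" for k by (rule chain_mono[OF t(2) that order_refl])
  have CC: "C k \<subseteq> C q" if "k \<le> q" for k by (rule chain_mono[OF t(3) that order_refl])
  have \<pi>A: "\<pi> v \<in> B p" "v - \<pi> v \<in> C q" if v: "v \<in> A r" for v
  proof -
    obtain x y where xy: "x \<in> B p" "y \<in> C q" "v = x + y" using v unfolding t(5) by blast
    then have "\<pi> v = x" using \<pi>(2,3) by (simp add: lin_add[OF \<pi>(1)])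
    then show "\<pi> v \<in> B p" "v - \<pi> v \<in> C q" using xy by simp_all
  qed
  have l1: "lin (\<lambda>v. \<pi> (X v))" by (rule lin_compose_app[OF \<pi>(1) X])
  have l2: "lin (\<lambda>v. X v - \<pi> (X v))" by (rule lin_minus[OF X l1])
  have "\<forall>k<p. \<forall>v\<in>B (Suc k). \<pi> (X v) - \<beta> k *s v \<in> B k"
  proof (intro allI impI ballI)
    fix k v assume k: "k < p" and v: "v \<in> B (Suc k)"
    have vp: "v \<in> B p" using BB[of "Suc k"] v k by auto
    obtain x y where xy: "x \<in> B k" "y \<in> C q" "X v - \<beta> k *s v = x + y" using XB[rule_format, OF k v] by blast
    have "\<pi> (X v - \<beta> k *s v) = x" unfolding xy(3) lin_add[OF \<pi>(1)] using xy BB[of k] k \<pi>(2,3) by auto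
    then show "\<pi> (X v) - \<beta> k *s v \<in> B k" using xy(1) vp \<pi>(2) by (simp add: lin_diff[OF \<pi>(1)] lin_scale[OF \<pi>(1)])
  qed
  from chain_resolution[OF t(2) l1 \<beta> this] obtain E where
    E: "resolution p (B p) E" "\<forall>k<p. dim (E k ` B p) = b k" "\<forall>k\<le>p. B k = fam_sum {..<k} (\<lambda>k. E k ` B p)"
      "\<forall>u\<in>B p. \<pi> (X u) = (\<Sum>k<p. \<beta> k *s E k u)" by (elim exE conjE)
  have "\<forall>k<q. \<forall>v\<in>C (Suc k). (X v - \<pi> (X v)) - \<gamma> k *s v \<in> C k"
  proof (intro allI impI ballI)
    fix k v assume k: "k < q" and v: "v \<in> C (Suc k)"
    have vp: "v \<in> C q" using CC[of "Suc k"] v k by auto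
    obtain x y where xy: "x \<in> C k" "y \<in> B p" "X v - \<gamma> k *s v = x + y" using XC[rule_format, OF k v] by blast
    have "\<pi> (X v - \<gamma> k *s v) = y" unfolding xy(3) lin_add[OF \<pi>(1)] using xy CC[of k] k \<pi>(2,3) by auto
    then have "\<pi> (X v) = y" using vp \<pi>(3) by (simp add: lin_diff[OF \<pi>(1)] lin_scale[OF \<pi>(1)])
    then have "(X v - \<pi> (X v)) - \<gamma> k *s v = x" using xy(3) by (simp add: algebra_simps)
    then show "(X v - \<pi> (X v)) - \<gamma> k *s v \<in> C k" using xy(1) by simp
  qed
  from chain_resolution[OF t(3) l2 \<gamma> this] obtain H where
    H: "resolution q (C q) H" "\<forall>l<q. dim (H l ` C q) = c l" "\<forall>l\<le>q. C l = fam_sum {..<l} (\<lambda>l. H l ` C q)"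
      "\<forall>w\<in>C q. X w - \<pi> (X w) = (\<Sum>l<q. \<gamma> l *s H l w)" by (elim exE conjE)
  have B: "bisystem p q (B p) E (C q) H (\<lambda>w. \<pi> (X w)) (\<lambda>u. X u - \<pi> (X u))"
    unfolding bisystem_def
  proof (intro conjI ballI)
    show "\<pi> (X w) \<in> B p" if "w \<in> C q" for w by (rule \<pi>A(1)[OF XA]) (use that t(10) in blast)
    show "X u - \<pi> (X u) \<in> C q" if "u \<in> B p" for u by (rule \<pi>A(2)[OF XA]) (use that t(9) in blast)
  qed (rule t(7) t(8) E(1) H(1) l1 l2)+
  have 1: "X u = (\<Sum>k<p. \<beta> k *s E k u) + (X u - \<pi> (X u))" if "u \<in> B p" for u
    using E(4) that by (simp add: algebra_simps)
  have 2: "X w = \<pi> (X w) + (\<Sum>l<q. \<gamma> l *s H l w)" if "w \<in> C q" for w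
    using bspec[OF H(4) that] by (simp add: algebra_simps)
  have "system_of p q \<beta> \<gamma> b c B C X E H (\<lambda>w. \<pi> (X w)) (\<lambda>u. X u - \<pi> (X u))"
    unfolding system_of_def
  proof (intro conjI)
    show "\<forall>u\<in>B p. X u = (\<Sum>k<p. \<beta> k *s E k u) + (X u - \<pi> (X u))" by (intro ballI 1)
    show "\<forall>w\<in>C q. X w = \<pi> (X w) + (\<Sum>l<q. \<gamma> l *s H l w)" by (intro ballI 2)
  qed (rule B E(2) E(3) H(2) H(3))+
  then show ?thesis by (intro exI)
qed

lemma system_realises:
  assumes t: "triple r p q a b c A B C" and X: "lin X" and \<alpha>: "inj_on \<alpha> {..<r}"
    and XA: "\<forall>i<r. \<forall>v\<in>A (Suc i). X v - \<alpha> i *s v \<in> A i"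
    and sy: "system_of p q \<beta> \<gamma> b c B C X E H P Q" and \<alpha>\<beta>: "\<forall>i<r. \<forall>k<p. \<alpha> i \<noteq> \<beta> k"
  shows "realises r p q \<alpha> \<beta> \<gamma> a b c (B p) E (C q) H P Q"
proof -
  note t = tripleD[OF t] and y = system_ofD[OF sy]
  note D = bisystemD[OF y(1)]
  have "dim (spectral_kernel p q \<beta> \<gamma> E (C q) H P Q (\<alpha> i)) = a i" if i: "i < r" for i
  proof -
    let ?K = "spectral_kernel p q \<beta> \<gamma> E (C q) H P Q (\<alpha> i)"
    let ?S = "{v \<in> A r. X v = \<alpha> i *s v}"
    let ?f = "\<lambda>w. (\<Sum>k<p. (1 / (\<alpha> i - \<beta> k)) *s E k (P w))"
    let ?g = "\<lambda>w. ?f w + w"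
    have ne: "\<alpha> i \<noteq> \<beta> k" if "k < p" for k using \<alpha>\<beta> i that by simp
    have l: "lin ?g" by (intro lin_plus lin_summation lin_smult lin_ident lin_compose_app[OF D(9)] D(5))
    have K: "subspace ?K" by (rule lin_subspace_kernel[OF spectral_map_lin[OF y(1)] D(2)])
    have fU: "?f w \<in> B p" if "w \<in> C q" for w by (rule resolvent(1)[OF D(3,1) D(7)[OF that] ne])
    have "inj_on ?g ?K"
    proof (rule lin_inj_onI[OF l K])
      fix w assume w: "w \<in> ?K" "?g w = 0"
      then have wC: "w \<in> C q" by blast
      have "w = - ?f w" using w(2) by (simp add: add_eq_0_iff)
      then have "w \<in> B p" using subspace_neg[OF D(1) fU[OF wC]] by simp
      then show "w = 0" using wC t(4) by blast
    qed
    moreover have "?g ` ?K = ?S"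
    proof (rule antisym; rule subsetI)
      fix v assume "v \<in> ?g ` ?K"
      then obtain w where w: "w \<in> C q" "spectral_map p q \<beta> \<gamma> E H P Q (\<alpha> i) w = 0" "v = ?g w" by blast
      have vA: "v \<in> A r" unfolding w(3) t(5) by (rule ssumI[OF fU[OF w(1)] w(1)])
      have r2: "\<alpha> i *s ?f w - (\<Sum>k<p. \<beta> k *s E k (?f w)) = P w"
        by (rule resolvent(2)[OF D(3,1) D(7)[OF w(1)] ne])
      have Qf: "Q (?f w) = \<alpha> i *s w - (\<Sum>l<q. \<gamma> l *s H l w)"
        using w(2) unfolding spectral_map_def by (simp add: lin_sum[OF D(6)] lin_scale[OF D(6)])
      define u where "u = ?f w"
      have uB: "u \<in> B p" unfolding u_def by (rule fU[OF w(1)])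
      have vu: "v = u + w" unfolding u_def by (rule w(3))
      have Pw: "P w = \<alpha> i *s u - (\<Sum>k<p. \<beta> k *s E k u)" unfolding u_def by (rule r2[symmetric])
      have "X v = ((\<Sum>k<p. \<beta> k *s E k u) + Q u) + (P w + (\<Sum>l<q. \<gamma> l *s H l w))"
        unfolding vu lin_add[OF X] y(6)[OF uB] y(7)[OF w(1)] ..
      also have "\<dots> = \<alpha> i *s v" unfolding Qf[folded u_def] Pw vu by (simp add: scale_right_distrib)
      finally show "v \<in> ?S" using vA by simp
    next
      fix v assume v: "v \<in> ?S"
      then obtain u w where uw: "u \<in> B p" "w \<in> C q" "v = u + w" unfolding t(5) by blast
      have "X v = ((\<Sum>k<p. \<beta> k *s E k u) + Q u) + (P w + (\<Sum>l<q. \<gamma> l *s H l w))"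
        unfolding uw(3) lin_add[OF X] y(6)[OF uw(1)] y(7)[OF uw(2)] ..
      moreover have "X v = \<alpha> i *s u + \<alpha> i *s w" using v uw(3) by (simp add: scale_right_distrib)
      ultimately have eq: "(\<Sum>k<p. \<beta> k *s E k u) + P w - \<alpha> i *s u = \<alpha> i *s w - Q u - (\<Sum>l<q. \<gamma> l *s H l w)"
        by (simp add: algebra_simps)
      have m1: "(\<Sum>k<p. \<beta> k *s E k u) + P w - \<alpha> i *s u \<in> B p"
        by (intro subspace_diff[OF D(1)] subspace_add[OF D(1)] subspace_sum[OF D(1)] subspace_scale[OF D(1)] D(7,11) uw) simp
      have m2: "\<alpha> i *s w - Q u - (\<Sum>l<q. \<gamma> l *s H l w) \<in> C q"
        by (intro subspace_diff[OF D(2)] subspace_sum[OF D(2)] subspace_scale[OF D(2)] D(8,12) uw) simp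
      have "(\<Sum>k<p. \<beta> k *s E k u) + P w - \<alpha> i *s u \<in> B p \<inter> C q" using m1 m2 eq by simp
      then have z1: "(\<Sum>k<p. \<beta> k *s E k u) + P w - \<alpha> i *s u = 0" using t(4) by blast
      then have z2: "\<alpha> i *s w - Q u - (\<Sum>l<q. \<gamma> l *s H l w) = 0" using eq by simp
      have Eu: "E k u = (1 / (\<alpha> i - \<beta> k)) *s E k (P w)" if k: "k < p" for k
      proof -
        have "E k ((\<Sum>k<p. \<beta> k *s E k u) + P w - \<alpha> i *s u) = 0" unfolding z1 by (rule lin_0[OF D(9)])
        then have "\<beta> k *s E k u + E k (P w) - \<alpha> i *s E k u = 0"
          unfolding lin_diff[OF D(9)] lin_add[OF D(9)] lin_scale[OF D(9)] resolution_coeff[OF D(3) k uw(1)] .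
        then have "E k (P w) = (\<alpha> i - \<beta> k) *s E k u" by (simp add: scale_left_diff_distrib algebra_simps)
        then show ?thesis using ne[OF k] by simp
      qed
      have uf: "?f w = u"
      proof -
        have "?f w = (\<Sum>k<p. E k u)" by (rule sum.cong[OF refl]) (use Eu in simp)
        then show ?thesis using resolution_sum[OF D(3) uw(1)] by simp
      qed
      have "(\<Sum>k<p. (1 / (\<alpha> i - \<beta> k)) *s Q (E k (P w))) = Q (?f w)"
        by (simp add: lin_sum[OF D(6)] lin_scale[OF D(6)])
      then have "spectral_map p q \<beta> \<gamma> E H P Q (\<alpha> i) w = 0"
        unfolding spectral_map_def uf using z2 by (simp add: algebra_simps)
      then have "w \<in> ?K" using uw(2) by simp
      moreover have "v = ?g w" using uf uw(3) by simp
      ultimately show "v \<in> ?g ` ?K" by (rule rev_image_eqI)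
    qed
    ultimately have "dim ?K = dim ?S" using dim_inj_image[OF l K] by simp
    then show ?thesis using chain_eigenspaces(1)[OF t(1) X \<alpha> XA i] by simp
  qed
  then show ?thesis unfolding realises_def using y(1-3) by blast
qed

definition triple_iso where
  "triple_iso r p q A B C A' B' C' \<longleftrightarrow> (\<exists>g. lin g \<and> inj_on g (A r) \<and> (\<forall>i\<le>r. g ` A i = A' i) \<and>
     (\<forall>k\<le>p. g ` B k = B' k) \<and> (\<forall>l\<le>q. g ` C l = C' l))"

text \<open>An isomorphism of the two systems commutes with the operators and hence maps eigenspaces of the
  diagonal blocks and of \<open>X\<close> to each other; the chains are sums of such eigenspaces.\<close>

lemma triple_iso_if_isomorphic:
  assumes t1: "triple r p q a b c A1 B1 C1" and X1: "lin X1" and XA1: "\<forall>i<r. \<forall>v\<in>A1 (Suc i). X1 v - \<alpha> i *s v \<in> A1 i"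
    and s1: "system_of p q \<beta> \<gamma> b c B1 C1 X1 E1 H1 P1 Q1"
    and t2: "triple r p q a b c A2 B2 C2" and X2: "lin X2" and XA2: "\<forall>i<r. \<forall>v\<in>A2 (Suc i). X2 v - \<alpha> i *s v \<in> A2 i"
    and s2: "system_of p q \<beta> \<gamma> b c B2 C2 X2 E2 H2 P2 Q2"
    and \<alpha>: "inj_on \<alpha> {..<r}" and iso: "isomorphic p q (B1 p) E1 (C1 q) H1 P1 Q1 (B2 p) E2 (C2 q) H2 P2 Q2"
  shows "triple_iso r p q A1 B1 C1 A2 B2 C2"
proof -
  note u1 = tripleD[OF t1] and u2 = tripleD[OF t2] and y1 = system_ofD[OF s1] and y2 = system_ofD[OF s2]
  note D1 = bisystemD[OF y1(1)] and D2 = bisystemD[OF y2(1)]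
  obtain g h where gh: "lin g" "lin h" "g ` B1 p = B2 p" "h ` C1 q = C2 q" "\<forall>k<p. \<forall>u\<in>B1 p. g (E1 k u) = E2 k (g u)"
    "\<forall>l<q. \<forall>w\<in>C1 q. h (H1 l w) = H2 l (h w)" "\<forall>w\<in>C1 q. g (P1 w) = P2 (h w)" "\<forall>u\<in>B1 p. h (Q1 u) = Q2 (g u)"
    using iso unfolding isomorphic_def by (elim exE conjE)
  obtain \<pi> where \<pi>: "lin \<pi>" "\<forall>x\<in>B1 p. \<pi> x = x" "\<forall>x\<in>C1 q. \<pi> x = 0" using projection_along[OF u1(7,8,4)] by blast
  define f where "f v = g (\<pi> v) + h (v - \<pi> v)" for v
  have f: "lin f" unfolding f_def
    by (intro lin_plus lin_compose_app[OF gh(1)] lin_compose_app[OF gh(2)] lin_minus lin_ident \<pi>(1))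
  have fB: "f u = g u" if "u \<in> B1 p" for u unfolding f_def using \<pi>(2) that by (simp add: lin_0[OF gh(2)])
  have fC: "f w = h w" if "w \<in> C1 q" for w unfolding f_def using \<pi>(3) that by (simp add: lin_0[OF gh(1)])
  have gU: "g u \<in> B2 p" if "u \<in> B1 p" for u unfolding gh(3)[symmetric] by (rule imageI[OF that])
  have hW: "h w \<in> C2 q" if "w \<in> C1 q" for w unfolding gh(4)[symmetric] by (rule imageI[OF that])
  have fX1: "f (X1 u) = X2 (f u)" if u: "u \<in> B1 p" for u
  proof -
    have m: "(\<Sum>k<p. \<beta> k *s E1 k u) \<in> B1 p"
      by (intro subspace_sum[OF D1(1)] subspace_scale[OF D1(1)] D1(11) u) simp
    have "f (X1 u) = g (\<Sum>k<p. \<beta> k *s E1 k u) + h (Q1 u)"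
      unfolding y1(6)[OF u] lin_add[OF f] fB[OF m] fC[OF D1(8)[OF u]] ..
    also have "g (\<Sum>k<p. \<beta> k *s E1 k u) = (\<Sum>k<p. \<beta> k *s E2 k (g u))"
      unfolding lin_sum[OF gh(1)] lin_scale[OF gh(1)] by (rule sum.cong[OF refl]) (use gh(5) u in simp)
    also have "h (Q1 u) = Q2 (g u)" using gh(8) u by simp
    finally show ?thesis unfolding fB[OF u] y2(6)[OF gU[OF u]] .
  qed
  have fX2: "f (X1 w) = X2 (f w)" if w: "w \<in> C1 q" for w
  proof -
    have m: "(\<Sum>k<q. \<gamma> k *s H1 k w) \<in> C1 q"
      by (intro subspace_sum[OF D1(2)] subspace_scale[OF D1(2)] D1(12) w) simp
    have "f (X1 w) = g (P1 w) + h (\<Sum>k<q. \<gamma> k *s H1 k w)"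
      unfolding y1(7)[OF w] lin_add[OF f] fC[OF m] fB[OF D1(7)[OF w]] ..
    also have "h (\<Sum>k<q. \<gamma> k *s H1 k w) = (\<Sum>k<q. \<gamma> k *s H2 k (h w))"
      unfolding lin_sum[OF gh(2)] lin_scale[OF gh(2)] by (rule sum.cong[OF refl]) (use gh(6) w in simp)
    also have "g (P1 w) = P2 (h w)" using gh(7) w by simp
    finally show ?thesis unfolding fC[OF w] y2(7)[OF hW[OF w]] .
  qed
  have fX: "f (X1 v) = X2 (f v)" if v: "v \<in> A1 r" for v
  proof -
    obtain x y where "x \<in> B1 p" "y \<in> C1 q" "v = x + y" using v unfolding u1(5) by blast
    then show ?thesis using fX1 fX2 by (simp add: lin_add[OF X1] lin_add[OF f] lin_add[OF X2])
  qed
  have imB: "f ` B1 p = B2 p" unfolding gh(3)[symmetric] by (rule image_cong[OF refl fB])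
  have imC: "f ` C1 q = C2 q" unfolding gh(4)[symmetric] by (rule image_cong[OF refl fC])
  have imA: "f ` A1 r = A2 r"
  proof (rule antisym; rule subsetI)
    fix z assume "z \<in> f ` A1 r"
    then obtain x y where xy: "x \<in> B1 p" "y \<in> C1 q" "z = f (x + y)" unfolding u1(5) by blast
    show "z \<in> A2 r" unfolding xy(3) lin_add[OF f] u2(5) unfolding imB[symmetric] imC[symmetric] by (rule ssumI[OF imageI[OF xy(1)] imageI[OF xy(2)]])
  next
    fix z assume "z \<in> A2 r"
    then obtain x y where xy: "x \<in> B2 p" "y \<in> C2 q" "z = x + y" unfolding u2(5) by blast
    from xy(1) obtain x' where x1: "x' \<in> B1 p" "x = f x'" unfolding imB[symmetric] by (rule imageE) blast
    from xy(2) obtain y' where x2: "y' \<in> C1 q" "y = f y'" unfolding imC[symmetric] by (rule imageE) blast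
    note x' = x1 x2
    have "z = f (x' + y')" using xy(3) x' by (simp add: lin_add[OF f])
    moreover have "x' + y' \<in> A1 r" unfolding u1(5) by (rule ssumI[OF x'(1,3)])
    ultimately show "z \<in> f ` A1 r" by (rule rev_image_eqI[rotated])
  qed
  have dA: "dim (A1 r) = dim (A2 r)" using chain_dim[OF u1(1) order_refl] chain_dim[OF u2(1) order_refl] by simp
  have inj: "inj_on f (A1 r)"
  proof (rule lin_inj_onI[OF f u1(6)])
    fix x assume x: "x \<in> A1 r" "f x = 0"
    have "dim {x \<in> A1 r. f x = 0} = 0" using rank_nullity[OF f u1(6)] imA dA by simp
    then have "{0} = {x \<in> A1 r. f x = 0}"
      by (intro subspace_eq_if_dim_le lin_subspace_kernel[OF f u1(6)]) (use subspace_0[OF u1(6)] lin_0[OF f] in auto)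
    then show "x = 0" using x by blast
  qed
  have fE: "f ` (E1 k ` B1 p) = E2 k ` B2 p" if k: "k < p" for k
  proof -
    have "f ` (E1 k ` B1 p) = (\<lambda>u. f (E1 k u)) ` B1 p" by (simp add: image_image)
    also have "\<dots> = (\<lambda>u. E2 k (g u)) ` B1 p" by (rule image_cong[OF refl]) (use fB D1(11)[OF k] gh(5) k in simp)
    also have "\<dots> = E2 k ` B2 p" unfolding gh(3)[symmetric] by (simp add: image_image)
    finally show ?thesis .
  qed
  have fH: "f ` (H1 k ` C1 q) = H2 k ` C2 q" if k: "k < q" for k
  proof -
    have "f ` (H1 k ` C1 q) = (\<lambda>u. f (H1 k u)) ` C1 q" by (simp add: image_image)
    also have "\<dots> = (\<lambda>u. H2 k (h u)) ` C1 q" by (rule image_cong[OF refl]) (use fC D1(12)[OF k] gh(6) k in simp)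
    also have "\<dots> = H2 k ` C2 q" unfolding gh(4)[symmetric] by (simp add: image_image)
    finally show ?thesis .
  qed
  define S1 where "S1 i = {v \<in> A1 r. X1 v = \<alpha> i *s v}" for i
  define S2 where "S2 i = {v \<in> A2 r. X2 v = \<alpha> i *s v}" for i
  note c1 = chain_eigenspaces[OF u1(1) X1 \<alpha> XA1, folded S1_def] and c2 = chain_eigenspaces[OF u2(1) X2 \<alpha> XA2, folded S2_def]
  have fS: "f ` S1 i = S2 i" if i: "i < r" for i
  proof (rule subspace_eq_if_dim_le[OF lin_subspace_image[OF f c1(4)] c2(4)])
    show "f ` S1 i \<subseteq> S2 i"
    proof
      fix x assume "x \<in> f ` S1 i"
      then obtain v where v: "v \<in> A1 r" "X1 v = \<alpha> i *s v" "x = f v" unfolding S1_def by blast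
      have "f v \<in> A2 r" using imA v(1) by blast
      moreover have "X2 (f v) = \<alpha> i *s f v" using fX[OF v(1)] v(2) by (simp add: lin_scale[OF f])
      ultimately show "x \<in> S2 i" unfolding S2_def v(3) by simp
    qed
    have "inj_on f (S1 i)" by (rule inj_on_subset[OF inj]) (simp add: S1_def)
    then show "dim (S2 i) \<le> dim (f ` S1 i)" using dim_inj_image[OF f c1(4)] c1(1)[OF i] c2(1)[OF i] by simp
  qed
  have "f ` A1 i = A2 i" if "i \<le> r" for i
    unfolding c1(2)[OF that] c2(2)[OF that] by (rule image_fam_sum[OF f]) (use fS that in simp)
  moreover have "f ` B1 k = B2 k" if "k \<le> p" for k
    by (subst y1(4)[OF that], subst y2(4)[OF that], rule image_fam_sum[OF f]) (use fE that in simp)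
  moreover have "f ` C1 k = C2 k" if "k \<le> q" for k
    by (subst y1(5)[OF that], subst y2(5)[OF that], rule image_fam_sum[OF f]) (use fH that in simp)
  ultimately show ?thesis unfolding triple_iso_def using f inj by (intro exI[of _ f]) simp
qed

end

context closed_ambient begin

text \<open>Indecomposability supplies the locality that the lifting needs, and weight \<open>0\<close> removes the
  remaining obstruction.\<close>

lemma indecomposable_lift:
  assumes t: "triple r p q a b c A B C" and ind: "indecomposable r p q A B C" and pos: "0 < (\<Sum>i<r. a i)"
    and w: "weight r p q x y z (\<lambda>i. int (a i)) (\<lambda>k. int (b k)) (\<lambda>l. int (c l)) = 0"
    and y: "inj_on y {..<p}" and z: "inj_on z {..<q}"
  shows "\<exists>X E H P Q. lin X \<and> (\<forall>i<r. \<forall>v\<in>A (Suc i). X v - x i *s v \<in> A i) \<and> system_of p q y z b c B C X E H P Q"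
proof -
  note d = tripleD[OF t]
  have "A r \<noteq> {0}" using pos chain_dim[OF d(1) order_refl] by auto
  note loc = indecomposable_local[OF d(1-3,9,10) ind this]
  have wt: "(\<Sum>i<r. x i * of_nat (a i)) = (\<Sum>k<p. y k * of_nat (b k)) + (\<Sum>l<q. z l * of_nat (c l))"
    using w unfolding weight_def by (simp add: mult.commute diff_eq_eq add.commute)
  obtain X where X: "lin X" "\<forall>i<r. \<forall>v\<in>A (Suc i). X v - x i *s v \<in> A i"
    "\<forall>k<p. \<forall>v\<in>B (Suc k). X v - y k *s v \<in> ssum (B k) (C q)" "\<forall>l<q. \<forall>v\<in>C (Suc l). X v - z l *s v \<in> ssum (C l) (B p)"
  proof -
    have "\<exists>X. lin X \<and> (\<forall>i<r. \<forall>v\<in>A (Suc i). X v - x i *s v \<in> A i) \<and>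
      (\<forall>k<p. \<forall>v\<in>B (Suc k). X v - y k *s v \<in> ssum (B k) (C q)) \<and> (\<forall>l<q. \<forall>v\<in>C (Suc l). X v - z l *s v \<in> ssum (C l) (B p))"
      by (rule lifting[OF d(1-5) _ wt], rule loc; assumption)
    then show ?thesis using that by (elim exE conjE)
  qed
  have XA: "X v \<in> A r" if v: "v \<in> A r" for v
  proof -
    have "r \<noteq> 0" using pos by (intro notI) simp
    then obtain m where m: "r = Suc m" using not0_implies_Suc by blast
    have "X v - x m *s v \<in> A m" using X(2)[rule_format, of m v] v m by simp
    then have "X v - x m *s v \<in> A r" using chainD(3)[OF d(1), of m] m by auto
    then have "(X v - x m *s v) + x m *s v \<in> A r" by (rule subspace_add[OF d(6) _ subspace_scale[OF d(6) v]])
    then show ?thesis by simp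
  qed
  have "\<exists>E H P Q. system_of p q y z b c B C X E H P Q"
    by (rule system_exists[OF t X(1) y z _ X(3,4)]) (rule XA)
  then obtain E H P Q where "system_of p q y z b c B C X E H P Q" by (elim exE)
  then show ?thesis using X(1,2) by (intro exI conjI)
qed

text \<open>An indecomposable triple can be lifted for generic spectra, and the lift is determined by its
  dimensions.\<close>

lemma indecomposable_unique:
  assumes t1: "triple r p q a b c A1 B1 C1" and t2: "triple r p q a b c A2 B2 C2"
    and ind: "indecomposable r p q A1 B1 C1" "indecomposable r p q A2 B2 C2"
    and pos: "0 < (\<Sum>i<r. a i)" and nc: "\<not> critical r p q a b c"
  shows "triple_iso r p q A1 B1 C1 A2 B2 C2"
proof -
  obtain X Y Z :: "nat \<Rightarrow> nat \<Rightarrow> 'k" where G: "generic r p q X Y Z a b c"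
    and w: "\<forall>M. weight r p q (X M) (Y M) (Z M) (\<lambda>i. int (a i)) (\<lambda>k. int (b k)) (\<lambda>l. int (c l)) = 0"
    using generic_exists[OF pos] by blast
  note d1 = tripleD[OF t1] and d2 = tripleD[OF t2]
  have "eventually (\<lambda>M. \<forall>i<r. \<forall>k<p. 0 < (\<Sum>l<q. c l) \<longrightarrow> X M i \<noteq> Y M k) sequentially"
    using generic_distinct(1)[OF G] by (cases "0 < (\<Sum>l<q. c l)") auto
  with generic_unique[OF d1(11) nc G] generic_inj[OF G] generic_inj(2)[OF generic_swap[OF G]]
  have "eventually (\<lambda>M. unique_system r p q (X M) (Y M) (Z M) a b c \<and> inj_on (X M) {..<r} \<and> inj_on (Y M) {..<p} \<and>
      inj_on (Z M) {..<q} \<and> (\<forall>i<r. \<forall>k<p. 0 < (\<Sum>l<q. c l) \<longrightarrow> X M i \<noteq> Y M k)) sequentially"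
    by eventually_elim simp
  from eventually_happens'[OF sequentially_bot this] obtain M where
    M: "unique_system r p q (X M) (Y M) (Z M) a b c" "inj_on (X M) {..<r}" "inj_on (Y M) {..<p}" "inj_on (Z M) {..<q}"
      "\<forall>i<r. \<forall>k<p. 0 < (\<Sum>l<q. c l) \<longrightarrow> X M i \<noteq> Y M k" by (elim exE conjE)
  obtain X1 E1 H1 P1 Q1 where l1: "lin X1" "\<forall>i<r. \<forall>v\<in>A1 (Suc i). X1 v - X M i *s v \<in> A1 i"
    "system_of p q (Y M) (Z M) b c B1 C1 X1 E1 H1 P1 Q1"
    using indecomposable_lift[OF t1 ind(1) pos w[rule_format] M(3,4)] by (elim exE conjE)
  obtain X2 E2 H2 P2 Q2 where l2: "lin X2" "\<forall>i<r. \<forall>v\<in>A2 (Suc i). X2 v - X M i *s v \<in> A2 i"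
    "system_of p q (Y M) (Z M) b c B2 C2 X2 E2 H2 P2 Q2"
    using indecomposable_lift[OF t2 ind(2) pos w[rule_format] M(3,4)] by (elim exE conjE)
  note y1 = system_ofD[OF l1(3)] and y2 = system_ofD[OF l2(3)]
  have iso: "isomorphic p q (B1 p) E1 (C1 q) H1 P1 Q1 (B2 p) E2 (C2 q) H2 P2 Q2"
  proof (cases "(\<Sum>l<q. c l) = 0")
    case True
    have "C1 q = {0}" "C2 q = {0}"
      using subspace_dim_0[OF d1(8)] subspace_dim_0[OF d2(8)] chain_dim[OF d1(3) order_refl] chain_dim[OF d2(3) order_refl] True by simp_all
    moreover have "dim (E1 k ` B1 p) = dim (E2 k ` B2 p)" if "k < p" for k using y1(2)[OF that] y2(2)[OF that] by simp
    ultimately show ?thesis by (intro isomorphic_if_trivial[OF y1(1) y2(1)])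
  next
    case False
    then have "0 < (\<Sum>l<q. c l)" by (simp only: neq0_conv)
    then have \<alpha>\<beta>: "\<forall>i<r. \<forall>k<p. X M i \<noteq> Y M k" using M(5) by blast
    show ?thesis
      by (rule unique_systemD[OF M(1) system_realises[OF t1 l1(1) M(2) l1(2,3) \<alpha>\<beta>] system_realises[OF t2 l2(1) M(2) l2(2,3) \<alpha>\<beta>]])
  qed
  show ?thesis by (rule triple_iso_if_isomorphic[OF t1 l1 t2 l2 M(2) iso])
qed

end

section \<open>Finiteness below no critical shape\<close>

context fin_ambient begin

text \<open>The function is cut off outside the range so that the possible types of direct summands form a
  finite set.\<close>

definition part where "part r A K i = (if i < r then dim (A (Suc i) \<inter> K) - dim (A i \<inter> K) else (0::nat))"

abbreviation cut where "cut A K \<equiv> (\<lambda>i. A i \<inter> K)"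

lemma split_chain:
  assumes A: "chain r a A" and KI: "subspace K" "subspace I" "K \<inter> I = {0}" and s: "splits r A K I"
  shows "chain r (part r A K) (cut A K)" "chain r (part r A I) (cut A I)" "\<And>i. i < r \<Longrightarrow> a i = part r A K i + part r A I i"
proof -
  have sA: "subspace (A i)" if "i \<le> r" for i by (rule chainD(2)[OF A that])
  have ch: "chain r (part r A J) (cut A J)" if J: "subspace J" for J
    unfolding chain_def
  proof (intro conjI allI impI)
    show "A 0 \<inter> J = {0}" using chainD(1)[OF A] subspace_0[OF J] by simp
    show "subspace (A i \<inter> J)" if "i \<le> r" for i by (rule subspace_inter[OF sA[OF that] J])
    show sub: "A i \<inter> J \<subseteq> A (Suc i) \<inter> J" if "i < r" for i using chainD(3)[OF A that] by blast
    show "dim (A (Suc i) \<inter> J) = dim (A i \<inter> J) + part r A J i" if "i < r" for i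
      unfolding part_def using dim_subset[OF sub[OF that]] that by simp
  qed
  show "chain r (part r A K) (cut A K)" by (rule ch[OF KI(1)])
  show "chain r (part r A I) (cut A I)" by (rule ch[OF KI(2)])
  have dd: "dim (A i) = dim (A i \<inter> K) + dim (A i \<inter> I)" if "i \<le> r" for i
  proof -
    have "A i \<inter> K \<inter> (A i \<inter> I) = {0}" using KI(3) subspace_0[OF sA[OF that]] by blast
    from dim_ssum[OF subspace_inter[OF sA[OF that] KI(1)] subspace_inter[OF sA[OF that] KI(2)] this]
    show ?thesis using s[unfolded splits_def, rule_format, OF that] by simp
  qed
  fix i assume i: "i < r"
  have "dim (A i \<inter> K) \<le> dim (A (Suc i) \<inter> K)" "dim (A i \<inter> I) \<le> dim (A (Suc i) \<inter> I)"
    using chainD(3)[OF A i] by (intro dim_subset; blast)+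
  then show "a i = part r A K i + part r A I i"
    using dd[of i] dd[of "Suc i"] chainD(4)[OF A i] i unfolding part_def by simp
qed

lemma split_triple:
  assumes t: "triple r p q a b c A B C" and KI: "subspace K" "subspace I" "K \<inter> I = {0}"
    and s: "splits r A K I" "splits p B K I" "splits q C K I"
  shows "triple r p q (part r A K) (part p B K) (part q C K) (cut A K) (cut B K) (cut C K)"
proof -
  note d = tripleD[OF t]
  have "A r \<inter> K = ssum (B p \<inter> K) (C q \<inter> K)"
  proof (rule antisym; rule subsetI)
    fix x assume x: "x \<in> A r \<inter> K"
    then obtain b c where bc: "b \<in> B p" "c \<in> C q" "x = b + c" unfolding d(5) by blast
    have "b \<in> ssum (B p \<inter> K) (B p \<inter> I)" "c \<in> ssum (C q \<inter> K) (C q \<inter> I)"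
      using bc s(2,3)[unfolded splits_def, rule_format, OF order_refl] by blast+
    then obtain b1 b2 c1 c2 where 1: "b1 \<in> B p \<inter> K" "b2 \<in> B p \<inter> I" "b = b1 + b2" "c1 \<in> C q \<inter> K" "c2 \<in> C q \<inter> I" "c = c1 + c2"
      by blast
    have "x - (b1 + c1) \<in> K" using x 1 subspace_diff[OF KI(1)] subspace_add[OF KI(1)] by blast
    moreover have "x - (b1 + c1) = b2 + c2" using bc 1 by simp
    moreover have "b2 + c2 \<in> I" using 1 subspace_add[OF KI(2)] by blast
    ultimately have "b2 + c2 = 0" using KI(3) by auto
    then have "x = b1 + c1" using bc 1 by (metis \<open>x - (b1 + c1) = b2 + c2\<close> eq_iff_diff_eq_0)
    then show "x \<in> ssum (B p \<inter> K) (C q \<inter> K)" using ssumI[OF 1(1,4)] by simp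
  next
    fix x assume "x \<in> ssum (B p \<inter> K) (C q \<inter> K)"
    then obtain b c where bc: "b \<in> B p" "b \<in> K" "c \<in> C q" "c \<in> K" "x = b + c" by blast
    then show "x \<in> A r \<inter> K" using ssumI[OF bc(1,3)] subspace_add[OF KI(1)] unfolding d(5) by simp
  qed
  moreover have "B p \<inter> K \<inter> (C q \<inter> K) = {0}" using d(4) subspace_0[OF KI(1)] by blast
  ultimately show ?thesis
    unfolding triple_def using split_chain(1)[OF d(1) KI s(1)] split_chain(1)[OF d(2) KI s(2)] split_chain(1)[OF d(3) KI s(3)] by blast
qed

lemma splits_swap: "splits r A K I \<Longrightarrow> splits r A I K"
proof -
  have sub: "ssum S T \<subseteq> ssum T S" for S T :: "'b set"
  proof
    fix z assume "z \<in> ssum S T"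
    then obtain x y where xy: "x \<in> S" "y \<in> T" "z = y + x" by (auto simp: add.commute)
    show "z \<in> ssum T S" unfolding xy(3) by (rule ssumI[OF xy(2,1)])
  qed
  assume s: "splits r A K I"
  show ?thesis unfolding splits_def
  proof (intro allI impI)
    fix i assume "i \<le> r"
    then have "A i = ssum (A i \<inter> K) (A i \<inter> I)" by (rule s[unfolded splits_def, rule_format])
    also have "\<dots> = ssum (A i \<inter> I) (A i \<inter> K)" by (rule antisym[OF sub sub])
    finally show "A i = ssum (A i \<inter> I) (A i \<inter> K)" .
  qed
qed

lemma triple_subset:
  assumes "triple r p q a b c A B C"
  shows "\<And>i. i \<le> r \<Longrightarrow> A i \<subseteq> A r" "\<And>k. k \<le> p \<Longrightarrow> B k \<subseteq> A r" "\<And>l. l \<le> q \<Longrightarrow> C l \<subseteq> A r"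
proof -
  note d = tripleD[OF assms]
  show "\<And>i. i \<le> r \<Longrightarrow> A i \<subseteq> A r" by (rule chain_mono[OF d(1) _ order_refl])
  show "\<And>k. k \<le> p \<Longrightarrow> B k \<subseteq> A r" using chain_mono[OF d(2) _ order_refl] d(9) by blast
  show "\<And>l. l \<le> q \<Longrightarrow> C l \<subseteq> A r" using chain_mono[OF d(3) _ order_refl] d(10) by blast
qed

lemma triple_isoE:
  assumes "triple_iso r p q A B C A' B' C'"
  obtains g where "lin g" "inj_on g (A r)" "\<forall>i\<le>r. g ` A i = A' i" "\<forall>k\<le>p. g ` B k = B' k" "\<forall>l\<le>q. g ` C l = C' l"
  using assms unfolding triple_iso_def by (elim exE conjE)

lemma triple_iso_sym:
  assumes t: "triple r p q a b c A B C" and i: "triple_iso r p q A B C A' B' C'"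
  shows "triple_iso r p q A' B' C' A B C"
proof -
  from i obtain g where g: "lin g" "inj_on g (A r)" "\<forall>i\<le>r. g ` A i = A' i" "\<forall>k\<le>p. g ` B k = B' k" "\<forall>l\<le>q. g ` C l = C' l"
    by (rule triple_isoE)
  obtain L where L: "lin L" "\<forall>x\<in>A r. L (g x) = x" using left_inverse_on[OF g(1) tripleD(6)[OF t] g(2)] by blast
  have LS: "L ` (g ` S) = S" if "S \<subseteq> A r" for S
  proof -
    have "L ` (g ` S) = (\<lambda>x. L (g x)) ` S" by (simp add: image_image)
    also have "\<dots> = (\<lambda>x. x) ` S" by (rule image_cong[OF refl]) (use L(2) that in blast)
    finally show ?thesis by simp
  qed
  have "inj_on L (A' r)"
  proof (rule inj_onI)
    fix x y assume xy: "x \<in> A' r" "y \<in> A' r" "L x = L y"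
    then obtain x' y' where "x' \<in> A r" "x = g x'" "y' \<in> A r" "y = g y'" using g(3) by blast
    then show "x = y" using xy(3) L(2) by simp
  qed
  moreover have "L ` A' i = A i" if "i \<le> r" for i using LS[OF triple_subset(1)[OF t that]] g(3) that by simp
  moreover have "L ` B' i = B i" if "i \<le> p" for i using LS[OF triple_subset(2)[OF t that]] g(4) that by simp
  moreover have "L ` C' i = C i" if "i \<le> q" for i using LS[OF triple_subset(3)[OF t that]] g(5) that by simp
  ultimately show ?thesis unfolding triple_iso_def using L(1) by (intro exI[of _ L]) simp
qed

lemma triple_iso_trans:
  fixes r p q :: nat
  assumes "triple_iso r p q A B C A' B' C'" "triple_iso r p q A' B' C' A'' B'' C''"
  shows "triple_iso r p q A B C A'' B'' C''"
proof -
  from assms(1) obtain g where g: "lin g" "inj_on g (A r)" "\<forall>i\<le>r. g ` A i = A' i" "\<forall>k\<le>p. g ` B k = B' k" "\<forall>l\<le>q. g ` C l = C' l"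
    by (rule triple_isoE)
  from assms(2) obtain h where h: "lin h" "inj_on h (A' r)" "\<forall>i\<le>r. h ` A' i = A'' i" "\<forall>k\<le>p. h ` B' k = B'' k" "\<forall>l\<le>q. h ` C' l = C'' l"
    by (rule triple_isoE)
  have gr: "g ` A r = A' r" by (rule g(3)[rule_format, OF order_refl])
  have "inj_on (h \<circ> g) (A r)" by (rule comp_inj_on[OF g(2)]) (unfold gr, rule h(2))
  then have "inj_on (\<lambda>x. h (g x)) (A r)" by (simp add: comp_def)
  note inj = this
  have im: "(\<lambda>x. h (g x)) ` S = h ` (g ` S)" for S by (rule image_image[symmetric])
  show ?thesis unfolding triple_iso_def
  proof (intro exI[of _ "\<lambda>x. h (g x)"] conjI allI impI)
    show "lin (\<lambda>x. h (g x))" by (rule lin_compose_app[OF h(1) g(1)])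
    show "inj_on (\<lambda>x. h (g x)) (A r)" by (rule inj)
    show "(\<lambda>x. h (g x)) ` A i = A'' i" if "i \<le> r" for i
      unfolding im g(3)[rule_format, OF that] by (rule h(3)[rule_format, OF that])
    show "(\<lambda>x. h (g x)) ` B i = B'' i" if "i \<le> p" for i
      unfolding im g(4)[rule_format, OF that] by (rule h(4)[rule_format, OF that])
    show "(\<lambda>x. h (g x)) ` C i = C'' i" if "i \<le> q" for i
      unfolding im g(5)[rule_format, OF that] by (rule h(5)[rule_format, OF that])
  qed
qed

lemma triple_iso_glue:
  assumes t1: "triple r p q a b c A B C" and t2: "triple r p q a b c A' B' C'"
    and KI: "subspace K" "subspace I" "K \<inter> I = {0}" and s: "splits r A K I" "splits p B K I" "splits q C K I"
    and s': "splits r A' K' I'" "splits p B' K' I'" "splits q C' K' I'"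
    and iK: "triple_iso r p q (cut A K) (cut B K) (cut C K) (cut A' K') (cut B' K') (cut C' K')"
    and iI: "triple_iso r p q (cut A I) (cut B I) (cut C I) (cut A' I') (cut B' I') (cut C' I')"
  shows "triple_iso r p q A B C A' B' C'"
proof -
  from iK obtain g where g: "lin g" "inj_on g (A r \<inter> K)" "\<forall>i\<le>r. g ` (A i \<inter> K) = A' i \<inter> K'" "\<forall>k\<le>p. g ` (B k \<inter> K) = B' k \<inter> K'" "\<forall>l\<le>q. g ` (C l \<inter> K) = C' l \<inter> K'"
    by (rule triple_isoE)
  from iI obtain h where h: "lin h" "inj_on h (A r \<inter> I)" "\<forall>i\<le>r. h ` (A i \<inter> I) = A' i \<inter> I'" "\<forall>k\<le>p. h ` (B k \<inter> I) = B' k \<inter> I'" "\<forall>l\<le>q. h ` (C l \<inter> I) = C' l \<inter> I'"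
    by (rule triple_isoE)
  obtain \<pi> where \<pi>: "lin \<pi>" "\<forall>x\<in>K. \<pi> x = x" "\<forall>x\<in>I. \<pi> x = 0" using projection_along[OF KI] by blast
  define f where "f x = g (\<pi> x) + h (x - \<pi> x)" for x
  have f: "lin f" unfolding f_def
    by (intro lin_plus lin_compose_app[OF g(1)] lin_compose_app[OF h(1)] lin_minus lin_ident \<pi>(1))
  have fxy: "f (x + y) = g x + h y" if "x \<in> K" "y \<in> I" for x y
    unfolding f_def using \<pi>(2,3) that by (simp add: lin_add[OF \<pi>(1)])
  have im: "f ` D = D'" if D: "D = ssum (D \<inter> K) (D \<inter> I)" and D': "D' = ssum (D' \<inter> K') (D' \<inter> I')"
    and gD: "g ` (D \<inter> K) = D' \<inter> K'" and hD: "h ` (D \<inter> I) = D' \<inter> I'" for D D'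
  proof (rule antisym; rule subsetI)
    fix z assume "z \<in> f ` D"
    then obtain w where w: "w \<in> D" "z = f w" by blast
    have "w \<in> ssum (D \<inter> K) (D \<inter> I)" by (rule subsetD[OF equalityD1[OF D] w(1)])
    then obtain x y where xy: "x \<in> D \<inter> K" "y \<in> D \<inter> I" "w = x + y" by blast
    have "z = g x + h y" using fxy xy w(2) by simp
    moreover have "g x \<in> D' \<inter> K'" unfolding gD[symmetric] by (rule imageI[OF xy(1)])
    moreover have "h y \<in> D' \<inter> I'" unfolding hD[symmetric] by (rule imageI[OF xy(2)])
    ultimately have "z \<in> ssum (D' \<inter> K') (D' \<inter> I')" by (simp only: ssumI)
    then show "z \<in> D'" by (rule subsetD[OF equalityD2[OF D']])
  next
    fix z assume "z \<in> D'"
    then have "z \<in> ssum (D' \<inter> K') (D' \<inter> I')" by (rule subsetD[OF equalityD1[OF D']])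
    then obtain x' y' where xy': "x' \<in> D' \<inter> K'" "y' \<in> D' \<inter> I'" "z = x' + y'" by blast
    from xy'(1) obtain x where x: "x \<in> D \<inter> K" "x' = g x" unfolding gD[symmetric] by (rule imageE) blast
    from xy'(2) obtain y where y: "y \<in> D \<inter> I" "y' = h y" unfolding hD[symmetric] by (rule imageE) blast
    have "z = f (x + y)" using fxy x y xy'(3) by simp
    moreover have "x + y \<in> ssum (D \<inter> K) (D \<inter> I)" by (rule ssumI[OF x(1) y(1)])
    then have "x + y \<in> D" by (rule subsetD[OF equalityD2[OF D]])
    ultimately show "z \<in> f ` D" by (rule rev_image_eqI[rotated])
  qed
  note d1 = tripleD[OF t1] and d2 = tripleD[OF t2]
  have fA: "f ` A i = A' i" if "i \<le> r" for i
    by (rule im[OF s(1)[unfolded splits_def, rule_format, OF that] s'(1)[unfolded splits_def, rule_format, OF that]]) (use g(3) h(3) that in simp_all)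
  have fB: "f ` B i = B' i" if "i \<le> p" for i
    by (rule im[OF s(2)[unfolded splits_def, rule_format, OF that] s'(2)[unfolded splits_def, rule_format, OF that]]) (use g(4) h(4) that in simp_all)
  have fC: "f ` C i = C' i" if "i \<le> q" for i
    by (rule im[OF s(3)[unfolded splits_def, rule_format, OF that] s'(3)[unfolded splits_def, rule_format, OF that]]) (use g(5) h(5) that in simp_all)
  have "inj_on f (A r)"
  proof (rule lin_inj_onI[OF f d1(6)])
    fix x assume x: "x \<in> A r" "f x = 0"
    have "dim {x \<in> A r. f x = 0} = 0"
      using rank_nullity[OF f d1(6)] fA[OF order_refl] chain_dim[OF d1(1) order_refl] chain_dim[OF d2(1) order_refl] by simp
    then have "{0} = {x \<in> A r. f x = 0}"
      by (intro subspace_eq_if_dim_le lin_subspace_kernel[OF f d1(6)]) (use subspace_0[OF d1(6)] lin_0[OF f] in auto)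
    then show "x = 0" using x by blast
  qed
  then show ?thesis unfolding triple_iso_def using f fA fB fC by (intro exI[of _ f]) simp
qed

lemma finite_bounded_functions:
  "finite {f :: nat \<Rightarrow> nat. (\<forall>i<r. f i \<le> a i) \<and> (\<forall>i\<ge>r. f i = 0)}"
proof -
  have "finite {f :: nat \<Rightarrow> nat. \<forall>i. (i \<in> {..<r} \<longrightarrow> f i \<in> {..Max (a ` {..<r})}) \<and> (i \<notin> {..<r} \<longrightarrow> f i = 0)}"
    by (rule finite_set_of_finite_funs) simp_all
  then show ?thesis
  proof (rule finite_subset[rotated], intro subsetI CollectI allI conjI impI)
    fix f i assume f: "f \<in> {f. (\<forall>i<r. f i \<le> a i) \<and> (\<forall>i\<ge>r. f i = 0)}"
    show "f i \<in> {..Max (a ` {..<r})}" if i: "i \<in> {..<r}"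
    proof -
      have "f i \<le> a i" using f i by simp
      also have "a i \<le> Max (a ` {..<r})" using i by simp
      finally show ?thesis by simp
    qed
    show "f i = 0" if "i \<notin> {..<r}" using f that by simp
  qed
qed

end

context closed_ambient begin

definition covers where
  "covers r p q a b c S \<longleftrightarrow> (\<forall>A B C. triple r p q a b c A B C \<longrightarrow>
     (\<exists>(A', B', C')\<in>S. triple_iso r p q A B C A' B' C'))"

text \<open>Induction on the total dimension. A triple is encoded by \<open>None\<close> if it is indecomposable, and
  otherwise by a pair of representatives for the two summands of some decomposition. Triples with the
  same code are isomorphic, and there are finitely many codes.\<close>

lemma finitely_many_triples:
  assumes "\<not> critical r p q a b c"
  shows "\<exists>S. finite S \<and> covers r p q a b c S"
  using assms
proof (induction "\<Sum>i<r. a i" arbitrary: a b c rule: less_induct)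
  case less
  define F where "F m f = {g :: nat \<Rightarrow> nat. (\<forall>i<m. g i \<le> f i) \<and> (\<forall>i\<ge>m. g i = 0)}" for m and f :: "nat \<Rightarrow> nat"
  define Ty where "Ty = {(a', b', c'). a' \<in> F r a \<and> b' \<in> F p b \<and> c' \<in> F q c \<and> (\<Sum>i<r. a' i) < (\<Sum>i<r. a i)}"
  have finF: "finite (F m f)" for m f unfolding F_def by (rule finite_bounded_functions)
  have finTy: "finite Ty"
    by (rule finite_subset[OF _ finite_cartesian_product[OF finF[of r a] finite_cartesian_product[OF finF[of p b] finF[of q c]]]])
      (auto simp: Ty_def)
  have "\<exists>S. finite S \<and> (\<tau> \<in> Ty \<longrightarrow> covers r p q (fst \<tau>) (fst (snd \<tau>)) (snd (snd \<tau>)) S)" for \<tau>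
  proof (cases "\<tau> \<in> Ty")
    case True
    then obtain a' b' c' where \<tau>: "\<tau> = (a', b', c')" "a' \<in> F r a" "b' \<in> F p b" "c' \<in> F q c" "(\<Sum>i<r. a' i) < (\<Sum>i<r. a i)"
      unfolding Ty_def by blast
    have "\<not> critical r p q a' b' c'"
    proof
      assume "critical r p q a' b' c'"
      then have "critical r p q a b c" by (rule critical_mono) (use \<tau>(2-4) in \<open>simp_all add: F_def\<close>)
      then show False using less.prems by simp
    qed
    from less.hyps[OF \<tau>(5) this] obtain S0 where "finite S0" "covers r p q a' b' c' S0" by (elim exE conjE)
    then show ?thesis by (intro exI[of _ S0]) (simp add: \<tau>(1))
  next
    case False
    then show ?thesis by (intro exI[of _ "{}"]) simp
  qed
  then have "\<forall>\<tau>. \<exists>S. finite S \<and> (\<tau> \<in> Ty \<longrightarrow> covers r p q (fst \<tau>) (fst (snd \<tau>)) (snd (snd \<tau>)) S)" by (rule allI)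
  from choice[OF this] obtain S where
    S: "\<forall>\<tau>. finite (S \<tau>) \<and> (\<tau> \<in> Ty \<longrightarrow> covers r p q (fst \<tau>) (fst (snd \<tau>)) (snd (snd \<tau>)) (S \<tau>))" ..
  define R where "R = (\<Union>\<tau>\<in>Ty. S \<tau>)"
  have finR: "finite R" unfolding R_def by (rule finite_UN_I[OF finTy]) (rule conjunct1[OF spec[OF S]])
  have coverR: "\<exists>(A', B', C')\<in>R. triple_iso r p q A B C A' B' C'"
    if "triple r p q a' b' c' A B C" "(a', b', c') \<in> Ty" for a' b' c' A B C
  proof -
    have "covers r p q a' b' c' (S (a', b', c'))" using spec[OF S, of "(a', b', c')"] that(2) by simp
    then have "\<exists>(A', B', C')\<in>S (a', b', c'). triple_iso r p q A B C A' B' C'"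
      using that(1) unfolding covers_def by simp
    then obtain T where T: "T \<in> S (a', b', c')" "case T of (A', B', C') \<Rightarrow> triple_iso r p q A B C A' B' C'" by (elim bexE)
    have "T \<in> R" unfolding R_def using that(2) T(1) by blast
    then show ?thesis using T(2) by (intro bexI[of _ T])
  qed
  define code where "code i A B C \<longleftrightarrow> (case i of None \<Rightarrow> indecomposable r p q A B C
      | Some ((A1, B1, C1), (A2, B2, C2)) \<Rightarrow> (\<exists>K I. subspace K \<and> subspace I \<and> K \<inter> I = {0} \<and>
          splits r A K I \<and> splits p B K I \<and> splits q C K I \<and>
          triple_iso r p q (cut A K) (cut B K) (cut C K) A1 B1 C1 \<and> triple_iso r p q (cut A I) (cut B I) (cut C I) A2 B2 C2))"
    for i A B C
  let ?t = "triple r p q a b c"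
  have iso_code: "triple_iso r p q A B C A' B' C'" if c: "code i A B C" "code i A' B' C'" and t: "?t A B C" "?t A' B' C'" and pos: "0 < (\<Sum>i<r. a i)"
    for i A B C A' B' C'
  proof (cases i)
    case None
    then have "indecomposable r p q A B C" "indecomposable r p q A' B' C'" using c unfolding code_def by simp_all
    then show ?thesis by (rule indecomposable_unique[OF t _ _ pos less.prems])
  next
    case (Some T)
    obtain A1 B1 C1 A2 B2 C2 where T: "T = ((A1, B1, C1), (A2, B2, C2))" by (metis prod.exhaust)
    from c(1) obtain K I where 1: "subspace K" "subspace I" "K \<inter> I = {0}"
      "splits r A K I" "splits p B K I" "splits q C K I"
      "triple_iso r p q (cut A K) (cut B K) (cut C K) A1 B1 C1" "triple_iso r p q (cut A I) (cut B I) (cut C I) A2 B2 C2"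
      unfolding code_def Some T option.case prod.case by (elim exE conjE)
    from c(2) obtain K' I' where 2: "subspace K'" "subspace I'" "K' \<inter> I' = {0}"
      "splits r A' K' I'" "splits p B' K' I'" "splits q C' K' I'"
      "triple_iso r p q (cut A' K') (cut B' K') (cut C' K') A1 B1 C1" "triple_iso r p q (cut A' I') (cut B' I') (cut C' I') A2 B2 C2"
      unfolding code_def Some T option.case prod.case by (elim exE conjE)
    have 3: "I' \<inter> K' = {0}" using 2(3) by blast
    have k: "triple_iso r p q (cut A K) (cut B K) (cut C K) (cut A' K') (cut B' K') (cut C' K')"
      by (rule triple_iso_trans[OF 1(7) triple_iso_sym[OF split_triple[OF t(2) 2(1-6)] 2(7)]])
    have l: "triple_iso r p q (cut A I) (cut B I) (cut C I) (cut A' I') (cut B' I') (cut C' I')"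
      by (rule triple_iso_trans[OF 1(8) triple_iso_sym[OF split_triple[OF t(2) 2(2,1) 3 splits_swap[OF 2(4)] splits_swap[OF 2(5)] splits_swap[OF 2(6)]] 2(8)]])
    show ?thesis by (rule triple_iso_glue[OF t 1(1-6) 2(4-6) k l])
  qed
  have has_code: "\<exists>i\<in>insert None (Some ` (R \<times> R)). code i A B C" if t: "?t A B C" for A B C
  proof (cases "indecomposable r p q A B C")
    case True
    then have "code None A B C" unfolding code_def by simp
    then show ?thesis by (intro bexI[of _ None]) simp_all
  next
    case False
    then obtain K I where KI: "subspace K" "subspace I" "K \<inter> I = {0}" "K \<subseteq> A r" "I \<subseteq> A r"
      "splits r A K I" "splits p B K I" "splits q C K I" "K \<noteq> {0}" "I \<noteq> {0}"
      unfolding indecomposable_def not_all not_imp de_Morgan_disj by (elim exE conjE)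
    have IK: "I \<inter> K = {0}" using KI(3) by blast
    note d = tripleD[OF t]
    note sw = splits_swap[OF KI(6)] splits_swap[OF KI(7)] splits_swap[OF KI(8)]
    note tK = split_triple[OF t KI(1-3,6-8)] and tI = split_triple[OF t KI(2,1) IK sw]
    note sA = split_chain(3)[OF d(1) KI(1-3,6)] and sB = split_chain(3)[OF d(2) KI(1-3,7)] and sC = split_chain(3)[OF d(3) KI(1-3,8)]
    have pos: "0 < (\<Sum>i<r. part r A J i)" if "chain r (part r A J) (cut A J)" "J \<subseteq> A r" "J \<noteq> {0}" "subspace J" for J
    proof -
      have "(\<Sum>i<r. part r A J i) = dim (A r \<inter> J)" using chain_dim[OF that(1) order_refl] by simp
      also have "A r \<inter> J = J" using that(2) by blast
      finally show ?thesis using subspace_dim_0[OF that(4)] that(3) by (metis gr_zeroI)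
    qed
    have sumA: "(\<Sum>i<r. a i) = (\<Sum>i<r. part r A K i) + (\<Sum>i<r. part r A I i)"
      unfolding sum.distrib[symmetric] by (rule sum.cong[OF refl]) (use sA in simp)
    have mem: "part m D J \<in> F m e" if "\<And>i. i < m \<Longrightarrow> part m D J i \<le> e i" for m D J e
      unfolding F_def using that by (simp add: part_def)
    have TyK: "(part r A K, part p B K, part q C K) \<in> Ty"
      unfolding Ty_def using sumA pos[OF tripleD(1)[OF tI] KI(5,10,2)] sA sB sC by (auto intro!: mem)
    have TyI: "(part r A I, part p B I, part q C I) \<in> Ty"
      unfolding Ty_def using sumA pos[OF tripleD(1)[OF tK] KI(4,9,1)] sA sB sC by (auto intro!: mem)
    obtain A1 B1 C1 where 1: "(A1, B1, C1) \<in> R" "triple_iso r p q (cut A K) (cut B K) (cut C K) A1 B1 C1"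
      using coverR[OF tK TyK] by auto
    obtain A2 B2 C2 where 2: "(A2, B2, C2) \<in> R" "triple_iso r p q (cut A I) (cut B I) (cut C I) A2 B2 C2"
      using coverR[OF tI TyI] by auto
    have "code (Some ((A1, B1, C1), (A2, B2, C2))) A B C"
      unfolding code_def option.case prod.case
      by (rule exI[of _ K], rule exI[of _ I]) (simp only: KI 1(2) 2(2) simp_thms)
    then show ?thesis using 1(1) 2(1) by (intro bexI[of _ "Some ((A1, B1, C1), (A2, B2, C2))"]) simp_all
  qed
  show ?case
  proof (cases "0 < (\<Sum>i<r. a i)")
    case True
    define T where "T i = (SOME (A, B, C). ?t A B C \<and> code i A B C)" for i
    have "covers r p q a b c (T ` insert None (Some ` (R \<times> R)))"
      unfolding covers_def
    proof (intro allI impI)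
      fix A B C assume t: "?t A B C"
      obtain i where i: "i \<in> insert None (Some ` (R \<times> R))" "code i A B C" using has_code[OF t] by blast
      have "case (A, B, C) of (A, B, C) \<Rightarrow> ?t A B C \<and> code i A B C" using t i(2) by simp
      then have s: "case T i of (A, B, C) \<Rightarrow> ?t A B C \<and> code i A B C" unfolding T_def by (rule someI)
      obtain A' B' C' where T: "T i = (A', B', C')" by (metis prod.exhaust)
      have "triple_iso r p q A B C A' B' C'" using iso_code[OF i(2) _ t _ True] s unfolding T by simp
      then have "case T i of (A', B', C') \<Rightarrow> triple_iso r p q A B C A' B' C'" unfolding T by simp
      then show "\<exists>(A', B', C')\<in>T ` insert None (Some ` (R \<times> R)). triple_iso r p q A B C A' B' C'"
        by (rule bexI[OF _ imageI[OF i(1)]])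
    qed
    note cov = this
    have "finite (T ` insert None (Some ` (R \<times> R)))"
      by (intro finite_imageI finite.insertI finite_cartesian_product finR)
    then show ?thesis using cov by (intro exI conjI)
  next
    case False
    have z: "A i = {0}" if ch: "chain m e A" "(\<Sum>i<m. e i) = 0" "i \<le> m" for m e A i
    proof -
      have "dim (A i) = (\<Sum>k<i. e k)" by (rule chain_dim[OF ch(1,3)])
      moreover have "(\<Sum>k<i. e k) \<le> (\<Sum>k<m. e k)" by (rule sum_mono2) (use ch(3) in auto)
      ultimately have "dim (A i) = 0" using ch(2) by linarith
      then show ?thesis by (rule subspace_dim_0[OF chainD(2)[OF ch(1,3)]])
    qed
    let ?Z = "\<lambda>i :: nat. {0 :: 'v}"
    have "covers r p q a b c {(?Z, ?Z, ?Z)}"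
      unfolding covers_def
    proof (intro allI impI)
      fix A B C assume t: "?t A B C"
      note d = tripleD[OF t]
      have s0: "(\<Sum>i<r. a i) = 0" "(\<Sum>i<p. b i) = 0" "(\<Sum>i<q. c i) = 0" using False d(11) by simp_all
      have im: "(\<lambda>x. x) ` D = {0}" if "D = {0}" for D :: "'v set" unfolding that by simp
      have "triple_iso r p q A B C ?Z ?Z ?Z"
        unfolding triple_iso_def
      proof (intro exI[of _ "\<lambda>x. x"] conjI allI impI)
        show "lin (\<lambda>x. x)" by (rule lin_ident)
        show "inj_on (\<lambda>x. x) (A r)" by (rule inj_on_id2)
        show "(\<lambda>x. x) ` A i = {0}" if "i \<le> r" for i by (rule im, rule z[OF d(1) s0(1) that])
        show "(\<lambda>x. x) ` B i = {0}" if "i \<le> p" for i by (rule im, rule z[OF d(2) s0(2) that])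
        show "(\<lambda>x. x) ` C i = {0}" if "i \<le> q" for i by (rule im, rule z[OF d(3) s0(3) that])
      qed
      then show "\<exists>(A', B', C')\<in>{(?Z, ?Z, ?Z)}. triple_iso r p q A B C A' B' C'"
        by (intro bexI[of _ "(?Z, ?Z, ?Z)"]) simp_all
    qed
    moreover have "finite {(?Z, ?Z, ?Z)}" by (intro finite.insertI finite.emptyI)
    ultimately show ?thesis by (intro exI conjI)
  qed
qed

end

section \<open>Six rigid pencils\<close>

text \<open>The positions at which a matrix can be non-zero if it preserves a pair of complementary
  coordinate flags, the first in the coordinates below \<open>u\<close> with steps \<open>kb\<close>, the second in the others
  with steps \<open>kc\<close>.\<close>

definition block_upper :: "nat \<Rightarrow> nat \<Rightarrow> nat \<Rightarrow> nat \<Rightarrow> nat \<Rightarrow> bool" where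
  "block_upper u kb kc i j \<longleftrightarrow>
     (i < u \<and> j < u \<and> i div kb \<le> j div kb) \<or> (u \<le> i \<and> u \<le> j \<and> (i - u) div kc \<le> (j - u) div kc)"

text \<open>A family of invertible matrices: \<open>G s\<close> lists the columns and \<open>H s\<close> the rows of the inverse, each as
  pairs of a coefficient and an index. Moving a coordinate flag with steps \<open>ka\<close> by these matrices and
  keeping the flags of \<open>block_upper\<close> fixed gives a family of triples. The last condition says that a
  homomorphism \<open>m\<close> from the member \<open>s\<close> to the member \<open>t\<close> has entry \<open>0\<close> in the upper left corner; the case
  \<open>s = 0\<close> is excluded because one of the families degenerates there.\<close>

definition rigid_pencil :: "nat \<Rightarrow> nat \<Rightarrow> nat \<Rightarrow> nat \<Rightarrow> nat \<Rightarrow> ('k \<Rightarrow> nat \<Rightarrow> ('k::field \<times> nat) list) \<Rightarrow>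
    ('k \<Rightarrow> nat \<Rightarrow> ('k \<times> nat) list) \<Rightarrow> bool" where
  "rigid_pencil u n ka kb kc G H \<longleftrightarrow>
     (\<forall>s. \<forall>l<n. \<forall>k<n. (\<Sum>(c, i)\<leftarrow>H s l. \<Sum>(d, j)\<leftarrow>G s k. if i = j then c * d else 0) = (if l = k then 1 else 0)) \<and>
     (\<forall>s. \<forall>l<n. \<forall>(c, i)\<in>set (H s l). i < n) \<and> (\<forall>s. \<forall>k<n. \<forall>(c, i)\<in>set (G s k). i < n) \<and>
     (\<forall>s t m. s \<noteq> t \<longrightarrow> s \<noteq> 0 \<longrightarrow> t \<noteq> 0 \<longrightarrow>
       (\<forall>i j. i < n \<longrightarrow> j < n \<longrightarrow> \<not> block_upper u kb kc i j \<longrightarrow> m i j = 0) \<longrightarrow>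
       (\<forall>l k. l < n \<longrightarrow> k < n \<longrightarrow> k div ka < l div ka \<longrightarrow>
          (\<Sum>(c, i)\<leftarrow>H t l. \<Sum>(d, j)\<leftarrow>G s k. c * d * m i j) = 0) \<longrightarrow> m 0 0 = 0)"

lemma rigid_pencilI:
  assumes "\<forall>s. \<forall>l<n. \<forall>k<n. (\<Sum>(c, i)\<leftarrow>H s l. \<Sum>(d, j)\<leftarrow>G s k. if i = j then c * d else 0) = (if l = k then 1 else 0)"
    "\<forall>s. \<forall>l<n. \<forall>(c, i)\<in>set (H s l). i < n" "\<forall>s. \<forall>k<n. \<forall>(c, i)\<in>set (G s k). i < n"
    "\<And>s t m. s \<noteq> t \<Longrightarrow> s \<noteq> 0 \<Longrightarrow> t \<noteq> 0 \<Longrightarrow>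
       (\<And>i j. i < n \<Longrightarrow> j < n \<Longrightarrow> \<not> block_upper u kb kc i j \<Longrightarrow> m i j = 0) \<Longrightarrow>
       (\<And>l k. l < n \<Longrightarrow> k < n \<Longrightarrow> k div ka < l div ka \<Longrightarrow>
          (\<Sum>(c, i)\<leftarrow>H t l. \<Sum>(d, j)\<leftarrow>G s k. c * d * m i j) = 0) \<Longrightarrow> m 0 0 = 0"
  shows "rigid_pencil u n ka kb kc G H"
  unfolding rigid_pencil_def
proof (intro conjI)
  show "\<forall>s t m. s \<noteq> t \<longrightarrow> s \<noteq> 0 \<longrightarrow> t \<noteq> 0 \<longrightarrow>
       (\<forall>i j. i < n \<longrightarrow> j < n \<longrightarrow> \<not> block_upper u kb kc i j \<longrightarrow> m i j = 0) \<longrightarrow>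
       (\<forall>l k. l < n \<longrightarrow> k < n \<longrightarrow> k div ka < l div ka \<longrightarrow>
          (\<Sum>(c, i)\<leftarrow>H t l. \<Sum>(d, j)\<leftarrow>G s k. c * d * m i j) = 0) \<longrightarrow> m 0 0 = 0"
  proof (intro allI impI)
    fix s t m
    assume a: "s \<noteq> t" "s \<noteq> 0" "t \<noteq> 0"
      and m: "\<forall>i j. i < n \<longrightarrow> j < n \<longrightarrow> \<not> block_upper u kb kc i j \<longrightarrow> m i j = 0"
      and E: "\<forall>l k. l < n \<longrightarrow> k < n \<longrightarrow> k div ka < l div ka \<longrightarrow>
          (\<Sum>(c, i)\<leftarrow>H t l. \<Sum>(d, j)\<leftarrow>G s k. c * d * m i j) = 0"
    show "m 0 0 = 0"
      by (rule assms(4)[OF a]) (rule m[rule_format] E[rule_format]; assumption)+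
  qed
qed (rule assms)+

lemma all_less_numeral:
  "(\<forall>i<numeral w. P i) \<longleftrightarrow> P (pred_numeral w) \<and> (\<forall>i<pred_numeral w. P i)"
  unfolding numeral_eq_Suc All_less_Suc by simp

text \<open>In this family, as in most of the following ones, the equations for a homomorphism leave only
  diagonal entries, and force these to be equal. The one entry of the matrices that contains the
  parameter then yields \<open>s * x = t * x\<close>.\<close>

lemma pencil_4_1_2_1_2_1:
  "rigid_pencil 2 4 1 1 1
     (\<lambda>(s :: 'a::field) k. [[(s, 1), (1, 2), (1, 3)], [(1, 0), (1, 1), (1, 3)], [(1, 3)], [(1, 1)]] ! k)
     (\<lambda>(s :: 'a) l. [[(1, 2)], [(1, 0)], [(- 1, 0), (- 1, 2), (1, 3)], [(- 1, 0), (1, 1), (- s, 2)]] ! l)"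
  (is "rigid_pencil _ _ _ _ _ ?G ?H")
proof (rule rigid_pencilI)
  show "\<forall>s. \<forall>l<4. \<forall>k<4. (\<Sum>(c, i)\<leftarrow>?H s l. \<Sum>(d, j)\<leftarrow>?G s k. if i = j then c * d else 0) = (if l = k then 1 else 0)"
    by (simp add: all_less_numeral)
  show "\<forall>s. \<forall>l<4. \<forall>(c, i)\<in>set (?H s l). i < 4" "\<forall>s. \<forall>k<4. \<forall>(c, i)\<in>set (?G s k). i < 4"
    by (simp_all add: all_less_numeral)
  fix s t :: 'a and m :: "nat \<Rightarrow> nat \<Rightarrow> 'a"
  assume st: "s \<noteq> t" "s \<noteq> 0" "t \<noteq> 0"
    and m: "\<And>i j. i < 4 \<Longrightarrow> j < 4 \<Longrightarrow> \<not> block_upper 2 1 1 i j \<Longrightarrow> m i j = 0"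
    and E: "\<And>l k. l < 4 \<Longrightarrow> k < 4 \<Longrightarrow> k div 1 < l div 1 \<Longrightarrow>
      (\<Sum>(c, i)\<leftarrow>?H t l. \<Sum>(d, j)\<leftarrow>?G s k. c * d * m i j) = 0"
  have z: "m 0 2 = 0" "m 0 3 = 0" "m 1 0 = 0" "m 1 2 = 0" "m 1 3 = 0" "m 2 0 = 0" "m 2 1 = 0" "m 3 0 = 0" "m 3 1 = 0" "m 3 2 = 0"
    by (rule m; simp add: block_upper_def)+
  have "m 0 1 = 0" using E[of 1 0] st by (simp add: z del: One_nat_def)
  note z = z this
  have "m 2 3 = 0" using E[of 3 2] st by (simp add: z del: One_nat_def)
  note z = z this
  have e21: "m 3 3 = m 0 0" using E[of 2 1] by (simp add: z algebra_simps del: One_nat_def)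
  have e20: "m 3 3 = m 2 2" using E[of 2 0] by (simp add: z algebra_simps del: One_nat_def)
  have e31: "m 1 1 = m 0 0" using E[of 3 1] by (simp add: z algebra_simps del: One_nat_def)
  have e30: "s * m 1 1 = t * m 2 2" using E[of 3 0] by (simp add: z algebra_simps del: One_nat_def)
  have "s * m 0 0 = t * m 0 0" using e21 e20 e31 e30 by simp
  then show "m 0 0 = 0" using st(1) by simp
qed

lemma pencil_5_1_1_2_3_1:
  "rigid_pencil 2 5 1 2 1
     (\<lambda>(s :: 'a::field) k. [[(1, 1), (1, 2), (1, 3), (s, 4)], [(1, 0), (1, 3), (1, 4)], [(1, 4)], [(1, 3)], [(1, 1)]] ! k)
     (\<lambda>(s :: 'a) l. [[(1, 2)], [(1, 0)], [(- 1, 0), (- s, 2), (1, 4)], [(- 1, 0), (- 1, 2), (1, 3)], [(1, 1), (- 1, 2)]] ! l)"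
  (is "rigid_pencil _ _ _ _ _ ?G ?H")
proof (rule rigid_pencilI)
  show "\<forall>s. \<forall>l<5. \<forall>k<5. (\<Sum>(c, i)\<leftarrow>?H s l. \<Sum>(d, j)\<leftarrow>?G s k. if i = j then c * d else 0) = (if l = k then 1 else 0)"
    by (simp add: all_less_numeral)
  show "\<forall>s. \<forall>l<5. \<forall>(c, i)\<in>set (?H s l). i < 5" "\<forall>s. \<forall>k<5. \<forall>(c, i)\<in>set (?G s k). i < 5"
    by (simp_all add: all_less_numeral)
  fix s t :: 'a and m :: "nat \<Rightarrow> nat \<Rightarrow> 'a"
  assume st: "s \<noteq> t" "s \<noteq> 0" "t \<noteq> 0"
    and m: "\<And>i j. i < 5 \<Longrightarrow> j < 5 \<Longrightarrow> \<not> block_upper 2 2 1 i j \<Longrightarrow> m i j = 0"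
    and E: "\<And>l k. l < 5 \<Longrightarrow> k < 5 \<Longrightarrow> k div 1 < l div 1 \<Longrightarrow>
      (\<Sum>(c, i)\<leftarrow>?H t l. \<Sum>(d, j)\<leftarrow>?G s k. c * d * m i j) = 0"
  have z: "m 0 2 = 0" "m 0 3 = 0" "m 0 4 = 0" "m 1 3 = 0" "m 1 4 = 0" "m 2 0 = 0" "m 2 1 = 0" "m 3 0 = 0" "m 3 1 = 0" "m 3 2 = 0" "m 4 0 = 0" "m 4 1 = 0" "m 4 2 = 0" "m 4 3 = 0"
    by (rule m; simp add: block_upper_def)+
  have "m 0 1 = 0" using E[of 1 0] st by (simp add: z del: One_nat_def)
  note z = z this
  have "m 2 4 = 0" using E[of 4 2] st by (simp add: z del: One_nat_def)
  note z = z this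
  have "m 2 3 = 0" using E[of 4 3] st by (simp add: z del: One_nat_def)
  note z = z this
  have "m 3 4 = 0" using E[of 3 2] st by (simp add: z del: One_nat_def)
  note z = z this
  have e21: "m 4 4 = m 0 0" using E[of 2 1] by (simp add: z algebra_simps del: One_nat_def)
  have e20: "s * m 4 4 = t * m 2 2" using E[of 2 0] by (simp add: z algebra_simps del: One_nat_def)
  have e30: "m 3 3 = m 2 2" using E[of 3 0] by (simp add: z algebra_simps del: One_nat_def)
  have e31: "m 3 3 = m 0 0" using E[of 3 1] by (simp add: z algebra_simps del: One_nat_def)
  have "s * m 0 0 = t * m 0 0" using e21 e20 e30 e31 by simp
  then show "m 0 0 = 0" using st(1) by simp
qed

lemma pencil_3_2_3_1_3_1:
  "rigid_pencil 3 6 2 1 1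
     (\<lambda>(s :: 'a::field) k. [[(1, 2), (1, 4)], [(1, 1), (1, 5)], [(1, 2), (1, 3), (s, 5)], [(1, 0), (1, 2), (1, 5)], [(1, 2)], [(1, 5)]] ! k)
     (\<lambda>(s :: 'a) l. [[(1, 4)], [(1, 1)], [(1, 3)], [(1, 0)], [(- 1, 0), (1, 2), (- 1, 3), (- 1, 4)], [(- 1, 0), (- 1, 1), (- s, 3), (1, 5)]] ! l)"
  (is "rigid_pencil _ _ _ _ _ ?G ?H")
proof (rule rigid_pencilI)
  show "\<forall>s. \<forall>l<6. \<forall>k<6. (\<Sum>(c, i)\<leftarrow>?H s l. \<Sum>(d, j)\<leftarrow>?G s k. if i = j then c * d else 0) = (if l = k then 1 else 0)"
    by (simp add: all_less_numeral)
  show "\<forall>s. \<forall>l<6. \<forall>(c, i)\<in>set (?H s l). i < 6" "\<forall>s. \<forall>k<6. \<forall>(c, i)\<in>set (?G s k). i < 6"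
    by (simp_all add: all_less_numeral)
  fix s t :: 'a and m :: "nat \<Rightarrow> nat \<Rightarrow> 'a"
  assume st: "s \<noteq> t" "s \<noteq> 0" "t \<noteq> 0"
    and m: "\<And>i j. i < 6 \<Longrightarrow> j < 6 \<Longrightarrow> \<not> block_upper 3 1 1 i j \<Longrightarrow> m i j = 0"
    and E: "\<And>l k. l < 6 \<Longrightarrow> k < 6 \<Longrightarrow> k div 2 < l div 2 \<Longrightarrow>
      (\<Sum>(c, i)\<leftarrow>?H t l. \<Sum>(d, j)\<leftarrow>?G s k. c * d * m i j) = 0"
  have z: "m 0 3 = 0" "m 0 4 = 0" "m 0 5 = 0" "m 1 0 = 0" "m 1 3 = 0" "m 1 4 = 0" "m 1 5 = 0" "m 2 0 = 0" "m 2 1 = 0" "m 2 3 = 0" "m 2 5 = 0" "m 3 0 = 0" "m 3 1 = 0" "m 3 2 = 0" "m 4 0 = 0" "m 4 1 = 0" "m 4 2 = 0" "m 4 3 = 0" "m 5 0 = 0" "m 5 2 = 0" "m 5 3 = 0" "m 5 4 = 0"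
    by (rule m; simp add: block_upper_def)+
  have "m 3 4 = 0" using E[of 2 0] st by (simp add: z del: One_nat_def)
  note z = z this
  have "m 3 5 = 0" using E[of 2 1] st by (simp add: z del: One_nat_def)
  note z = z this
  have "m 0 2 = 0" using E[of 3 0] st by (simp add: z del: One_nat_def)
  note z = z this
  have "m 0 1 = 0" using E[of 3 1] st by (simp add: z del: One_nat_def)
  note z = z this
  have "m 4 5 = 0" using E[of 4 1] st by (simp add: z del: One_nat_def)
  note z = z this
  have "m 1 2 = 0" using E[of 5 0] st by (simp add: z del: One_nat_def)
  note z = z this
  have e43: "m 2 2 = m 0 0" using E[of 4 3] by (simp add: z algebra_simps del: One_nat_def)
  have e42: "m 2 2 = m 3 3" using E[of 4 2] by (simp add: z algebra_simps del: One_nat_def)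
  have e53: "m 5 5 = m 0 0" using E[of 5 3] by (simp add: z algebra_simps del: One_nat_def)
  have e52: "s * m 5 5 = t * m 3 3" using E[of 5 2] by (simp add: z algebra_simps del: One_nat_def)
  have "s * m 0 0 = t * m 0 0" using e43 e42 e53 e52 by simp
  then show "m 0 0 = 0" using st(1) by simp
qed

text \<open>In this family the off-diagonal entries of the homomorphism interact with the diagonal ones, so the
  remaining equations have to be solved in a particular order.\<close>

lemma pencil_7_1_1_3_2_2:
  "rigid_pencil 3 7 1 3 2
     (\<lambda>(s :: 'a::field) k. [[(1, 0), (1, 5)], [(1, 2), (1, 4), (1, 5), (1, 6)], [(1, 1), (1, 6)], [(1, 3), (1, 6)], [(1, 2), (s, 6)], [(1, 6)], [(1, 5)]] ! k)
     (\<lambda>(s :: 'a) l. [[(1, 0)], [(1, 4)], [(1, 1)], [(1, 3)], [(1, 2), (- 1, 4)], [(- 1, 1), (- s, 2), (- 1, 3), (- 1 + s, 4), (1, 6)], [(- 1, 0), (- 1, 4), (1, 5)]] ! l)"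
  (is "rigid_pencil _ _ _ _ _ ?G ?H")
proof (rule rigid_pencilI)
  show "\<forall>s. \<forall>l<7. \<forall>k<7. (\<Sum>(c, i)\<leftarrow>?H s l. \<Sum>(d, j)\<leftarrow>?G s k. if i = j then c * d else 0) = (if l = k then 1 else 0)"
    by (simp add: all_less_numeral)
  show "\<forall>s. \<forall>l<7. \<forall>(c, i)\<in>set (?H s l). i < 7" "\<forall>s. \<forall>k<7. \<forall>(c, i)\<in>set (?G s k). i < 7"
    by (simp_all add: all_less_numeral)
  fix s t :: 'a and m :: "nat \<Rightarrow> nat \<Rightarrow> 'a"
  assume st: "s \<noteq> t" "s \<noteq> 0" "t \<noteq> 0"
    and m: "\<And>i j. i < 7 \<Longrightarrow> j < 7 \<Longrightarrow> \<not> block_upper 3 3 2 i j \<Longrightarrow> m i j = 0"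
    and E: "\<And>l k. l < 7 \<Longrightarrow> k < 7 \<Longrightarrow> k div 1 < l div 1 \<Longrightarrow>
      (\<Sum>(c, i)\<leftarrow>?H t l. \<Sum>(d, j)\<leftarrow>?G s k. c * d * m i j) = 0"
  have z: "m 0 3 = 0" "m 0 4 = 0" "m 0 5 = 0" "m 0 6 = 0" "m 1 4 = 0" "m 1 5 = 0" "m 1 6 = 0" "m 2 3 = 0" "m 2 4 = 0" "m 2 5 = 0" "m 2 6 = 0" "m 3 0 = 0" "m 3 1 = 0" "m 3 2 = 0" "m 4 0 = 0" "m 4 2 = 0" "m 5 0 = 0" "m 5 2 = 0" "m 5 3 = 0" "m 5 4 = 0" "m 6 0 = 0" "m 6 2 = 0" "m 6 4 = 0"
    by (rule m; simp add: block_upper_def)+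
  have "m 4 5 = 0" using E[of 1 0] st by (simp add: z del: One_nat_def)
  note z = z this
  have "m 1 0 = 0" using E[of 2 0] st by (simp add: z del: One_nat_def)
  note z = z this
  have "m 1 2 = 0" using E[of 2 1] st by (simp add: z del: One_nat_def)
  note z = z this
  have "m 3 5 = 0" using E[of 3 0] st by (simp add: z del: One_nat_def)
  note z = z this
  have "m 3 6 = 0" using E[of 3 2] st by (simp add: z del: One_nat_def)
  note z = z this
  have "m 2 0 = 0" using E[of 4 0] st by (simp add: z del: One_nat_def)
  note z = z this
  have "m 6 5 = 0" using E[of 5 0] st by (simp add: z del: One_nat_def)
  note z = z this
  have "m 3 4 = 0" using E[of 3 1] st by (simp add: z del: One_nat_def)
  note z = z this
  have e65: "m 5 6 = m 4 6" using E[of 6 5] by (simp add: z algebra_simps del: One_nat_def)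
  have e63: "m 5 6 = m 4 3 + m 4 6" using E[of 6 3] by (simp add: z algebra_simps del: One_nat_def)
  have e43: "- m 4 3 = m 4 6" using E[of 4 3] by (simp add: z algebra_simps del: One_nat_def)
  have e41: "m 2 2 = m 4 4 + m 4 6" using E[of 4 1] by (simp add: z algebra_simps del: One_nat_def)
  have e54: "(- s + s * t) * m 4 6 + s * m 6 6 = t * m 2 2" using E[of 5 4] by (simp add: z algebra_simps del: One_nat_def)
  have e51: "(- 1 + t) * m 4 4 + (- 1 + t) * m 4 6 + m 6 6 = t * m 2 2" using E[of 5 1] by (simp add: z algebra_simps del: One_nat_def)
  have e64: "s * m 5 6 = m 0 2 + s * m 4 6" using E[of 6 4] by (simp add: z algebra_simps del: One_nat_def)
  have e61: "m 5 5 + m 5 6 = m 0 2 + m 4 4 + m 4 6" using E[of 6 1] by (simp add: z algebra_simps del: One_nat_def)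
  have e60: "m 5 5 = m 0 0" using E[of 6 0] by (simp add: z algebra_simps del: One_nat_def)
  have y: "m 5 6 = m 4 6" "m 4 3 = 0" "m 4 6 = 0" using e65 e63 e43 by simp_all
  have "m 2 2 = m 4 4" "m 6 6 = m 2 2" using e41 e51 y by (simp_all add: algebra_simps)
  then have "s * m 2 2 = t * m 2 2" using e54 y by (simp add: algebra_simps)
  then have "m 2 2 = 0" using st(1) by simp
  then show "m 0 0 = 0" using e64 e61 e60 e41 y by simp
qed

lemma pencil_4_2_1_3_5_1:
  "rigid_pencil 3 8 2 3 1
     (\<lambda>(s :: 'a::field) k. [[(1, 2), (1, 5), (1, 7)], [(1, 1), (1, 4), (1, 6), (s, 7)], [(1, 0), (1, 4)], [(1, 7)], [(1, 6)], [(1, 3), (1, 4), (1, 5)], [(1, 4)], [(1, 5)]] ! k)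
     (\<lambda>(s :: 'a) l. [[(1, 2)], [(1, 1)], [(1, 0)], [(- s, 1), (- 1, 2), (1, 7)], [(- 1, 1), (1, 6)], [(1, 3)], [(- 1, 0), (- 1, 1), (- 1, 3), (1, 4)], [(- 1, 2), (- 1, 3), (1, 5)]] ! l)"
  (is "rigid_pencil _ _ _ _ _ ?G ?H")
proof (rule rigid_pencilI)
  show "\<forall>s. \<forall>l<8. \<forall>k<8. (\<Sum>(c, i)\<leftarrow>?H s l. \<Sum>(d, j)\<leftarrow>?G s k. if i = j then c * d else 0) = (if l = k then 1 else 0)"
    by (simp add: all_less_numeral)
  show "\<forall>s. \<forall>l<8. \<forall>(c, i)\<in>set (?H s l). i < 8" "\<forall>s. \<forall>k<8. \<forall>(c, i)\<in>set (?G s k). i < 8"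
    by (simp_all add: all_less_numeral)
  fix s t :: 'a and m :: "nat \<Rightarrow> nat \<Rightarrow> 'a"
  assume st: "s \<noteq> t" "s \<noteq> 0" "t \<noteq> 0"
    and m: "\<And>i j. i < 8 \<Longrightarrow> j < 8 \<Longrightarrow> \<not> block_upper 3 3 1 i j \<Longrightarrow> m i j = 0"
    and E: "\<And>l k. l < 8 \<Longrightarrow> k < 8 \<Longrightarrow> k div 2 < l div 2 \<Longrightarrow>
      (\<Sum>(c, i)\<leftarrow>?H t l. \<Sum>(d, j)\<leftarrow>?G s k. c * d * m i j) = 0"
  have z: "m 0 3 = 0" "m 0 4 = 0" "m 0 5 = 0" "m 0 6 = 0" "m 0 7 = 0" "m 1 3 = 0" "m 1 4 = 0" "m 1 5 = 0" "m 1 6 = 0" "m 1 7 = 0" "m 2 3 = 0" "m 2 4 = 0" "m 2 5 = 0" "m 2 6 = 0" "m 2 7 = 0" "m 3 0 = 0" "m 3 1 = 0" "m 3 2 = 0" "m 4 0 = 0" "m 4 1 = 0" "m 4 2 = 0" "m 4 3 = 0" "m 5 1 = 0" "m 5 2 = 0" "m 5 3 = 0" "m 5 4 = 0" "m 6 0 = 0" "m 6 2 = 0" "m 6 4 = 0" "m 6 5 = 0" "m 7 1 = 0" "m 7 2 = 0" "m 7 4 = 0" "m 7 5 = 0" "m 7 6 = 0"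
    by (rule m; simp add: block_upper_def)+
  have "m 0 2 = 0" using E[of 2 0] st by (simp add: z del: One_nat_def)
  note z = z this
  have "m 0 1 = 0" using E[of 2 1] st by (simp add: z del: One_nat_def)
  note z = z this
  have "m 1 0 = 0" using E[of 4 2] st by (simp add: z del: One_nat_def)
  note z = z this
  have "m 6 7 = 0" using E[of 4 3] st by (simp add: z del: One_nat_def)
  note z = z this
  have "m 3 4 = 0" using E[of 5 2] st by (simp add: z del: One_nat_def)
  note z = z this
  have "m 3 7 = 0" using E[of 5 3] st by (simp add: z del: One_nat_def)
  note z = z this
  have "m 4 7 = 0" using E[of 6 3] st by (simp add: z del: One_nat_def)
  note z = z this
  have "m 5 7 = 0" using E[of 7 3] st by (simp add: z del: One_nat_def)
  note z = z this
  have "m 1 2 = 0" using E[of 4 0] st by (simp add: z del: One_nat_def)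
  note z = z this
  have "m 3 5 = 0" using E[of 5 0] st by (simp add: z del: One_nat_def)
  note z = z this
  have "m 3 6 = 0" using E[of 5 1] st by (simp add: z del: One_nat_def)
  note z = z this
  have "m 4 5 = 0" using E[of 6 0] st by (simp add: z del: One_nat_def)
  note z = z this
  have "m 4 6 = 0" using E[of 6 4] st by (simp add: z del: One_nat_def)
  note z = z this
  have "m 5 6 = 0" using E[of 7 4] st by (simp add: z del: One_nat_def)
  note z = z this
  have "m 2 1 = 0" using E[of 7 1] st by (simp add: z del: One_nat_def)
  note z = z this
  have e62: "m 4 4 = m 0 0" using E[of 6 2] by (simp add: z algebra_simps del: One_nat_def)
  have e61: "m 4 4 = m 1 1" using E[of 6 1] by (simp add: z algebra_simps del: One_nat_def)
  have e30: "m 7 7 = m 2 2" using E[of 3 0] by (simp add: z algebra_simps del: One_nat_def)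
  have e31: "s * m 7 7 = t * m 1 1" using E[of 3 1] by (simp add: z algebra_simps del: One_nat_def)
  have e70: "m 5 5 = m 2 2" using E[of 7 0] by (simp add: z algebra_simps del: One_nat_def)
  have e75: "m 5 5 = m 3 3" using E[of 7 5] by (simp add: z algebra_simps del: One_nat_def)
  have e65: "m 4 4 = m 3 3" using E[of 6 5] by (simp add: z algebra_simps del: One_nat_def)
  have "s * m 0 0 = t * m 0 0" using e62 e61 e30 e31 e70 e75 e65 by simp
  then show "m 0 0 = 0" using st(1) by simp
qed

lemma pencil_3_3_2_2_5_1:
  "rigid_pencil 4 9 3 2 1
     (\<lambda>(s :: 'a::field) k. [[(1, 1), (1, 6), (1, 8)], [(1, 3), (1, 7), (1, 8)], [(1, 2), (1, 8)], [(1, 0), (1, 3), (s, 6)], [(1, 3), (1, 4)], [(1, 5), (1, 8)], [(1, 3)], [(1, 8)], [(1, 6)]] ! k)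
     (\<lambda>(s :: 'a) l. [[(1, 1)], [(1, 7)], [(1, 2)], [(1, 0)], [(1, 4)], [(1, 5)], [(- 1, 0), (1, 3), (- 1, 4), (- 1, 7)], [(- 1, 1), (- 1, 2), (- 1, 5), (- 1, 7), (1, 8)], [(- s, 0), (- 1, 1), (1, 6)]] ! l)"
  (is "rigid_pencil _ _ _ _ _ ?G ?H")
proof (rule rigid_pencilI)
  show "\<forall>s. \<forall>l<9. \<forall>k<9. (\<Sum>(c, i)\<leftarrow>?H s l. \<Sum>(d, j)\<leftarrow>?G s k. if i = j then c * d else 0) = (if l = k then 1 else 0)"
    by (simp add: all_less_numeral)
  show "\<forall>s. \<forall>l<9. \<forall>(c, i)\<in>set (?H s l). i < 9" "\<forall>s. \<forall>k<9. \<forall>(c, i)\<in>set (?G s k). i < 9"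
    by (simp_all add: all_less_numeral)
  fix s t :: 'a and m :: "nat \<Rightarrow> nat \<Rightarrow> 'a"
  assume st: "s \<noteq> t" "s \<noteq> 0" "t \<noteq> 0"
    and m: "\<And>i j. i < 9 \<Longrightarrow> j < 9 \<Longrightarrow> \<not> block_upper 4 2 1 i j \<Longrightarrow> m i j = 0"
    and E: "\<And>l k. l < 9 \<Longrightarrow> k < 9 \<Longrightarrow> k div 3 < l div 3 \<Longrightarrow>
      (\<Sum>(c, i)\<leftarrow>?H t l. \<Sum>(d, j)\<leftarrow>?G s k. c * d * m i j) = 0"
  have z: "m 0 4 = 0" "m 0 5 = 0" "m 0 6 = 0" "m 0 7 = 0" "m 0 8 = 0" "m 1 4 = 0" "m 1 5 = 0" "m 1 6 = 0" "m 1 7 = 0" "m 1 8 = 0" "m 2 0 = 0" "m 2 1 = 0" "m 2 4 = 0" "m 2 6 = 0" "m 2 7 = 0" "m 2 8 = 0" "m 3 0 = 0" "m 3 1 = 0" "m 3 6 = 0" "m 3 7 = 0" "m 3 8 = 0" "m 4 0 = 0" "m 4 1 = 0" "m 4 2 = 0" "m 4 3 = 0" "m 5 0 = 0" "m 5 1 = 0" "m 5 2 = 0" "m 5 3 = 0" "m 5 4 = 0" "m 6 0 = 0" "m 6 1 = 0" "m 6 3 = 0" "m 6 4 = 0" "m 6 5 = 0" "m 7 0 = 0" "m 7 1 = 0" "m 7 3 = 0" "m 7 4 = 0" "m 7 6 = 0" "m 8 0 = 0" "m 8 1 = 0" "m 8 3 = 0" "m 8 4 = 0" "m 8 6 = 0"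 "m 8 7 = 0"
    by (rule m; simp add: block_upper_def)+
  have "m 0 1 = 0" using E[of 3 0] st by (simp add: z del: One_nat_def)
  note z = z this
  have "m 0 3 = 0" using E[of 3 1] st by (simp add: z del: One_nat_def)
  note z = z this
  have "m 4 8 = 0" using E[of 4 2] st by (simp add: z del: One_nat_def)
  note z = z this
  have "m 5 8 = 0" using E[of 5 2] st by (simp add: z del: One_nat_def)
  note z = z this
  have "m 1 3 = 0" using E[of 8 4] st by (simp add: z del: One_nat_def)
  note z = z this
  have "m 6 8 = 0" using E[of 8 5] st by (simp add: z del: One_nat_def)
  note z = z this
  have "m 4 6 = 0" using E[of 4 0] st by (simp add: z del: One_nat_def)
  note z = z this
  have "m 4 7 = 0" using E[of 4 1] st by (simp add: z del: One_nat_def)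
  note z = z this
  have "m 5 6 = 0" using E[of 5 0] st by (simp add: z del: One_nat_def)
  note z = z this
  have "m 5 7 = 0" using E[of 5 1] st by (simp add: z del: One_nat_def)
  note z = z this
  have "m 7 8 = 0" using E[of 6 0] st by (simp add: z del: One_nat_def)
  note z = z this
  have "m 2 3 = 0" using E[of 7 4] st by (simp add: z del: One_nat_def)
  note z = z this
  have "m 1 0 = 0" using E[of 7 3] st by (simp add: z del: One_nat_def)
  note z = z this
  have e63: "m 3 3 = m 0 0" using E[of 6 3] by (simp add: z algebra_simps del: One_nat_def)
  have e61: "m 3 3 = m 7 7" using E[of 6 1] by (simp add: z algebra_simps del: One_nat_def)
  have e71: "m 8 8 = m 7 7" using E[of 7 1] by (simp add: z algebra_simps del: One_nat_def)
  have e70: "m 8 8 = m 1 1" using E[of 7 0] by (simp add: z algebra_simps del: One_nat_def)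
  have e80: "m 6 6 = m 1 1" using E[of 8 0] by (simp add: z algebra_simps del: One_nat_def)
  have e83: "s * m 6 6 = t * m 0 0" using E[of 8 3] by (simp add: z algebra_simps del: One_nat_def)
  have "s * m 0 0 = t * m 0 0" using e63 e61 e71 e70 e80 e83 by simp
  then show "m 0 0 = 0" using st(1) by simp
qed

section \<open>Infinitely many orbits below a critical summand\<close>

lemma sum_list_scale: "(c :: 'k::comm_ring) * (\<Sum>(d, j)\<leftarrow>g. d * M j) = (\<Sum>(d, j)\<leftarrow>g. c * d * M j)"
  by (induction g) (auto simp: algebra_simps)

text \<open>Coordinates for the members of a flag whose type is the sum of a type with constant part \<open>k\<close> at the
  places in \<open>S\<close> and of a rest: the constant part uses the coordinates from \<open>x\<close> on, the rest those from
  \<open>y\<close> on.\<close>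

definition blocks :: "nat \<Rightarrow> nat \<Rightarrow> nat \<Rightarrow> nat set \<Rightarrow> (nat \<Rightarrow> nat) \<Rightarrow> nat \<Rightarrow> nat set" where
  "blocks x k y S f i = {x..<x + k * card (S \<inter> {..<i})} \<union> {y..<y + (\<Sum>l<i. f l - (if l \<in> S then k else 0))}"

lemma card_initial_Suc: "card (S \<inter> {..<Suc i :: nat}) = card (S \<inter> {..<i}) + (if i \<in> S then 1 else 0)"
proof -
  have "S \<inter> {..<Suc i} = (if i \<in> S then insert i (S \<inter> {..<i}) else S \<inter> {..<i})"
    by (auto simp: less_Suc_eq)
  then show ?thesis by simp
qed

lemma card_initial_le: "finite S \<Longrightarrow> card (S \<inter> {..<i}) \<le> card S"
  by (rule card_mono) auto

lemma sum_excess: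
  fixes i k :: nat and f :: "nat \<Rightarrow> nat"
  assumes "\<forall>l\<in>S. k \<le> f l"
  shows "(\<Sum>l<i. f l) = k * card (S \<inter> {..<i}) + (\<Sum>l<i. f l - (if l \<in> S then k else 0))"
proof (induction i)
  case (Suc i)
  then show ?case using assms by (auto simp: card_initial_Suc algebra_simps)
qed simp

lemma initial_count: "s \<le> card (S \<inter> {..<r :: nat}) \<Longrightarrow> \<exists>i\<le>r. card (S \<inter> {..<i}) = s"
proof (induction r)
  case (Suc r)
  show ?case
  proof (cases "s \<le> card (S \<inter> {..<r})")
    case True then show ?thesis using Suc.IH le_SucI by blast
  next
    case False
    then have "s = card (S \<inter> {..<Suc r})" using Suc.prems unfolding card_initial_Suc by (auto split: if_splits)
    then show ?thesis by blast
  qed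
qed simp

lemma blocks_chain:
  assumes S: "finite S" "\<forall>l\<in>S. k \<le> f l" and y: "x + k * card S \<le> y"
  shows "blocks x k y S f 0 = {}" "blocks x k y S f i \<subseteq> blocks x k y S f (Suc i)"
    "card (blocks x k y S f (Suc i)) = card (blocks x k y S f i) + f i"
proof -
  show "blocks x k y S f 0 = {}" unfolding blocks_def by simp
  show "blocks x k y S f i \<subseteq> blocks x k y S f (Suc i)"
    unfolding blocks_def card_initial_Suc by (intro Un_mono) auto
  have card: "card (blocks x k y S f i) = (\<Sum>l<i. f l)" for i
  proof -
    have "k * card (S \<inter> {..<i}) \<le> k * card S" by (rule mult_le_mono2[OF card_initial_le[OF S(1)]])
    then have le: "x + k * card (S \<inter> {..<i}) \<le> y" using y by linarith
    have "{x..<z} \<inter> {y..<z'} = {}" if "z \<le> y" for z z' using that by auto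
    note dis = this[OF le]
    then show ?thesis unfolding blocks_def sum_excess[OF S(2)] by (subst card_Un_disjoint[OF _ _ dis]) simp_all
  qed
  show "card (blocks x k y S f (Suc i)) = card (blocks x k y S f i) + f i"
    unfolding card by simp
qed

lemma blocks_mono: "i \<le> j \<Longrightarrow> finite S \<Longrightarrow> \<forall>l\<in>S. k \<le> f l \<Longrightarrow> x + k * card S \<le> y \<Longrightarrow>
    blocks x k y S f i \<subseteq> blocks x k y S f j"
  by (rule lift_Suc_mono_le[of "blocks x k y S f"]) (rule blocks_chain(2))

lemma blocks_last:
  assumes "S \<subseteq> {..<r}"
  shows "blocks x k y S f r = {x..<x + k * card S} \<union> {y..<y + (\<Sum>l<r. f l - (if l \<in> S then k else 0))}"
  using assms unfolding blocks_def by (simp add: Int_absorb2)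

text \<open>Each coordinate of the constant part appears at some step together with its own block and the
  earlier ones, but without the later ones.\<close>

lemma blocks_separate:
  assumes S: "S \<subseteq> {..<r}" and k: "0 < k" and y: "x + k * card S \<le> y" and j: "x \<le> j" "j < x + k * card S"
  shows "\<exists>i\<le>r. j \<in> blocks x k y S f i \<and>
    (\<forall>l. l < y \<longrightarrow> l \<in> blocks x k y S f i \<longrightarrow> x \<le> l \<and> l < x + k * card S \<and> (l - x) div k \<le> (j - x) div k)"
proof -
  have fin: "finite S" using S finite_subset by blast
  have "(j - x) div k < card S" using j k by (simp add: div_less_iff_less_mult mult.commute less_diff_conv2 add.commute)
  then obtain i where i: "i \<le> r" "card (S \<inter> {..<i}) = Suc ((j - x) div k)"
    using initial_count[of "Suc ((j - x) div k)" S r] S by (auto simp: Int_absorb2)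
  let ?s = "Suc ((j - x) div k)"
  have in_iff: "l < x + k * ?s \<longleftrightarrow> (l - x) div k < ?s" if "x \<le> l" for l
    using k that by (simp add: div_less_iff_less_mult mult.commute less_diff_conv2 add.commute del: mult_Suc mult_Suc_right)
  have "j \<in> blocks x k y S f i" unfolding blocks_def i(2) using in_iff[OF j(1)] j(1) by simp
  moreover have "x \<le> l \<and> l < x + k * card S \<and> (l - x) div k \<le> (j - x) div k"
    if "l < y" "l \<in> blocks x k y S f i" for l
  proof -
    have l: "x \<le> l" "l < x + k * ?s" using that unfolding blocks_def i(2) by auto
    have "k * ?s \<le> k * card S" using card_initial_le[OF fin, of i] unfolding i(2) by (rule mult_le_mono2)
    then show ?thesis using l in_iff[OF l(1)] by simp
  qed
  ultimately show ?thesis using i(1) by blast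
qed

context fin_ambient begin

definition covector :: "('b \<Rightarrow> 'a) \<Rightarrow> bool" where
  "covector \<chi> \<longleftrightarrow> (\<forall>x y. \<chi> (x + y) = \<chi> x + \<chi> y) \<and> (\<forall>c x. \<chi> (c *s x) = c * \<chi> x)"

text \<open>Vectors with dual covectors. The index set is arbitrary: with the parameters of a family as indices,
  the finiteness of independent sets bounds how many of them can share an orbit.\<close>

definition frame :: "'i set \<Rightarrow> ('i \<Rightarrow> 'b) \<Rightarrow> ('i \<Rightarrow> 'b \<Rightarrow> 'a) \<Rightarrow> bool" where
  "frame I w \<psi> \<longleftrightarrow> (\<forall>l\<in>I. covector (\<psi> l)) \<and> (\<forall>l\<in>I. \<forall>s\<in>I. \<psi> l (w s) = (if l = s then 1 else 0))"

lemma covectorD: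
  assumes "covector \<chi>"
  shows "\<chi> (x + y) = \<chi> x + \<chi> y" "\<chi> (c *s x) = c * \<chi> x" "\<chi> 0 = 0"
proof -
  show "\<chi> (x + y) = \<chi> x + \<chi> y" "\<chi> (c *s x) = c * \<chi> x" using assms unfolding covector_def by simp_all
  have "\<chi> (0 *s 0) = 0 * \<chi> 0" using assms unfolding covector_def by blast
  then show "\<chi> 0 = 0" by simp
qed

lemma frameD:
  assumes "frame I w \<psi>"
  shows "\<And>l. l \<in> I \<Longrightarrow> covector (\<psi> l)" "\<And>l s. l \<in> I \<Longrightarrow> s \<in> I \<Longrightarrow> \<psi> l (w s) = (if l = s then 1 else 0)"
  using assms unfolding frame_def by simp_all

lemma frame_span_zero:
  assumes "frame I w \<psi>" "J \<subseteq> I" "l \<in> I" "l \<notin> J" "v \<in> span (w ` J)"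
  shows "\<psi> l v = 0"
proof -
  note c = covectorD[OF frameD(1)[OF assms(1,3)]]
  have "subspace {v. \<psi> l v = 0}" unfolding subspace_def by (simp add: c)
  moreover have "\<psi> l (w s) = 0" if "s \<in> J" for s using frameD(2)[OF assms(1,3), of s] that assms(2,4) by auto
  then have "w ` J \<subseteq> {v. \<psi> l v = 0}" by blast
  ultimately have "span (w ` J) \<subseteq> {v. \<psi> l v = 0}" by (intro span_minimal)
  then show ?thesis using assms(5) by blast
qed

lemma frame_expand:
  assumes F: "frame I w \<psi>" and J: "finite J" "J \<subseteq> I" and v: "v \<in> span (w ` J)"
  shows "v = (\<Sum>j\<in>J. \<psi> j v *s w j)"
proof -
  have c: "\<psi> j (x + y) = \<psi> j x + \<psi> j y" "\<psi> j (c *s x) = c * \<psi> j x" "\<psi> j 0 = 0" if "j \<in> J" for j x y c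
    using covectorD[OF frameD(1)[OF F]] that J(2) by auto
  let ?E = "\<lambda>v. \<Sum>j\<in>J. \<psi> j v *s w j"
  have add: "?E (x + y) = ?E x + ?E y" for x y
    unfolding sum.distrib[symmetric] by (rule sum.cong[OF refl]) (simp add: c scale_left_distrib)
  have sc: "?E (d *s x) = d *s ?E x" for d x
    unfolding scale_sum_right by (rule sum.cong[OF refl]) (simp add: c)
  have z: "?E 0 = 0" by (rule sum.neutral) (simp add: c)
  have "subspace {v. ?E v = v}" unfolding subspace_def by (simp add: add sc z)
  moreover have "?E (w s) = w s" if "s \<in> J" for s
  proof -
    have "?E (w s) = (\<Sum>j\<in>J. if j = s then w j else 0)"
      by (rule sum.cong[OF refl]) (simp add: frameD(2)[OF F subsetD[OF J(2)] subsetD[OF J(2) that]])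
    then show ?thesis using sum.delta[OF J(1), of s w] that by simp
  qed
  then have "w ` J \<subseteq> {v. ?E v = v}" by blast
  ultimately have "span (w ` J) \<subseteq> {v. ?E v = v}" by (intro span_minimal)
  then have "?E v = v" using v by blast
  then show ?thesis by simp
qed

lemma frame_indep:
  assumes F: "frame I w \<psi>"
  shows "inj_on w I" "independent (w ` I)"
proof -
  show "inj_on w I"
  proof (rule inj_onI)
    fix s t assume st: "s \<in> I" "t \<in> I" "w s = w t"
    have "\<psi> s (w t) = 1" using frameD(2)[OF F st(1,1)] st(3) by simp
    then show "s = t" using frameD(2)[OF F st(1,2)] by (simp split: if_splits)
  qed
  have False if s: "s \<in> I" "w s \<in> span (w ` I - {w s})" for s
  proof -
    have "w ` I - {w s} \<subseteq> w ` (I - {s})" by blast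
    then have "w s \<in> span (w ` (I - {s}))" using s(2) span_mono by blast
    from frame_span_zero[OF F Diff_subset s(1) _ this] have "\<psi> s (w s) = 0" by simp
    then show False using frameD(2)[OF F s(1,1)] by simp
  qed
  then show "independent (w ` I)" unfolding dependent_def by blast
qed

lemma frame_dim:
  assumes F: "frame I w \<psi>" and J: "J \<subseteq> I" shows "dim (span (w ` J)) = card J"
proof -
  have "independent (w ` J)" by (rule independent_mono[OF frame_indep(2)[OF F] image_mono[OF J]])
  then have "dim (span (w ` J)) = card (w ` J)" by (rule dim_span_eq_card_independent)
  then show ?thesis using card_image[OF inj_on_subset[OF frame_indep(1)[OF F] J]] by simp
qed

lemma frame_chain:
  assumes F: "frame I w \<psi>" and J: "J 0 = {}" "\<And>i. i < r \<Longrightarrow> J i \<subseteq> J (Suc i)"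
    "\<And>i. i < r \<Longrightarrow> card (J (Suc i)) = card (J i) + f i" "\<And>i. i \<le> r \<Longrightarrow> J i \<subseteq> I"
  shows "chain r f (\<lambda>i. span (w ` J i))"
  unfolding chain_def
proof (intro conjI allI impI)
  show "span (w ` J 0) = {0}" unfolding J(1) by simp
  show "subspace (span (w ` J i))" for i by simp
  show "span (w ` J i) \<subseteq> span (w ` J (Suc i))" if "i < r" for i by (rule span_mono[OF image_mono[OF J(2)[OF that]]])
  show "dim (span (w ` J (Suc i))) = dim (span (w ` J i)) + f i" if "i < r" for i
    using frame_dim[OF F J(4), of "Suc i"] frame_dim[OF F J(4), of i] J(3)[OF that] that by simp
qed

lemma frame_complement:
  assumes N: "N = dim UNIV" and F: "frame {..<N} w \<psi>" and J: "J \<inter> K = {}" "J \<union> K = {..<N}"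
  shows "span (w ` J) \<inter> span (w ` K) = {0}" "ssum (span (w ` J)) (span (w ` K)) = UNIV"
    "span (w ` {..<N}) = UNIV"
proof -
  show all: "span (w ` {..<N}) = UNIV"
    by (rule subspace_eq_if_dim_le[OF subspace_span subspace_UNIV subset_UNIV])
      (simp only: frame_dim[OF F order_refl] card_lessThan N[symmetric] order_refl)
  have "v = 0" if v: "v \<in> span (w ` J)" "v \<in> span (w ` K)" for v
  proof -
    have "\<psi> l v = 0" if l: "l < N" for l
    proof (cases "l \<in> J")
      case True
      then have "l \<notin> K" using J(1) by blast
      then show ?thesis using frame_span_zero[OF F _ _ _ v(2), of l] J(2) l by blast
    next
      case False
      then show ?thesis using frame_span_zero[OF F _ _ _ v(1), of l] J(2) l by blast
    qed
    then have "(\<Sum>j\<in>{..<N}. \<psi> j v *s w j) = 0" by (intro sum.neutral) simp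
    then show "v = 0" using frame_expand[OF F finite_lessThan order_refl, of v] all by simp
  qed
  then show "span (w ` J) \<inter> span (w ` K) = {0}" using span_zero by blast
  show "ssum (span (w ` J)) (span (w ` K)) = UNIV"
    using span_Un[of "w ` J" "w ` K"] all J(2) unfolding image_Un[symmetric] by simp
qed

lemma coordinates: "\<exists>e \<psi>. frame {..<dim UNIV} e \<psi>"
proof -
  have d: "dim UNIV = card Basis" using dim_span_eq_card_independent[OF independent_Basis] span_Basis by simp
  obtain e where e: "bij_betw e {0..<card Basis} Basis" using ex_bij_betw_nat_finite[OF finite_Basis] by blast
  have b: "e j \<in> Basis" if "j < card Basis" for j using e that unfolding bij_betw_def by auto
  have inj: "e i = e j \<longleftrightarrow> i = j" if "i < card Basis" "j < card Basis" for i j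
    using inj_on_eq_iff[OF bij_betw_imp_inj_on[OF e]] that by simp
  have "frame {..<dim UNIV} e (\<lambda>j v. representation Basis v (e j))"
    unfolding frame_def covector_def d
    by (simp add: representation_add[OF independent_Basis] representation_scale[OF independent_Basis] span_Basis
        representation_basis[OF independent_Basis b] inj)
  then show ?thesis by blast
qed

text \<open>The covector \<open>\<chi>\<close> and the vector \<open>v\<close> pick out one matrix entry, which is \<open>1\<close> for the identity and
  vanishes for all homomorphisms between different members.\<close>

definition orthogonal_family where
  "orthogonal_family r p q a b c A B C v \<chi> \<longleftrightarrow>
     (\<forall>s :: 'a. triple r p q a b c (A s) B C \<and> A s r = UNIV) \<and> covector \<chi> \<and> \<chi> v = 1 \<and>
     (\<forall>s t f. s \<noteq> t \<longrightarrow> s \<noteq> 0 \<longrightarrow> t \<noteq> 0 \<longrightarrow> lin f \<longrightarrow> (\<forall>i\<le>r. f ` A s i \<subseteq> A t i) \<longrightarrow>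
       (\<forall>k\<le>p. f ` B k \<subseteq> B k) \<longrightarrow> (\<forall>l\<le>q. f ` C l \<subseteq> C l) \<longrightarrow> \<chi> (f v) = 0)"

text \<open>The first \<open>n\<close> coordinates carry the pencil and the others a fixed coordinate flag, so that every
  homomorphism of the sums restricts to a homomorphism of the pencil after projection.\<close>

lemma pencil_family:
  fixes G H :: "'a \<Rightarrow> nat \<Rightarrow> ('a \<times> nat) list"
  assumes pen: "rigid_pencil u n ka kb kc G H" and k: "0 < ka" "0 < kb" "0 < kc"
    and SA: "SA \<subseteq> {..<r}" "\<forall>i\<in>SA. ka \<le> a i" "ka * card SA = n"
    and SB: "SB \<subseteq> {..<p}" "\<forall>i\<in>SB. kb \<le> b i" "kb * card SB = u"
    and SC: "SC \<subseteq> {..<q}" "\<forall>i\<in>SC. kc \<le> c i" "u + kc * card SC = n" and u: "0 < u"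
    and N0: "N = dim UNIV" and N: "(\<Sum>i<r. a i) = N" "(\<Sum>i<p. b i) + (\<Sum>i<q. c i) = N"
  shows "\<exists>A B C v \<chi>. orthogonal_family r p q a b c A B C v \<chi>"
proof -
  note fin = finite_subset[OF SA(1) finite_lessThan] finite_subset[OF SB(1) finite_lessThan] finite_subset[OF SC(1) finite_lessThan]
  define EA where "EA = (\<Sum>l<r. a l - (if l \<in> SA then ka else 0))"
  define EB where "EB = (\<Sum>l<p. b l - (if l \<in> SB then kb else 0))"
  define EC where "EC = (\<Sum>l<q. c l - (if l \<in> SC then kc else 0))"
  have NA: "N = n + EA" using sum_excess[OF SA(2), of r] SA N(1) unfolding EA_def by (simp add: Int_absorb2)
  have "(\<Sum>i<p. b i) = u + EB" using sum_excess[OF SB(2), of p] SB unfolding EB_def by (simp add: Int_absorb2)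
  moreover have "(\<Sum>i<q. c i) = kc * card SC + EC" using sum_excess[OF SC(2), of q] SC(1) unfolding EC_def by (simp add: Int_absorb2)
  ultimately have NB: "N = n + EB + EC" using N(2) SC(3) by simp
  have nN: "n \<le> N" "u \<le> n" "0 < n" using NA SC(3) u by simp_all
  obtain e \<psi> where e: "frame {..<N} e \<psi>" unfolding N0 using coordinates by blast
  note c\<psi> = frameD(1)[OF e, unfolded lessThan_iff]
  define vec where "vec g = (\<Sum>(d, j)\<leftarrow>g. d *s e j)" for g
  define cov where "cov h v = (\<Sum>(d, i)\<leftarrow>h. d * \<psi> i v)" for h v
  have pen1: "(\<Sum>(c, i)\<leftarrow>H s l. \<Sum>(d, j)\<leftarrow>G s k. if i = j then c * d else 0) = (if l = k then 1 else 0)"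
    if "l < n" "k < n" for s l k using pen that unfolding rigid_pencil_def by blast
  have supp: "i < n" if "l < n" "(d, i) \<in> set (H s l)" for s l d i
    using pen that unfolding rigid_pencil_def by blast
  have supp': "i < n" if "l < n" "(d, i) \<in> set (G s l)" for s l d i
    using pen that unfolding rigid_pencil_def by blast
  have lin_vec: "f (vec g) = (\<Sum>(d, j)\<leftarrow>g. d *s f (e j))" if "lin f" for f g
    unfolding vec_def by (induction g) (auto simp: lin_0[OF that] lin_add[OF that] lin_scale[OF that])
  have cov_sum: "\<chi> (\<Sum>(d, j)\<leftarrow>g. d *s y j) = (\<Sum>(d, j)\<leftarrow>g. d * \<chi> (y j))" if "covector \<chi>" for \<chi> g and y :: "nat \<Rightarrow> 'b"
    by (induction g) (auto simp: covectorD[OF that])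
  have cov: "covector (cov h)" if "\<forall>(d, i)\<in>set h. i < N" for h
    using that unfolding covector_def cov_def
    by (induction h) (auto simp: covectorD[OF c\<psi>] algebra_simps)
  have cov_expand: "cov h (\<Sum>(d, j)\<leftarrow>g. d *s y j) = (\<Sum>(c, i)\<leftarrow>h. \<Sum>(d, j)\<leftarrow>g. c * d * \<psi> i (y j))"
    if "\<forall>(d, i)\<in>set h. i < N" for h g and y :: "nat \<Rightarrow> 'b"
  proof -
    have one: "\<psi> i (\<Sum>(d, j)\<leftarrow>g. d *s y j) = (\<Sum>(d, j)\<leftarrow>g. d * \<psi> i (y j))" if "i < N" for i
      by (rule cov_sum[OF c\<psi>[OF that]])
    have "cov h (\<Sum>(d, j)\<leftarrow>g. d *s y j) = (\<Sum>(c, i)\<leftarrow>h. c * (\<Sum>(d, j)\<leftarrow>g. d * \<psi> i (y j)))"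
      using that unfolding cov_def by (induction h) (auto simp: one)
    then show ?thesis by (simp only: sum_list_scale)
  qed
  define w where "w s k = (if k < n then vec (G s k) else e k)" for s k
  define \<phi> where "\<phi> s l = (if l < n then cov (H s l) else \<psi> l)" for s l
  have suppN: "\<forall>(d, i)\<in>set (H s l). i < N" if "l < n" for s l using supp[OF that] nN(1) by fastforce
  have W: "frame {..<N} (w s) (\<phi> s)" for s
    unfolding frame_def
  proof (intro conjI ballI)
    show "covector (\<phi> s l)" if "l \<in> {..<N}" for l
      using that cov[OF suppN] c\<psi> unfolding \<phi>_def by auto
    fix l k assume "l \<in> {..<N}" "k \<in> {..<N}"
    then have lk: "l < N" "k < N" by auto
    have ee: "\<psi> i (e j) = (if i = j then 1 else 0)" if "i < N" "j < N" for i j using frameD(2)[OF e] that by simp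
    show "\<phi> s l (w s k) = (if l = k then 1 else 0)"
    proof (cases "l < n")
      case l: True
      show ?thesis
      proof (cases "k < n")
        case True
        have "\<phi> s l (w s k) = (\<Sum>(c, i)\<leftarrow>H s l. \<Sum>(d, j)\<leftarrow>G s k. c * d * \<psi> i (e j))"
          unfolding \<phi>_def w_def using l True cov_expand[OF suppN[OF l]] by (simp add: vec_def)
        also have "\<dots> = (\<Sum>(c, i)\<leftarrow>H s l. \<Sum>(d, j)\<leftarrow>G s k. if i = j then c * d else 0)"
        proof (intro arg_cong[where f = sum_list] map_cong refl, clarify, intro arg_cong[where f = sum_list] map_cong refl, clarify)
          fix c i d j assume "(c, i) \<in> set (H s l)" "(d, j) \<in> set (G s k)"
          then have "i < N" "j < N" using supp[OF l] supp'[OF True] nN(1) by (meson less_le_trans)+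
          then show "c * d * \<psi> i (e j) = (if i = j then c * d else 0)" using ee by simp
        qed
        finally show ?thesis using pen1[OF l True] by simp
      next
        case False
        have "cov h (e k) = 0" if "\<forall>(d, i)\<in>set h. i < n" for h
          using that lk(2) False nN(1) unfolding cov_def by (induction h) (auto simp: ee)
        then have "cov (H s l) (e k) = 0" using supp[OF l] by blast
        then show ?thesis using l False unfolding \<phi>_def w_def by auto
      qed
    next
      case l: False
      show ?thesis
      proof (cases "k < n")
        case True
        have "\<psi> l (vec g) = 0" if "\<forall>(d, i)\<in>set g. i < n" for g
          using that lk(1) l nN(1) unfolding vec_def by (induction g) (auto simp: ee covectorD[OF c\<psi>[OF lk(1)]])
        then have "\<psi> l (vec (G s k)) = 0" using supp'[OF True] by blast
        then show ?thesis using l True unfolding \<phi>_def w_def by auto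
      next
        case False
        then show ?thesis using l ee[OF lk] unfolding \<phi>_def w_def by simp
      qed
    qed
  qed
  let ?JA = "blocks 0 ka n SA a" and ?JB = "blocks 0 kb n SB b" and ?JC = "blocks u kc (n + EB) SC c"
  have yA: "0 + ka * card SA \<le> n" and yB: "0 + kb * card SB \<le> n" and yC: "u + kc * card SC \<le> n + EB"
    using SA(3) SB(3) SC(3) by simp_all
  have lastA: "?JA r = {..<N}" unfolding blocks_last[OF SA(1)] EA_def[symmetric] SA(3) using NA by auto
  have lastB: "?JB p = {0..<u} \<union> {n..<n + EB}" unfolding blocks_last[OF SB(1)] EB_def[symmetric] SB(3) by simp
  have lastC: "?JC q = {u..<n} \<union> {n + EB..<N}" unfolding blocks_last[OF SC(1)] EC_def[symmetric] SC(3) NB by simp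
  have subA: "?JA i \<subseteq> {..<N}" if "i \<le> r" for i
    using blocks_mono[OF that fin(1) SA(2) yA] unfolding lastA .
  have subB: "?JB i \<subseteq> {..<N}" if "i \<le> p" for i
    using blocks_mono[OF that fin(2) SB(2) yB] unfolding lastB using NB nN by fastforce
  have subC: "?JC i \<subseteq> {..<N}" if "i \<le> q" for i
    using blocks_mono[OF that fin(3) SC(2) yC] unfolding lastC using NB nN by fastforce
  define A where "A s i = span (w s ` ?JA i)" for s i
  define B where "B i = span (e ` ?JB i)" for i
  define C where "C i = span (e ` ?JC i)" for i
  have chA: "chain r a (A s)" for s unfolding A_def
    by (rule frame_chain[OF W]) (rule blocks_chain[OF fin(1) SA(2) yA] subA; assumption)+
  have chB: "chain p b B" unfolding B_def
    by (rule frame_chain[OF e]) (rule blocks_chain[OF fin(2) SB(2) yB] subB; assumption)+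
  have chC: "chain q c C" unfolding C_def
    by (rule frame_chain[OF e]) (rule blocks_chain[OF fin(3) SC(2) yC] subC; assumption)+
  have dis: "?JB p \<inter> ?JC q = {}" unfolding lastB lastC using nN(2) by auto
  have un: "?JB p \<union> ?JC q = {..<N}" unfolding lastB lastC using nN(2) NB by auto
  have full: "A s r = UNIV" for s unfolding A_def lastA using frame_complement(3)[OF N0 W, of "{}" "{..<N}"] by simp
  have tri: "triple r p q a b c (A s) B C" for s
    unfolding triple_def full using chA chB chC frame_complement(1,2)[OF N0 e dis un] unfolding B_def C_def by blast
  have orth: "\<psi> 0 (f (e 0)) = 0"
    if st: "s \<noteq> t" "s \<noteq> 0" "t \<noteq> 0" and f: "lin f" and fA: "\<forall>i\<le>r. f ` A s i \<subseteq> A t i"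
      and fB: "\<forall>k\<le>p. f ` B k \<subseteq> B k" and fC: "\<forall>l\<le>q. f ` C l \<subseteq> C l" for s t f
  proof -
    define m where "m i j = \<psi> i (f (e j))" for i j
    have m0: "m i j = 0" if ij: "i < n" "j < n" "\<not> block_upper u kb kc i j" for i j
    proof (cases "j < u")
      case True
      then have "j < 0 + kb * card SB" using SB(3) by simp
      from blocks_separate[OF SB(1) k(2) yB le0 this] obtain x where x: "x \<le> p" "j \<in> ?JB x"
        "\<forall>l. l < n \<longrightarrow> l \<in> ?JB x \<longrightarrow> 0 \<le> l \<and> l < 0 + kb * card SB \<and> (l - 0) div kb \<le> (j - 0) div kb" by blast
      have "i \<notin> ?JB x"
      proof
        assume "i \<in> ?JB x"
        then have "i < u" "i div kb \<le> j div kb" using x(3)[rule_format, OF ij(1)] SB(3) by simp_all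
        then show False using ij(3) True unfolding block_upper_def by simp
      qed
      moreover have "e j \<in> B x" unfolding B_def by (rule span_base[OF imageI[OF x(2)]])
      then have "f (e j) \<in> span (e ` ?JB x)" using fB x(1) unfolding B_def by blast
      ultimately show ?thesis unfolding m_def by (intro frame_span_zero[OF e subB[OF x(1)]]) (use ij nN in simp_all)
    next
      case False
      then have "u \<le> j" "j < u + kc * card SC" using SC(3) ij(2) by simp_all
      from blocks_separate[OF SC(1) k(3) yC this] obtain x where x: "x \<le> q" "j \<in> ?JC x"
        "\<forall>l. l < n + EB \<longrightarrow> l \<in> ?JC x \<longrightarrow> u \<le> l \<and> l < u + kc * card SC \<and> (l - u) div kc \<le> (j - u) div kc" by blast
      have "i \<notin> ?JC x"
      proof
        assume "i \<in> ?JC x"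
        then have "u \<le> i" "(i - u) div kc \<le> (j - u) div kc" using x(3)[rule_format, of i] ij(1) by simp_all
        then show False using ij(3) False unfolding block_upper_def by simp
      qed
      moreover have "e j \<in> C x" unfolding C_def by (rule span_base[OF imageI[OF x(2)]])
      then have "f (e j) \<in> span (e ` ?JC x)" using fC x(1) unfolding C_def by blast
      ultimately show ?thesis unfolding m_def by (intro frame_span_zero[OF e subC[OF x(1)]]) (use ij nN in simp_all)
    qed
    have mE: "(\<Sum>(c, i)\<leftarrow>H t l. \<Sum>(d, j)\<leftarrow>G s k. c * d * m i j) = 0"
      if lk: "l < n" "k < n" "k div ka < l div ka" for l k
    proof -
      have "k < 0 + ka * card SA" using SA(3) lk(2) by simp
      from blocks_separate[OF SA(1) \<open>0 < ka\<close> yA le0 this] obtain x where x: "x \<le> r" "k \<in> ?JA x"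
        "\<forall>l. l < n \<longrightarrow> l \<in> ?JA x \<longrightarrow> 0 \<le> l \<and> l < 0 + ka * card SA \<and> (l - 0) div ka \<le> (k - 0) div ka" by blast
      have l: "l \<notin> ?JA x" using x(3)[rule_format, OF lk(1)] lk(3) by auto
      have "w s k \<in> A s x" unfolding A_def by (rule span_base[OF imageI[OF x(2)]])
      then have "f (w s k) \<in> span (w t ` ?JA x)" using fA x(1) unfolding A_def by blast
      then have "\<phi> t l (f (w s k)) = 0"
        by (intro frame_span_zero[OF W subA[OF x(1)] _ l]) (use lk nN in simp)
      then show ?thesis unfolding \<phi>_def w_def m_def using lk(1,2) cov_expand[OF suppN[OF lk(1)]]
        by (simp add: lin_vec[OF f])
    qed
    have "\<forall>m. (\<forall>i j. i < n \<longrightarrow> j < n \<longrightarrow> \<not> block_upper u kb kc i j \<longrightarrow> m i j = 0) \<longrightarrow>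
       (\<forall>l k. l < n \<longrightarrow> k < n \<longrightarrow> k div ka < l div ka \<longrightarrow>
          (\<Sum>(c, i)\<leftarrow>H t l. \<Sum>(d, j)\<leftarrow>G s k. c * d * m i j) = 0) \<longrightarrow> m 0 0 = 0"
      using pen st unfolding rigid_pencil_def by simp
    from this[rule_format, of m, OF m0 mE] show ?thesis unfolding m_def .
  qed
  have "\<psi> 0 (e 0) = 1" using frameD(2)[OF e, of 0 0] nN by simp
  moreover have "covector (\<psi> 0)" by (rule c\<psi>) (use nN in simp)
  ultimately have "orthogonal_family r p q a b c A B C (e 0) (\<psi> 0)"
    unfolding orthogonal_family_def using tri full orth by simp
  then show ?thesis by (intro exI)
qed

lemma ssum_commute: "ssum S T = ssum T S"
proof -
  have "ssum S T \<subseteq> ssum T S" for S T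
  proof
    fix x assume "x \<in> ssum S T"
    then obtain y z where yz: "y \<in> S" "z \<in> T" "x = y + z" by blast
    have "x = z + y" unfolding yz(3) by (rule add.commute)
    then show "x \<in> ssum T S" using yz(1,2) by blast
  qed
  from this[of S T] this[of T S] show ?thesis by (rule antisym)
qed

lemma triple_swap: "triple r p q a b c A B C \<Longrightarrow> triple r q p a c b A C B"
  unfolding triple_def ssum_commute[of "C q"] Int_commute[of "C q"] by (elim conjE) (intro conjI)

lemma orthogonal_family_swap:
  "orthogonal_family r p q a b c A B C v \<chi> \<Longrightarrow> orthogonal_family r q p a c b A C B v \<chi>"
  unfolding orthogonal_family_def by (simp add: triple_swap)

end

lemma pencil_exists:
  assumes "(ma, ka, mb, kb, mc, kc) \<in> {(4,1,2,1,2,1), (3,2,3,1,3,1), (3,3,2,2,5,1), (4,2,1,3,5,1), (5,1,1,2,3,1), (7,1,1,3,2,2)}"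
  shows "\<exists>G H. rigid_pencil (kb * mb) (ka * ma) ka kb kc G (H :: 'k::field \<Rightarrow> _) \<and> 0 < ka \<and> 0 < kb \<and> 0 < kc \<and> 0 < mb \<and>
    kb * mb + kc * mc = ka * ma"
proof -
  have ex: ?thesis if "rigid_pencil u n ka kb kc G (H :: 'k \<Rightarrow> _)" "u = kb * mb" "n = ka * ma" "0 < ka" "0 < kb" "0 < kc" "0 < mb"
    "kb * mb + kc * mc = ka * ma" for u n G H
    by (rule exI[of _ G], rule exI[of _ H]) (use that in simp)
  from assms show ?thesis
    unfolding insert_iff empty_iff prod.inject simp_thms
  proof (elim disjE conjE)
    assume e: "ma = 4" "ka = 1" "mb = 2" "kb = 1" "mc = 2" "kc = 1"
    show ?thesis by (rule ex, unfold e, rule pencil_4_1_2_1_2_1) simp_all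
  next
    assume e: "ma = 3" "ka = 2" "mb = 3" "kb = 1" "mc = 3" "kc = 1"
    show ?thesis by (rule ex, unfold e, rule pencil_3_2_3_1_3_1) simp_all
  next
    assume e: "ma = 3" "ka = 3" "mb = 2" "kb = 2" "mc = 5" "kc = 1"
    show ?thesis by (rule ex, unfold e, rule pencil_3_3_2_2_5_1) simp_all
  next
    assume e: "ma = 4" "ka = 2" "mb = 1" "kb = 3" "mc = 5" "kc = 1"
    show ?thesis by (rule ex, unfold e, rule pencil_4_2_1_3_5_1) simp_all
  next
    assume e: "ma = 5" "ka = 1" "mb = 1" "kb = 2" "mc = 3" "kc = 1"
    show ?thesis by (rule ex, unfold e, rule pencil_5_1_1_2_3_1) simp_all
  next
    assume e: "ma = 7" "ka = 1" "mb = 1" "kb = 3" "mc = 2" "kc = 2"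
    show ?thesis by (rule ex, unfold e, rule pencil_7_1_1_3_2_2) simp_all
  qed
qed

context closed_ambient begin

text \<open>Six of the shapes have their own pencil; the others arise by interchanging the second and the third
  flag.\<close>

lemma critical_family:
  assumes crit: "critical r p q a b c" and N: "(\<Sum>i<r. a i) = dim UNIV" "(\<Sum>i<p. b i) + (\<Sum>i<q. c i) = dim UNIV"
  shows "\<exists>A B C v \<chi>. orthogonal_family r p q a b c A B C v \<chi>"
proof -
  let ?D = "{(4,1,2,1,2,1), (3,2,3,1,3,1), (3,3,2,2,5,1), (4,2,1,3,5,1), (5,1,1,2,3,1), (7,1,1,3,2,2)} :: (nat \<times> nat \<times> nat \<times> nat \<times> nat \<times> nat) set"
  have main: "\<exists>A B C v \<chi>. orthogonal_family r p q a b c A B C v \<chi>"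
    if D: "(ma, ka, mb, kb, mc, kc) \<in> ?D"
      and m: "ma \<le> card (parts_ge r a ka)" "mb \<le> card (parts_ge p b kb)" "mc \<le> card (parts_ge q c kc)"
      and N: "(\<Sum>i<r. a i) = dim UNIV" "(\<Sum>i<p. b i) + (\<Sum>i<q. c i) = dim UNIV"
    for ma ka mb kb mc kc p q b c
  proof -
    obtain SA where SA: "SA \<subseteq> parts_ge r a ka" "card SA = ma" using obtain_subset_with_card_n[OF m(1)] by blast
    obtain SB where SB: "SB \<subseteq> parts_ge p b kb" "card SB = mb" using obtain_subset_with_card_n[OF m(2)] by blast
    obtain SC where SC: "SC \<subseteq> parts_ge q c kc" "card SC = mc" using obtain_subset_with_card_n[OF m(3)] by blast
    obtain G H where P: "rigid_pencil (kb * mb) (ka * ma) ka kb kc G (H :: 'k \<Rightarrow> _)" "0 < ka" "0 < kb" "0 < kc" "0 < mb"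
      "kb * mb + kc * mc = ka * ma" using pencil_exists[OF D] by (elim exE conjE)
    have sub: "S \<subseteq> {..<r}" "\<forall>i\<in>S. k \<le> f i" if "S \<subseteq> parts_ge r f k" for S r f k
      using that unfolding parts_ge_def by auto
    show ?thesis
      by (rule pencil_family[OF P(1-4) sub[OF SA(1)] _ sub[OF SB(1)] _ sub[OF SC(1)] _ _ refl N]) (simp_all only: SA(2) SB(2) SC(2) P(3,5,6) nat_0_less_mult_iff simp_thms)
  qed
  from crit obtain ma ka mb kb mc kc where s: "(ma, ka, mb, kb, mc, kc) \<in> critical_shapes"
    "ma \<le> card (parts_ge r a ka)" "mb \<le> card (parts_ge p b kb)" "mc \<le> card (parts_ge q c kc)"
    unfolding critical_def by (elim bexE) (simp split: prod.splits)
  have "(ma, ka, mb, kb, mc, kc) \<in> ?D \<or> (ma, ka, mc, kc, mb, kb) \<in> ?D"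
    using s(1) unfolding critical_shapes_def insert_iff empty_iff prod.inject simp_thms
    by (elim disjE conjE; simp)
  then show ?thesis
  proof
    assume "(ma, ka, mb, kb, mc, kc) \<in> ?D"
    from main[OF this s(2-4) N] show ?thesis .
  next
    assume "(ma, ka, mc, kc, mb, kb) \<in> ?D"
    from main[OF this s(2,4,3) N(1) trans[OF add.commute N(2)]] obtain A C B v \<chi> where "orthogonal_family r q p a c b A C B v \<chi>"
      by (elim exE)
    from orthogonal_family_swap[OF this] show ?thesis by (intro exI)
  qed
qed

text \<open>By the pigeonhole principle infinitely many members \<open>s\<close> have isomorphisms \<open>g s\<close> to one triple. The
  vectors \<open>g s v\<close> are independent, because \<open>\<chi>\<close> composed with the inverse of \<open>g t\<close> sends \<open>g s v\<close> to an entry of a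
  homomorphism from the member \<open>s\<close> to the member \<open>t\<close>.\<close>

lemma orthogonal_family_infinite:
  assumes F: "orthogonal_family r p q a b c A B C v \<chi>" and S: "finite S"
    and cov: "\<And>s. \<exists>(A', B', C')\<in>S. triple_iso r p q (A s) B C A' B' C'"
  shows False
proof -
  note F = F[unfolded orthogonal_family_def]
  have full: "A s r = UNIV" for s using F by blast
  have \<chi>: "covector \<chi>" "\<chi> v = 1" using F by blast+
  have "\<forall>s. \<exists>x. x \<in> S \<and> (case x of (A', B', C') \<Rightarrow> triple_iso r p q (A s) B C A' B' C')"
    using cov unfolding Bex_def by simp
  from choice[OF this] obtain y where y: "\<forall>s. y s \<in> S \<and> (case y s of (A', B', C') \<Rightarrow> triple_iso r p q (A s) B C A' B' C')" ..
  \<comment> \<open>The parameter \<open>0\<close> is left out because orthogonality is only known between non-zero parameters.\<close>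
  let ?T = "UNIV - {0 :: 'k}"
  have "infinite ?T" by (simp add: infinite_UNIV_char_0)
  moreover have "finite (y ` ?T)" by (rule finite_subset[OF _ S]) (use y in blast)
  ultimately obtain s0 where s0: "infinite {s \<in> ?T. y s = y s0}" using pigeonhole_infinite by blast
  define T where "T = {s \<in> ?T. y s = y s0}"
  obtain A' B' C' where y0: "y s0 = (A', B', C')" by (metis prod.exhaust)
  have iso: "triple_iso r p q (A s) B C A' B' C'" if "s \<in> T" for s
    using spec[OF y, of s] that y0 unfolding T_def by simp
  have "\<exists>g h. lin g \<and> lin h \<and> (\<forall>x. h (g x) = x) \<and> (\<forall>i\<le>r. g ` A s i = A' i) \<and> (\<forall>k\<le>p. g ` B k = B' k) \<and> (\<forall>l\<le>q. g ` C l = C' l)"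
    if "s \<in> T" for s
  proof -
    from iso[OF that] obtain g where g: "lin g" "inj_on g (A s r)" "\<forall>i\<le>r. g ` A s i = A' i" "\<forall>k\<le>p. g ` B k = B' k" "\<forall>l\<le>q. g ` C l = C' l"
      by (rule triple_isoE)
    obtain h where h: "lin h" "\<forall>x\<in>UNIV. h (g x) = x" using left_inverse_on[OF g(1) subspace_UNIV] g(2) unfolding full by blast
    show ?thesis by (rule exI[of _ g], rule exI[of _ h]) (use g h in simp)
  qed
  then have "\<forall>s\<in>T. \<exists>gh. lin (fst gh) \<and> lin (snd gh) \<and> (\<forall>x. snd gh (fst gh x) = x) \<and> (\<forall>i\<le>r. fst gh ` A s i = A' i) \<and>
      (\<forall>k\<le>p. fst gh ` B k = B' k) \<and> (\<forall>l\<le>q. fst gh ` C l = C' l)" by simp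
  from bchoice[OF this] obtain gh where gh: "\<forall>s\<in>T. lin (fst (gh s)) \<and> lin (snd (gh s)) \<and> (\<forall>x. snd (gh s) (fst (gh s) x) = x) \<and>
      (\<forall>i\<le>r. fst (gh s) ` A s i = A' i) \<and> (\<forall>k\<le>p. fst (gh s) ` B k = B' k) \<and> (\<forall>l\<le>q. fst (gh s) ` C l = C' l)" ..
  define g where "g s = fst (gh s)" for s
  define h where "h s = snd (gh s)" for s
  have g: "lin (g s)" "lin (h s)" "\<And>x. h s (g s x) = x" "\<And>i. i \<le> r \<Longrightarrow> g s ` A s i = A' i"
    "\<And>i. i \<le> p \<Longrightarrow> g s ` B i = B' i" "\<And>i. i \<le> q \<Longrightarrow> g s ` C i = C' i" if "s \<in> T" for s
    using bspec[OF gh that] unfolding g_def h_def by simp_all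
  have pull: "(\<lambda>x. h t (g s x)) ` X = Y" if t: "t \<in> T" and XY: "g s ` X = Z" "g t ` Y = Z" for s t X Y Z
  proof -
    have "(\<lambda>x. h t (g s x)) ` X = h t ` (g t ` Y)" unfolding XY(2) XY(1)[symmetric] by (rule image_image[symmetric])
    also have "\<dots> = (\<lambda>x. x) ` Y" unfolding image_image g(3)[OF t] ..
    finally show ?thesis by simp
  qed
  have "frame T (\<lambda>s. g s v) (\<lambda>t x. \<chi> (h t x))"
    unfolding frame_def
  proof (intro conjI ballI)
    show "covector (\<lambda>x. \<chi> (h t x))" if "t \<in> T" for t
      unfolding covector_def by (simp add: lin_add[OF g(2)[OF that]] lin_scale[OF g(2)[OF that]] covectorD[OF \<chi>(1)])
    fix t s assume t: "t \<in> T" and s: "s \<in> T"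
    show "\<chi> (h t (g s v)) = (if t = s then 1 else 0)"
    proof (cases "t = s")
      case True
      then show ?thesis using g(3)[OF t] \<chi>(2) by simp
    next
      case False
      have ne: "s \<noteq> t" "s \<noteq> 0" "t \<noteq> 0" using False s t unfolding T_def by auto
      have "lin (\<lambda>x. h t (g s x))" by (rule lin_compose_app[OF g(2)[OF t] g(1)[OF s]])
      moreover have "\<forall>i\<le>r. (\<lambda>x. h t (g s x)) ` A s i \<subseteq> A t i"
        by (intro allI impI equalityD1 pull[OF t]) (rule g(4)[OF s] g(4)[OF t]; assumption)+
      moreover have "\<forall>i\<le>p. (\<lambda>x. h t (g s x)) ` B i \<subseteq> B i"
        by (intro allI impI equalityD1 pull[OF t]) (rule g(5)[OF s] g(5)[OF t]; assumption)+
      moreover have "\<forall>i\<le>q. (\<lambda>x. h t (g s x)) ` C i \<subseteq> C i"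
        by (intro allI impI equalityD1 pull[OF t]) (rule g(6)[OF s] g(6)[OF t]; assumption)+
      ultimately have "\<chi> (h t (g s v)) = 0" using F[THEN conjunct2, THEN conjunct2, THEN conjunct2, rule_format, OF ne, of "\<lambda>x. h t (g s x)"] by simp
      then show ?thesis using False by simp
    qed
  qed
  from frame_indep[OF this] have "finite T" using finiteI_independent finite_imageD by blast
  then show False using s0 unfolding T_def by simp
qed

end

section \<open>Critical summands\<close>

text \<open>In the semigroup the last parts of the second and third partition are determined by the others, so
  its elements are parametrised by the first partition and the two truncated ones.\<close>

definition joint :: "partition \<Rightarrow> partition \<Rightarrow> partition \<Rightarrow> partition_triple" where
  "joint a b c = (a, b @ [sum_list c], c @ [sum_list b])"

lemma joint_inject: "joint a b c = joint a' b' c' \<longleftrightarrow> a = a' \<and> b = b' \<and> c = c'"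
  unfolding joint_def by auto

lemma joint_in_LambdaJ:
  "joint a b c \<in> LambdaJ r (Suc p) (Suc q) \<longleftrightarrow>
     length a = r \<and> length b = p \<and> length c = q \<and> sum_list a = sum_list b + sum_list c"
  unfolding LambdaJ_def joint_def by auto

lemma LambdaJ_joint:
  assumes "d \<in> LambdaJ r (Suc p) (Suc q)" obtains a b c where "d = joint a b c"
proof -
  obtain a b c where d: "d = (a, b, c)" by (metis prod.exhaust)
  have l: "length b = Suc p" "length c = Suc q" and s: "sum_list a = sum_list b" "sum_list b = sum_list c"
    "sum_list a = sum_list (butlast b) + sum_list (butlast c)"
    using assms unfolding d LambdaJ_def by simp_all
  have b: "butlast b @ [last b] = b" and c: "butlast c @ [last c] = c" using l by (auto intro: append_butlast_last_id)
  have "sum_list b = sum_list (butlast b) + last b" "sum_list c = sum_list (butlast c) + last c"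
    using arg_cong[OF b, of sum_list] arg_cong[OF c, of sum_list] by simp_all
  then have "last b = sum_list (butlast c)" "last c = sum_list (butlast b)" using s by simp_all
  then have "d = joint a (butlast b) (butlast c)" using b c unfolding d joint_def by simp
  then show thesis by (rule that)
qed

lemma sum_list_map2_add:
  fixes x y :: "nat list"
  shows "length x = length y \<Longrightarrow> sum_list (map2 (+) x y) = sum_list x + sum_list y"
  by (induction x y rule: list_induct2) simp_all

lemma add_joint:
  assumes "length a = length a'" "length b = length b'" "length c = length c'"
  shows "add_triple (joint a b c) (joint a' b' c') = joint (map2 (+) a a') (map2 (+) b b') (map2 (+) c c')"
  using assms unfolding add_triple_def joint_def by (simp add: sum_list_map2_add)

lemma sum_list_upt: "sum_list (map f [0..<n]) = (\<Sum>i<n. f i)"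
  by (induction n) simp_all

lemma plus_partition_constant:
  assumes S: "S \<subseteq> {..<n}" and k: "0 < (k :: nat)"
  shows "plus_partition (map (\<lambda>i. if i \<in> S then k else 0) [0..<n]) = replicate (card S) k"
    "sum_list (map (\<lambda>i. if i \<in> S then k else 0) [0..<n]) = k * card S"
proof -
  let ?x = "map (\<lambda>i. if i \<in> S then k else 0) [0..<n]"
  let ?y = "filter (\<lambda>m. m \<noteq> 0) ?x"
  have "length ?y = card {i. i < length ?x \<and> ?x ! i \<noteq> 0}" by (rule length_filter_conv_card)
  also have "{i. i < length ?x \<and> ?x ! i \<noteq> 0} = S" using S k by (auto split: if_splits)
  finally have l: "length ?y = card S" .
  have "\<forall>z\<in>set ?y. z = k" by auto
  then have "replicate (length ?y) k = ?y" by (intro replicate_length_same) blast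
  then have "?y = replicate (card S) k" unfolding l by simp
  then show "plus_partition ?x = replicate (card S) k"
    unfolding plus_partition_def by (simp only:) (simp add: sorted_sort_id)
  have "sum_list ?x = (\<Sum>i<n. if i \<in> S then k else 0)" by (rule sum_list_upt)
  also have "\<dots> = (\<Sum>i\<in>{..<n} \<inter> S. k)" by (rule sum.inter_restrict[symmetric]) simp
  also have "{..<n} \<inter> S = S" using S by blast
  finally show "sum_list ?x = k * card S" by simp
qed

text \<open>The non-zero parts of \<open>x\<close> all equal \<open>k\<close>, and each of them bounds a part of \<open>y\<close> from below.\<close>

lemma parts_of_constant_plus:
  assumes x: "plus_partition x = replicate m k" and le: "\<And>i. i < length x \<Longrightarrow> x ! i \<le> y ! i"
  shows "m \<le> card (parts_ge (length x) ((!) y) k)"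
proof -
  let ?T = "{i. i < length x \<and> x ! i \<noteq> 0}"
  have "m = length (plus_partition x)" unfolding x by simp
  also have "\<dots> = card ?T" unfolding plus_partition_def by (simp add: length_filter_conv_card)
  also have "\<dots> \<le> card (parts_ge (length x) ((!) y) k)"
  proof (rule card_mono[OF finite_parts_ge], rule subsetI)
    fix i assume "i \<in> ?T"
    then have i: "i < length x" "x ! i \<noteq> 0" by simp_all
    then have "x ! i \<in> set (plus_partition x)" unfolding plus_partition_def by simp
    then have "x ! i = k" unfolding x by simp
    then show "i \<in> parts_ge (length x) ((!) y) k" using i(1) le[OF i(1)] unfolding parts_ge_def by simp
  qed
  finally show ?thesis .
qed

definition shape_triple :: "nat \<times> nat \<times> nat \<times> nat \<times> nat \<times> nat \<Rightarrow> partition_triple" where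
  "shape_triple = (\<lambda>(ma, ka, mb, kb, mc, kc).
     (replicate ma ka, replicate mb kb @ [kc * mc], replicate mc kc @ [kb * mb]))"

lemma critical_triples_shapes: "critical_triples = shape_triple ` critical_shapes"
  unfolding critical_triples_def critical_shapes_def shape_triple_def image_insert image_empty prod.case
  by (simp add: numeral_eq_Suc insert_commute)

lemma critical_shapes_balanced:
  assumes "(ma, ka, mb, kb, mc, kc) \<in> critical_shapes"
  shows "0 < ka" "0 < kb" "0 < kc" "0 < ma" "ka * ma = kb * mb + kc * mc"
  using assms unfolding critical_shapes_def insert_iff empty_iff prod.inject simp_thms
  by (elim disjE conjE; simp)+

text \<open>Conversely to a comparison of parts, a summand is built by choosing as many parts as the shape
  demands and replacing each by the constant of the shape; the rest stays in the semigroup because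
  the shapes satisfy the same linear equation.\<close>

lemma summand_iff_critical:
  assumes len: "length a = r" "length b = p" "length c = q" and sum: "sum_list a = sum_list b + sum_list c"
  shows "(\<exists>d'. is_summand r (Suc p) (Suc q) d' (joint a b c) \<and> plus_triple d' \<in> critical_triples) \<longleftrightarrow>
    critical r p q ((!) a) ((!) b) ((!) c)"
proof
  assume "\<exists>d'. is_summand r (Suc p) (Suc q) d' (joint a b c) \<and> plus_triple d' \<in> critical_triples"
  then obtain d' e where d': "d' \<in> LambdaJ r (Suc p) (Suc q)" "e \<in> LambdaJ r (Suc p) (Suc q)"
    "joint a b c = add_triple d' e" "plus_triple d' \<in> critical_triples"
    unfolding is_summand_def by blast
  obtain a' b' c' where x: "d' = joint a' b' c'" using LambdaJ_joint[OF d'(1)] .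
  obtain ae be ce where y: "e = joint ae be ce" using LambdaJ_joint[OF d'(2)] .
  have l: "length a' = r" "length b' = p" "length c' = q" "length ae = r" "length be = p" "length ce = q"
    using d'(1,2) unfolding x y joint_in_LambdaJ by simp_all
  have abc: "a = map2 (+) a' ae" "b = map2 (+) b' be" "c = map2 (+) c' ce"
    using d'(3) l unfolding x y by (simp_all add: add_joint joint_inject)
  have le: "v ! i \<le> map2 (+) v w ! i" if "length v = length w" "i < length v" for v w :: "nat list" and i
    using that by simp
  from d'(4) obtain s where s: "s \<in> critical_shapes" "plus_triple d' = shape_triple s"
    unfolding critical_triples_shapes by blast
  obtain ma ka mb kb mc kc where s6: "s = (ma, ka, mb, kb, mc, kc)" by (metis prod.exhaust)
  have "plus_partition a' = replicate ma ka" "plus_partition b' = replicate mb kb" "plus_partition c' = replicate mc kc"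
    using s(2) unfolding x s6 plus_triple_def joint_def shape_triple_def by simp_all
  then have "ma \<le> card (parts_ge (length a') ((!) a) ka)" "mb \<le> card (parts_ge (length b') ((!) b) kb)"
    "mc \<le> card (parts_ge (length c') ((!) c) kc)"
    unfolding abc using l le by (metis parts_of_constant_plus)+
  then show "critical r p q ((!) a) ((!) b) ((!) c)"
    unfolding critical_def l(1-3) by (intro bexI[OF _ s(1)]) (simp add: s6)
next
  assume "critical r p q ((!) a) ((!) b) ((!) c)"
  then obtain ma ka mb kb mc kc where s: "(ma, ka, mb, kb, mc, kc) \<in> critical_shapes"
    "ma \<le> card (parts_ge r ((!) a) ka)" "mb \<le> card (parts_ge p ((!) b) kb)" "mc \<le> card (parts_ge q ((!) c) kc)"
    unfolding critical_def by (elim bexE) (simp split: prod.splits)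
  note k = critical_shapes_balanced[OF s(1)]
  have part: "\<exists>u v. length u = length x \<and> length v = length x \<and> map2 (+) u v = x \<and>
      plus_partition u = replicate m k \<and> sum_list u = k * m"
    if m: "m \<le> card (parts_ge (length x) ((!) x) k)" and k: "0 < k" for m k and x :: "nat list"
  proof -
    obtain S where S: "S \<subseteq> parts_ge (length x) ((!) x) k" "card S = m" using obtain_subset_with_card_n[OF m] by blast
    have Sn: "S \<subseteq> {..<length x}" and Sk: "\<And>i. i \<in> S \<Longrightarrow> k \<le> x ! i" using S(1) unfolding parts_ge_def by auto
    let ?f = "\<lambda>i. if i \<in> S then k else 0"
    have "map2 (+) (map ?f [0..<length x]) (map (\<lambda>i. x ! i - ?f i) [0..<length x]) = x"
      by (rule nth_equalityI) (use Sk in auto)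
    then show ?thesis using plus_partition_constant[OF Sn k] S(2)
      by (intro exI[of _ "map ?f [0..<length x]"] exI[of _ "map (\<lambda>i. x ! i - ?f i) [0..<length x]"]) simp
  qed
  obtain a' ae where A: "length a' = r" "length ae = r" "map2 (+) a' ae = a" "plus_partition a' = replicate ma ka" "sum_list a' = ka * ma"
    using part[of ma a ka] s(2) k(1) len(1) by auto
  obtain b' be where B: "length b' = p" "length be = p" "map2 (+) b' be = b" "plus_partition b' = replicate mb kb" "sum_list b' = kb * mb"
    using part[of mb b kb] s(3) k(2) len(2) by auto
  obtain c' ce where C: "length c' = q" "length ce = q" "map2 (+) c' ce = c" "plus_partition c' = replicate mc kc" "sum_list c' = kc * mc"
    using part[of mc c kc] s(4) k(3) len(3) by auto
  have sums: "sum_list a = sum_list a' + sum_list ae" "sum_list b = sum_list b' + sum_list be" "sum_list c = sum_list c' + sum_list ce"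
    unfolding A(3)[symmetric] B(3)[symmetric] C(3)[symmetric] by (rule sum_list_map2_add; simp add: A B C)+
  have d: "joint a' b' c' \<in> LambdaJ r (Suc p) (Suc q)"
    unfolding joint_in_LambdaJ using A(1,5) B(1,5) C(1,5) k(5) by simp
  have e: "joint ae be ce \<in> LambdaJ r (Suc p) (Suc q)"
    unfolding joint_in_LambdaJ using A(2,5) B(2,5) C(2,5) k(5) sums sum by simp
  have "joint a b c = add_triple (joint a' b' c') (joint ae be ce)"
    using A(1-3) B(1-3) C(1-3) by (simp add: add_joint)
  moreover have "joint a' b' c' \<noteq> zero_triple r (Suc p) (Suc q)"
  proof
    assume "joint a' b' c' = zero_triple r (Suc p) (Suc q)"
    then have "a' = replicate r 0" unfolding joint_def zero_triple_def by simp
    then have "sum_list a' = 0" by (simp add: sum_list_replicate)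
    then show False using A(5) k(1,4) by simp
  qed
  moreover have "plus_triple (joint a' b' c') = shape_triple (ma, ka, mb, kb, mc, kc)"
    unfolding plus_triple_def joint_def shape_triple_def using A(4) B(4,5) C(4,5) by simp
  then have "plus_triple (joint a' b' c') \<in> critical_triples"
    unfolding critical_triples_shapes using s(1) by (metis imageI)
  ultimately show "\<exists>d'. is_summand r (Suc p) (Suc q) d' (joint a b c) \<and> plus_triple d' \<in> critical_triples"
    unfolding is_summand_def using d e by blast
qed

section \<open>Orbits of joint flag varieties\<close>

context closed_ambient begin

lemma Jl_triple:
  assumes x: "(A, B, C) \<in> Jl scale (joint a b c)"
  defines "r \<equiv> length a" and "p \<equiv> length b" and "q \<equiv> length c"
  shows "triple r p q ((!) a) ((!) b) ((!) c) ((!) A) ((!) B) ((!) C)" "A ! r = UNIV"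
    "B ! Suc p = UNIV" "C ! Suc q = UNIV" "length A = Suc r" "length B = Suc (Suc p)" "length C = Suc (Suc q)"
proof -
  have F: "A \<in> Fl scale a" "B \<in> Fl scale (b @ [sum_list c])" "C \<in> Fl scale (c @ [sum_list b])"
    and D: "is_direct_sum (B ! p) (C ! q)"
    using x unfolding Jl_def joint_def p_def q_def by auto
  have chA: "chain r ((!) a) ((!) A)" using F(1) unfolding Fl_def chain_def r_def by simp
  have chB: "chain p ((!) b) ((!) B)" using F(2) unfolding Fl_def chain_def p_def by (simp add: nth_append)
  have chC: "chain q ((!) c) ((!) C)" using F(3) unfolding Fl_def chain_def q_def by (simp add: nth_append)
  show A: "A ! r = UNIV" using F(1) unfolding Fl_def r_def by simp
  show "B ! Suc p = UNIV" "C ! Suc q = UNIV" "length A = Suc r" "length B = Suc (Suc p)" "length C = Suc (Suc q)"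
    using F unfolding Fl_def r_def p_def q_def by simp_all
  show "triple r p q ((!) a) ((!) b) ((!) c) ((!) A) ((!) B) ((!) C)"
    unfolding triple_def A using chA chB chC D[unfolded is_direct_sum_def] by (intro conjI) (assumption | elim conjE | rule sym)+
qed

lemma triple_Jl:
  assumes t: "triple r p q ((!) a) ((!) b) ((!) c) A B C" and A: "A r = UNIV"
    and len: "length a = r" "length b = p" "length c = q"
    and sum: "sum_list a = sum_list b + sum_list c" "dim UNIV = sum_list a"
  shows "(map A [0..<Suc r], map B [0..<Suc p] @ [UNIV], map C [0..<Suc q] @ [UNIV]) \<in> Jl scale (joint a b c)"
proof -
  note d = tripleD[OF t]
  have sl: "sum_list x = (\<Sum>i<length x. x ! i)" for x :: "nat list"
    by (simp add: sum_list_sum_nth atLeast0LessThan)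
  have flag: "map B [0..<Suc p] @ [UNIV] \<in> Fl scale (b @ [n])"
    if ch: "chain p ((!) b) B" and len: "length b = p" and n: "dim UNIV = sum_list b + n" for p b B n
  proof -
    have D: "dim (B p) = sum_list b" using chain_dim[OF ch order_refl] sl[of b] len by simp
    let ?L = "map B [0..<Suc p] @ [UNIV]"
    have L: "?L ! i = B i" if "i \<le> p" for i using that by (simp add: nth_append del: upt_Suc)
    have L': "?L ! Suc p = UNIV" by (simp add: nth_append del: upt_Suc)
    show ?thesis unfolding Fl_def
    proof (intro CollectI conjI allI impI)
      show "length ?L = length (b @ [n]) + 1" using len by simp
      show "?L ! 0 = {0}" using L[of 0] chainD(1)[OF ch] by simp
      show "?L ! length (b @ [n]) = UNIV" using L' len by simp
      show "subspace (?L ! i)" if "i \<le> length (b @ [n])" for i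
      proof (cases "i \<le> p")
        case True then show ?thesis using L chainD(2)[OF ch] by simp
      next
        case False
        then have "i = Suc p" using that len by simp
        then show ?thesis using L' by (simp only: subspace_UNIV)
      qed
      fix i assume i: "i < length (b @ [n])"
      show "?L ! i \<subseteq> ?L ! (i + 1)" "dim (?L ! (i + 1)) = dim (?L ! i) + (b @ [n]) ! i"
      proof (atomize (full), cases "i < p")
        case True
        then show "?L ! i \<subseteq> ?L ! (i + 1) \<and> dim (?L ! (i + 1)) = dim (?L ! i) + (b @ [n]) ! i"
          using L[of i] L[of "Suc i"] chainD(3,4)[OF ch True] len by (simp only: Suc_eq_plus1[symmetric] nth_append) simp
      next
        case False
        then have "i = p" using i len by simp
        then show "?L ! i \<subseteq> ?L ! (i + 1) \<and> dim (?L ! (i + 1)) = dim (?L ! i) + (b @ [n]) ! i"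
          using L[of p] L' D n len by (simp only: Suc_eq_plus1[symmetric] nth_append) simp
      qed
    qed
  qed
  have LA: "map A [0..<Suc r] ! i = A i" if "i \<le> r" for i using that by (simp del: upt_Suc)
  have "map A [0..<Suc r] \<in> Fl scale a"
    unfolding Fl_def using LA chainD[OF d(1)] A len(1) by (simp del: upt_Suc)
  moreover have "map B [0..<Suc p] @ [UNIV] \<in> Fl scale (b @ [sum_list c])"
    by (rule flag[OF d(2) len(2)]) (use sum in simp)
  moreover have "map C [0..<Suc q] @ [UNIV] \<in> Fl scale (c @ [sum_list b])"
    by (rule flag[OF d(3) len(3)]) (use sum in simp)
  moreover have "is_direct_sum (B p) (C q)"
    unfolding is_direct_sum_def using d(4,5) unfolding A by (intro conjI) (assumption | rule sym)+
  ultimately show ?thesis unfolding Jl_def joint_def using len by (simp add: nth_append del: upt_Suc)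
qed

lemma GL_image_iso:
  assumes "g \<in> GL scale" "length A = Suc r" "length B = Suc (Suc p)" "length C = Suc (Suc q)" "act g (A, B, C) = (A', B', C')"
  shows "triple_iso r p q ((!) A) ((!) B) ((!) C) ((!) A') ((!) B') ((!) C')"
proof -
  have g: "lin g" "inj g" using assms(1) unfolding GL_def by (simp_all add: bij_is_inj)
  have im: "A' = map (image g) A" "B' = map (image g) B" "C' = map (image g) C" using assms(5) unfolding act_def by simp_all
  have "inj_on g S" for S by (rule inj_on_subset[OF g(2) subset_UNIV])
  then show ?thesis unfolding triple_iso_def im
    by (intro exI[of _ g] conjI allI impI g(1)) (simp_all add: assms(2-4))
qed

text \<open>An isomorphism of the truncated triples is defined on the whole space, because the first flag ends
  there, and it maps the last members of the other flags to each other as these are the whole space.\<close>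

lemma iso_orbit_subset:
  assumes x: "(A, B, C) \<in> Jl scale (joint a b c)" and y: "(A', B', C') \<in> Jl scale (joint a b c)"
    and i: "triple_iso (length a) (length b) (length c) ((!) A) ((!) B) ((!) C) ((!) A') ((!) B') ((!) C')"
  shows "orbit scale (A', B', C') \<subseteq> orbit scale (A, B, C)"
proof -
  let ?r = "length a" and ?p = "length b" and ?q = "length c"
  note X = Jl_triple[OF x] and Y = Jl_triple[OF y]
  obtain g where g: "lin g" "inj_on g (A ! ?r)" "\<forall>i\<le>?r. g ` (A ! i) = A' ! i" "\<forall>k\<le>?p. g ` (B ! k) = B' ! k" "\<forall>l\<le>?q. g ` (C ! l) = C' ! l"
    using i by (rule triple_isoE)
  have sur: "g ` UNIV = UNIV" using g(3)[rule_format, of ?r] X(2) Y(2) by simp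
  have "bij g" using g(2) sur unfolding X(2) bij_def by simp
  have A: "map (image g) A = A'"
    by (rule nth_equalityI) (use g(3) X(5) Y(5) in \<open>auto simp: less_Suc_eq_le\<close>)
  have last: "map (image g) D = D'" if "length D = Suc (Suc m)" "length D' = Suc (Suc m)" "\<forall>k\<le>m. g ` (D ! k) = D' ! k"
    "D ! Suc m = UNIV" "D' ! Suc m = UNIV" for D D' m
  proof (rule nth_equalityI)
    show "length (map (image g) D) = length D'" using that by simp
    fix i assume "i < length (map (image g) D)"
    then have i: "i < Suc (Suc m)" using that(1) by simp
    then show "map (image g) D ! i = D' ! i" using that sur by (cases "i = Suc m") (simp_all add: less_Suc_eq_le)
  qed
  have act: "act g (A, B, C) = (A', B', C')"
    unfolding act_def using A last[OF X(6) Y(6) g(4) X(3) Y(3)] last[OF X(7) Y(7) g(5) X(4) Y(4)] by simp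
  show ?thesis
  proof
    fix z assume "z \<in> orbit scale (A', B', C')"
    then obtain h where h: "lin h" "bij h" "z = act h (A', B', C')" unfolding orbit_def GL_def by blast
    have "z = act (h \<circ> g) (A, B, C)" unfolding h(3) act[symmetric] act_def by (simp add: image_comp comp_def)
    moreover have "lin (h \<circ> g)" using lin_compose_app[OF h(1) g(1)] by (simp add: comp_def)
    moreover have "bij (h \<circ> g)" by (rule bij_comp[OF \<open>bij g\<close> h(2)])
    ultimately show "z \<in> orbit scale (A, B, C)" unfolding orbit_def GL_def by blast
  qed
qed

lemma iso_orbit_eq:
  assumes x: "(A, B, C) \<in> Jl scale (joint a b c)" and y: "(A', B', C') \<in> Jl scale (joint a b c)"
    and i: "triple_iso (length a) (length b) (length c) ((!) A) ((!) B) ((!) C) D E F"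
    and j: "triple_iso (length a) (length b) (length c) ((!) A') ((!) B') ((!) C') D E F"
  shows "orbit scale (A, B, C) = orbit scale (A', B', C')"
proof (rule antisym)
  note I = triple_iso_sym[OF Jl_triple(1)[OF x] i] and J = triple_iso_sym[OF Jl_triple(1)[OF y] j]
  show "orbit scale (A, B, C) \<subseteq> orbit scale (A', B', C')" by (rule iso_orbit_subset[OF y x triple_iso_trans[OF j I]])
  show "orbit scale (A', B', C') \<subseteq> orbit scale (A, B, C)" by (rule iso_orbit_subset[OF x y triple_iso_trans[OF i J]])
qed

lemma orbit_refl: "x \<in> orbit scale x"
proof -
  obtain A B C where x: "x = (A, B, C)" by (metis prod.exhaust)
  have "lin (\<lambda>x. x)" "bij (\<lambda>x. x)" using lin_ident bij_id unfolding id_def by blast+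
  moreover have "map (image (\<lambda>x. x)) D = D" for D :: "'v flag" by (rule nth_equalityI) simp_all
  then have "x = act (\<lambda>x. x) x" unfolding x act_def by simp
  ultimately show ?thesis unfolding orbit_def GL_def by blast
qed

text \<open>Orbits are isomorphism classes of triples of chains, so the two directions are
  \<open>critical_family\<close> and \<open>finitely_many_triples\<close>.\<close>

theorem finite_type_iff_not_critical:
  assumes sum: "sum_list a = sum_list b + sum_list c" "dim UNIV = sum_list a"
  shows "finite_type scale (joint a b c) \<longleftrightarrow> \<not> critical (length a) (length b) (length c) ((!) a) ((!) b) ((!) c)"
proof
  let ?r = "length a" and ?p = "length b" and ?q = "length c" and ?J = "Jl scale (joint a b c)"
  assume fin: "finite_type scale (joint a b c)"
  have sl: "(\<Sum>i<length x. x ! i) = sum_list x" for x :: "nat list"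
    by (simp add: sum_list_sum_nth atLeast0LessThan)
  show "\<not> critical ?r ?p ?q ((!) a) ((!) b) ((!) c)"
  proof
    assume "critical ?r ?p ?q ((!) a) ((!) b) ((!) c)"
    from critical_family[OF this, unfolded sl sum(2), OF refl sum(1)[symmetric]] obtain A B C v \<chi>
      where F: "orthogonal_family ?r ?p ?q ((!) a) ((!) b) ((!) c) A B C v \<chi>"
      by (elim exE)
    define x where "x s = (map (A s) [0..<Suc ?r], map B [0..<Suc ?p] @ [UNIV], map C [0..<Suc ?q] @ [UNIV])" for s
    have xJ: "x s \<in> ?J" for s
      unfolding x_def by (rule triple_Jl[OF _ _ refl refl refl sum]) (use F in \<open>simp_all add: orthogonal_family_def\<close>)
    \<comment> \<open>One representative from each orbit is a finite set of triples that meets all isomorphism classes.\<close>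
    define rep where "rep z = (SOME y. y \<in> ?J \<and> orbit scale y = z)" for z
    define fn where "fn y = (case y of (A, B, C) \<Rightarrow> ((!) A, (!) B, (!) C))" for y :: "'v flag_triple"
    have "finite ((\<lambda>z. fn (rep z)) ` orbit scale ` ?J)" using fin unfolding finite_type_def by (rule finite_imageI)
    moreover have "\<exists>(A', B', C')\<in>(\<lambda>z. fn (rep z)) ` orbit scale ` ?J. triple_iso ?r ?p ?q (A s) B C A' B' C'" for s
    proof -
      have "rep (orbit scale (x s)) \<in> ?J \<and> orbit scale (rep (orbit scale (x s))) = orbit scale (x s)"
        unfolding rep_def by (rule someI[of _ "x s"]) (simp add: xJ)
      then have "rep (orbit scale (x s)) \<in> orbit scale (x s)" using orbit_refl by blast
      then obtain g where g: "g \<in> GL scale" "rep (orbit scale (x s)) = act g (x s)" unfolding orbit_def by blast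
      obtain A' B' C' where y: "act g (x s) = (A', B', C')" by (metis prod.exhaust)
      have "triple_iso ?r ?p ?q ((!) (map (A s) [0..<Suc ?r])) ((!) (map B [0..<Suc ?p] @ [UNIV])) ((!) (map C [0..<Suc ?q] @ [UNIV])) ((!) A') ((!) B') ((!) C')"
        by (rule GL_image_iso[OF g(1) _ _ _ y[unfolded x_def]]) simp_all
      then obtain h where h: "lin h" "inj_on h (map (A s) [0..<Suc ?r] ! ?r)" "\<forall>i\<le>?r. h ` (map (A s) [0..<Suc ?r] ! i) = A' ! i"
        "\<forall>k\<le>?p. h ` ((map B [0..<Suc ?p] @ [UNIV]) ! k) = B' ! k" "\<forall>l\<le>?q. h ` ((map C [0..<Suc ?q] @ [UNIV]) ! l) = C' ! l"
        by (rule triple_isoE)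
      have n1: "map D [0..<Suc m] ! i = D i" "(map D [0..<Suc m] @ [UNIV]) ! i = D i" if "i \<le> m" for D :: "nat \<Rightarrow> 'v set" and m i
        using that by (simp_all add: nth_append del: upt_Suc)
      have "triple_iso ?r ?p ?q (A s) B C ((!) A') ((!) B') ((!) C')"
        unfolding triple_iso_def
        by (rule exI[of _ h]) (use h in \<open>simp add: n1 del: upt_Suc\<close>)
      then have "case fn (rep (orbit scale (x s))) of (A', B', C') \<Rightarrow> triple_iso ?r ?p ?q (A s) B C A' B' C'"
        unfolding g(2) y fn_def by simp
      then show ?thesis by (rule bexI) (intro imageI xJ)
    qed
    ultimately show False by (rule orthogonal_family_infinite[OF F])
  qed
next
  let ?r = "length a" and ?p = "length b" and ?q = "length c" and ?J = "Jl scale (joint a b c)"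
  assume "\<not> critical ?r ?p ?q ((!) a) ((!) b) ((!) c)"
  from finitely_many_triples[OF this] obtain S where S: "finite S" "covers ?r ?p ?q ((!) a) ((!) b) ((!) c) S" by (elim exE conjE)
  define code where "code x s = (case x of (A, B, C) \<Rightarrow> case s of (D, E, F) \<Rightarrow> triple_iso ?r ?p ?q ((!) A) ((!) B) ((!) C) D E F)"
    for x :: "'v flag_triple" and s
  define rep where "rep s = (SOME x. x \<in> ?J \<and> code x s)" for s
  have "orbit scale ` ?J \<subseteq> (\<lambda>s. orbit scale (rep s)) ` S"
  proof (rule image_subsetI)
    fix x assume x: "x \<in> ?J"
    obtain A B C where xe: "x = (A, B, C)" by (metis prod.exhaust)
    have "\<exists>(D, E, F)\<in>S. triple_iso ?r ?p ?q ((!) A) ((!) B) ((!) C) D E F"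
      by (rule S(2)[unfolded covers_def, rule_format, OF Jl_triple(1)[OF x[unfolded xe]]])
    then obtain s where s: "s \<in> S" "case s of (D, E, F) \<Rightarrow> triple_iso ?r ?p ?q ((!) A) ((!) B) ((!) C) D E F" by (rule bexE)
    have cx: "code x s" using s(2) unfolding code_def xe by simp
    have y: "rep s \<in> ?J \<and> code (rep s) s" unfolding rep_def by (rule someI[of _ x]) (use x cx in simp)
    obtain A' B' C' where ye: "rep s = (A', B', C')" by (metis prod.exhaust)
    obtain D E F where se: "s = (D, E, F)" by (metis prod.exhaust)
    have "orbit scale x = orbit scale (rep s)"
      unfolding xe ye
      by (rule iso_orbit_eq[OF x[unfolded xe] y[THEN conjunct1, unfolded ye], of D E F])
        (rule cx[unfolded code_def xe se prod.case], rule y[THEN conjunct2, unfolded ye, unfolded code_def se prod.case])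
    then show "orbit scale x \<in> (\<lambda>s. orbit scale (rep s)) ` S" using s(1) by (rule image_eqI)
  qed
  then show "finite_type scale (joint a b c)"
    unfolding finite_type_def using finite_subset finite_imageI[OF S(1)] by blast
qed

end

theorem theorem2p13:
  fixes scale :: "'k::{alg_closed_field, field_char_0} \<Rightarrow> 'v::ab_group_add \<Rightarrow> 'v"
    and Basis :: "'v set"
    and r p q :: nat
    and a b c :: partition
  assumes "finite_dimensional_vector_space scale Basis"
    and "r \<ge> 1" "p \<ge> 1" "q \<ge> 1"
    and "(a, b, c) \<in> LambdaJ r p q"
    and "vector_space.dim scale (UNIV :: 'v set) = sum_list a"
  shows "(finite_type scale (a, b, c) \<or>
           (\<exists>d'. is_summand r p q d' (a, b, c) \<and> plus_triple d' \<in> critical_triples)) \<and>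
         \<not> (finite_type scale (a, b, c) \<and>
           (\<exists>d'. is_summand r p q d' (a, b, c) \<and> plus_triple d' \<in> critical_triples))"
proof -
  interpret closed_ambient scale Basis
    using assms(1) by (simp add: closed_ambient_def fin_ambient_def)
  obtain p' q' where pq: "p = Suc p'" "q = Suc q'" using assms(3,4) by (cases p; cases q) auto
  note L = assms(5)[unfolded pq]
  obtain a' b' c' where d: "(a, b, c) = joint a' b' c'" using LambdaJ_joint[OF L] .
  have aa: "a = a'" using d unfolding joint_def by simp
  have j: "length a' = r" "length b' = p'" "length c' = q'" "sum_list a' = sum_list b' + sum_list c'"
    using L unfolding d joint_in_LambdaJ by simp_all
  have "dim UNIV = sum_list a'" using assms(6) unfolding aa .
  from finite_type_iff_not_critical[OF j(4) this] summand_iff_critical[OF j]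
  show ?thesis unfolding d pq j(1-3) by blast
qed

end
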